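(* Let $(X,J)$ be a Markov-modulated Lévy process with matrix Laplace exponent $A$, as described in the context, and let $J_0$ have distribution $w_0=(w_{01},\dots,w_{0N})'$ (an arbitrary probability vector). Let $0<p_1<\cdots<p_\tau<1$ and $q_1,\dots,q_\tau>0$ with $\sum_{j}q_j=1$, and let the trade time $T$, independent of $(X,J)$, have the mixture-of-geometrics law $$\mathbb P(T=t)=\sum_{j=1}^{\tau}q_j(1-p_j)^{t-1}p_j,\qquad t=1,2,\dots.$$ Let $P_T=e^{X_T}$. Suppose there exists a positive real number $\alpha$ such that $r_D(A(-\alpha))=-\log(1-p_1)$, and that $A(z)$ admits a holomorphic extension to an open connected neighborhood in $\mathbb C$ of the real interval $[-\alpha,0]$. Then $\alpha$ is unique, and the following hold. (i) There exist constants $0<C_1\le C_2<\infty$ such that $$\widetilde M C_1\le y^{\alpha}\,\mathbb P(P_T>y)\le \widetilde M C_2$$ for all sufficiently large $y$; that is, $P_T$ has a Pareto-type tail. (ii) Suppose, in addition, that either (a) the moment generating function $z\mapsto e^{\psi_j(z)}$ is nonlattice for some $j\in\mathcal E$, or (b) the transition-jump moment generating function $z\mapsto E[e^{zV_{jk}}]$ is nonlattice for some $j,k\in\mathcal E$ with $\varrho_{jk}>0$. In particular, condition (a) holds whenever $\sigma_j^2>0$ for some $j\in\mathcal E$. Then $$\lim_{y\to\infty}y^{\alpha}\,\mathbb P(P_T>y)=\widetilde M/\alpha.$$ In (i) and (ii), $\widetilde M$ is positive and given by $$\widetilde M=\left(\frac{q_1p_1}{1-p_1}\right)\frac{(w_0'x_p)(y_p'1_N)}{-\,y_p'B^{(1)}(-\alpha)x_p},$$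 where $B(s)=e^{\log(1-p_1)I+A(s)}$, $B^{(1)}(s)=\frac{d}{ds}B(s)$, and $x_p,y_p$ are right and left eigenvectors of $B(-\alpha)$ associated with the unit eigenvalue.
   Context: Markov-modulated Lévy process. Let $\mathcal E=\{1,\dots,N\}$ and let $J=(J_t)_{t\ge0}$ be a continuous-time Markov chain on $\mathcal E$ with irreducible infinitesimal generator $G=(g_{jk})$. The real process $X=(X_t)_{t\ge 0}$ has $X_0=0$ almost surely, and $(X,J)$ is a Markov process whose $X$-increments are governed by $J$: $E[f(X_{t+s}-X_t)g(J_{t+s})\mid\mathcal F_t]=E[f(X_s-X_0)g(J_s)\mid J_0]$ (the right side evaluated with initial state $J_t$) for all $s,t\ge0$ and nonnegative measurable $f,g$. While $J$ is in state $j$, $X$ evolves as a Lévy process $X^{(j)}$ with exponent $$\psi_j(z)=\mu_jz+\tfrac12\sigma_j^2z^2+\int_{-\infty}^{\infty}\left(e^{zx}-1-zx\mathbf 1(|x|\le1)\right)\nu_j(dx),$$ for $z\in\mathbb C$ with $E[e^{\mathrm{Re}(z)X^{(j)}_1}]<\infty$. When $J$ jumps from $j$ to $k\ne j$, $X$ jumps with probability $\varrho_{jk}$, the jump size being an iid random variable $U_{jk}$ independent of $J$ and of $(X^{(j)},j\in\mathcal E)$; $\varrho_{jj}=0$ and $U_{jj}\equiv0$ for all $j$. Let $V_{jk}=U_{jk}$ with probability $\varrho_{jk}$ and $V_{jk}=0$ with probability $1-\varrho_{jk}$. Let $\Psi(z)$ be the diagonal matrix with entries $\psi_j(z)$, $\Upsilon(z)=(E[e^{zV_{jk}}])_{jk}$,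 and define the matrix Laplace exponent $A(z)=G\odot\Upsilon(z)+\Psi(z)$ ($\odot$ is the entrywise product); then $E[e^{zX_t}\mathbf 1(J_t=k)\mid J_0=j]=(e^{A(z)t})_{jk}$ whenever $E[e^{zX_t}]$ exists. For real $s$, $A(s)$ is considered for $s\in\mathcal I=\{s\in\mathbb R: E[e^{sX_t}\mid J_0=j]<\infty\ \text{for all } j\in\mathcal E\}$ (finiteness for all $t>0$). Notation. For a square matrix $M$, $r_D(M)$ (the dominant real eigenvalue) is the real eigenvalue of $M$ equal to the spectral abscissa $\max\{\mathrm{Re}(r): r\text{ an eigenvalue of }M\}$, when such an eigenvalue exists (it does for $A(s)$, $s\in\mathcal I$). $1_N$ is the $N\times1$ vector of ones, $I$ is the identity matrix, and $'$ denotes transpose. A moment generating function is nonlattice if it corresponds to a distribution that is not supported on a lattice. A random variable $Y$ has a Pareto-type tail with exponent $\alpha>0$ if there are constants $0<c_1\le c_2<\infty$ with $c_1\le y^{\alpha}\mathbb P(Y>y)\le c_2$ for all sufficiently large $y$.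
   Formalization: A and its domain are taken for E[e^{-zX_t}] instead of E[e^{zX_t}] (with the latter the claim fails for one-state Brownian motion with nonzero drift), and ϱ_jk = 0 is required when g_jk = 0 (else (ii)(b) could be met by a jump that never occurs). *)

theory Defs
  imports "HOL-Probability.Probability"
begin

section \<open>Matrices\<close>

definition mexp :: "real^'n^'n \<Rightarrow> real^'n^'n" where
  "mexp M = (\<Sum>k. (1 / fact k) *\<^sub>R (((\<lambda>N. M ** N) ^^ k) (mat 1)))"

definition is_eigenvalue :: "complex^'n^'n \<Rightarrow> complex \<Rightarrow> bool" where
  "is_eigenvalue M c \<longleftrightarrow> (\<exists>v. v \<noteq> 0 \<and> M *v v = c *s v)"

text \<open>The relation \<open>dominant_real_eigenvalue M r\<close> reads: \<open>r\<^sub>D(M)\<close> exists and equals \<open>r\<close>, that is,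
  the spectral abscissa of \<open>M\<close> is \<open>r\<close> and \<open>r\<close> is itself an eigenvalue. For given \<open>M\<close> there is at
  most one such \<open>r\<close>.\<close>

definition dominant_real_eigenvalue :: "complex^'n^'n \<Rightarrow> real \<Rightarrow> bool" where
  "dominant_real_eigenvalue M r \<longleftrightarrow>
     is_eigenvalue M (complex_of_real r) \<and> (\<forall>c. is_eigenvalue M c \<longrightarrow> Re c \<le> r)"

definition irreducible_generator :: "real^'n^'n \<Rightarrow> bool" where
  "irreducible_generator G \<longleftrightarrow>
     (\<forall>j k. j \<noteq> k \<longrightarrow> 0 \<le> G $ j $ k) \<and>
     (\<forall>j. (\<Sum>k\<in>UNIV. G $ j $ k) = 0) \<and>
     (\<forall>j k. (j, k) \<in> {(a, b). a \<noteq> b \<and> 0 < G $ a $ b}\<^sup>*)"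

section \<open>Lattice distributions, Pareto-type tails\<close>

text \<open>A lattice is a set \<open>a + h\<int>\<close> with an arbitrary offset \<open>a\<close>; in particular point masses are
  lattice distributions. (With \<open>a = 0\<close> only, nonlattice transition jumps would not rule out periodic
  behaviour of the modulated process: offsets of jumps from \<open>j\<close> to \<open>k\<close> and back may cancel.)\<close>

definition lattice_distribution :: "real measure \<Rightarrow> bool" where
  "lattice_distribution \<mu> \<longleftrightarrow> (\<exists>a h. 0 < h \<and> (AE x in \<mu>. \<exists>k::int. x = a + h * of_int k))"

definition is_mgf_of :: "(complex \<Rightarrow> complex) \<Rightarrow> real measure \<Rightarrow> bool" where
  "is_mgf_of \<phi> \<mu> \<longleftrightarrow> real_distribution \<mu> \<and>
     (\<forall>z. integrable \<mu> (\<lambda>x. exp (Re z * x)) \<longrightarrow> (\<integral>x. exp (z * complex_of_real x) \<partial>\<mu>) = \<phi> z)"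

definition nonlattice_mgf :: "(complex \<Rightarrow> complex) \<Rightarrow> bool" where
  "nonlattice_mgf \<phi> \<longleftrightarrow> (\<exists>\<mu>. is_mgf_of \<phi> \<mu> \<and> \<not> lattice_distribution \<mu>)"

definition pareto_type_tail :: "'w measure \<Rightarrow> ('w \<Rightarrow> real) \<Rightarrow> real \<Rightarrow> bool" where
  "pareto_type_tail M Y \<alpha> \<longleftrightarrow> (\<exists>c1 c2. 0 < c1 \<and> c1 \<le> c2 \<and>
     (\<forall>\<^sub>F y in at_top. c1 \<le> y powr \<alpha> * measure M {\<omega> \<in> space M. Y \<omega> > y} \<and>
        y powr \<alpha> * measure M {\<omega> \<in> space M. Y \<omega> > y} \<le> c2))"

section \<open>Levy processes\<close>

definition levy_measure :: "real measure \<Rightarrow> bool" where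
  "levy_measure \<nu> \<longleftrightarrow> sets \<nu> = sets borel \<and> emeasure \<nu> {0} = 0 \<and>
     (\<integral>\<^sup>+x. ennreal (min 1 (x\<^sup>2)) \<partial>\<nu>) < \<infinity>"

definition levy_exponent :: "real \<Rightarrow> real \<Rightarrow> real measure \<Rightarrow> complex \<Rightarrow> complex" where
  "levy_exponent \<mu> \<sigma> \<nu> z = of_real \<mu> * z + of_real (\<sigma>\<^sup>2) * z\<^sup>2 / 2 +
     (\<integral>x. (exp (z * of_real x) - 1 - z * of_real x * of_real (indicator {-1..1} x)) \<partial>\<nu>)"

definition levy_process ::
  "'w measure \<Rightarrow> (real \<Rightarrow> 'w \<Rightarrow> real) \<Rightarrow> real \<Rightarrow> real \<Rightarrow> real measure \<Rightarrow> bool" where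
  "levy_process M Y \<mu> \<sigma> \<nu> \<longleftrightarrow>
     levy_measure \<nu> \<and>
     (\<forall>t\<ge>0. Y t \<in> borel_measurable M) \<and>
     (AE \<omega> in M. Y 0 \<omega> = 0) \<and>
     (AE \<omega> in M. (\<forall>t\<ge>0. ((\<lambda>u. Y u \<omega>) \<longlongrightarrow> Y t \<omega>) (at_right t)) \<and>
        (\<forall>t>0. \<exists>l. ((\<lambda>u. Y u \<omega>) \<longlongrightarrow> l) (at_left t))) \<and>
     (\<forall>(n::nat) \<tau>. 0 \<le> \<tau> 0 \<and> mono \<tau> \<longrightarrow>
        prob_space.indep_vars M (\<lambda>_. borel) (\<lambda>i \<omega>. Y (\<tau> (Suc i)) \<omega> - Y (\<tau> i) \<omega>) {..<n}) \<and>
     (\<forall>s\<ge>0. \<forall>t\<ge>0. distr M borel (\<lambda>\<omega>. Y (s + t) \<omega> - Y s \<omega>) = distr M borel (Y t)) \<and>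
     (\<forall>t\<ge>0. \<forall>z. integrable M (\<lambda>\<omega>. exp (Re z * Y 1 \<omega>)) \<longrightarrow>
        (\<integral>\<omega>. exp (z * of_real (Y t \<omega>)) \<partial>M) = exp (of_real t * levy_exponent \<mu> \<sigma> \<nu> z))"

section \<open>Markov-modulated Levy processes\<close>

text \<open>Law of \<open>V\<^sub>j\<^sub>k\<close>: the law \<open>U\<close> with probability \<open>\<rho>\<close>, the point mass at \<open>0\<close> otherwise.\<close>

definition transition_jump_law :: "real \<Rightarrow> real measure \<Rightarrow> real measure" where
  "transition_jump_law \<rho> U = measure_pmf (bernoulli_pmf \<rho>) \<bind> (\<lambda>b. if b then U else return borel 0)"

definition transition_jump_mgf :: "real \<Rightarrow> real measure \<Rightarrow> complex \<Rightarrow> complex" where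
  "transition_jump_mgf \<rho> U z = (\<integral>x. exp (z * complex_of_real x) \<partial>transition_jump_law \<rho> U)"

definition process_filtration ::
  "'w set \<Rightarrow> (real \<Rightarrow> 'w \<Rightarrow> real) \<Rightarrow> (real \<Rightarrow> 'w \<Rightarrow> 'n) \<Rightarrow> real \<Rightarrow> 'w measure" where
  "process_filtration \<Omega> X J t = sigma \<Omega>
     ({X u -` S \<inter> \<Omega> | u S. 0 \<le> u \<and> u \<le> t \<and> S \<in> sets borel} \<union>
      {J u -` S \<inter> \<Omega> | u S. 0 \<le> u \<and> u \<le> t})"

definition process_sets ::
  "'w set \<Rightarrow> (real \<Rightarrow> 'w \<Rightarrow> real) \<Rightarrow> (real \<Rightarrow> 'w \<Rightarrow> 'n) \<Rightarrow> 'w set set" where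
  "process_sets \<Omega> X J = sigma_sets \<Omega>
     ({X u -` S \<inter> \<Omega> | u S. 0 \<le> u \<and> S \<in> sets borel} \<union> {J u -` S \<inter> \<Omega> | u S. 0 \<le> u})"

definition jumps_at :: "(real \<Rightarrow> 'n) \<Rightarrow> real \<Rightarrow> bool" where
  "jumps_at c v \<longleftrightarrow> 0 < v \<and> \<not> (\<forall>\<^sub>F u in at_left v. c u = c v)"

definition jump_count :: "(real \<Rightarrow> 'n) \<Rightarrow> real \<Rightarrow> nat" where
  "jump_count c u = card {v. v \<le> u \<and> jumps_at c v}"

datatype 'n noise_source = Chain | Levy 'n | Jump 'n 'n nat

fun noise_sets ::
  "'w set \<Rightarrow> (real \<Rightarrow> 'w \<Rightarrow> 'n) \<Rightarrow> ('n \<Rightarrow> real \<Rightarrow> 'w \<Rightarrow> real) \<Rightarrow>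
   ('n \<Rightarrow> 'n \<Rightarrow> nat \<Rightarrow> 'w \<Rightarrow> real) \<Rightarrow> 'n noise_source \<Rightarrow> 'w set set" where
  "noise_sets \<Omega> J L V Chain = sigma_sets \<Omega> {J t -` S \<inter> \<Omega> | t S. 0 \<le> t}"
| "noise_sets \<Omega> J L V (Levy j) = sigma_sets \<Omega> {L j t -` S \<inter> \<Omega> | t S. 0 \<le> t \<and> S \<in> sets borel}"
| "noise_sets \<Omega> J L V (Jump j k n) = {V j k n -` S \<inter> \<Omega> | S. S \<in> sets borel}"

text \<open>
  The process is given as a Markov family: \<open>P i\<close> is the law of the experiment started in \<open>J\<^sub>0 = i\<close>,
  \<open>X\<^sub>0 = 0\<close>, all on one measurable space, so that \<open>E[\<dots> | J\<^sub>0 = i]\<close> is the expectation under \<open>P i\<close>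
  also for states \<open>i\<close> that a given initial distribution does not charge. \<open>L j\<close> is the Levy process
  \<open>X\<^sup>(\<^sup>j\<^sup>)\<close>; \<open>V j k n\<close> is the (possibly zero) jump of \<open>X\<close> triggered when the \<open>n\<close>-th jump of \<open>J\<close> leads
  from \<open>j\<close> to \<open>k\<close>.

  Assumption \<open>additive\<close> with \<open>f = 1\<close> is the Markov property of \<open>J\<close>, and \<open>transition\<close> says that \<open>J\<close>
  has generator \<open>G\<close>. The probability \<open>\<rho> j k\<close> is meaningless for a transition that does not occur; it
  is set to \<open>0\<close> then, just as on the diagonal.
\<close>

locale markov_modulated_levy =
  fixes P :: "'n::finite \<Rightarrow> 'w measure"
    and X :: "real \<Rightarrow> 'w \<Rightarrow> real"
    and J :: "real \<Rightarrow> 'w \<Rightarrow> 'n"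
    and G :: "real^'n^'n"
    and \<mu> \<sigma> :: "'n \<Rightarrow> real"
    and \<nu> :: "'n \<Rightarrow> real measure"
    and \<rho> :: "'n \<Rightarrow> 'n \<Rightarrow> real"
    and U :: "'n \<Rightarrow> 'n \<Rightarrow> real measure"
    and L :: "'n \<Rightarrow> real \<Rightarrow> 'w \<Rightarrow> real"
    and V :: "'n \<Rightarrow> 'n \<Rightarrow> nat \<Rightarrow> 'w \<Rightarrow> real"
  assumes prob_spaces: "\<And>i. prob_space (P i)"
    and common_space: "\<And>i j. sets (P i) = sets (P j)"
    and measurable_X: "\<And>i t. 0 \<le> t \<Longrightarrow> X t \<in> borel_measurable (P i)"
    and measurable_J: "\<And>i t. 0 \<le> t \<Longrightarrow> J t \<in> measurable (P i) (count_space UNIV)"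
    and generator: "irreducible_generator G"
    and prob_range: "\<And>j k. 0 \<le> \<rho> j k \<and> \<rho> j k \<le> 1"
    and no_transition: "\<And>j k. j = k \<or> G $ j $ k = 0 \<Longrightarrow> \<rho> j k = 0"
    and jump_sizes: "\<And>j k. real_distribution (U j k)"
    and no_diagonal_jump: "\<And>j. U j j = return borel 0"
    and start: "\<And>i. AE \<omega> in P i. J 0 \<omega> = i \<and> X 0 \<omega> = 0"
    and transition: "\<And>i t k. 0 \<le> t \<Longrightarrow>
          measure (P i) {\<omega> \<in> space (P i). J t \<omega> = k} = mexp (t *\<^sub>R G) $ i $ k"
    and additive: "\<And>i s t (f :: real \<Rightarrow> ennreal) (g :: 'n \<Rightarrow> ennreal).
          0 \<le> s \<Longrightarrow> 0 \<le> t \<Longrightarrow> f \<in> borel_measurable borel \<Longrightarrow>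
          AE \<omega> in P i.
            nn_cond_exp (P i) (process_filtration (space (P i)) X J t)
              (\<lambda>\<omega>. f (X (t + s) \<omega> - X t \<omega>) * g (J (t + s) \<omega>)) \<omega> =
            (\<integral>\<^sup>+\<omega>'. f (X s \<omega>' - X 0 \<omega>') * g (J s \<omega>') \<partial>P (J t \<omega>))"
    and levy: "\<And>i j. levy_process (P i) (L j) (\<mu> j) (\<sigma> j) (\<nu> j)"
    and measurable_V: "\<And>i j k n. V j k n \<in> borel_measurable (P i)"
    and jump_law: "\<And>i j k n. distr (P i) borel (V j k n) = transition_jump_law (\<rho> j k) (U j k)"
    and independent: "\<And>i. prob_space.indep_sets (P i) (noise_sets (space (P i)) J L V) UNIV"
    and step_paths: "\<And>i. AE \<omega> in P i.
          (\<forall>t\<ge>0. \<forall>\<^sub>F u in at_right t. J u \<omega> = J t \<omega>) \<and>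
          (\<forall>t>0. \<exists>k. \<forall>\<^sub>F u in at_left t. J u \<omega> = k)"
    and evolution: "\<And>i. AE \<omega> in P i. \<forall>s t j. 0 \<le> s \<and> s \<le> t \<and> (\<forall>u\<in>{s..t}. J u \<omega> = j) \<longrightarrow>
          X t \<omega> - X s \<omega> = L j t \<omega> - L j s \<omega>"
    and jumps: "\<And>i. AE \<omega> in P i. \<forall>u>0. \<forall>j k.
          (\<forall>\<^sub>F v in at_left u. J v \<omega> = j) \<and> J u \<omega> = k \<and> j \<noteq> k \<longrightarrow>
          ((\<lambda>v. X v \<omega>) \<longlongrightarrow> X u \<omega> - V j k (jump_count (\<lambda>v. J v \<omega>) u) \<omega>) (at_left u)"

text \<open>\<open>G \<odot> \<Upsilon>(z) + \<Psi>(z)\<close>, with \<open>E[exp (z X\<^sub>t) 1(J\<^sub>t = k) | J\<^sub>0 = j]\<close> the \<open>(j,k)\<close> entry of \<open>exp (t A(z))\<close>.\<close>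

definition matrix_exponent ::
  "real^'n^'n \<Rightarrow> ('n \<Rightarrow> real) \<Rightarrow> ('n \<Rightarrow> real) \<Rightarrow> ('n \<Rightarrow> real measure) \<Rightarrow> ('n \<Rightarrow> 'n \<Rightarrow> real) \<Rightarrow>
   ('n \<Rightarrow> 'n \<Rightarrow> real measure) \<Rightarrow> complex \<Rightarrow> complex^'n^'n" where
  "matrix_exponent G \<mu> \<sigma> \<nu> \<rho> U z = (\<chi> j k.
     of_real (G $ j $ k) * transition_jump_mgf (\<rho> j k) (U j k) z +
     (if j = k then levy_exponent (\<mu> j) (\<sigma> j) (\<nu> j) z else 0))"

definition mgf_domain :: "('n \<Rightarrow> 'w measure) \<Rightarrow> (real \<Rightarrow> 'w \<Rightarrow> real) \<Rightarrow> real set" where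
  "mgf_domain P X = {s. \<forall>t>0. \<forall>j. integrable (P j) (\<lambda>\<omega>. exp (s * X t \<omega>))}"

text \<open>Sign convention. The condition \<open>r\<^sub>D(A(-\<alpha>)) = - log (1 - p\<^sub>1)\<close> describes the upper tail of
  \<open>exp X\<^sub>T\<close> when \<open>A\<close> is the exponent of the two-sided Laplace transform \<open>E[exp (- z X\<^sub>t)]\<close>, as used
  in the Tauberian theory of tails; with \<open>E[exp (z X\<^sub>t)]\<close> in its place it describes the lower tail.
  (For Brownian motion with drift, one state, the two exponents differ unless the drift vanishes.)
  Hence the matrix Laplace exponent and its domain are the reflections of the objects above.\<close>

definition matrix_laplace_exponent ::
  "real^'n^'n \<Rightarrow> ('n \<Rightarrow> real) \<Rightarrow> ('n \<Rightarrow> real) \<Rightarrow> ('n \<Rightarrow> real measure) \<Rightarrow> ('n \<Rightarrow> 'n \<Rightarrow> real) \<Rightarrow>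
   ('n \<Rightarrow> 'n \<Rightarrow> real measure) \<Rightarrow> complex \<Rightarrow> complex^'n^'n" where
  "matrix_laplace_exponent G \<mu> \<sigma> \<nu> \<rho> U z = matrix_exponent G \<mu> \<sigma> \<nu> \<rho> U (- z)"

definition laplace_domain :: "('n \<Rightarrow> 'w measure) \<Rightarrow> (real \<Rightarrow> 'w \<Rightarrow> real) \<Rightarrow> real set" where
  "laplace_domain P X = {s. - s \<in> mgf_domain P X}"

text \<open>The matrix \<open>A(s)\<close> has real entries for real \<open>s\<close> in its domain; \<open>Re\<close> only changes the type.\<close>

definition discounted_exponential :: "real \<Rightarrow> (complex \<Rightarrow> complex^'n^'n) \<Rightarrow> real \<Rightarrow> real^'n^'n" where
  "discounted_exponential p A s =
     mexp (ln (1 - p) *\<^sub>R mat 1 + (\<chi> j k. Re (A (complex_of_real s) $ j $ k)))"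

definition extends_holomorphically ::
  "(complex \<Rightarrow> complex^'n^'n) \<Rightarrow> real set \<Rightarrow> real set \<Rightarrow> bool" where
  "extends_holomorphically A D K \<longleftrightarrow>
     (\<exists>S F. open S \<and> connected S \<and> complex_of_real ` K \<subseteq> S \<and>
        (\<forall>j k. (\<lambda>z. F z $ j $ k) holomorphic_on S) \<and>
        (\<forall>z\<in>S. Re z \<in> D \<longrightarrow> F z = A z))"

end

theory Submission
  imports Defs "HOL-Complex_Analysis.Conformal_Mappings" "HOL-Real_Asymp.Real_Asymp"
begin

text \<open>Write \<open>M(z)\<close> for the matrix with entries \<open>E[exp (z X_1); J_1 = k | J_0 = j]\<close>, so that \<open>B(-s) = (1 - p_1) M(s)\<close> for real \<open>s\<close>.
Conditioning on \<open>T\<close> gives \<open>E exp (z X_T)\<close> as a combination of the resolvents \<open>(I - (1 - p_l) M(z))^{-1} 1\<close>. For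
\<open>0 < Re z < \<alpha>\<close> all these matrices contract a weighted maximum norm. On the line \<open>Re z = \<alpha>\<close> only \<open>l = 1\<close> can fail,
and it fails at \<open>z = \<alpha>\<close>, where \<open>B(-\<alpha>)\<close> has the Perron eigenvalue \<open>1\<close>. There the transform has a simple pole, whose
coefficient is computed from the left and right Perron vectors by bordering the singular matrix (\<open>resolvent_pole\<close>).
Dividing by \<open>z\<close> turns \<open>E exp (z X_T)\<close> into the Laplace transform of \<open>y \<mapsto> P(X_T > y)\<close>, and a Tauberian theorem of
Wiener-Ikehara type translates the pole into the tail (\<open>wiener_ikehara_convolution\<close>). If nothing is known about the
transform on the line away from \<open>\<alpha>\<close>, a Fejer kernel of small bandwidth still gives two-sided bounds (\<open>tail_bounds\<close>). In the
nonlattice case every bandwidth is admissible, and narrowing the kernel gives the limit (\<open>tail_limit\<close>).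

The matrix exponent enters through \<open>n (M_{1/n}(z) - I) \<rightarrow> A(z)\<close> (\<open>generator_limit\<close>): in a short time \<open>J\<close> either stays put or
jumps exactly once, and on both events \<open>X\<close> is explicit. Hence \<open>M(s) = exp A(s)\<close>. The holomorphic extension of \<open>A\<close> is needed
because \<open>\<alpha>\<close> could be the boundary of the domain of the moment generating function. By the principle of Landau, a
transform of a positive measure has a singularity at its abscissa of convergence, so the extension forces the
moments to exist beyond \<open>\<alpha>\<close> (\<open>emgf_beyond\<close>).

Two convexity arguments replace the differentiability of the Perron root. Jensen applied to \<open>exp (s X_1) x(J_1)\<close> with
exponent \<open>l\<close>, differentiated at \<open>l = 1\<close>, shows \<open>y' M'(\<alpha>) x > 0\<close>, so the pole is simple and the constant positive. Jensen
applied to the entries of \<open>A\<close> shows that \<open>r_D(A(-s)) / s\<close> does not decrease, so \<open>\<alpha>\<close> is unique. Finally, an eigenvalue \<open>1\<close> of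
\<open>(1 - p_1) M(\<alpha> + i \<theta>)\<close> forces equality in all triangle inequalities, first for time \<open>1\<close>, then for all short times,
hence for the entries of \<open>A\<close>. Equality for one law means that this law lives on a lattice.\<close>

section \<open>The Fejer kernel and a local Wiener-Ikehara theorem\<close>

text \<open>Fatou: this gives integrability at the critical exponent, where it is not assumed but inherited from smaller exponents.\<close>

lemma integrable_of_bounded_nonneg_limit:
 fixes u :: "nat => 'a => real" and v :: "'a => real"
 assumes int: "\<And>n. integrable M (u n)" and nn: "\<And>n x. 0 <= u n x"
  and v[measurable]: "v \<in> borel_measurable M"
  and lim: "AE x in M. (%n. u n x) \<longlonglongrightarrow> v x" and C: "\<And>n. (\<integral>x. u n x \<partial>M) <= C"
 shows "integrable M v" "(\<integral>x. v x \<partial>M) <= C"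
proof -
 have [measurable]: "u n \<in> borel_measurable M" for n using int by auto
 have vn: "AE x in M. 0 <= v x"
  using lim by eventually_elim (rule LIMSEQ_le_const, auto simp: nn)
 have C0: "0 <= C"
  using C[of 0] integral_nonneg_AE[of "u 0" M] nn by (smt (verit) AE_I2)
 have "(\<integral>\<^sup>+x. ennreal (v x) \<partial>M) = (\<integral>\<^sup>+x. liminf (%n. ennreal (u n x)) \<partial>M)"
 proof (rule nn_integral_cong_AE, use lim in eventually_elim)
  case (elim x)
  then have "(%n. ennreal (u n x)) \<longlonglongrightarrow> ennreal (v x)" by (intro tendsto_ennrealI)
  then show ?case by (rule lim_imp_Liminf[symmetric, rotated]) simp
 qed
 also have "\<dots> <= liminf (%n. \<integral>\<^sup>+x. ennreal (u n x) \<partial>M)"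
  by (rule nn_integral_liminf) simp
 also have "\<dots> <= liminf (%n. ennreal C)"
  by (rule Liminf_mono, rule always_eventually)
    (auto simp: nn_integral_eq_integral[OF int] nn intro!: ennreal_leI C)
 also have "\<dots> = ennreal C" by (simp add: Liminf_const)
 finally have *: "(\<integral>\<^sup>+x. ennreal (v x) \<partial>M) <= ennreal C" .
 show "integrable M v"
  by (rule integrableI_nonneg) (use vn * in \<open>auto simp: le_less_trans\<close>)
 then have "ennreal (\<integral>x. v x \<partial>M) <= ennreal C"
  using nn_integral_eq_integral[of M v] vn * by simp
 then show "(\<integral>x. v x \<partial>M) <= C" using C0 by simp
qed

section \<open>The Fejer kernel\<close>

text \<open>The Fourier transform of this function is \<open>fejer K\<close>; its support \<open>[-K, K]\<close> is the only part of the critical line that a smoothed tail sees.\<close>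

definition tent :: "real => real => real" where
 "tent K \<theta> = max 0 (1 - \<bar>\<theta>\<bar> / K)"

text \<open>The value at \<open>0\<close> makes the function continuous there.\<close>

definition fejer :: "real => real => real" where
 "fejer K x = (if x = 0 then K else 2 * (1 - cos (K * x)) / (K * x\<^sup>2))"

lemma fejer_nonneg: "0 < K ==> 0 <= fejer K x"
 by (auto simp: fejer_def)

lemma fejer_minus [simp]: "fejer K (- x) = fejer K x"
 by (auto simp: fejer_def)

lemma fejer_measurable [measurable]: "fejer K \<in> borel_measurable borel"
 unfolding fejer_def[abs_def] by measurable

lemma fejer_scale: "0 < K ==> fejer K x = K * fejer 1 (K * x)"
 by (auto simp: fejer_def field_simps power2_eq_square)

lemma tent_integral_half:
 fixes x :: real
 assumes l: "0 < K" and x: "x \<noteq> 0"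
 shows "(\<integral>\<theta>. indicator {0..K} \<theta> *\<^sub>R (complex_of_real (1 - \<theta> / K) * exp (\<i> * of_real (\<theta> * x))) \<partial>lborel)
  = - exp (\<i> * of_real (K * x)) / of_real (K * x\<^sup>2) - 1 / (\<i> * of_real x) + 1 / of_real (K * x\<^sup>2)"
proof -
 define F where "F = (%\<theta>. complex_of_real (1 - \<theta> / K) * exp (\<i> * of_real (\<theta> * x)) / (\<i> * of_real x)
   - exp (\<i> * of_real (\<theta> * x)) / of_real (K * x\<^sup>2))"
 have D: "(F has_vector_derivative complex_of_real (1 - \<theta> / K) * exp (\<i> * of_real (\<theta> * x))) (at \<theta> within S)" for \<theta> S
 proof -
  have "((%w. (1 - w / of_real K) * exp (\<i> * (w * of_real x)) / (\<i> * of_real x)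
    - exp (\<i> * (w * of_real x)) / of_real (K * x\<^sup>2)) has_field_derivative
    complex_of_real (1 - \<theta> / K) * exp (\<i> * of_real (\<theta> * x))) (at (of_real \<theta>))"
   using l x by (auto intro!: derivative_eq_intros simp: field_simps power2_eq_square)
  from has_vector_derivative_real_field[OF this, of S] show ?thesis
   unfolding F_def by (simp add: o_def)
 qed
 have "(\<integral>\<theta>. indicator {0..K} \<theta> *\<^sub>R (complex_of_real (1 - \<theta> / K) * exp (\<i> * of_real (\<theta> * x))) \<partial>lborel) = F K - F 0"
  using l by (intro integral_FTC_Icc D) (auto intro!: continuous_intros)
 then show ?thesis using l by (simp add: F_def)
qed

lemma tent_fourier:
 assumes l: "0 < K"
 shows "(\<integral>\<theta>. complex_of_real (tent K \<theta>) * exp (\<i> * of_real (\<theta> * x)) \<partial>lborel) = of_real (fejer K x)"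
  (is "?L = _")
proof -
 define h where "h = (%y \<theta>. indicator {0..K} \<theta> *\<^sub>R (complex_of_real (1 - \<theta> / K) * exp (\<i> * of_real (\<theta> * y))))"
 have hint: "integrable lborel (h y)" for y
  unfolding h_def using l by (intro borel_integrable_compact) (auto intro!: continuous_intros)
 have hint': "integrable lborel (%\<theta>. h y (- \<theta>))" for y
  using lborel_integrable_real_affine[OF hint[of y], where c = "-1" and t = 0] by simp
 have heq: "(\<integral>\<theta>. h y (- \<theta>) \<partial>lborel) = (\<integral>\<theta>. h y \<theta> \<partial>lborel)" for y
  using lborel_integral_real_affine[of "-1" "h y" 0] by simp
 have "?L = (\<integral>\<theta>. h x \<theta> + h (- x) (- \<theta>) \<partial>lborel)"
 proof (rule integral_cong_AE)
  show "AE \<theta> in lborel. complex_of_real (tent K \<theta>) * exp (\<i> * of_real (\<theta> * x)) = h x \<theta> + h (- x) (- \<theta>)"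
   using AE_lborel_singleton[of 0]
   by eventually_elim (use l in \<open>auto simp: h_def tent_def indicator_def max_def field_simps\<close>)
 qed (use hint[of x] hint'[of "-x"] in \<open>auto simp: tent_def\<close>)
 also have "\<dots> = (\<integral>\<theta>. h x \<theta> \<partial>lborel) + (\<integral>\<theta>. h (- x) \<theta> \<partial>lborel)"
  by (subst Bochner_Integration.integral_add[OF hint hint']) (simp add: heq)
 also have "\<dots> = of_real (fejer K x)"
 proof (cases "x = 0")
  case False
  have "(\<integral>\<theta>. h x \<theta> \<partial>lborel) + (\<integral>\<theta>. h (- x) \<theta> \<partial>lborel) =
    2 / of_real (K * x\<^sup>2) - (exp (\<i> * of_real (K * x)) + exp (- (\<i> * of_real (K * x)))) / of_real (K * x\<^sup>2)"
  proof -
   have a: "(\<integral>\<theta>. h y \<theta> \<partial>lborel) = - exp (\<i> * of_real (K * y)) / of_real (K * y\<^sup>2) - 1 / (\<i> * of_real y)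
     + 1 / of_real (K * y\<^sup>2)" if "y \<noteq> 0" for y
    unfolding h_def by (rule tent_integral_half[OF l that])
   show ?thesis
    unfolding a[OF False] using a[of "- x"] False by (simp add: add_divide_distrib)
  qed
  also have "exp (\<i> * of_real (K * x)) + exp (- (\<i> * of_real (K * x))) = 2 * complex_of_real (cos (K * x))"
   using cos_exp_eq[of "complex_of_real (K * x)"] cos_of_real[of "K * x", where 'a = complex]
   by (simp add: mult.commute[of 2])
  also have "2 / complex_of_real (K * x\<^sup>2) - 2 * complex_of_real (cos (K * x)) / of_real (K * x\<^sup>2) = of_real (fejer K x)"
   using False by (simp add: fejer_def diff_divide_distrib[symmetric] right_diff_distrib)
  finally show ?thesis .
 next
  case True
  have "(\<integral>\<theta>. h 0 \<theta> \<partial>lborel) = complex_of_real (K - K\<^sup>2 / (2 * K)) - complex_of_real (0 - 0\<^sup>2 / (2 * K))"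
   unfolding h_def using l
  proof (intro integral_FTC_Icc[where F = "%t. complex_of_real (t - t\<^sup>2 / (2 * K))"])
   fix t
   have "((%t. t - t\<^sup>2 / (2 * K)) has_real_derivative (1 - t / K)) (at t within {0..K})"
    using l by (auto intro!: derivative_eq_intros)
   then show "((%t. complex_of_real (t - t\<^sup>2 / (2 * K))) has_vector_derivative
     complex_of_real (1 - t / K) * exp (\<i> * of_real (t * 0))) (at t within {0..K})"
    using has_vector_derivative_of_real[of "%t. t - t\<^sup>2 / (2 * K)"]
    by (simp add: has_real_derivative_iff_has_vector_derivative del: of_real_diff of_real_divide of_real_power)
  qed (auto intro!: continuous_intros)
  then show ?thesis using True l by (simp add: fejer_def field_simps power2_eq_square)
 qed
 finally show ?thesis .
qed

lemma fejer_le: assumes l: "0 < K" shows "fejer K x <= K"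
proof (cases "x = 0")
 case False
 have "1 - cos (K * x) = 2 * (sin (K * x / 2))\<^sup>2"
  using cos_double_sin[of "K * x / 2"] by simp
 also have "\<dots> <= 2 * (K * x / 2)\<^sup>2"
  using abs_sin_x_le_abs_x[of "K * x / 2"] by (simp add: abs_le_square_iff[symmetric])
 finally have "2 * (1 - cos (K * x)) <= K * (K * x\<^sup>2)" by (simp add: power2_eq_square field_simps)
 then show ?thesis using l False by (simp add: fejer_def pos_divide_le_eq)
qed (simp add: fejer_def)

lemma fejer_1_bound: "fejer 1 x <= 5 * inverse (1 + x\<^sup>2)"
proof (cases "\<bar>x\<bar> <= 2")
 case True
 then have "x\<^sup>2 <= 4" using abs_le_square_iff[of x 2] by simp
 then have "1 <= 5 * inverse (1 + x\<^sup>2)" by (simp add: field_simps add_pos_nonneg)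
 then show ?thesis using fejer_le[of 1 x] by simp
next
 case False
 then have x: "4 <= x\<^sup>2" "x \<noteq> 0" using abs_le_square_iff[of 2 x] by auto
 have "2 * (1 - cos x) <= 2 * (1 - (-1))" by (intro mult_left_mono diff_left_mono cos_ge_minus_one) simp
 then have "2 * (1 - cos x) <= 4" by simp
 then have "2 * (1 - cos x) / x\<^sup>2 <= 4 / x\<^sup>2" by (rule divide_right_mono) simp
 then have "fejer 1 x <= 4 / x\<^sup>2" using x by (simp add: fejer_def)
 also have "\<dots> <= 5 * inverse (1 + x\<^sup>2)" using x by (simp add: field_simps)
 finally show ?thesis .
qed

lemma fejer_integrable: assumes l: "0 < K" shows "integrable lborel (fejer K)"
proof -
 have "integrable lborel (%x. 5 * inverse (1 + x\<^sup>2) :: real)"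
  using integrable_inverse_1_plus_square by (simp add: set_integrable_def)
 then have "integrable lborel (fejer 1)"
  by (rule Bochner_Integration.integrable_bound)
    (auto simp: fejer_nonneg intro!: order_trans[OF fejer_1_bound])
 then have "integrable lborel (%x. K * fejer 1 (0 + K * x))"
  using l by (intro integrable_mult_right lborel_integrable_real_affine) auto
 then show ?thesis by (subst fejer_scale[OF l, abs_def]) simp
qed

lemma fejer_set_integral_pos:
 assumes l: "0 < K" and r: "0 < r"
 shows "0 < (\<integral>x. indicator {-r..r} x * fejer K x \<partial>lborel)"
proof -
 have int: "integrable lborel (%x. indicator {-r..r} x * fejer K x)"
  by (rule Bochner_Integration.integrable_bound[OF fejer_integrable[OF l]])
    (auto simp: indicator_def)
 have nn: "AE x in lborel. 0 <= indicator {-r..r} x * fejer K x"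
  by (auto simp: fejer_nonneg l)
 have "(\<integral>x. indicator {-r..r} x * fejer K x \<partial>lborel) \<noteq> 0"
 proof
  assume "(\<integral>x. indicator {-r..r} x * fejer K x \<partial>lborel) = 0"
  then have ae: "AE x in lborel. indicator {-r..r} x * fejer K x = 0"
   using integral_nonneg_eq_0_iff_AE[OF int nn] by simp
  define s where "s = min r (pi / K)"
  have s: "0 < s" using l r by (simp add: s_def)
  have "AE x in lborel. x \<notin> {0<..<s}"
   using ae
  proof eventually_elim
   case (elim x)
   show ?case
   proof
    assume x: "x \<in> {0<..<s}"
    then have "0 < K * x" "K * x < pi" using l by (auto simp: s_def field_simps)
    then have "cos (K * x) < cos 0" by (intro cos_monotone_0_pi) auto
    then have "0 < fejer K x" using l x by (auto simp: fejer_def)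
    then show False using elim x by (auto simp: s_def indicator_def)
   qed
  qed
  then have "emeasure lborel {0<..<s} = 0" by (subst (asm) AE_iff_measurable[OF _ refl]) (auto simp: greaterThanLessThan_def greaterThan_def lessThan_def Int_def)
  then show False using s by simp
 qed
 moreover have "0 <= (\<integral>x. indicator {-r..r} x * fejer K x \<partial>lborel)"
  by (rule integral_nonneg_AE[OF nn])
 ultimately show ?thesis by simp
qed

section \<open>Fourier integrals\<close>

lemma riemann_lebesgue_compact_support:
 fixes r :: "real => complex"
 assumes c: "continuous_on UNIV r" and z: "\<And>\<theta>. \<kappa> <= \<bar>\<theta>\<bar> ==> r \<theta> = 0" and l: "0 < \<kappa>"
 shows "((%x. \<integral>\<theta>. r \<theta> * exp (- \<i> * of_real (\<theta> * x)) \<partial>lborel) \<longlongrightarrow> 0) at_top"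
proof -
 have [measurable]: "r \<in> borel_measurable borel"
  using c by (rule borel_measurable_continuous_onI)
 obtain K where K: "\<And>\<theta>. norm (r \<theta>) <= K"
 proof -
  have "bounded (r ` {-\<kappa>..\<kappa>})"
   by (intro compact_imp_bounded compact_continuous_image continuous_on_subset[OF c]) auto
  then obtain K where K: "\<And>\<theta>. \<theta> \<in> {-\<kappa>..\<kappa>} ==> norm (r \<theta>) <= K"
   unfolding bounded_iff by (metis imageI)
  have "norm (r \<theta>) <= max K 0" for \<theta>
  proof (cases "\<bar>\<theta>\<bar> <= \<kappa>")
   case True
   then have "\<theta> \<in> {-\<kappa>..\<kappa>}" by auto
   from K[OF this] show ?thesis by simp
  next
   case False then show ?thesis using z[of \<theta>] by auto
  qed
  then show ?thesis by (rule that)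
 qed
 have bnd: "norm (r (\<theta> + a)) <= indicator {-(\<kappa>+1)..\<kappa>+1} \<theta> * K" if "\<bar>a\<bar> <= 1" for \<theta> a
 proof (cases "\<theta> \<in> {-(\<kappa>+1)..\<kappa>+1}")
  case False
  then have "\<kappa> <= \<bar>\<theta> + a\<bar>" using that by (auto simp: abs_if split: if_splits)
  then show ?thesis using z False by auto
 qed (use K in auto)
 have bint: "integrable lborel (%\<theta>. indicator {-(\<kappa>+1)..\<kappa>+1} \<theta> * K :: real)"
  by (intro integrable_mult_left integrable_real_indicator) (auto simp: emeasure_lborel_Icc_eq)
 have rint: "integrable lborel (%\<theta>. r (\<theta> + a) * exp (- \<i> * of_real (\<theta> * x)))" if "\<bar>a\<bar> <= 1" for a x
  by (rule Bochner_Integration.integrable_bound[OF bint])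
    (use bnd[OF that] in \<open>auto simp: norm_mult intro!: AE_I2 order_trans[OF _ abs_ge_self]\<close>)
 have lim: "((%x. \<integral>\<theta>. norm (r \<theta> - r (\<theta> + pi / x)) \<partial>lborel) \<longlongrightarrow> (\<integral>\<theta>. (0::real) \<partial>(lborel::real measure))) at_top"
 proof (rule integral_dominated_convergence_at_top)
  show "integrable lborel (%\<theta>. 2 * (indicator {-(\<kappa>+1)..\<kappa>+1} \<theta> * K) :: real)"
   by (intro integrable_mult_right bint)
  show "\<forall>\<^sub>F x in at_top. AE \<theta> in lborel. norm (norm (r \<theta> - r (\<theta> + pi / x))) <= 2 * (indicator {-(\<kappa>+1)..\<kappa>+1} \<theta> * K)"
   using eventually_ge_at_top[of pi]
  proof eventually_elim
   case (elim x)
   have "0 < x" using elim pi_gt_zero by linarith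
   then have "\<bar>pi / x\<bar> <= 1" using elim by (simp add: field_simps)
   have "norm (norm (r \<theta> - r (\<theta> + pi / x))) <= 2 * (indicator {-(\<kappa>+1)..\<kappa>+1} \<theta> * K)" for \<theta>
   proof -
    have "norm (r \<theta> - r (\<theta> + pi / x)) <= norm (r (\<theta> + 0)) + norm (r (\<theta> + pi / x))"
     using norm_triangle_ineq4[of "r \<theta>"] by simp
    also have "\<dots> <= indicator {-(\<kappa>+1)..\<kappa>+1} \<theta> * K + indicator {-(\<kappa>+1)..\<kappa>+1} \<theta> * K"
     by (intro add_mono bnd \<open>\<bar>pi / x\<bar> <= 1\<close>) simp
    finally show ?thesis by (simp only: mult_2 real_norm_def abs_norm_cancel)
   qed
   then show ?case by (intro AE_I2)
  qed
  show "AE \<theta> in lborel. ((%x. norm (r \<theta> - r (\<theta> + pi / x))) \<longlongrightarrow> 0) at_top"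
  proof (rule AE_I2)
   fix \<theta>
   have "((%x. \<theta> + pi / x) \<longlongrightarrow> \<theta> + 0) at_top"
    by (intro tendsto_intros tendsto_divide_0[OF tendsto_const] filterlim_at_top_imp_at_infinity filterlim_ident)
   moreover have "isCont r \<theta>" using c by (simp add: continuous_on_eq_continuous_at)
   ultimately have "((%x. r (\<theta> + pi / x)) \<longlongrightarrow> r \<theta>) at_top"
    by (intro isCont_tendsto_compose[of _ r]) auto
   then have "((%x. norm (r \<theta> - r (\<theta> + pi / x))) \<longlongrightarrow> norm (r \<theta> - r \<theta>)) at_top"
    by (intro tendsto_intros)
   then show "((%x. norm (r \<theta> - r (\<theta> + pi / x))) \<longlongrightarrow> 0) at_top" by simp
  qed
 qed auto
 have "((%x. norm (\<integral>\<theta>. r \<theta> * exp (- \<i> * of_real (\<theta> * x)) \<partial>lborel)) \<longlongrightarrow> 0) at_top"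
 proof (rule tendsto_sandwich[OF always_eventually _ tendsto_const lim[simplified]])
  show "\<forall>\<^sub>F x in at_top. norm (\<integral>\<theta>. r \<theta> * exp (- \<i> * of_real (\<theta> * x)) \<partial>lborel)
    <= (\<integral>\<theta>. norm (r \<theta> - r (\<theta> + pi / x)) \<partial>lborel)"
   using eventually_ge_at_top[of pi]
  proof eventually_elim
   case (elim x)
   then have x: "0 < x" using pi_gt_zero by linarith
   with elim have x: "0 < x" "\<bar>pi / x\<bar> <= 1" by (auto simp: field_simps)
   let ?I = "\<integral>\<theta>. r \<theta> * exp (- \<i> * of_real (\<theta> * x)) \<partial>lborel"
   have "?I = (\<integral>\<theta>. r (pi / x + 1 * \<theta>) * exp (- \<i> * of_real ((pi / x + 1 * \<theta>) * x)) \<partial>lborel)"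
    using lborel_integral_real_affine[of 1 "%\<theta>. r \<theta> * exp (- \<i> * of_real (\<theta> * x))" "pi / x"] by simp
   also have "\<dots> = (\<integral>\<theta>. - (r (\<theta> + pi / x) * exp (- \<i> * of_real (\<theta> * x))) \<partial>lborel)"
   proof (intro Bochner_Integration.integral_cong refl)
    fix \<theta>
    have "(pi / x + 1 * \<theta>) * x = pi + \<theta> * x" using x by (simp add: field_simps)
    then have "- \<i> * complex_of_real ((pi / x + 1 * \<theta>) * x) = - (\<i> * of_real pi) + - \<i> * of_real (\<theta> * x)"
     by (simp add: algebra_simps del: of_real_mult)
    then have "exp (- \<i> * complex_of_real ((pi / x + 1 * \<theta>) * x)) = exp (- (\<i> * of_real pi)) * exp (- \<i> * of_real (\<theta> * x))"
     by (simp only: exp_add)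
    also have "exp (- (\<i> * of_real pi)) = -1" by (simp add: exp_minus)
    finally show "r (pi / x + 1 * \<theta>) * exp (- \<i> * of_real ((pi / x + 1 * \<theta>) * x)) =
     - (r (\<theta> + pi / x) * exp (- \<i> * of_real (\<theta> * x)))" by (simp add: add.commute)
   qed
   finally have "?I + ?I = ?I - (\<integral>\<theta>. (r (\<theta> + pi / x) * exp (- \<i> * of_real (\<theta> * x))) \<partial>lborel)" by simp
   also have "\<dots> = (\<integral>\<theta>. (r \<theta> - r (\<theta> + pi / x)) * exp (- \<i> * of_real (\<theta> * x)) \<partial>lborel)"
    using Bochner_Integration.integral_diff[OF rint[of 0 x] rint[OF x(2), of x]]
    by (simp add: left_diff_distrib)
   finally have "norm (?I + ?I) <= (\<integral>\<theta>. norm ((r \<theta> - r (\<theta> + pi / x)) * exp (- \<i> * of_real (\<theta> * x))) \<partial>lborel)"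
    by (simp only: integral_norm_bound)
   also have "\<dots> = (\<integral>\<theta>. norm (r \<theta> - r (\<theta> + pi / x)) \<partial>lborel)"
    by (simp add: norm_mult)
   finally have "norm (2 * ?I) <= (\<integral>\<theta>. norm (r \<theta> - r (\<theta> + pi / x)) \<partial>lborel)" by (simp only: mult_2)
   then have "2 * norm ?I <= (\<integral>\<theta>. norm (r \<theta> - r (\<theta> + pi / x)) \<partial>lborel)"
    by (simp only: norm_mult norm_numeral)
   then show ?case using norm_ge_zero[of ?I] by linarith
  qed
 qed auto
 then show ?thesis by (rule tendsto_norm_zero_cancel)
qed

lemma exp_half_line_integral:
 fixes s :: complex
 assumes s: "Re s < 0"
 shows "integrable lborel (%y. indicator {0..} y *\<^sub>R exp (s * of_real y))"
  "(\<integral>y. indicator {0..} y *\<^sub>R exp (s * of_real y) \<partial>lborel) = - 1 / s"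
proof -
 have ex: "((%y. exp (Re s * y)) \<longlongrightarrow> 0) at_top"
 proof -
  have "filterlim (%y. Re s * y) at_bot at_top"
   using s by (intro filterlim_tendsto_neg_mult_at_bot[OF tendsto_const] filterlim_ident)
  then show ?thesis by (rule filterlim_compose[OF exp_at_bot])
 qed
 have D: "((%y. exp (s * of_real y) / s) has_vector_derivative exp (s * of_real y)) (at y)" for y
 proof -
  have "((%w. exp (s * w) / s) has_field_derivative exp (s * of_real y)) (at (of_real y))"
   using s by (auto intro!: derivative_eq_intros)
  from has_vector_derivative_real_field[OF this, of UNIV] show ?thesis by (simp add: o_def)
 qed
 have r: "set_integrable lborel (einterval 0 \<infinity>) (%y. exp (Re s * y))"
 proof (rule interval_integral_FTC_nonneg)
  show "(((%y. exp (Re s * y) / Re s) \<circ> real_of_ereal) \<longlongrightarrow> 0) (at_left \<infinity>)"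
   using tendsto_divide[OF ex tendsto_const, of "Re s"] s by (simp add: ereal_tendsto_simps)
  have "((%y. exp (Re s * y) / Re s) \<longlongrightarrow> exp (Re s * 0) / Re s) (at_right 0)"
   by (intro tendsto_intros) (use s in auto)
  then show "(((%y. exp (Re s * y) / Re s) \<circ> real_of_ereal) \<longlongrightarrow> 1 / Re s) (at_right 0)"
   by (simp add: zero_ereal_def ereal_tendsto_simps)
 qed (use s in \<open>auto intro!: derivative_eq_intros\<close>)
 then have "integrable lborel (%y. indicator {0<..} y * exp (Re s * y))"
  by (simp add: set_integrable_def zero_ereal_def einterval_eq_Ici)
 then have ri: "integrable lborel (%y. exp (Re s * y) * indicator {0..} y)"
  by (rule integrable_cong_AE_imp)
    (measurable, use AE_lborel_singleton[of 0] in eventually_elim, auto simp: indicator_def)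
 show I: "integrable lborel (%y. indicator {0..} y *\<^sub>R exp (s * of_real y))"
  by (rule Bochner_Integration.integrable_bound[OF ri]) (auto simp: indicator_def)
 have I': "set_integrable lborel {0<..} (%y. exp (s * of_real y))"
  unfolding set_integrable_def
  by (rule Bochner_Integration.integrable_bound[OF I]) (auto simp: indicator_def)
 have "(LBINT y=0..\<infinity>. exp (s * of_real y)) = 0 - 1 / s"
 proof (rule interval_integral_FTC_integrable[OF _ D])
  show "set_integrable lborel (einterval 0 \<infinity>) (%y. exp (s * of_real y))"
   using I' by (simp add: zero_ereal_def einterval_eq_Ici)
  have "((%y. exp (s * of_real y) / s) \<longlongrightarrow> exp (s * of_real 0) / s) (at_right 0)"
   by (intro tendsto_intros) (use s in auto)
  then show "(((%y. exp (s * of_real y) / s) \<circ> real_of_ereal) \<longlongrightarrow> 1 / s) (at_right 0)"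
   by (simp add: zero_ereal_def ereal_tendsto_simps)
  have "s \<noteq> 0" using s by auto
  then have "((%y. norm (exp (s * of_real y) / s)) \<longlongrightarrow> 0) at_top"
   using tendsto_divide[OF ex tendsto_const, of "norm s"] by (simp add: norm_divide)
  then show "(((%y. exp (s * of_real y) / s) \<circ> real_of_ereal) \<longlongrightarrow> 0) (at_left \<infinity>)"
   by (simp add: ereal_tendsto_simps tendsto_norm_zero_iff)
 qed auto
 also have "(LBINT y=0..\<infinity>. exp (s * of_real y)) = (\<integral>y. indicator {0<..} y *\<^sub>R exp (s * of_real y) \<partial>lborel)"
  by (simp add: interval_lebesgue_integral_def zero_ereal_def einterval_eq_Ici set_lebesgue_integral_def)
 also have "\<dots> = (\<integral>y. indicator {0..} y *\<^sub>R exp (s * of_real y) \<partial>lborel)"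
  by (rule integral_cong_AE, measurable)
    (use AE_lborel_singleton[of 0] in eventually_elim, auto simp: indicator_def)
 finally show "(\<integral>y. indicator {0..} y *\<^sub>R exp (s * of_real y) \<partial>lborel) = - 1 / s" by simp
qed

section \<open>A local Wiener-Ikehara theorem\<close>

text \<open>For \<open>\<epsilon> > 0\<close>, expand the Fejer kernel as a Fourier integral over \<open>[-\<kappa>, \<kappa>]\<close> and exchange the integrals: the smoothed tail becomes an
integral of the transform against the tent. The pole \<open>1 / (\<epsilon> - i \<theta>)\<close> is the transform of the half-line, so it contributes the
smoothed constant \<open>c\<close>. Continuity of the rest up to \<open>\<epsilon> = 0\<close> allows the limit \<open>\<epsilon> \<rightarrow> 0\<close>, after which the rest vanishes at infinity by
the lemma of Riemann and Lebesgue.\<close>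

lemma wiener_ikehara_convolution:
 fixes H :: "real => real" and R :: "real => real => complex" and c :: real
 assumes d: "0 < \<delta>" "\<delta> <= \<alpha>" and k: "0 < \<kappa>"
  and H[measurable]: "H \<in> borel_measurable borel" and H0: "\<And>y. 0 <= H y" and H1: "\<And>y. H y <= 1"
  and int: "\<And>\<epsilon>. 0 < \<epsilon> ==> \<epsilon> < \<delta> ==> integrable lborel (%y. exp ((\<alpha> - \<epsilon>) * y) * H y)"
  and tr: "\<And>\<epsilon> \<theta>. 0 < \<epsilon> ==> \<epsilon> < \<delta> ==> \<bar>\<theta>\<bar> <= \<kappa> ==>
   (\<integral>y. exp (Complex (\<alpha> - \<epsilon>) \<theta> * of_real y) * of_real (H y) \<partial>lborel) = of_real c / Complex \<epsilon> (- \<theta>) + R \<epsilon> \<theta>"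
  and cont: "continuous_on ({0..<\<delta>} \<times> {-\<kappa>..\<kappa>}) (%(\<epsilon>, \<theta>). R \<epsilon> \<theta>)"
 shows "integrable lborel (%y. exp (\<alpha> * y) * H y * fejer \<kappa> (x - y))"
  "((%x. \<integral>y. exp (\<alpha> * y) * H y * fejer \<kappa> (x - y) \<partial>lborel) \<longlongrightarrow> c * (\<integral>y. fejer \<kappa> y \<partial>lborel)) at_top"
proof -
 define cl where "cl = (%\<theta>. max (-\<kappa>) (min \<kappa> \<theta>))"
 have cl_in: "cl \<theta> \<in> {-\<kappa>..\<kappa>}" for \<theta> using k by (auto simp: cl_def)
 have cl_id: "cl \<theta> = \<theta>" if "\<bar>\<theta>\<bar> <= \<kappa>" for \<theta> using that by (auto simp: cl_def)
 have cl_cont: "continuous_on S cl" for S unfolding cl_def by (intro continuous_intros)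
 have tent0: "tent \<kappa> \<theta> = 0" if "\<kappa> <= \<bar>\<theta>\<bar>" for \<theta> using that k by (simp add: tent_def)
 have tent_ge: "0 <= tent \<kappa> \<theta>" for \<theta> by (simp add: tent_def)
 have tent_bd: "\<bar>tent \<kappa> \<theta>\<bar> <= indicator {-\<kappa>..\<kappa>} \<theta>" for \<theta>
  using k by (auto simp: tent_def indicator_def)
 have [measurable]: "tent \<kappa> \<in> borel_measurable borel" unfolding tent_def[abs_def] by measurable
 have kint: "integrable lborel (%\<theta>. indicator {-\<kappa>..\<kappa>} \<theta> :: real)" by (intro integrable_real_indicator) (auto simp: emeasure_lborel_Icc_eq)
 have Rc1: "continuous_on UNIV (%\<theta>. R \<epsilon> (cl \<theta>))" if "\<epsilon> \<in> {0..<\<delta>}" for \<epsilon>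
 proof -
  have "continuous_on UNIV (%\<theta>. (\<epsilon>, cl \<theta>))" by (intro continuous_intros cl_cont)
  moreover have "(%\<theta>. (\<epsilon>, cl \<theta>)) ` UNIV \<subseteq> {0..<\<delta>} \<times> {-\<kappa>..\<kappa>}" using cl_in that by blast
  ultimately show ?thesis using continuous_on_compose2[OF cont] by fastforce
 qed
 have Rc2: "continuous_on {0..<\<delta>} (%\<epsilon>. R \<epsilon> (cl \<theta>))" for \<theta>
 proof -
  have "continuous_on {0..<\<delta>} (%\<epsilon>. (\<epsilon>, cl \<theta>))" by (intro continuous_intros)
  moreover have "(%\<epsilon>. (\<epsilon>, cl \<theta>)) ` {0..<\<delta>} \<subseteq> {0..<\<delta>} \<times> {-\<kappa>..\<kappa>}" using cl_in by blast
  ultimately show ?thesis using continuous_on_compose2[OF cont] by fastforce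
 qed
 obtain K where K: "\<And>\<epsilon> \<theta>. \<epsilon> \<in> {0..\<delta>/2} ==> norm (R \<epsilon> (cl \<theta>)) <= K"
 proof -
  have "compact ((%(\<epsilon>, \<theta>). R \<epsilon> \<theta>) ` ({0..\<delta>/2} \<times> {-\<kappa>..\<kappa>}))"
   by (intro compact_continuous_image continuous_on_subset[OF cont] compact_Times) (use d in auto)
  then obtain K where "\<forall>z\<in>(%(\<epsilon>, \<theta>). R \<epsilon> \<theta>) ` ({0..\<delta>/2} \<times> {-\<kappa>..\<kappa>}). norm z <= K"
   by (auto dest!: compact_imp_bounded simp: bounded_iff)
  then show ?thesis using cl_in by (intro that[of K]) (auto simp: image_iff)
 qed
 define e where "e = (%n. \<delta> / 2 / (real n + 1))"
 have e: "0 < e n" "e n < \<delta>" "e n \<in> {0..\<delta>/2}" "e n <= \<delta>/2" for n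
 proof -
  have "e n <= \<delta> / 2" using d unfolding e_def by (intro divide_left_mono[of 1 "real n + 1", simplified]) auto
  moreover show "0 < e n" using d by (simp add: e_def)
  ultimately show "e n < \<delta>" "e n \<in> {0..\<delta>/2}" "e n <= \<delta>/2" using d by auto
 qed
 have elim: "e \<longlonglongrightarrow> 0" unfolding e_def by real_asymp
 define g where "g = (%\<epsilon> y. exp ((\<alpha> - \<epsilon>) * y) * H y)"
 have [measurable]: "g \<epsilon> \<in> borel_measurable borel" for \<epsilon> unfolding g_def by measurable
 have g0: "0 <= g \<epsilon> y" for \<epsilon> y using H0 by (simp add: g_def)
 define E where "E = (%\<epsilon> y. indicator {0..} y * exp (- \<epsilon> * y) :: real)"
 have [measurable]: "E \<epsilon> \<in> borel_measurable borel" for \<epsilon> unfolding E_def by measurable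
 have Eint: "integrable lborel (E \<epsilon>)"
  and EF: "(\<integral>y. complex_of_real (E \<epsilon> y) * exp (\<i> * of_real (\<theta> * y)) \<partial>lborel) = 1 / Complex \<epsilon> (- \<theta>)"
  if "0 < \<epsilon>" for \<epsilon> \<theta>
 proof -
  have *: "indicator {0..} y *\<^sub>R exp (Complex (-\<epsilon>) \<theta> * of_real y) = complex_of_real (E \<epsilon> y) * exp (\<i> * of_real (\<theta> * y))" for y \<theta>
  proof -
   have "Complex (-\<epsilon>) \<theta> * complex_of_real y = of_real (- \<epsilon> * y) + \<i> * of_real (\<theta> * y)"
    by (simp add: complex_eq_iff)
   then show ?thesis by (simp only: exp_add exp_of_real) (simp add: E_def scaleR_conv_of_real)
  qed
  have "- 1 / Complex (- \<epsilon>) \<theta> = 1 / Complex \<epsilon> (- \<theta>)"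
  proof -
   have "Complex (- \<epsilon>) \<theta> = - Complex \<epsilon> (- \<theta>)" by (simp add: complex_eq_iff)
   then show ?thesis by (simp only:) simp
  qed
  then show "(\<integral>y. of_real (E \<epsilon> y) * exp (\<i> * of_real (\<theta> * y)) \<partial>lborel) = 1 / Complex \<epsilon> (- \<theta>)"
   using exp_half_line_integral(2)[of "Complex (-\<epsilon>) \<theta>"] that unfolding * by simp
  have "integrable lborel (%y. complex_of_real (E \<epsilon> y) * exp (\<i> * of_real (0 * y)))"
   using exp_half_line_integral(1)[of "Complex (-\<epsilon>) 0"] that unfolding * by simp
  then show "integrable lborel (E \<epsilon>)" by (simp add: complex_of_real_integrable_eq)
 qed
 define D where "D = (%\<epsilon> y. g \<epsilon> y - c * E \<epsilon> y)"
 have [measurable]: "D \<epsilon> \<in> borel_measurable borel" for \<epsilon> unfolding D_def by measurable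
 have gint: "integrable lborel (g \<epsilon>)" if "0 < \<epsilon>" "\<epsilon> < \<delta>" for \<epsilon>
  using int[OF that] by (simp add: g_def)
 have Dint: "integrable lborel (D \<epsilon>)" if "0 < \<epsilon>" "\<epsilon> < \<delta>" for \<epsilon>
  unfolding D_def using that by (intro Bochner_Integration.integrable_diff integrable_mult_right gint Eint)
 have iexp_int: "integrable lborel (%y. complex_of_real (f y) * exp (\<i> * of_real (\<theta> * y)))"
  if "integrable lborel f" for f \<theta>
 proof -
  have [measurable]: "f \<in> borel_measurable borel" using that by auto
  show ?thesis by (rule Bochner_Integration.integrable_bound[OF that]) (auto simp: norm_mult)
 qed
 have DF: "(\<integral>y. of_real (D \<epsilon> y) * exp (\<i> * of_real (\<theta> * y)) \<partial>lborel) = R \<epsilon> (cl \<theta>)"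
  if "0 < \<epsilon>" "\<epsilon> < \<delta>" "\<bar>\<theta>\<bar> <= \<kappa>" for \<epsilon> \<theta>
 proof -
  have "exp (Complex (\<alpha> - \<epsilon>) \<theta> * of_real y) * of_real (H y) = of_real (g \<epsilon> y) * exp (\<i> * of_real (\<theta> * y))" for y
  proof -
   have "Complex (\<alpha> - \<epsilon>) \<theta> * complex_of_real y = of_real ((\<alpha> - \<epsilon>) * y) + \<i> * of_real (\<theta> * y)"
    by (simp add: complex_eq_iff)
   then show ?thesis by (simp only: exp_add exp_of_real) (simp add: g_def)
  qed
  then have "(\<integral>y. of_real (g \<epsilon> y) * exp (\<i> * of_real (\<theta> * y)) \<partial>lborel) = of_real c / Complex \<epsilon> (- \<theta>) + R \<epsilon> \<theta>"
   using tr[OF that] by simp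
  moreover have "(\<integral>y. of_real (D \<epsilon> y) * exp (\<i> * of_real (\<theta> * y)) \<partial>lborel) =
    (\<integral>y. of_real (g \<epsilon> y) * exp (\<i> * of_real (\<theta> * y)) - of_real c * (of_real (E \<epsilon> y) * exp (\<i> * of_real (\<theta> * y))) \<partial>lborel)"
   by (simp add: D_def algebra_simps)
  moreover have "\<dots> = (\<integral>y. of_real (g \<epsilon> y) * exp (\<i> * of_real (\<theta> * y)) \<partial>lborel) - of_real c * (1 / Complex \<epsilon> (- \<theta>))"
   using that
   by (subst Bochner_Integration.integral_diff)
     (simp_all only: integral_mult_right_zero EF iexp_int gint Eint integrable_mult_right)
  ultimately show ?thesis using cl_id[OF that(3)] by simp
 qed
 have conv: "complex_of_real (\<integral>y. D \<epsilon> y * fejer \<kappa> (x - y) \<partial>lborel) =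
   (\<integral>\<theta>. of_real (tent \<kappa> \<theta>) * R \<epsilon> (cl \<theta>) * exp (- \<i> * of_real (\<theta> * x)) \<partial>lborel)"
  if ep: "0 < \<epsilon>" "\<epsilon> < \<delta>" for \<epsilon> x
 proof -

  let ?f = "%y \<theta>. complex_of_real (D \<epsilon> y) * (of_real (tent \<kappa> \<theta>) * exp (\<i> * of_real (\<theta> * (y - x))))"
  have fint: "integrable (lborel \<Otimes>\<^sub>M lborel) (%(y, \<theta>). ?f y \<theta>)"
  proof (rule Bochner_Integration.integrable_bound)
   show "integrable (lborel \<Otimes>\<^sub>M lborel) (%(y, \<theta>). D \<epsilon> y * indicator {-\<kappa>..\<kappa>} \<theta>)"
   proof (rule lborel_pair.Fubini_integrable)
    show "AE y in lborel. integrable lborel (%\<theta>. case (y, \<theta>) of (y, \<theta>) => D \<epsilon> y * indicator {-\<kappa>..\<kappa>} \<theta>)"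
     using kint by auto
    show "integrable lborel (%y. LINT \<theta>|lborel. norm (case (y, \<theta>) of (y, \<theta>) => D \<epsilon> y * indicator {-\<kappa>..\<kappa>} \<theta>))"
     using Dint[OF ep] kint by (simp add: abs_mult)
   qed auto
   show "AE z in lborel \<Otimes>\<^sub>M lborel. norm (case z of (y, \<theta>) => ?f y \<theta>) \<le>
     norm (case z of (y, \<theta>) => D \<epsilon> y * indicator {-\<kappa>..\<kappa>} \<theta>)"
    using tent_bd by (auto intro!: AE_I2 mult_left_mono simp: norm_mult abs_mult simp del: abs_indicator split: prod.split)
  qed auto
  have "complex_of_real (\<integral>y. D \<epsilon> y * fejer \<kappa> (x - y) \<partial>lborel) = (\<integral>y. complex_of_real (D \<epsilon> y * fejer \<kappa> (x - y)) \<partial>lborel)"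
   by (rule integral_complex_of_real[symmetric])
  also have "\<dots> = (\<integral>y. (\<integral>\<theta>. ?f y \<theta> \<partial>lborel) \<partial>lborel)"
  proof (intro Bochner_Integration.integral_cong refl)
   fix y
   have "fejer \<kappa> (x - y) = fejer \<kappa> (y - x)" using fejer_minus[of \<kappa> "x - y"] by simp
   then show "complex_of_real (D \<epsilon> y * fejer \<kappa> (x - y)) = (\<integral>\<theta>. ?f y \<theta> \<partial>lborel)"
    using tent_fourier[OF k, of "y - x"] by simp
  qed
  also have "\<dots> = (\<integral>\<theta>. (\<integral>y. ?f y \<theta> \<partial>lborel) \<partial>lborel)"
   using lborel_pair.Fubini_integral[OF fint] by simp
  also have "\<dots> = (\<integral>\<theta>. of_real (tent \<kappa> \<theta>) * R \<epsilon> (cl \<theta>) * exp (- \<i> * of_real (\<theta> * x)) \<partial>lborel)"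
  proof (intro Bochner_Integration.integral_cong refl)
   fix \<theta>
   show "(\<integral>y. ?f y \<theta> \<partial>lborel) = of_real (tent \<kappa> \<theta>) * R \<epsilon> (cl \<theta>) * exp (- \<i> * of_real (\<theta> * x))"
   proof (cases "\<bar>\<theta>\<bar> <= \<kappa>")
    case True
    have "?f y \<theta> = of_real (tent \<kappa> \<theta>) * exp (- \<i> * of_real (\<theta> * x)) * (of_real (D \<epsilon> y) * exp (\<i> * of_real (\<theta> * y)))" for y
    proof -
     have "\<i> * complex_of_real (\<theta> * (y - x)) = - \<i> * of_real (\<theta> * x) + \<i> * of_real (\<theta> * y)" by (simp add: algebra_simps)
     then show ?thesis by (simp only: exp_add) (simp add: algebra_simps)
    qed
    then have "(\<integral>y. ?f y \<theta> \<partial>lborel) = of_real (tent \<kappa> \<theta>) * exp (- \<i> * of_real (\<theta> * x)) *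
      (\<integral>y. of_real (D \<epsilon> y) * exp (\<i> * of_real (\<theta> * y)) \<partial>lborel)" by (simp only: integral_mult_right_zero)
    then show ?thesis using DF[OF ep True] by simp
   qed (simp add: tent0)
  qed
  finally show ?thesis .
 qed
 define I0 where "I0 = (%x. \<integral>\<theta>. of_real (tent \<kappa> \<theta>) * R 0 (cl \<theta>) * exp (- \<i> * of_real (\<theta> * x)) \<partial>lborel)"
 have lim1: "(%n. complex_of_real (\<integral>y. D (e n) y * fejer \<kappa> (x - y) \<partial>lborel)) \<longlonglongrightarrow> I0 x" for x
  unfolding conv[OF e(1,2)] I0_def
 proof (rule integral_dominated_convergence)
  have mR: "(%\<theta>. R \<epsilon> (cl \<theta>)) \<in> borel_measurable borel" if "\<epsilon> \<in> {0..<\<delta>}" for \<epsilon>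
   by (rule borel_measurable_continuous_onI[OF Rc1[OF that]])
  have [measurable]: "(%\<theta>. R 0 (cl \<theta>)) \<in> borel_measurable borel"
   "\<And>n. (%\<theta>. R (e n) (cl \<theta>)) \<in> borel_measurable borel"
   using mR[of 0] mR[of "e n" for n] d e by (auto simp: less_imp_le)
  show "(%\<theta>. of_real (tent \<kappa> \<theta>) * R 0 (cl \<theta>) * exp (- \<i> * of_real (\<theta> * x))) \<in> borel_measurable lborel"
   "(%\<theta>. of_real (tent \<kappa> \<theta>) * R (e n) (cl \<theta>) * exp (- \<i> * of_real (\<theta> * x))) \<in> borel_measurable lborel" for n
   by measurable
  show "integrable lborel (%\<theta>. indicator {-\<kappa>..\<kappa>} \<theta> * K)" using kint by (rule integrable_mult_left)
  show "AE \<theta> in lborel. norm (of_real (tent \<kappa> \<theta>) * R (e n) (cl \<theta>) * exp (- \<i> * of_real (\<theta> * x))) <= indicator {-\<kappa>..\<kappa>} \<theta> * K" for n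
   using tent_bd K[OF e(3)] by (auto simp: norm_mult intro!: AE_I2 mult_mono)
  have "(%n. R (e n) (cl \<theta>)) \<longlonglongrightarrow> R 0 (cl \<theta>)" for \<theta>
   using continuous_on_tendsto_compose[OF Rc2 elim] d e by (auto simp: less_imp_le)
  then show "AE \<theta> in lborel. (%n. of_real (tent \<kappa> \<theta>) * R (e n) (cl \<theta>) * exp (- \<i> * of_real (\<theta> * x)))
    \<longlonglongrightarrow> of_real (tent \<kappa> \<theta>) * R 0 (cl \<theta>) * exp (- \<i> * of_real (\<theta> * x))"
   by (intro AE_I2 tendsto_intros)
 qed
 have bdd_mult: "integrable lborel (%y. f y * fejer \<kappa> (x - y))" if "integrable lborel f" for f x
 proof -
  have [measurable]: "f \<in> borel_measurable borel" using that by auto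
  show ?thesis
  by (rule Bochner_Integration.integrable_bound[OF integrable_mult_left[OF that, of \<kappa>]])
    (use k in \<open>auto simp: abs_mult fejer_nonneg fejer_le intro!: AE_I2 mult_left_mono\<close>)
 qed
 have fsh: "integrable lborel (%y. fejer \<kappa> (x - y))" for x
  using lborel_integrable_real_affine[OF fejer_integrable[OF k], where c = "-1" and t = x] by simp
 define P where "P = (%x. \<integral>y. indicator {0..} y * fejer \<kappa> (x - y) \<partial>lborel)"
 have limE: "(%n. \<integral>y. E (e n) y * fejer \<kappa> (x - y) \<partial>lborel) \<longlonglongrightarrow> P x" for x
  unfolding P_def
 proof (rule integral_dominated_convergence[OF _ _ fsh])
  have "(%n. indicator {0..} y * exp (- e n * y) * fejer \<kappa> (x - y)) \<longlonglongrightarrow> indicator {0..} y * exp (- 0 * y) * fejer \<kappa> (x - y)" for y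
   by (intro tendsto_intros elim)
  then show "AE y in lborel. (%n. E (e n) y * fejer \<kappa> (x - y)) \<longlonglongrightarrow> indicator {0..} y * fejer \<kappa> (x - y)"
   unfolding E_def by (intro AE_I2) simp
  show "AE y in lborel. norm (E (e n) y * fejer \<kappa> (x - y)) <= fejer \<kappa> (x - y)" for n
   using e(1)[of n] by (auto simp: E_def indicator_def fejer_nonneg k abs_mult intro!: AE_I2 mult_left_le_one_le)
 qed auto
 have limg: "(%n. \<integral>y. g (e n) y * fejer \<kappa> (x - y) \<partial>lborel) \<longlonglongrightarrow> c * P x + Re (I0 x)" for x
 proof -
  have "(%n. Re (complex_of_real (\<integral>y. D (e n) y * fejer \<kappa> (x - y) \<partial>lborel))) \<longlonglongrightarrow> Re (I0 x)"
   by (intro tendsto_Re lim1)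
  then have "(%n. c * (\<integral>y. E (e n) y * fejer \<kappa> (x - y) \<partial>lborel) + (\<integral>y. D (e n) y * fejer \<kappa> (x - y) \<partial>lborel)) \<longlonglongrightarrow> c * P x + Re (I0 x)"
   by (intro tendsto_intros limE) simp
  moreover have "(\<integral>y. g (e n) y * fejer \<kappa> (x - y) \<partial>lborel) =
    c * (\<integral>y. E (e n) y * fejer \<kappa> (x - y) \<partial>lborel) + (\<integral>y. D (e n) y * fejer \<kappa> (x - y) \<partial>lborel)" for n
  proof -
   have "(\<integral>y. g (e n) y * fejer \<kappa> (x - y) \<partial>lborel) =
    (\<integral>y. c * (E (e n) y * fejer \<kappa> (x - y)) + D (e n) y * fejer \<kappa> (x - y) \<partial>lborel)"
    by (simp add: D_def algebra_simps)
   also have "\<dots> = c * (\<integral>y. E (e n) y * fejer \<kappa> (x - y) \<partial>lborel) + (\<integral>y. D (e n) y * fejer \<kappa> (x - y) \<partial>lborel)"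
    using e by (subst Bochner_Integration.integral_add) (auto intro!: bdd_mult Eint Dint integrable_mult_right)
   finally show ?thesis .
  qed
  ultimately show ?thesis by simp
 qed
 have glim: "(%n. g (e n) y) \<longlonglongrightarrow> g 0 y" for y
  unfolding g_def by (intro tendsto_intros elim)
 have int0: "integrable lborel (%y. g 0 y * fejer \<kappa> (x - y))" for x
 proof -
  have "Bseq (%n. \<integral>y. g (e n) y * fejer \<kappa> (x - y) \<partial>lborel)"
   using limg by (intro convergent_imp_Bseq convergentI)
  then obtain C where C: "\<And>n. norm (\<integral>y. g (e n) y * fejer \<kappa> (x - y) \<partial>lborel) <= C" by (elim BseqE) blast
  show ?thesis
  proof (rule integrable_of_bounded_nonneg_limit(1)[where u = "%n y. g (e n) y * fejer \<kappa> (x - y)" and C = C])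
   show "AE y in lborel. (%n. g (e n) y * fejer \<kappa> (x - y)) \<longlonglongrightarrow> g 0 y * fejer \<kappa> (x - y)"
    by (intro AE_I2 tendsto_intros glim)
   show "(\<integral>y. g (e n) y * fejer \<kappa> (x - y) \<partial>lborel) <= C" for n using C[of n] by simp
  qed (use e g0 k in \<open>auto intro!: bdd_mult gint mult_nonneg_nonneg fejer_nonneg\<close>)
 qed
 then show "integrable lborel (%y. exp (\<alpha> * y) * H y * fejer \<kappa> (x - y))" by (simp add: g_def)
 have neg_int: "integrable lborel (%y. exp (\<alpha> / 2 * y) * indicator {..0} y :: real)"
 proof -
  have "integrable lborel (%y. E (\<alpha>/2) (0 + (-1) * y))"
   using d by (intro lborel_integrable_real_affine Eint) auto
  then show ?thesis by (rule Bochner_Integration.integrable_cong[THEN iffD1, rotated -1])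
    (auto simp: E_def indicator_def)
 qed
 have val: "(\<integral>y. g 0 y * fejer \<kappa> (x - y) \<partial>lborel) = c * P x + Re (I0 x)" for x
 proof (rule LIMSEQ_unique[OF _ limg])
  show "(%n. \<integral>y. g (e n) y * fejer \<kappa> (x - y) \<partial>lborel) \<longlonglongrightarrow> (\<integral>y. g 0 y * fejer \<kappa> (x - y) \<partial>lborel)"
  proof (rule integral_dominated_convergence)
   show "integrable lborel (%y. g 0 y * fejer \<kappa> (x - y) + exp (\<alpha> / 2 * y) * indicator {..0} y * fejer \<kappa> (x - y))"
    by (intro Bochner_Integration.integrable_add int0 bdd_mult neg_int)
   have "g (e n) y <= g 0 y + exp (\<alpha> / 2 * y) * indicator {..0} y" for n y
   proof (cases "0 <= y")
    case True
    have "g (e n) y <= g 0 y"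
     unfolding g_def using True e(1)[of n] by (intro mult_right_mono H0) (auto simp: mult_right_mono)
    then show ?thesis by (simp add: indicator_def add_increasing2)
   next
    case False
    have "exp ((\<alpha> - e n) * y) <= exp (\<alpha> / 2 * y)"
     using False e(4)[of n] d by (auto intro!: mult_right_mono_neg)
    then have "g (e n) y <= exp (\<alpha> / 2 * y)"
     unfolding g_def using H1[of y] H0[of y] by (smt (verit) exp_gt_zero mult_left_le)
    then show ?thesis using False g0[of 0 y] by (simp add: indicator_def)
   qed
   then show "AE y in lborel. norm (g (e n) y * fejer \<kappa> (x - y))
     <= g 0 y * fejer \<kappa> (x - y) + exp (\<alpha> / 2 * y) * indicator {..0} y * fejer \<kappa> (x - y)" for n
    using g0 k by (auto simp: abs_mult fejer_nonneg distrib_right[symmetric] intro!: AE_I2 mult_right_mono)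
   show "AE y in lborel. (%n. g (e n) y * fejer \<kappa> (x - y)) \<longlonglongrightarrow> g 0 y * fejer \<kappa> (x - y)"
    by (intro AE_I2 tendsto_intros glim)
  qed auto
 qed
 have P_lim: "(P \<longlongrightarrow> (\<integral>y. fejer \<kappa> y \<partial>lborel)) at_top"
 proof -
  have "P = (%x. \<integral>y. indicator {..x} y * fejer \<kappa> y \<partial>lborel)"
  proof
   fix x
   show "P x = (\<integral>y. indicator {..x} y * fejer \<kappa> y \<partial>lborel)"
    using lborel_integral_real_affine[of "-1" "%y. indicator {0..} y * fejer \<kappa> (x - y)" x]
    unfolding P_def by (simp add: indicator_def)
  qed
  moreover have "((%x. \<integral>y. indicator {..x} y * fejer \<kappa> y \<partial>lborel) \<longlongrightarrow> (\<integral>y. fejer \<kappa> y \<partial>lborel)) at_top"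
  proof (rule integral_dominated_convergence_at_top[OF _ _ fejer_integrable[OF k]])
   show "AE y in lborel. ((%x. indicator {..x} y * fejer \<kappa> y) \<longlongrightarrow> fejer \<kappa> y) at_top"
   proof (rule AE_I2)
    fix y
    show "((%x. indicator {..x} y * fejer \<kappa> y) \<longlongrightarrow> fejer \<kappa> y) at_top"
     by (rule tendsto_eventually, use eventually_ge_at_top[of y] in eventually_elim) (auto simp: indicator_def)
   qed
  qed (auto simp: indicator_def fejer_nonneg k intro!: always_eventually)
  ultimately show ?thesis by simp
 qed
 have I0_lim: "(I0 \<longlongrightarrow> 0) at_top"
  unfolding I0_def
 proof (rule riemann_lebesgue_compact_support[OF _ _ k])
  have "continuous_on UNIV (%\<theta>. complex_of_real (tent \<kappa> \<theta>))"
   unfolding tent_def using k by (intro continuous_intros) auto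
  then show "continuous_on UNIV (%\<theta>. of_real (tent \<kappa> \<theta>) * R 0 (cl \<theta>))"
   using Rc1[of 0] d by (intro continuous_on_mult) auto
 qed (simp add: tent0)
 have "((%x. c * P x + Re (I0 x)) \<longlongrightarrow> c * (\<integral>y. fejer \<kappa> y \<partial>lborel) + Re 0) at_top"
  by (intro tendsto_intros P_lim I0_lim)
 then show "((%x. \<integral>y. exp (\<alpha> * y) * H y * fejer \<kappa> (x - y) \<partial>lborel) \<longlongrightarrow> c * (\<integral>y. fejer \<kappa> y \<partial>lborel)) at_top"
  using val by (simp add: g_def)
qed

section \<open>Tails from smoothed tails\<close>

text \<open>A decreasing \<open>H\<close> cannot be small just before a point at which it is large, so one value of \<open>exp (\<alpha> y) H y\<close>
bounds a whole window of the smoothed function.\<close>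

lemma fejer_window_lower_bound:
 fixes H :: "real => real"
 assumes a: "0 <= \<alpha>" and k: "0 < K" and r: "0 <= r" and H0: "\<And>y. 0 <= H y" and mono: "\<And>x y. x <= y ==> H y <= H x"
  and int: "integrable lborel (%y. exp (\<alpha> * y) * H y * fejer K (x - y))"
 shows "exp (\<alpha> * (x + r)) * H (x + r) * exp (- 2 * \<alpha> * r) * (\<integral>y. indicator {-r..r} y * fejer K y \<partial>lborel)
   <= (\<integral>y. exp (\<alpha> * y) * H y * fejer K (x - y) \<partial>lborel)"
proof -
 let ?C = "exp (\<alpha> * (x + r)) * H (x + r) * exp (- 2 * \<alpha> * r)"
 have i: "integrable lborel (%y. indicator {-r..r} y * fejer K y)"
  by (rule Bochner_Integration.integrable_bound[OF fejer_integrable[OF k]]) (auto simp: indicator_def)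
 have "?C * (\<integral>y. indicator {-r..r} y * fejer K y \<partial>lborel) = ?C * (\<integral>y. indicator {-r..r} (x - y) * fejer K (x - y) \<partial>lborel)"
  using lborel_integral_real_affine[of "-1" "%y. indicator {-r..r} y * fejer K y" x] by simp
 also have "\<dots> = (\<integral>y. ?C * (indicator {-r..r} (x - y) * fejer K (x - y)) \<partial>lborel)" by simp
 also have "\<dots> <= (\<integral>y. exp (\<alpha> * y) * H y * fejer K (x - y) \<partial>lborel)"
 proof (rule integral_mono[OF _ int])
  show "integrable lborel (%y. ?C * (indicator {-r..r} (x - y) * fejer K (x - y)))"
   using lborel_integrable_real_affine[OF i, where c = "-1" and t = x] by (intro integrable_mult_right) simp
  fix y
  show "?C * (indicator {-r..r} (x - y) * fejer K (x - y)) <= exp (\<alpha> * y) * H y * fejer K (x - y)"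
  proof (cases "x - y \<in> {-r..r}")
   case True
   have "exp (\<alpha> * (x + r)) * exp (- 2 * \<alpha> * r) = exp (\<alpha> * (x - r))"
    by (simp add: algebra_simps flip: exp_add)
   then have "?C = exp (\<alpha> * (x - r)) * H (x + r)" by (simp only: mult.assoc mult.commute mult.left_commute)
   also have "\<dots> <= exp (\<alpha> * y) * H y"
    using True a by (intro mult_mono H0 mono) (auto intro!: mult_left_mono)
   finally show ?thesis using True by (auto intro!: mult_right_mono fejer_nonneg k)
  qed (auto simp: H0 fejer_nonneg k)
 qed
 finally show ?thesis .
qed

lemma fejer_window_upper_bound:
 fixes H :: "real => real"
 assumes a: "0 <= \<alpha>" and k: "0 < K" and r: "0 <= r" and H0: "\<And>y. 0 <= H y" and mono: "\<And>x y. x <= y ==> H y <= H x"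
  and G: "\<And>y. exp (\<alpha> * y) * H y <= G" and m: "H \<in> borel_measurable borel"
 shows "(\<integral>y. exp (\<alpha> * y) * H y * fejer K (x - y) \<partial>lborel) \<le>
   exp (\<alpha> * (x - r)) * H (x - r) * exp (2 * \<alpha> * r) * (\<integral>y. fejer K y \<partial>lborel)
   + G * (\<integral>y. indicator (- {-r..r}) y * fejer K y \<partial>lborel)"
proof -
 let ?C = "exp (\<alpha> * (x - r)) * H (x - r) * exp (2 * \<alpha> * r)"
 have G0: "0 <= G" using G[of 0] H0[of 0] by simp
 have i: "integrable lborel (%y. indicator (- {-r..r}) y * fejer K y)"
  by (rule Bochner_Integration.integrable_bound[OF fejer_integrable[OF k]]) (auto simp: indicator_def)
 have i1: "integrable lborel (%y. ?C * fejer K (x - y))"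
  using lborel_integrable_real_affine[OF fejer_integrable[OF k], where c = "-1" and t = x] by (intro integrable_mult_right) simp
 have i2: "integrable lborel (%y. G * (indicator (- {-r..r}) (x - y) * fejer K (x - y)))"
  using lborel_integrable_real_affine[OF i, where c = "-1" and t = x] by (intro integrable_mult_right) simp
 have le: "exp (\<alpha> * y) * H y * fejer K (x - y) <= ?C * fejer K (x - y) + G * (indicator (- {-r..r}) (x - y) * fejer K (x - y))" for y
 proof (cases "x - y \<in> {-r..r}")
  case True
  then have "exp (\<alpha> * y) * H y <= exp (\<alpha> * (x + r)) * H (x - r)"
   using a by (intro mult_mono H0 mono) (auto intro!: mult_left_mono)
  also have "exp (\<alpha> * (x + r)) = exp (\<alpha> * (x - r)) * exp (2 * \<alpha> * r)"
   by (simp add: algebra_simps flip: exp_add)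
  also have "\<dots> * H (x - r) = ?C" by (simp only: mult.assoc mult.commute mult.left_commute)
  finally show ?thesis using True by (auto intro!: mult_right_mono fejer_nonneg k)
 next
  case False
  have "exp (\<alpha> * y) * H y * fejer K (x - y) <= G * fejer K (x - y)"
   by (intro mult_right_mono G fejer_nonneg k)
  moreover have "0 <= ?C * fejer K (x - y)" by (intro mult_nonneg_nonneg H0 fejer_nonneg k) auto
  ultimately show ?thesis using False by simp
 qed
 have "(\<integral>y. exp (\<alpha> * y) * H y * fejer K (x - y) \<partial>lborel) \<le>
   (\<integral>y. ?C * fejer K (x - y) + G * (indicator (- {-r..r}) (x - y) * fejer K (x - y)) \<partial>lborel)"
 proof (rule integral_mono[OF _ Bochner_Integration.integrable_add[OF i1 i2] le])
  show "integrable lborel (%y. exp (\<alpha> * y) * H y * fejer K (x - y))"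
   by (rule Bochner_Integration.integrable_bound[OF Bochner_Integration.integrable_add[OF i1 i2]])
     (use m le in \<open>auto simp: abs_mult H0 fejer_nonneg k intro!: AE_I2 order_trans[OF le abs_ge_self]\<close>)
 qed
 also have "\<dots> = ?C * (\<integral>y. fejer K (x - y) \<partial>lborel) + G * (\<integral>y. indicator (- {-r..r}) (x - y) * fejer K (x - y) \<partial>lborel)"
  by (subst Bochner_Integration.integral_add[OF i1 i2]) simp
 also have "(\<integral>y. fejer K (x - y) \<partial>lborel) = (\<integral>y. fejer K y \<partial>lborel)"
  using lborel_integral_real_affine[of "-1" "fejer K" x] by simp
 also have "(\<integral>y. indicator (- {-r..r}) (x - y) * fejer K (x - y) \<partial>lborel) = (\<integral>y. indicator (- {-r..r}) y * fejer K y \<partial>lborel)"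
  using lborel_integral_real_affine[of "-1" "%y. indicator (- {-r..r}) y * fejer K y" x] by simp
 finally show ?thesis .
qed

locale exponential_tail =
 fixes H :: "real => real" and \<alpha> c :: real
 assumes alpha: "0 < \<alpha>" and c: "0 < c"
  and H0: "\<And>y. 0 <= H y" and H1: "\<And>y. H y <= 1" and mono: "\<And>x y. x <= y ==> H y <= H x"
  and H_measurable: "H \<in> borel_measurable borel"
begin

text \<open>The smoothed tail at bandwidth \<open>K\<close> converges. It depends on the transform only for imaginary parts in \<open>[-K, K]\<close>.\<close>

definition pole_up_to :: "real => bool" where
 "pole_up_to K \<longleftrightarrow> (\<forall>x. integrable lborel (%y. exp (\<alpha> * y) * H y * fejer K (x - y))) \<and>
   ((%x. \<integral>y. exp (\<alpha> * y) * H y * fejer K (x - y) \<partial>lborel) \<longlongrightarrow> c * (\<integral>y. fejer K y \<partial>lborel)) at_top"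

lemma fejer_integral_pos: "0 < K ==> 0 < (\<integral>y. fejer K y \<partial>lborel)"
proof -
 assume k: "0 < K"
 have "0 < (\<integral>x. indicator {-1..1} x * fejer K x \<partial>lborel)" by (rule fejer_set_integral_pos[OF k]) simp
 also have "\<dots> <= (\<integral>y. fejer K y \<partial>lborel)"
  by (rule integral_mono_AE'[OF fejer_integrable[OF k]]) (auto simp: indicator_def fejer_nonneg k)
 finally show ?thesis .
qed

lemma eventually_upper:
 assumes k: "0 < K" and p: "pole_up_to K" and r: "0 < r"
  and b: "c * (\<integral>y. fejer K y \<partial>lborel) * exp (2 * \<alpha> * r) < b * (\<integral>y. indicator {-r..r} y * fejer K y \<partial>lborel)"
 shows "\<forall>\<^sub>F x in at_top. exp (\<alpha> * x) * H x < b"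
proof -
 let ?w = "\<integral>y. indicator {-r..r} y * fejer K y \<partial>lborel"
 have w: "0 < ?w" by (rule fejer_set_integral_pos[OF k r])
 have "c * (\<integral>y. fejer K y \<partial>lborel) < b * ?w * exp (- 2 * \<alpha> * r)"
  using b by (simp add: exp_minus field_simps)
 then have "\<forall>\<^sub>F x in at_top. (\<integral>y. exp (\<alpha> * y) * H y * fejer K (x - y) \<partial>lborel) < b * ?w * exp (- 2 * \<alpha> * r)"
  using p unfolding pole_up_to_def by (intro order_tendstoD(2)) auto
 then have "\<forall>\<^sub>F x in at_top. exp (\<alpha> * (x + r)) * H (x + r) < b"
 proof eventually_elim
  case (elim x)
  have "exp (\<alpha> * (x + r)) * H (x + r) * exp (- 2 * \<alpha> * r) * ?w <= (\<integral>y. exp (\<alpha> * y) * H y * fejer K (x - y) \<partial>lborel)"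
   by (rule fejer_window_lower_bound) (use alpha k r H0 mono p in \<open>auto simp: pole_up_to_def\<close>)
  also note elim
  finally have "(exp (\<alpha> * (x + r)) * H (x + r)) * (?w * exp (- 2 * \<alpha> * r)) < b * (?w * exp (- 2 * \<alpha> * r))" by (simp add: ac_simps)
  then show ?case using w by (subst (asm) mult_less_cancel_right_pos) auto
 qed
 then obtain N where N: "\<And>x. N <= x ==> exp (\<alpha> * (x + r)) * H (x + r) < b" by (auto simp: eventually_at_top_linorder)
 show ?thesis
  unfolding eventually_at_top_linorder by (rule exI[of _ "N + r"]) (use N[of "x - r" for x] in auto)
qed

lemma weighted_tail_bounded:
 assumes k: "0 < K" and p: "pole_up_to K"
 obtains G where "\<And>x. exp (\<alpha> * x) * H x <= G" "0 < G"
proof -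
 have w: "0 < (\<integral>y. indicator {-1..1} y * fejer K y \<partial>lborel)" by (rule fejer_set_integral_pos[OF k]) simp
 define b where "b = (c * (\<integral>y. fejer K y \<partial>lborel) * exp (2 * \<alpha> * 1) + 1) / (\<integral>y. indicator {-1..1} y * fejer K y \<partial>lborel)"
 have "\<forall>\<^sub>F x in at_top. exp (\<alpha> * x) * H x < b"
  by (rule eventually_upper[OF k p, of 1]) (use w in \<open>auto simp: b_def\<close>)
 then obtain N where N: "\<And>x. N <= x ==> exp (\<alpha> * x) * H x < b" by (auto simp: eventually_at_top_linorder)
 show ?thesis
 proof (rule that[of "max 1 (max b (exp (\<alpha> * N)))"])
  fix x
  show "exp (\<alpha> * x) * H x <= max 1 (max b (exp (\<alpha> * N)))"
  proof (cases "N <= x")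
   case False
   have "exp (\<alpha> * x) * H x <= exp (\<alpha> * N) * 1"
    using False alpha by (intro mult_mono H1 H0) auto
   then show ?thesis by simp
  qed (use N[of x] in auto)
 qed simp
qed

lemma eventually_lower:
 assumes k: "0 < \<kappa>" and p: "pole_up_to \<kappa>" and r: "0 < r" and G: "\<And>x. exp (\<alpha> * x) * H x <= G"
  and b: "b * exp (2 * \<alpha> * r) * (\<integral>y. fejer \<kappa> y \<partial>lborel) + G * (\<integral>y. indicator (- {-r..r}) y * fejer \<kappa> y \<partial>lborel)
   < c * (\<integral>y. fejer \<kappa> y \<partial>lborel)"
 shows "\<forall>\<^sub>F x in at_top. b < exp (\<alpha> * x) * H x"
proof -
 let ?K = "\<integral>y. fejer \<kappa> y \<partial>lborel" and ?t = "\<integral>y. indicator (- {-r..r}) y * fejer \<kappa> y \<partial>lborel"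
 have K: "0 < ?K" by (rule fejer_integral_pos[OF k])
 have "\<forall>\<^sub>F x in at_top. b * exp (2 * \<alpha> * r) * ?K + G * ?t < (\<integral>y. exp (\<alpha> * y) * H y * fejer \<kappa> (x - y) \<partial>lborel)"
  using p b unfolding pole_up_to_def by (intro order_tendstoD(1)) auto
 then have "\<forall>\<^sub>F x in at_top. b < exp (\<alpha> * (x - r)) * H (x - r)"
 proof eventually_elim
  case (elim x)
  note elim
  also have "(\<integral>y. exp (\<alpha> * y) * H y * fejer \<kappa> (x - y) \<partial>lborel) \<le>
    exp (\<alpha> * (x - r)) * H (x - r) * exp (2 * \<alpha> * r) * ?K + G * ?t"
   by (rule fejer_window_upper_bound) (use alpha k r H0 mono G H_measurable in auto)
  finally have "b * (exp (2 * \<alpha> * r) * ?K) < (exp (\<alpha> * (x - r)) * H (x - r)) * (exp (2 * \<alpha> * r) * ?K)" by (simp add: ac_simps)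
  then show ?case using K by (subst (asm) mult_less_cancel_right_pos) auto
 qed
 then obtain N where N: "\<And>x. N <= x ==> b < exp (\<alpha> * (x - r)) * H (x - r)" by (auto simp: eventually_at_top_linorder)
 show ?thesis
  unfolding eventually_at_top_linorder by (rule exI[of _ "N - r"]) (use N[of "x + r" for x] in auto)
qed

lemma fejer_tail_tendsto: "0 < K ==> ((%r. \<integral>y. indicator (- {-r..r}) y * fejer K y \<partial>lborel) \<longlongrightarrow> 0) at_top"
proof -
 assume k: "0 < K"
 have "((%r. \<integral>y. indicator (- {-r..r}) y * fejer K y \<partial>lborel) \<longlongrightarrow> (\<integral>y. (0::real) \<partial>(lborel::real measure))) at_top"
 proof (rule integral_dominated_convergence_at_top[OF _ _ fejer_integrable[OF k]])
  show "AE y in lborel. ((%r. indicator (- {-r..r}) y * fejer K y) \<longlongrightarrow> 0) at_top"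
  proof (rule AE_I2)
   fix y :: real
   show "((%r. indicator (- {-r..r}) y * fejer K y) \<longlongrightarrow> 0) at_top"
    by (rule tendsto_eventually, use eventually_ge_at_top[of "\<bar>y\<bar>"] in eventually_elim) (auto simp: indicator_def)
  qed
 qed (auto simp: indicator_def fejer_nonneg k intro!: always_eventually)
 then show ?thesis by simp
qed

text \<open>One bandwidth suffices for bounds: the window around a point carries a positive share of the kernel, and the share outside a wide
window is small against the limit once an upper bound is known.\<close>

lemma tail_bounds:
 assumes k: "0 < \<kappa>" and p: "pole_up_to \<kappa>"
 obtains C1 C2 where "0 < C1" "C1 <= C2" "\<forall>\<^sub>F x in at_top. C1 <= exp (\<alpha> * x) * H x \<and> exp (\<alpha> * x) * H x <= C2"
proof -
 obtain G where G: "\<And>x. exp (\<alpha> * x) * H x <= G" "0 < G" using weighted_tail_bounded[OF k p] by blast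
 let ?K = "\<integral>y. fejer \<kappa> y \<partial>lborel"
 have K: "0 < ?K" by (rule fejer_integral_pos[OF k])
 have "\<forall>\<^sub>F r in at_top. (\<integral>y. indicator (- {-r..r}) y * fejer \<kappa> y \<partial>lborel) < c * ?K / (2 * G) \<and> 0 < r"
  using K c G by (intro eventually_conj order_tendstoD(2)[OF fejer_tail_tendsto[OF k]] eventually_gt_at_top) auto
 then obtain r where r: "(\<integral>y. indicator (- {-r..r}) y * fejer \<kappa> y \<partial>lborel) < c * ?K / (2 * G)" "0 < r"
  by (auto dest!: eventually_happens)
 define b where "b = c / 2 * exp (- 2 * \<alpha> * r)"
 have e: "exp (- 2 * \<alpha> * r) * exp (2 * \<alpha> * r) = 1" by (simp flip: exp_add)
 have "G * (\<integral>y. indicator (- {-r..r}) y * fejer \<kappa> y \<partial>lborel) < c * ?K / 2"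
  using r G by (simp add: field_simps)
 moreover have "b * exp (2 * \<alpha> * r) * ?K = c * ?K / 2" using e by (simp add: b_def)
 ultimately have "b * exp (2 * \<alpha> * r) * ?K + G * (\<integral>y. indicator (- {-r..r}) y * fejer \<kappa> y \<partial>lborel) < c * ?K"
  by linarith
 then have ev: "\<forall>\<^sub>F x in at_top. b < exp (\<alpha> * x) * H x"
  by (intro eventually_lower[OF k p r(2) G(1)])
 have b: "0 < b" using c by (simp add: b_def)
 have "b <= G" using ev G(1) by (meson eventually_happens less_le_trans less_imp_le trivial_limit_at_top_linorder)
 then show ?thesis using ev G(1) b by (intro that[of b G]) (auto elim!: eventually_mono)
qed

text \<open>With large \<open>\<kappa>\<close> the kernel concentrates near \<open>0\<close>, so that the loss from comparing \<open>H\<close> with its window averages tends to zero.\<close>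

lemma tail_limit:
 assumes p: "\<And>\<kappa>. 0 < \<kappa> ==> pole_up_to \<kappa>"
 shows "((%x. exp (\<alpha> * x) * H x) \<longlongrightarrow> c) at_top"
proof -
 obtain G where G: "\<And>x. exp (\<alpha> * x) * H x <= G" "0 < G" using weighted_tail_bounded[OF zero_less_one p] by auto
 define K where "K = (\<integral>y. fejer 1 y \<partial>lborel)"
 have K: "0 < K" unfolding K_def by (rule fejer_integral_pos) simp
 have KK: "(\<integral>y. fejer \<kappa> y \<partial>lborel) = K" if "0 < \<kappa>" for \<kappa>
  using lborel_integral_real_affine[of \<kappa> "fejer 1" 0] that unfolding K_def by (subst fejer_scale[OF that, abs_def]) simp
 have T: "(\<integral>y. indicator (- {-r..r}) y * fejer \<kappa> y \<partial>lborel) = (\<integral>y. indicator (- {-\<kappa>*r..\<kappa>*r}) y * fejer 1 y \<partial>lborel)"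
  if k: "0 < \<kappa>" for \<kappa> r
 proof -
  have "indicator (- {-\<kappa>*r..\<kappa>*r}) (\<kappa> * y) = (indicator (- {-r..r}) y :: real)" for y
  proof -
   have "-\<kappa>*r <= \<kappa>*y \<longleftrightarrow> -r <= y" "\<kappa>*y <= \<kappa>*r \<longleftrightarrow> y <= r"
    using mult_le_cancel_left_pos[OF k, of "-r" y] k by auto
   then show ?thesis by (simp add: indicator_def)
  qed
  then show ?thesis
   using lborel_integral_real_affine[of \<kappa> "%y. indicator (- {-\<kappa>*r..\<kappa>*r}) y * fejer 1 y" 0] k
   by (simp only: fejer_scale[OF k, of "_ :: real"] mult.left_commute[of "indicator _ _"] integral_mult_right_zero)
     simp
 qed
 have W: "(\<integral>y. indicator {-r..r} y * fejer \<kappa> y \<partial>lborel) = K - (\<integral>y. indicator (- {-r..r}) y * fejer \<kappa> y \<partial>lborel)"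
  if k: "0 < \<kappa>" for \<kappa> r
 proof -
  have "integrable lborel (%y. indicator A y * fejer \<kappa> y)" if "A \<in> sets borel" for A
   by (rule Bochner_Integration.integrable_bound[OF fejer_integrable[OF k]]) (use that in \<open>auto simp: indicator_def\<close>)
  then have "(\<integral>y. indicator {-r..r} y * fejer \<kappa> y \<partial>lborel) + (\<integral>y. indicator (- {-r..r}) y * fejer \<kappa> y \<partial>lborel)
   = (\<integral>y. indicator {-r..r} y * fejer \<kappa> y + indicator (- {-r..r}) y * fejer \<kappa> y \<partial>lborel)"
   by (intro Bochner_Integration.integral_add[symmetric]) auto
  also have "\<dots> = K" unfolding KK[OF k, symmetric]
   by (rule Bochner_Integration.integral_cong) (auto simp: indicator_def)
  finally show ?thesis by simp
 qed
 have small: "\<exists>\<kappa>>0. (\<integral>y. indicator (- {-r..r}) y * fejer \<kappa> y \<partial>lborel) < e" if "0 < e" "0 < r" for e r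
 proof -
  have "\<forall>\<^sub>F s in at_top. (\<integral>y. indicator (- {-s..s}) y * fejer 1 y \<partial>lborel) < e \<and> 0 < s"
   using that by (intro eventually_conj order_tendstoD(2)[OF fejer_tail_tendsto] eventually_gt_at_top) auto
  then obtain s where "(\<integral>y. indicator (- {-s..s}) y * fejer 1 y \<partial>lborel) < e" "0 < s"
   by (auto dest!: eventually_happens)
  then show ?thesis using that T[of "s / r" r] by (intro exI[of _ "s / r"]) simp
 qed
 show ?thesis
 proof (rule order_tendstoI)
  fix b assume b: "b < c"
  have "((%r. b * exp (2 * \<alpha> * r) * K) \<longlongrightarrow> b * exp (2 * \<alpha> * 0) * K) (at_right 0)"
   by (intro tendsto_intros)
  then have "\<forall>\<^sub>F r in at_right 0. b * exp (2 * \<alpha> * r) * K < c * K"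
   by (rule order_tendstoD(2)[where y = "b * exp (2 * \<alpha> * 0) * K"]) (use b K in simp)
  then have "\<forall>\<^sub>F r in at_right 0. b * exp (2 * \<alpha> * r) * K < c * K \<and> 0 < r"
   using eventually_at_right_less[of 0] by eventually_elim auto
  then obtain r where r: "b * exp (2 * \<alpha> * r) * K < c * K" "0 < r"
   by (auto dest!: eventually_happens)
  define e where "e = (c * K - b * exp (2 * \<alpha> * r) * K) / G"
  have "0 < e" using r G by (simp add: e_def)
  then obtain \<kappa> where k: "0 < \<kappa>" "(\<integral>y. indicator (- {-r..r}) y * fejer \<kappa> y \<partial>lborel) < e" using small r by auto
  have "G * (\<integral>y. indicator (- {-r..r}) y * fejer \<kappa> y \<partial>lborel) < G * e" using k G by simp
  then have "b * exp (2 * \<alpha> * r) * K + G * (\<integral>y. indicator (- {-r..r}) y * fejer \<kappa> y \<partial>lborel) < c * K"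
   using G by (simp add: e_def)
  then show "\<forall>\<^sub>F x in at_top. b < exp (\<alpha> * x) * H x"
   by (intro eventually_lower[OF k(1) p[OF k(1)] r(2) G(1)]) (simp add: KK[OF k(1)])
 next
  fix b assume b: "c < b"
  have "((%r. c * K * exp (2 * \<alpha> * r)) \<longlongrightarrow> c * K * exp (2 * \<alpha> * 0)) (at_right 0)"
   by (intro tendsto_intros)
  then have "\<forall>\<^sub>F r in at_right 0. c * K * exp (2 * \<alpha> * r) < b * K"
   by (rule order_tendstoD(2)[where y = "c * K * exp (2 * \<alpha> * 0)"]) (use b K in simp)
  then have "\<forall>\<^sub>F r in at_right 0. c * K * exp (2 * \<alpha> * r) < b * K \<and> 0 < r"
   using eventually_at_right_less[of 0] by eventually_elim auto
  then obtain r where r: "c * K * exp (2 * \<alpha> * r) < b * K" "0 < r"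
   by (auto dest!: eventually_happens)
  define e where "e = (b * K - c * K * exp (2 * \<alpha> * r)) / b"
  have b0: "0 < b" using b c by simp
  have "0 < e" using r b0 by (simp add: e_def)
  then obtain \<kappa> where k: "0 < \<kappa>" "(\<integral>y. indicator (- {-r..r}) y * fejer \<kappa> y \<partial>lborel) < e" using small r by auto
  have "b * (\<integral>y. indicator (- {-r..r}) y * fejer \<kappa> y \<partial>lborel) < b * e" using k b0 by simp
  then have "c * K * exp (2 * \<alpha> * r) < b * (\<integral>y. indicator {-r..r} y * fejer \<kappa> y \<partial>lborel)"
  proof -
   have "b * e = b * K - c * K * exp (2 * \<alpha> * r)" using b0 by (simp add: e_def)
   then show ?thesis unfolding W[OF k(1)] using \<open>b * _ < b * e\<close> by (simp only: right_diff_distrib)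
  qed
  then show "\<forall>\<^sub>F x in at_top. exp (\<alpha> * x) * H x < b"
   by (intro eventually_upper[OF k(1) p[OF k(1)] r(2)]) (simp add: KK[OF k(1)])
 qed
qed

end

section \<open>Matrix exponentials and Perron vectors\<close>

section \<open>Matrix powers and exponentials\<close>

abbreviation matpow :: "('a::semiring_1)^'n^'n => nat => 'a^'n^'n" where
 "matpow M k \<equiv> ((%N. M ** N) ^^ k) (mat 1)"

lemma mat_1_entry: "(mat 1 :: ('a::zero_neq_one)^'n^'n)$j$k = (if j = k then 1 else 0)"
 by (simp add: mat_def)

lemma matrix_mult_entry: "(A ** B)$j$k = (\<Sum>l\<in>UNIV. A$j$l * B$l$k)"
 by (simp add: matrix_matrix_mult_def)

lemma matpow_row_sum_le:
 fixes M :: "'a::{real_normed_field}^'n^'n"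
 assumes c: "\<And>j. (\<Sum>k\<in>UNIV. norm (M$j$k)) <= c"
 shows "(\<Sum>k\<in>UNIV. norm (matpow M n$j$k)) <= c ^ n"
proof (induction n arbitrary: j)
 case 0
 have "(\<Sum>k\<in>UNIV. norm ((mat 1 :: 'a^'n^'n)$j$k)) = (\<Sum>k\<in>UNIV. if j = k then 1 else 0)"
  by (intro sum.cong) (auto simp: mat_1_entry)
 then show ?case by simp
next
 case (Suc n)
 have c0: "0 <= c" using c[of undefined] sum_nonneg[of UNIV "%k. norm (M$undefined$k)"] by (meson norm_ge_zero order_trans)
 have "(\<Sum>k\<in>UNIV. norm (matpow M (Suc n)$j$k)) <= (\<Sum>k\<in>UNIV. \<Sum>l\<in>UNIV. norm (M$j$l) * norm (matpow M n$l$k))"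
  by (auto simp: matrix_mult_entry intro!: sum_mono order_trans[OF norm_sum] simp: norm_mult)
 also have "\<dots> = (\<Sum>l\<in>UNIV. norm (M$j$l) * (\<Sum>k\<in>UNIV. norm (matpow M n$l$k)))"
  by (subst sum.swap) (simp add: sum_distrib_left)
 also have "\<dots> <= (\<Sum>l\<in>UNIV. norm (M$j$l) * c ^ n)"
  by (intro sum_mono mult_left_mono Suc) auto
 also have "\<dots> <= c * c ^ n"
  unfolding sum_distrib_right[symmetric] using c0 by (intro mult_right_mono c) auto
 finally show ?case by simp
qed

lemma matpow_entry_le:
 fixes M :: "'a::{real_normed_field}^'n^'n"
 assumes c: "\<And>j. (\<Sum>k\<in>UNIV. norm (M$j$k)) <= c"
 shows "norm (matpow M n$j$k) <= c ^ n"
 using matpow_row_sum_le[OF c, of n j] member_le_sum[of k UNIV "%k. norm (matpow M n$j$k)"] by simp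

lemma row_sum_bound_exists:
 fixes M :: "'a::{real_normed_field}^'n^'n"
 obtains c where "0 < c" "\<And>j. (\<Sum>k\<in>UNIV. norm (M$j$k)) <= c"
proof (rule that[of "1 + (\<Sum>j\<in>UNIV. \<Sum>k\<in>UNIV. norm (M$j$k))"])
 fix j
 have "(\<Sum>k\<in>UNIV. norm (M$j$k)) <= (\<Sum>j\<in>UNIV. \<Sum>k\<in>UNIV. norm (M$j$k))"
  by (rule member_le_sum[where f = "%j. \<Sum>k\<in>UNIV. norm (M$j$k)"]) (auto intro: sum_nonneg)
 then show "(\<Sum>k\<in>UNIV. norm (M$j$k)) <= 1 + (\<Sum>j\<in>UNIV. \<Sum>k\<in>UNIV. norm (M$j$k))" by simp
qed (auto intro!: add_pos_nonneg sum_nonneg)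

lemma matpow_series_summable:
 fixes M :: "'a::{real_normed_field, banach}^'n^'n"
 shows "summable (%i. norm (matpow M i$j$k / fact i))"
proof -
 obtain c where c: "0 < c" "\<And>j. (\<Sum>k\<in>UNIV. norm (M$j$k)) <= c" using row_sum_bound_exists[of M] by blast
 show ?thesis
 proof (rule summable_comparison_test'[of "%i. c ^ i / fact i" 0])
  show "summable (%i. c ^ i / fact i)" using summable_exp[of c] by (simp add: divide_inverse mult.commute)
  show "norm (norm (matpow M n$j$k / fact n)) <= c ^ n / fact n" for n
   using matpow_entry_le[OF c(2), of n j k] by (simp add: norm_divide divide_right_mono)
 qed
qed

lemma mexp_sums: "(%i. matpow M i$j$k / fact i) sums (mexp M$j$k)"
proof -
 define S where "S = (\<chi> j k. \<Sum>i. matpow M i$j$k / fact i)"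
 have s: "(%i. matpow M i$j$k / fact i) sums (S$j$k)" for j k
  unfolding S_def using summable_norm_cancel[OF matpow_series_summable[of M j k]] by (simp add: summable_sums)
 have "(%i. (1 / fact i) *\<^sub>R matpow M i) sums S"
  unfolding sums_def
 proof (intro vec_tendstoI)
  fix j k
  show "(%n. (\<Sum>i<n. (1 / fact i) *\<^sub>R matpow M i)$j$k) \<longlonglongrightarrow> S$j$k"
   using s[of j k] by (simp add: sums_def)
 qed
 then have "mexp M = S" unfolding mexp_def by (rule sums_unique[symmetric])
 then show ?thesis using s by simp
qed

lemma mexp_entry: "mexp M$j$k = (\<Sum>i. matpow M i$j$k / fact i)"
 using mexp_sums by (rule sums_unique)

lemma matpow_scaleR: "matpow (a *\<^sub>R M) n$j$k = a ^ n * matpow (M :: real^'n^'n) n$j$k"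
 by (induction n arbitrary: j k) (auto simp: matrix_mult_entry sum_distrib_left ac_simps)

lemma matpow_binomial:
 fixes X :: "real^'n^'n"
 shows "matpow (mat 1 + X) n$j$k = (\<Sum>i\<le>n. real (n choose i) * matpow X i$j$k)"
proof (induction n arbitrary: j k)
 case (Suc n)
 have a: "(\<Sum>l\<in>UNIV. X$j$l * matpow X i$l$k) = matpow X (Suc i)$j$k" for i
  by (simp add: matrix_mult_entry)
 have "matpow (mat 1 + X) (Suc n)$j$k = (\<Sum>l\<in>UNIV. (mat 1$j$l) * matpow (mat 1 + X) n$l$k)
   + (\<Sum>l\<in>UNIV. X$j$l * matpow (mat 1 + X) n$l$k)"
  by (simp add: matrix_mult_entry distrib_right sum.distrib)
 also have "(\<Sum>l\<in>UNIV. (mat 1$j$l) * matpow (mat 1 + X) n$l$k) = matpow (mat 1 + X) n$j$k"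
  by (simp add: mat_1_entry if_distrib[of "%x. x * _"] cong: if_cong)
 also have "(\<Sum>l\<in>UNIV. X$j$l * matpow (mat 1 + X) n$l$k) =
   (\<Sum>i\<le>n. real (n choose i) * (\<Sum>l\<in>UNIV. X$j$l * matpow X i$l$k))"
  unfolding Suc sum_distrib_left by (subst sum.swap) (simp add: ac_simps)
 also have "\<dots> = (\<Sum>i\<le>n. real (n choose i) * matpow X (Suc i)$j$k)" by (simp only: a)
 also have "matpow (mat 1 + X) n$j$k = (\<Sum>i\<le>n. real (n choose i) * matpow X i$j$k)" by (rule Suc)
 also have "\<dots> = (\<Sum>i\<le>Suc n. real (n choose i) * matpow X i$j$k)" by simp
 also have "\<dots> = matpow X 0$j$k + (\<Sum>i\<le>n. real (n choose Suc i) * matpow X (Suc i)$j$k)"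
  by (subst sum.atMost_Suc_shift) simp
 also have "\<dots> + (\<Sum>i\<le>n. real (n choose i) * matpow X (Suc i)$j$k)
   = matpow X 0$j$k + (\<Sum>i\<le>n. real (Suc n choose Suc i) * matpow X (Suc i)$j$k)"
  by (simp add: sum.distrib[symmetric] algebra_simps del: funpow.simps)
 also have "\<dots> = (\<Sum>i\<le>Suc n. real (Suc n choose i) * matpow X i$j$k)"
  by (subst sum.atMost_Suc_shift) simp
 finally show ?case .
qed simp

lemma matpow_tendsto:
 fixes R :: "nat => real^'n^'n"
 assumes "\<And>j k. (%n. R n$j$k) \<longlonglongrightarrow> C$j$k"
 shows "(%n. matpow (R n) i$j$k) \<longlonglongrightarrow> matpow C i$j$k"
 by (induction i arbitrary: j k) (auto simp: matrix_mult_entry intro!: tendsto_sum tendsto_mult assms)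

text \<open>Expand the power by the binomial theorem and pass to the limit under the sum, with the exponential series as majorant.\<close>

lemma mexp_limit:
 fixes Q :: "nat => real^'n^'n"
 assumes lim: "\<And>j k. (%n. real (Suc n) * (Q n - mat 1)$j$k) \<longlonglongrightarrow> C$j$k"
 shows "(%n. matpow (Q n) (Suc n)$j$k) \<longlonglongrightarrow> mexp C$j$k"
proof -
 define R where "R = (%n. real (Suc n) *\<^sub>R (Q n - mat 1))"
 have Rlim: "(%n. R n$j$k) \<longlonglongrightarrow> C$j$k" for j k using lim[of j k] by (simp add: R_def)
 have Q: "Q n = mat 1 + (1 / real (Suc n)) *\<^sub>R R n" for n by (simp add: R_def)
 obtain b where b: "\<And>j n. (\<Sum>k\<in>UNIV. norm (R n$j$k)) <= b"
 proof -
  have "\<exists>b. \<forall>n. (\<Sum>k\<in>UNIV. norm (R n$j$k)) <= b" for j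
  proof -
   have "(%n. \<Sum>k\<in>UNIV. norm (R n$j$k)) \<longlonglongrightarrow> (\<Sum>k\<in>UNIV. norm (C$j$k))"
    by (intro tendsto_sum tendsto_norm Rlim)
   then have "Bseq (%n. \<Sum>k\<in>UNIV. norm (R n$j$k))"
    by (intro convergent_imp_Bseq convergentI)
   then obtain K where "\<And>n. norm (\<Sum>k\<in>UNIV. norm (R n$j$k)) <= K" by (elim BseqE) blast
   then show ?thesis by (metis abs_ge_self order_trans real_norm_def)
  qed
  then obtain b where b: "\<And>j n. (\<Sum>k\<in>UNIV. norm (R n$j$k)) <= b j" by metis
  show ?thesis
  proof (rule that)
   fix j n show "(\<Sum>k\<in>UNIV. norm (R n$j$k)) <= Max (range b)"
    by (rule order_trans[OF b]) auto
  qed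
 qed
 have b0: "0 <= b" using b[of 0 undefined] by (meson norm_ge_zero order_trans sum_nonneg)
 define a where "a = (%i n. real (Suc n choose i) / real (Suc n) ^ i * matpow (R n) i$j$k)"
 have fin: "matpow (Q n) (Suc n)$j$k = (\<Sum>i. a i n)" for n
 proof -
  have "matpow (Q n) (Suc n)$j$k = (\<Sum>i\<le>Suc n. a i n)"
   unfolding Q matpow_binomial by (simp only: matpow_scaleR a_def power_one_over) (simp add: divide_inverse ac_simps)
  also have "\<dots> = (\<Sum>i. a i n)"
   by (rule suminf_finite[symmetric]) (auto simp: a_def not_le)
  finally show ?thesis .
 qed
 have "eventually (%n. summable (%i. norm (a i n))) sequentially \<and>
   summable (%i. norm (matpow C i$j$k / fact i)) \<and>
   (%n. \<Sum>i. a i n) \<longlonglongrightarrow> (\<Sum>i. matpow C i$j$k / fact i)"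
 proof (rule tannerys_theorem[where M = "%i. b ^ i / fact i"])
  show "(%n. a i n) \<longlonglongrightarrow> matpow C i$j$k / fact i" for i
  proof -
   have "real (Suc n choose i) / real (Suc n) ^ i = (\<Prod>l=0..<i. (real (Suc n) - real l) / real (Suc n)) / fact i" for n
    by (simp add: binomial_gbinomial gbinomial_prod_rev prod_dividef)
   moreover have "(%n. (real (Suc n) - real l) / real (Suc n)) \<longlonglongrightarrow> 1" for l by real_asymp
   then have "(%n. (\<Prod>l=0..<i. (real (Suc n) - real l) / real (Suc n)) / fact i) \<longlonglongrightarrow> (\<Prod>l=0..<i. 1) / fact i"
    by (intro tendsto_divide tendsto_prod tendsto_const) auto
   ultimately have "(%n. real (Suc n choose i) / real (Suc n) ^ i) \<longlonglongrightarrow> 1 / fact i" by simp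
   from tendsto_mult[OF this matpow_tendsto[OF Rlim, of i j k]] show ?thesis by (simp add: a_def)
  qed
  have "norm (a i n) <= b ^ i / fact i" for i n
  proof -
   have "real (Suc n choose i) * fact i <= real (Suc n) ^ i"
    using binomial_fact_pow[of "Suc n" i] by (metis of_nat_fact of_nat_le_iff of_nat_mult of_nat_power)
   then have "real (Suc n choose i) / real (Suc n) ^ i <= 1 / fact i" by (simp add: field_simps)
   then have "norm (a i n) <= 1 / fact i * b ^ i"
    unfolding a_def norm_mult using matpow_entry_le[OF b, of i n j k] by (intro mult_mono) auto
   then show ?thesis by simp
  qed
  then show "\<forall>\<^sub>F x in sequentially \<times>\<^sub>F sequentially. case x of (i, n) => norm (a i n) <= b ^ i / fact i"
   by (intro always_eventually) auto
  show "summable (%i. b ^ i / fact i)" using summable_exp[of b] by (simp add: divide_inverse mult.commute)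
 qed auto
 then show ?thesis by (simp only: fin mexp_entry)
qed

lemma mexp_scaleR_deriv_0: "((%h. mexp (h *\<^sub>R G)$j$k) has_real_derivative G$j$k) (at 0)"
proof -
 define c where "c = (%i. matpow G i$j$k / fact i)"
 have e: "mexp (h *\<^sub>R G)$j$k = (\<Sum>i. c i * h ^ i)" for h
  unfolding mexp_entry matpow_scaleR c_def by (simp add: mult.commute)
 have "summable (%i. c i * 1 ^ i)"
  using summable_norm_cancel[OF matpow_series_summable[of G j k]] by (simp add: c_def)
 then have "DERIV (%x. \<Sum>n. c n * x^n) 0 :> (\<Sum>n. diffs c n * 0^n)"
  by (rule termdiffs_strong) simp
 also have "(\<Sum>n. diffs c n * 0^n) = G$j$k"
  by (simp only: powser_zero) (simp add: diffs_def c_def)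
 finally show ?thesis by (simp only: e)
qed

lemma mexp_zero: "mexp (0 *\<^sub>R G)$j$k = (if j = k then 1 else 0)"
proof -
 have "(\<Sum>i. matpow (0 *\<^sub>R G) i$j$k / fact i) = (\<Sum>i. (matpow G i$j$k / fact i) * 0 ^ i)"
  by (simp only: matpow_scaleR) (simp add: mult.commute)
 also have "\<dots> = (if j = k then 1 else 0)" by (subst powser_zero) (simp add: mat_1_entry)
 finally show ?thesis by (simp only: mexp_entry)
qed

lemma mexp_eigenvector:
 assumes x: "\<And>j. (\<Sum>k\<in>UNIV. A$j$k * x$k) = K * x$j"
 shows "(\<Sum>k\<in>UNIV. mexp A$j$k * x$k) = exp K * x$j"
proof -
 have p: "(\<Sum>k\<in>UNIV. matpow A i$j$k * x$k) = K ^ i * x$j" for i j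
 proof (induction i arbitrary: j)
  case 0 then show ?case by (simp add: mat_1_entry if_distrib[of "%x. x * _"] cong: if_cong)
 next
  case (Suc i)
  have "(\<Sum>k\<in>UNIV. matpow A (Suc i)$j$k * x$k) = (\<Sum>l\<in>UNIV. A$j$l * (\<Sum>k\<in>UNIV. matpow A i$l$k * x$k))"
   by (simp add: matrix_mult_entry sum_distrib_left sum_distrib_right mult.assoc) (rule sum.swap)
  also have "\<dots> = K ^ i * (\<Sum>l\<in>UNIV. A$j$l * x$l)" by (simp only: Suc sum_distrib_left) (simp add: ac_simps)
  finally show ?case by (simp add: x)
 qed
 have "(%i. \<Sum>k\<in>UNIV. (matpow A i$j$k / fact i) * x$k) sums (\<Sum>k\<in>UNIV. mexp A$j$k * x$k)"
  by (intro sums_sum sums_mult2 mexp_sums)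
 moreover have "(\<Sum>k\<in>UNIV. (matpow A i$j$k / fact i) * x$k) = (inverse (fact i) *\<^sub>R K ^ i) * x$j" for i
  using p[of i j] by (simp add: sum_divide_distrib[symmetric] divide_inverse ac_simps flip: sum_distrib_left)
 moreover have "(%i. (inverse (fact i) *\<^sub>R K ^ i) * x$j) sums (exp K * x$j)"
  by (intro sums_mult2 exp_converges)
 ultimately show ?thesis by (simp add: sums_unique2)
qed

lemma mexp_left_eigenvector:
 assumes y: "\<And>k. (\<Sum>j\<in>UNIV. y$j * A$j$k) = K * y$k"
 shows "(\<Sum>j\<in>UNIV. y$j * mexp A$j$k) = exp K * y$k"
proof -
 have p: "(\<Sum>j\<in>UNIV. y$j * matpow A i$j$k) = K ^ i * y$k" for i k
 proof (induction i arbitrary: k)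
  case 0 then show ?case by (simp add: mat_1_entry if_distrib[of "%x. _ * x"] cong: if_cong)
 next
  case (Suc i)
  have "(\<Sum>j\<in>UNIV. y$j * matpow A (Suc i)$j$k) = (\<Sum>l\<in>UNIV. (\<Sum>j\<in>UNIV. y$j * A$j$l) * matpow A i$l$k)"
   by (simp add: matrix_mult_entry sum_distrib_left sum_distrib_right mult.assoc) (rule sum.swap)
  also have "\<dots> = K * (\<Sum>l\<in>UNIV. y$l * matpow A i$l$k)" by (simp only: y sum_distrib_left) (simp add: ac_simps)
  finally show ?case by (simp add: Suc)
 qed
 have "(%i. \<Sum>j\<in>UNIV. y$j * (matpow A i$j$k / fact i)) sums (\<Sum>j\<in>UNIV. y$j * mexp A$j$k)"
  by (intro sums_sum sums_mult mexp_sums)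
 moreover have "(\<Sum>j\<in>UNIV. y$j * (matpow A i$j$k / fact i)) = (inverse (fact i) *\<^sub>R K ^ i) * y$k" for i
  using p[of i k] by (simp add: sum_divide_distrib[symmetric] divide_inverse ac_simps flip: sum_distrib_left)
 moreover have "(%i. (inverse (fact i) *\<^sub>R K ^ i) * y$k) sums (exp K * y$k)"
  by (intro sums_mult2 exp_converges)
 ultimately show ?thesis by (simp add: sums_unique2)
qed

section \<open>Perron-Frobenius theory\<close>

text \<open>Brouwer's theorem gives a fixed point of a normalised positive map on the simplex; irreducibility makes all its entries positive.\<close>

lemma perron_eigenvector:
 fixes A :: "real^'n^'n"
 assumes off: "\<And>j k. j \<noteq> k ==> 0 <= A$j$k"
  and irr: "\<And>j k. (j, k) \<in> {(a, b). a \<noteq> b \<and> 0 < A$a$b}\<^sup>*"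
 obtains x :: "real^'n" and K :: real where "\<And>j. 0 < x$j" "\<And>j. (\<Sum>k\<in>UNIV. A$j$k * x$k) = K * x$j"
proof -
 define c where "c = 1 + (\<Sum>j\<in>UNIV. \<bar>A$j$j\<bar>)"
 define N where "N = A + c *\<^sub>R mat 1"
 have Nd: "1 <= N$j$j" for j
 proof -
  have "\<bar>A$j$j\<bar> <= (\<Sum>j\<in>UNIV. \<bar>A$j$j\<bar>)" by (rule member_le_sum) auto
  then show ?thesis by (simp add: N_def c_def mat_1_entry)
 qed
 have Noff: "N$j$k = A$j$k" if "j \<noteq> k" for j k using that by (simp add: N_def mat_1_entry)
 have N0: "0 <= N$j$k" for j k using Nd[of j] off[of j k] Noff[of j k] by (cases "j = k") auto
 define S where "S = {x :: real^'n. (\<forall>j. 0 <= x$j) \<and> (\<Sum>j\<in>UNIV. x$j) = 1}"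
 define s where "s = (%x :: real^'n. \<Sum>j\<in>UNIV. \<Sum>k\<in>UNIV. N$j$k * x$k)"
 define f where "f = (%x :: real^'n. (1 / s x) *\<^sub>R (N *v x))"
 have Nx: "(N *v x)$j = (\<Sum>k\<in>UNIV. N$j$k * x$k)" for x j by (simp add: matrix_vector_mult_def)
 have s1: "1 <= s x" if "x \<in> S" for x
 proof -
  have "x$j <= (\<Sum>k\<in>UNIV. N$j$k * x$k)" for j
  proof -
   have "x$j <= N$j$j * x$j" using mult_right_mono[OF Nd[of j], of "x$j"] that by (simp add: S_def)
   also have "\<dots> <= (\<Sum>k\<in>UNIV. N$j$k * x$k)"
    using that N0 by (intro member_le_sum[where f = "%k. N$j$k * x$k"]) (auto simp: S_def)
   finally show ?thesis .
  qed
  then have "(\<Sum>j\<in>UNIV. x$j) <= s x" unfolding s_def by (rule sum_mono)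
  then show ?thesis using that by (simp add: S_def)
 qed
 have "compact S"
 proof (rule compact_eq_bounded_closed[THEN iffD2, OF conjI])
  have "norm x <= 1" if "x \<in> S" for x
   using norm_le_l1_cart[of x] that by (auto simp: S_def)
  then show "bounded S" by (auto simp: bounded_iff)
  have "S = (\<Inter>j. {x. 0 <= x$j}) \<inter> {x. (\<Sum>j\<in>UNIV. x$j) = 1}" by (auto simp: S_def)
  then show "closed S"
   by (auto intro!: closed_Int closed_INT closed_Collect_le closed_Collect_eq continuous_intros)
 qed
 moreover have "convex S"
  unfolding convex_def S_def by (auto simp: sum.distrib simp flip: sum_distrib_left)
 moreover have "axis undefined 1 \<in> S" by (auto simp: S_def axis_def)
 then have "S \<noteq> {}" by auto
 moreover have "continuous_on S f"
 proof -
  have "continuous_on S s" unfolding s_def by (intro continuous_intros)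
  moreover have "continuous_on S ((*v) N)" by (intro linear_continuous_on matrix_vector_mul_bounded_linear)
  moreover have "\<forall>x\<in>S. s x \<noteq> 0" using s1 by fastforce
  ultimately show ?thesis unfolding f_def by (intro continuous_on_scaleR continuous_on_divide continuous_on_const)
 qed
 moreover have "f \<in> S \<rightarrow> S"
 proof
  fix x assume x: "x \<in> S"
  have "0 <= f x$j" for j
   using x s1[OF x] N0 by (auto simp: f_def Nx S_def intro!: divide_nonneg_nonneg sum_nonneg)
  moreover have "(\<Sum>j\<in>UNIV. f x$j) = 1"
   using s1[OF x] by (simp add: f_def Nx s_def flip: sum_divide_distrib)
  ultimately show "f x \<in> S" by (simp add: S_def)
 qed
 ultimately obtain x where x: "x \<in> S" "f x = x" by (rule brouwer)
 have eig: "(\<Sum>k\<in>UNIV. N$j$k * x$k) = s x * x$j" for j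
 proof -
  have "x$j = (1 / s x) * (\<Sum>k\<in>UNIV. N$j$k * x$k)"
   using x(2) by (metis f_def Nx vector_scaleR_component real_scaleR_def)
  then show ?thesis using s1[OF x(1)] by (simp add: field_simps)
 qed
 have xnn: "0 <= x$j" for j using x by (simp add: S_def)
 have step: "x$b = 0" if "x$a = 0" "a \<noteq> b" "0 < A$a$b" for a b
 proof -
  have "(\<Sum>k\<in>UNIV. N$a$k * x$k) = 0" using eig[of a] that by simp
  then have "N$a$b * x$b = 0"
   by (subst (asm) sum_nonneg_eq_0_iff) (auto simp: N0 xnn)
  then show ?thesis using Noff[OF that(2)] that(3) by simp
 qed
 have pos: "0 < x$j" for j
 proof (rule ccontr)
  assume "\<not> 0 < x$j"
  then have j0: "x$j = 0" using xnn[of j] by simp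
  have "x$k = 0" for k
   using irr[of j k] by (induction rule: rtrancl_induct) (use j0 step in auto)
  then show False using x(1) by (simp add: S_def)
 qed
 have "(\<Sum>k\<in>UNIV. A$j$k * x$k) = (s x - c) * x$j" for j
 proof -
  have "(\<Sum>k\<in>UNIV. N$j$k * x$k) = (\<Sum>k\<in>UNIV. A$j$k * x$k) + (\<Sum>k\<in>UNIV. if j = k then c * x$k else 0)"
   unfolding sum.distrib[symmetric] by (intro sum.cong) (auto simp: N_def mat_1_entry algebra_simps)
  then show ?thesis using eig[of j] by (simp add: algebra_simps)
 qed
 with pos show ?thesis by (rule that)
qed

lemma eigen_pairing:
 fixes y x :: "real^'n"
 assumes y: "\<And>k. (\<Sum>j\<in>UNIV. y$j * A$j$k) = K * y$k"
 shows "(\<Sum>j\<in>UNIV. y$j * (\<Sum>k\<in>UNIV. A$j$k * v k)) = K * (\<Sum>k\<in>UNIV. y$k * v k)"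
proof -
 have "(\<Sum>j\<in>UNIV. y$j * (\<Sum>k\<in>UNIV. A$j$k * v k)) = (\<Sum>k\<in>UNIV. (\<Sum>j\<in>UNIV. y$j * A$j$k) * v k)"
  unfolding sum_distrib_left sum_distrib_right mult.assoc by (rule sum.swap)
 then show ?thesis by (simp add: y sum_distrib_left mult.assoc)
qed

lemma perron_pair:
 fixes A :: "real^'n^'n"
 assumes off: "\<And>j k. j \<noteq> k ==> 0 <= A$j$k"
  and irr: "\<And>j k. (j, k) \<in> {(a, b). a \<noteq> b \<and> 0 < A$a$b}\<^sup>*"
 obtains x y :: "real^'n" and K :: real where "\<And>j. 0 < x$j" "\<And>j. (\<Sum>k\<in>UNIV. A$j$k * x$k) = K * x$j"
  "\<And>j. 0 < y$j" "\<And>k. (\<Sum>j\<in>UNIV. y$j * A$j$k) = K * y$k"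
proof -
 obtain x K where x: "\<And>j. 0 < x$j" "\<And>j. (\<Sum>k\<in>UNIV. A$j$k * x$k) = K * x$j"
  using perron_eigenvector[OF off irr] by blast
 have conv: "{(a, b). a \<noteq> b \<and> 0 < transpose A$a$b} = {(a, b). a \<noteq> b \<and> 0 < A$a$b}\<inverse>"
  by (auto simp: transpose_def)
 have irr': "(j, k) \<in> {(a, b). a \<noteq> b \<and> 0 < transpose A$a$b}\<^sup>*" for j k
  unfolding conv rtrancl_converse using irr[of k j] by simp
 have off': "j \<noteq> k ==> 0 <= transpose A$j$k" for j k using off[of k j] by (simp add: transpose_def)
 obtain y \<eta> where y: "\<And>j. 0 < y$j" "\<And>j. (\<Sum>k\<in>UNIV. transpose A$j$k * y$k) = \<eta> * y$j"
  using perron_eigenvector[of "transpose A", OF off' irr'] by blast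
 have y': "(\<Sum>j\<in>UNIV. y$j * A$j$k) = \<eta> * y$k" for k
  using y(2)[of k] by (simp add: transpose_def mult.commute)
 have "\<eta> * (\<Sum>k\<in>UNIV. y$k * x$k) = (\<Sum>j\<in>UNIV. y$j * (\<Sum>k\<in>UNIV. A$j$k * x$k))"
  by (rule eigen_pairing[OF y', symmetric])
 also have "\<dots> = K * (\<Sum>k\<in>UNIV. y$k * x$k)"
  unfolding x(2) by (simp add: sum_distrib_left mult.left_commute)
 finally have "\<eta> = K"
  using sum_pos[of "UNIV :: 'n set" "%k. y$k * x$k"] x(1) y(1) by auto
 then show ?thesis using x y y' by (intro that[of x K y]) auto
qed

text \<open>Pair an eigenvector of the dominant eigenvalue, taken entrywise in modulus, with the positive left eigenvector.\<close>

lemma dominant_real_eigenvalue_perron: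
 fixes A :: "real^'n^'n"
 assumes off: "\<And>j k. j \<noteq> k ==> 0 <= A$j$k"
  and x: "\<And>j. 0 < x$j" "\<And>j. (\<Sum>k\<in>UNIV. A$j$k * x$k) = K * x$j"
  and y: "\<And>j. 0 < y$j" "\<And>k. (\<Sum>j\<in>UNIV. y$j * A$j$k) = K * y$k"
  and d: "dominant_real_eigenvalue (\<chi> j k. complex_of_real (A$j$k)) r"
 shows "r = K"
proof (rule antisym)
 let ?A = "\<chi> j k. complex_of_real (A$j$k)"
 have "?A *v (\<chi> j. of_real (x$j)) = of_real K *s (\<chi> j. of_real (x$j))"
  by (simp add: vec_eq_iff matrix_vector_mult_def flip: of_real_mult of_real_sum x(2))
 moreover have "(\<chi> j. complex_of_real (x$j)) \<noteq> 0" using x(1)[of undefined] by (simp add: vec_eq_iff) (metis less_irrefl)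
 ultimately have "is_eigenvalue ?A (of_real K)" unfolding is_eigenvalue_def by blast
 then have "Re (of_real K) <= r" using d unfolding dominant_real_eigenvalue_def by blast
 then show "K <= r" by simp
 obtain v where v: "v \<noteq> 0" "?A *v v = of_real r *s v"
  using d unfolding dominant_real_eigenvalue_def is_eigenvalue_def by blast
 have eq: "(\<Sum>k\<in>UNIV. of_real (A$j$k) * v$k) = of_real r * v$j" for j
  using v(2) by (simp add: vec_eq_iff matrix_vector_mult_def)
 have le: "r * norm (v$j) <= (\<Sum>k\<in>UNIV. A$j$k * norm (v$k))" for j
 proof -
  have s: "(\<Sum>k\<in>UNIV. f k) = f j + (\<Sum>k\<in>UNIV - {j}. f k)" for f :: "'n => 'b::comm_monoid_add"
   by (rule sum.remove) auto
  have "of_real (r - A$j$j) * v$j = (\<Sum>k\<in>UNIV - {j}. of_real (A$j$k) * v$k)"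
   using eq[of j] unfolding s[of "%k. of_real (A$j$k) * v$k"] by (simp add: algebra_simps)
  then have "norm (of_real (r - A$j$j) * v$j) <= (\<Sum>k\<in>UNIV - {j}. norm (of_real (A$j$k) * v$k))"
   by (simp only: norm_sum)
  also have "\<dots> = (\<Sum>k\<in>UNIV - {j}. A$j$k * norm (v$k))"
   by (intro sum.cong) (auto simp: norm_mult off)
  finally have "\<bar>r - A$j$j\<bar> * norm (v$j) <= (\<Sum>k\<in>UNIV - {j}. A$j$k * norm (v$k))"
   by (simp add: norm_mult del: of_real_diff)
  moreover have "(r - A$j$j) * norm (v$j) <= \<bar>r - A$j$j\<bar> * norm (v$j)"
   by (intro mult_right_mono) auto
  ultimately show ?thesis unfolding s[of "%k. A$j$k * norm (v$k)"] by (simp add: algebra_simps)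
 qed
 have "r * (\<Sum>j\<in>UNIV. y$j * norm (v$j)) = (\<Sum>j\<in>UNIV. y$j * (r * norm (v$j)))"
  by (simp add: sum_distrib_left ac_simps)
 also have "\<dots> <= (\<Sum>j\<in>UNIV. y$j * (\<Sum>k\<in>UNIV. A$j$k * norm (v$k)))"
  using y(1) by (intro sum_mono mult_left_mono le) (auto simp: less_imp_le)
 also have "\<dots> = K * (\<Sum>j\<in>UNIV. y$j * norm (v$j))" by (rule eigen_pairing[OF y(2)])
 finally have "r * (\<Sum>j\<in>UNIV. y$j * norm (v$j)) <= K * (\<Sum>j\<in>UNIV. y$j * norm (v$j))" .
 moreover have "0 < (\<Sum>j\<in>UNIV. y$j * norm (v$j))"
 proof -
  obtain i where "v$i \<noteq> 0" using v(1) by (auto simp: vec_eq_iff)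
  then show ?thesis using y(1) by (intro sum_pos2[of _ i]) (auto simp: less_imp_le)
 qed
 ultimately show "r <= K" by simp
qed

lemma positive_matrix_eigenvector_unique:
 fixes M :: "real^'n^'n"
 assumes M: "\<And>j k. 0 < M$j$k" and x: "\<And>j. 0 < x$j" "\<And>j. (\<Sum>k\<in>UNIV. M$j$k * x$k) = x$j"
  and v: "\<And>j. (\<Sum>k\<in>UNIV. M$j$k * v$k) = v$j"
 obtains c where "v = c *\<^sub>R (x :: real^'n)"
proof -
 define c where "c = Min (range (%j. v$j / x$j))"
 have le: "c * x$j <= v$j" for j
 proof -
  have "c <= v$j / x$j" unfolding c_def by (intro Min_le) auto
  then show ?thesis using x(1)[of j] by (simp add: field_simps)
 qed
 have "c \<in> range (%j. v$j / x$j)" unfolding c_def by (intro Min_in) auto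
 then obtain i where "c = v$i / x$i" by auto
 then have i: "c * x$i = v$i" using x(1)[of i] by simp
 have "(\<Sum>k\<in>UNIV. M$i$k * (v$k - c * x$k)) = (\<Sum>k\<in>UNIV. M$i$k * v$k) - c * (\<Sum>k\<in>UNIV. M$i$k * x$k)"
  by (simp add: sum_subtractf sum_distrib_left algebra_simps)
 also have "\<dots> = 0" by (simp add: x(2) v i)
 finally have "\<forall>k\<in>UNIV. M$i$k * (v$k - c * x$k) = 0"
  using le M by (subst (asm) sum_nonneg_eq_0_iff) (auto intro!: mult_nonneg_nonneg simp: less_imp_le)
 then have "v$k = c * x$k" for k using M[of i k] by (metis UNIV_I eq_iff_diff_eq_0 less_irrefl mult_eq_0_iff)
 then show ?thesis by (intro that[of c]) (simp add: vec_eq_iff)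
qed

lemma weighted_max_exists:
 fixes v :: "complex^'n" and x :: "real^'n"
 assumes x: "\<And>j. 0 < x$j"
 obtains K i where "0 <= K" "\<And>j. norm (v$j) <= K * x$j" "norm (v$i) = K * x$i"
proof -
 define K where "K = Max (range (%j. norm (v$j) / x$j))"
 have "K \<in> range (%j. norm (v$j) / x$j)" unfolding K_def by (intro Max_in) auto
 then obtain i where i: "K = norm (v$i) / x$i" by auto
 show ?thesis
 proof (rule that[of K i])
  show "0 <= K" using i x[of i] by simp
  show "norm (v$i) = K * x$i" using i x[of i] by simp
  fix j
  have "norm (v$j) / x$j <= K" unfolding K_def by (intro Max_ge) auto
  then show "norm (v$j) <= K * x$j" using x[of j] by (simp add: field_simps)
 qed
qed

text \<open>The norm is the maximum of \<open>|v_j| / x_j\<close>.\<close>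

lemma dominated_matrix_contracts:
 fixes Q :: "complex^'n^'n"
 assumes Q: "\<And>j k. norm (Q$j$k) <= S j k" and x: "\<And>j. 0 < x$j" and S: "\<And>j. (\<Sum>k\<in>UNIV. S j k * x$k) <= r * x$j"
  and v: "\<And>j. norm (v$j) <= K * x$j" and K: "0 <= K"
 shows "norm ((Q *v v)$j) <= r * (K * x$j)"
proof -
 have "norm ((Q *v v)$j) <= (\<Sum>k\<in>UNIV. norm (Q$j$k) * norm (v$k))"
  by (simp add: matrix_vector_mult_def) (auto intro!: order_trans[OF norm_sum] simp: norm_mult)
 also have "\<dots> <= (\<Sum>k\<in>UNIV. S j k * (K * x$k))"
  using x by (intro sum_mono mult_mono Q v order_trans[OF norm_ge_zero Q]) auto
 also have "\<dots> = K * (\<Sum>k\<in>UNIV. S j k * x$k)" by (simp add: sum_distrib_left ac_simps)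
 also have "\<dots> <= K * (r * x$j)" by (intro mult_left_mono S K)
 finally show ?thesis by (simp add: ac_simps)
qed

lemma det_nonzeroI:
 fixes A :: "'a::field^'n^'n"
 assumes "\<And>v. A *v v = 0 ==> v = 0"
 shows "det A \<noteq> 0"
 using assms matrix_left_invertible_ker[of A] by (metis invertible_det_nz invertible_left_inverse)

lemma det_nonzeroD:
 fixes A :: "'a::field^'n^'n"
 assumes "det A \<noteq> 0" "A *v v = 0"
 shows "v = 0"
 using assms matrix_left_invertible_ker[of A] by (metis invertible_det_nz invertible_left_inverse)

lemma dominated_matrix_det_nonzero:
 fixes Q :: "complex^'n^'n"
 assumes Q: "\<And>j k. norm (Q$j$k) <= S j k" and x: "\<And>j. 0 < x$j" and S: "\<And>j. (\<Sum>k\<in>UNIV. S j k * x$k) <= r * x$j"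
  and r: "r < 1"
 shows "det (mat 1 - Q) \<noteq> 0"
proof (rule det_nonzeroI)
 fix v assume "(mat 1 - Q) *v v = 0"
 then have v: "Q *v v = v" by (simp add: matrix_vector_mult_diff_rdistrib)
 obtain K i where K: "0 <= K" "\<And>j. norm (v$j) <= K * x$j" "norm (v$i) = K * x$i"
  using weighted_max_exists[OF x, of v] by blast
 have "K * x$i <= r * (K * x$i)"
  using dominated_matrix_contracts[OF Q x S K(2,1), of i] v K(3) by simp
 then have "K = 0"
 proof (rule contrapos_pp)
  assume "K \<noteq> 0"
  then have "0 < K * x$i" using K(1) x[of i] by simp
  then have "r * (K * x$i) < 1 * (K * x$i)" using r by (intro mult_strict_right_mono)
  then show "\<not> K * x$i <= r * (K * x$i)" by simp
 qed
 then show "v = 0" using K(2) by (simp add: vec_eq_iff)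
qed

text \<open>The modulus of the eigenvector is subinvariant for \<open>S\<close>, and pairing with \<open>y\<close> makes it invariant. Then no triangle
inequality may be strict.\<close>

lemma peripheral_eigenvector_modulus:
 fixes Q :: "complex^'n^'n" and S :: "real^'n^'n"
 assumes Q: "\<And>j k. norm (Q$j$k) <= S$j$k" and S: "\<And>j k. 0 < S$j$k"
  and y: "\<And>j. 0 < y$j" "\<And>k. (\<Sum>j\<in>UNIV. y$j * S$j$k) = y$k"
  and v: "Q *v v = v" "v \<noteq> 0"
 shows "norm (Q$j$k) = S$j$k"
proof -
 define a where "a = (%j. norm (v$j))"
 have le1: "a j <= (\<Sum>k\<in>UNIV. norm (Q$j$k) * a k)" for j
 proof -
  have "a j = norm (\<Sum>k\<in>UNIV. Q$j$k * v$k)"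
   using arg_cong[OF v(1), of "%v. v$j"] by (simp add: a_def matrix_vector_mult_def)
  also have "\<dots> <= (\<Sum>k\<in>UNIV. norm (Q$j$k) * a k)"
   by (auto intro!: order_trans[OF norm_sum] simp: norm_mult a_def)
  finally show ?thesis .
 qed
 have le2: "(\<Sum>k\<in>UNIV. norm (Q$j$k) * a k) <= (\<Sum>k\<in>UNIV. S$j$k * a k)" for j
  by (intro sum_mono mult_right_mono Q) (simp add: a_def)
 have "(\<Sum>j\<in>UNIV. y$j * ((\<Sum>k\<in>UNIV. S$j$k * a k) - a j)) = 0"
  using eigen_pairing[of y S 1 a] y(2) by (simp add: right_diff_distrib sum_subtractf)
 then have *: "\<forall>j\<in>UNIV. y$j * ((\<Sum>k\<in>UNIV. S$j$k * a k) - a j) = 0"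
  using y(1) order_trans[OF le1 le2] by (subst (asm) sum_nonneg_eq_0_iff) (auto intro!: mult_nonneg_nonneg simp: less_imp_le)
 then have eq: "(\<Sum>k\<in>UNIV. S$j$k * a k) = a j" for j
 proof -
  have "y$j * ((\<Sum>k\<in>UNIV. S$j$k * a k) - a j) = 0" using * by blast
  then show ?thesis using y(1)[of j] by (simp only: mult_eq_0_iff) simp
 qed
 obtain i where i: "0 < a i" using v(2) by (auto simp: a_def vec_eq_iff)
 have pos: "0 < a j" for j
  unfolding eq[of j, symmetric] using S i by (intro sum_pos2[of _ i]) (auto simp: a_def less_imp_le)
 have "(\<Sum>k\<in>UNIV. (S$j$k - norm (Q$j$k)) * a k) = 0"
  using le1[of j] le2[of j] eq[of j] by (simp add: left_diff_distrib sum_subtractf)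
 then have "\<forall>k\<in>UNIV. (S$j$k - norm (Q$j$k)) * a k = 0"
  using Q pos by (subst (asm) sum_nonneg_eq_0_iff) (auto intro!: mult_nonneg_nonneg simp: less_imp_le)
 then have "(S$j$k - norm (Q$j$k)) * a k = 0" by blast
 then show ?thesis using pos[of k] by (simp only: mult_eq_0_iff) simp
qed

section \<open>Convexity\<close>

lemma powr_le_affine:
 fixes t l :: real
 assumes "0 <= t" "0 <= l" "l <= 1"
 shows "t powr l <= 1 - l + l * t"
proof (cases "t = 0")
 case False
 then show ?thesis using Youngs_inequality_0[of l "1 - l" t 1] assms by simp
qed (use assms in auto)

lemma (in prob_space) jensen_powr:
 fixes f :: "'a => real"
 assumes f: "integrable M f" "\<And>x. 0 <= f x" and m: "0 < expectation f" and l: "0 <= l" "l <= 1"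
 shows "integrable M (%x. f x powr l)" "expectation (%x. f x powr l) <= expectation f powr l"
proof -
 let ?m = "expectation f"
 have [measurable]: "f \<in> borel_measurable M" using f by auto
 have le: "f x powr l <= ?m powr l * (1 - l + l * (f x / ?m))" for x
 proof -
  have "f x powr l = ?m powr l * (f x / ?m) powr l" using f(2)[of x] m by (simp add: powr_divide)
  also have "\<dots> <= ?m powr l * (1 - l + l * (f x / ?m))"
   using f(2)[of x] m l by (intro mult_left_mono powr_le_affine) auto
  finally show ?thesis .
 qed
 have i: "integrable M (%x. ?m powr l * (1 - l + l * (f x / ?m)))"
  using f(1) by (intro integrable_mult_right Bochner_Integration.integrable_add integrable_divide) auto
 show i2: "integrable M (%x. f x powr l)"
  by (rule Bochner_Integration.integrable_bound[OF i]) (use le in \<open>auto intro!: AE_I2 intro: order_trans[OF _ abs_ge_self]\<close>)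
 have "expectation (%x. f x powr l) <= expectation (%x. ?m powr l * (1 - l + l * (f x / ?m)))"
  by (rule integral_mono[OF i2 i le])
 also have "\<dots> = ?m powr l" using f(1) m by (simp add: prob_space)
 finally show "expectation (%x. f x powr l) <= ?m powr l" .
qed

text \<open>The matrix form of convexity of cumulants. Off the diagonal this is the weighted inequality of means, and the diagonal of \<open>G\<close>
absorbs the additive constants because the rows of \<open>G\<close> sum to zero.\<close>

lemma generator_log_convex:
 fixes G A1 A2 :: "real^'n^'n" and x :: "real^'n"
 assumes off: "\<And>j k. j \<noteq> k ==> 0 <= G$j$k" and row: "\<And>j. (\<Sum>k\<in>UNIV. G$j$k) = 0"
  and A1: "\<And>j k. A1$j$k = G$j$k * u j k + (if j = k then a j else 0)"
  and A2: "\<And>j k. A2$j$k = G$j$k * v j k + (if j = k then b j else 0)"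
  and uv: "\<And>j k. j \<noteq> k ==> 0 < G$j$k ==> u j k <= v j k powr l \<and> 0 <= v j k"
  and uvd: "\<And>j. u j j = 1" "\<And>j. v j j = 1" and ab: "\<And>j. a j <= l * b j"
  and l: "0 <= l" "l <= 1" and x: "\<And>j. 0 < x$j" "\<And>j. (\<Sum>k\<in>UNIV. A2$j$k * x$k) = K * x$j"
 shows "(\<Sum>k\<in>UNIV. A1$j$k * (x$k powr l)) <= l * K * (x$j powr l)"
proof -
 have s: "(\<Sum>k\<in>UNIV. f k) = f j + (\<Sum>k\<in>UNIV - {j}. f k)" for f :: "'n => real"
  by (rule sum.remove) auto
 let ?p = "x$j powr l"
 have t: "A1$j$k * (x$k powr l) <= ?p * ((1 - l) * G$j$k + l * (A2$j$k * x$k / x$j))" if k: "k \<noteq> j" for k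
 proof (cases "G$j$k = 0")
  case True then show ?thesis using k by (simp add: A1 A2)
 next
  case False
  then have G: "0 < G$j$k" using off[of j k] k by auto
  have u: "u j k <= v j k powr l" "0 <= v j k" using uv[of j k] G k by auto
  have "u j k * (x$k powr l) <= v j k powr l * (x$k powr l)" using u by (intro mult_right_mono) auto
  also have "\<dots> = ?p * (v j k * x$k / x$j) powr l"
   using u(2) x(1)[of j] x(1)[of k] by (simp add: powr_mult powr_divide)
  also have "\<dots> <= ?p * (1 - l + l * (v j k * x$k / x$j))"
   using u(2) x(1)[of j] x(1)[of k] l by (intro mult_left_mono powr_le_affine) auto
  finally have "G$j$k * (u j k * (x$k powr l)) <= G$j$k * (?p * (1 - l + l * (v j k * x$k / x$j)))"
   using G by (intro mult_left_mono) auto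
  then show ?thesis using k by (simp add: A1 A2 algebra_simps)
 qed
 have "(\<Sum>k\<in>UNIV. A1$j$k * (x$k powr l)) <= (G$j$j + l * b j) * ?p +
   (\<Sum>k\<in>UNIV - {j}. ?p * ((1 - l) * G$j$k + l * (A2$j$k * x$k / x$j)))"
  unfolding s[of "%k. A1$j$k * (x$k powr l)"]
  using ab[of j] by (intro add_mono sum_mono t) (auto simp: A1 uvd intro: mult_right_mono)
 also have "(\<Sum>k\<in>UNIV - {j}. ?p * ((1 - l) * G$j$k + l * (A2$j$k * x$k / x$j)))
   = ?p * ((1 - l) * (\<Sum>k\<in>UNIV - {j}. G$j$k) + l * ((\<Sum>k\<in>UNIV - {j}. A2$j$k * x$k) / x$j))"
  by (simp only: sum.distrib sum_distrib_left sum_divide_distrib distrib_left)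
 also have "(\<Sum>k\<in>UNIV - {j}. G$j$k) = - G$j$j" using row[of j] s[of "%k. G$j$k"] by simp
 also have "(\<Sum>k\<in>UNIV - {j}. A2$j$k * x$k) = (K - G$j$j - b j) * x$j"
  using x(2)[of j] s[of "%k. A2$j$k * x$k"] by (simp add: A2 uvd algebra_simps)
 also have "(K - G$j$j - b j) * x$j / x$j = K - G$j$j - b j" using x(1)[of j] by simp
 finally show ?thesis by (simp add: algebra_simps)
qed

section \<open>The matrix semigroup of exponential moments\<close>

lemma integral_pair_mult:
 fixes f :: "'a => complex" and g :: "'b => complex"
 assumes M: "finite_measure M" and N: "finite_measure N" and f: "integrable M f" and g: "integrable N g"
 shows "(\<integral>z. f (fst z) * g (snd z) \<partial>(M \<Otimes>\<^sub>M N)) = (\<integral>x. f x \<partial>M) * (\<integral>y. g y \<partial>N)"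
proof -
 interpret M: finite_measure M by fact
 interpret N: finite_measure N by fact
 interpret pair_sigma_finite M N ..
 have [measurable]: "f \<in> borel_measurable M" "g \<in> borel_measurable N" using f g by auto
 have int: "integrable (M \<Otimes>\<^sub>M N) (%z. f (fst z) * g (snd z))"
 proof (rule Fubini_integrable)
  show "integrable M (%x. LINT y|N. norm (f (fst (x, y)) * g (snd (x, y))))"
   using f by (simp add: norm_mult)
  show "AE x in M. integrable N (%y. f (fst (x, y)) * g (snd (x, y)))" using g by simp
 qed simp
 show ?thesis using integral_fst'[OF int] by simp
qed

context markov_modulated_levy
begin

lemma prob_space_P: "prob_space (P i)" by (rule prob_spaces)

lemma X_measurable_P [measurable]: "0 <= t ==> X t \<in> borel_measurable (P i)" by (rule measurable_X)
lemma J_measurable_P [measurable]: "0 <= t ==> J t \<in> measurable (P i) (count_space UNIV)" by (rule measurable_J)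

definition Fil :: "real => 'n => 'w measure" where
 "Fil t i = process_filtration (space (P i)) X J t"

lemma space_Fil: "space (Fil t i) = space (P i)"
 unfolding Fil_def process_filtration_def by (rule space_measure_of) auto

lemma sets_Fil: "sets (Fil t i) = sigma_sets (space (P i))
   ({X u -` S \<inter> space (P i) | u S. 0 <= u \<and> u <= t \<and> S \<in> sets borel} \<union>
   {J u -` S \<inter> space (P i) | u S. 0 <= u \<and> u <= t})"
 unfolding Fil_def process_filtration_def by (rule sets_measure_of) auto

lemma subalgebra_Fil: "subalgebra (P i) (Fil t i)"
 unfolding subalgebra_def space_Fil sets_Fil
 by (intro conjI refl sets.sigma_sets_subset) (auto intro: measurable_sets[OF measurable_X] measurable_sets[OF measurable_J])

lemma X_Fil: "0 <= u ==> u <= t ==> X u \<in> borel_measurable (Fil t i)"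
 unfolding measurable_def space_Fil sets_Fil by (auto intro!: sigma_sets.Basic)

lemma J_Fil: assumes "0 <= u" "u <= t" shows "J u \<in> measurable (Fil t i) (count_space UNIV)"
proof (rule measurableI)
 fix S
 show "J u -` S \<inter> space (Fil t i) \<in> sets (Fil t i)"
  unfolding space_Fil sets_Fil using assms by (intro sigma_sets.Basic UnI2) blast
qed simp

lemma start_P: "AE w in P i. J 0 w = i \<and> X 0 w = 0" by (rule start)

lemma markov_nn:
 fixes f :: "real => ennreal" and g :: "'n => ennreal"
 assumes st: "0 <= s" "0 <= t" and f[measurable]: "f \<in> borel_measurable borel"
  and u: "u \<in> borel_measurable (Fil t i)"
 shows "(\<integral>\<^sup>+w. u w * (f (X (t + s) w - X t w) * g (J (t + s) w)) \<partial>P i) =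
   (\<integral>\<^sup>+w. u w * (\<integral>\<^sup>+w'. f (X s w') * g (J s w') \<partial>P (J t w)) \<partial>P i)"
proof -
 interpret prob_space "P i" by (rule prob_space_P)
 interpret finite_measure_subalgebra "P i" "Fil t i" by unfold_locales (rule subalgebra_Fil)
 have [measurable]: "g \<in> measurable (count_space UNIV) borel" by simp
 have [measurable]: "X (t + s) \<in> borel_measurable (P i)" "X t \<in> borel_measurable (P i)"
  "J (t + s) \<in> measurable (P i) (count_space UNIV)"
  using st by (auto intro: measurable_X measurable_J)
 have m: "(%w. f (X (t + s) w - X t w) * g (J (t + s) w)) \<in> borel_measurable (P i)"
  by measurable
 have s0: "(\<integral>\<^sup>+w'. f (X s w' - X 0 w') * g (J s w') \<partial>P j) = (\<integral>\<^sup>+w'. f (X s w') * g (J s w') \<partial>P j)" for j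
  by (rule nn_integral_cong_AE, use start_P[of j] in eventually_elim) simp
 have "(\<integral>\<^sup>+w. u w * (f (X (t + s) w - X t w) * g (J (t + s) w)) \<partial>P i) =
   (\<integral>\<^sup>+w. u w * nn_cond_exp (P i) (Fil t i) (%w. f (X (t + s) w - X t w) * g (J (t + s) w)) w \<partial>P i)"
  by (rule nn_cond_exp_intg[OF u m, symmetric])
 also have "\<dots> = (\<integral>\<^sup>+w. u w * (\<integral>\<^sup>+w'. f (X s w') * g (J s w') \<partial>P (J t w)) \<partial>P i)"
  by (rule nn_integral_cong_AE, use additive[OF st f, of i g] in eventually_elim) (simp add: s0 Fil_def)
 finally show ?thesis .
qed

text \<open>The Markov property for products of functions of the past position and of the increment, which is all that the semigroup law needs.\<close>

lemma markov_product:
 fixes a b :: "real => ennreal"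
 assumes st: "0 <= s" "0 <= t" and [measurable]: "a \<in> borel_measurable borel" "b \<in> borel_measurable borel"
 shows "(\<integral>\<^sup>+w. a (X t w) * indicator {l} (J t w) * (b (X (t + s) w - X t w) * indicator {k} (J (t + s) w)) \<partial>P i) =
   (\<integral>\<^sup>+w. a (X t w) * indicator {l} (J t w) \<partial>P i) * (\<integral>\<^sup>+w. b (X s w) * indicator {k} (J s w) \<partial>P l)"
proof -
 have [measurable]: "(indicator {l} :: 'n => ennreal) \<in> measurable (count_space UNIV) borel" for l by simp
 have X_m: "X t \<in> borel_measurable (Fil t i)" and J_m: "J t \<in> measurable (Fil t i) (count_space UNIV)"
  using st by (auto intro: X_Fil J_Fil)
 have u: "(%w. a (X t w) * indicator {l} (J t w)) \<in> borel_measurable (Fil t i)"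
  using X_m J_m by measurable
 have "(\<integral>\<^sup>+w. a (X t w) * indicator {l} (J t w) * (b (X (t + s) w - X t w) * indicator {k} (J (t + s) w)) \<partial>P i) =
   (\<integral>\<^sup>+w. a (X t w) * indicator {l} (J t w) * (\<integral>\<^sup>+w'. b (X s w') * indicator {k} (J s w') \<partial>P (J t w)) \<partial>P i)"
  by (rule markov_nn[OF st _ u]) simp
 also have "\<dots> = (\<integral>\<^sup>+w. a (X t w) * indicator {l} (J t w) * (\<integral>\<^sup>+w'. b (X s w') * indicator {k} (J s w') \<partial>P l) \<partial>P i)"
  by (intro nn_integral_cong) (auto simp: indicator_def)
 also have "\<dots> = (\<integral>\<^sup>+w. a (X t w) * indicator {l} (J t w) \<partial>P i) * (\<integral>\<^sup>+w. b (X s w) * indicator {k} (J s w) \<partial>P l)"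
  using st by (intro nn_integral_multc) measurable
 finally show ?thesis .
qed

section \<open>The transform semigroup\<close>

definition nM :: "real => real => 'n => 'n => ennreal" where
 "nM s t i k = (\<integral>\<^sup>+w. ennreal (exp (s * X t w)) * indicator {k} (J t w) \<partial>P i)"

text \<open>The semigroup is studied for complex exponents, but the complex exponential of a matrix is never needed: only its generator
and the values at time \<open>1\<close> enter.\<close>

definition cM :: "complex => real => complex^'n^'n" where
 "cM z t = (\<chi> i k. \<integral>w. exp (z * of_real (X t w)) * indicator {k} (J t w) \<partial>P i)"

definition rM :: "real => real => real^'n^'n" where
 "rM s t = (\<chi> i k. \<integral>w. exp (s * X t w) * indicator {k} (J t w) \<partial>P i)"

definition emgf :: "real => bool" where
 "emgf s \<longleftrightarrow> (\<forall>j. integrable (P j) (%w. exp (s * X 1 w)))"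

definition emgft :: "real => real => bool" where
 "emgft s t \<longleftrightarrow> (\<forall>j. integrable (P j) (%w. exp (s * X t w)))"

lemma ind_measurable [measurable]: "(indicator A :: 'n => 'b::{zero_neq_one, topological_space}) \<in> measurable (count_space UNIV) borel" by simp

lemma nM_add:
 assumes st: "0 <= t" "0 <= u"
 shows "nM s (t + u) i k = (\<Sum>l\<in>UNIV. nM s t i l * nM s u l k)"
proof -
 have "nM s (t + u) i k = (\<integral>\<^sup>+w. (\<Sum>l\<in>UNIV. ennreal (exp (s * X t w)) * indicator {l} (J t w) *
   (ennreal (exp (s * (X (t + u) w - X t w))) * indicator {k} (J (t + u) w))) \<partial>P i)"
  unfolding nM_def
 proof (intro nn_integral_cong)
  fix w
  have "ennreal (exp (s * X (t + u) w)) = ennreal (exp (s * X t w)) * ennreal (exp (s * (X (t + u) w - X t w)))"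
   by (simp add: ennreal_mult[symmetric] algebra_simps flip: exp_add)
  moreover have "(\<Sum>l\<in>UNIV. f * indicator {l} (J t w) * g) = f * g" for f g :: ennreal
  proof -
   have "(\<Sum>l\<in>UNIV. f * indicator {l} (J t w) * g) = (\<Sum>l\<in>UNIV. if l = J t w then f * g else 0)"
    by (intro sum.cong) (auto simp: indicator_def)
   then show ?thesis by simp
  qed
  ultimately show "ennreal (exp (s * X (t + u) w)) * indicator {k} (J (t + u) w) =
   (\<Sum>l\<in>UNIV. ennreal (exp (s * X t w)) * indicator {l} (J t w) *
   (ennreal (exp (s * (X (t + u) w - X t w))) * indicator {k} (J (t + u) w)))"
   by (simp add: mult.assoc)
 qed
 also have "\<dots> = (\<Sum>l\<in>UNIV. (\<integral>\<^sup>+w. ennreal (exp (s * X t w)) * indicator {l} (J t w) *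
   (ennreal (exp (s * (X (t + u) w - X t w))) * indicator {k} (J (t + u) w)) \<partial>P i))"
  using st by (intro nn_integral_sum) measurable
 also have "\<dots> = (\<Sum>l\<in>UNIV. nM s t i l * nM s u l k)"
  unfolding nM_def by (intro sum.cong refl markov_product st(2,1)) measurable
 finally show ?thesis .
qed

lemma nM_sum: "0 <= t ==> (\<Sum>k\<in>UNIV. nM s t i k) = (\<integral>\<^sup>+w. ennreal (exp (s * X t w)) \<partial>P i)"
 unfolding nM_def
 by (subst nn_integral_sum[symmetric])
   (auto intro!: nn_integral_cong simp: indicator_def if_distrib[of "%x. _ * x"] cong: if_cong)

lemma integrable_iff_nM: assumes t: "0 <= t"
 shows "integrable (P i) (%w. exp (s * X t w)) \<longleftrightarrow> (\<forall>k. nM s t i k < \<infinity>)"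
proof -
 have "integrable (P i) (%w. exp (s * X t w)) \<longleftrightarrow> (\<integral>\<^sup>+w. ennreal (exp (s * X t w)) \<partial>P i) < \<infinity>"
  using t by (subst integrable_iff_bounded) simp
 also have "\<dots> \<longleftrightarrow> (\<forall>k. nM s t i k < \<infinity>)"
  unfolding nM_sum[OF t, symmetric] by (simp add: less_top)
 finally show ?thesis .
qed

lemma emgftD: "emgft s t ==> integrable (P j) (%w. exp (s * X t w))" by (simp add: emgft_def)

lemma J_event: "0 <= t ==> {w \<in> space (P i). J t w = k} \<in> sets (P i)" by measurable

lemma integrable_exp_J:
 assumes t: "0 <= t" and e: "emgft (Re z) t"
 shows "integrable (P j) (%w. exp (z * of_real (X t w)) * indicator {k} (J t w))"
 using t by (intro Bochner_Integration.integrable_bound[OF emgftD[OF e, of j]]) (auto simp: indicator_def)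

lemma integrable_rexp_J:
 assumes t: "0 <= t" and e: "emgft s t"
 shows "integrable (P j) (%w. exp (s * X t w) * indicator {k} (J t w))"
 using t by (intro Bochner_Integration.integrable_bound[OF emgftD[OF e, of j]]) (auto simp: indicator_def)

lemma rM_nonneg: "0 <= rM s t$i$k"
 unfolding rM_def by (auto intro!: integral_nonneg_AE)

lemma nM_eq_rM: assumes t: "0 <= t" and e: "emgft s t" shows "nM s t i k = ennreal (rM s t$i$k)"
 unfolding nM_def rM_def vec_lambda_beta
 by (subst nn_integral_eq_integral[OF integrable_rexp_J[OF t e], symmetric])
   (auto simp: ennreal_mult' indicator_def intro!: nn_integral_cong)

lemma cM_of_real: "cM (of_real s) t$i$k = of_real (rM s t$i$k)"
 unfolding cM_def rM_def vec_lambda_beta integral_complex_of_real[symmetric]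
 by (intro Bochner_Integration.integral_cong) (auto simp: exp_of_real indicator_def simp flip: of_real_mult)

lemma cM_norm_le: assumes t: "0 <= t" and e: "emgft (Re z) t" shows "norm (cM z t$i$k) <= rM (Re z) t$i$k"
 unfolding cM_def rM_def vec_lambda_beta
 by (intro order_trans[OF integral_norm_bound] eq_refl Bochner_Integration.integral_cong) (auto simp: norm_mult indicator_def)

lemma rM_add:
 assumes st: "0 <= t" "0 <= u" and e: "emgft s t" "emgft s u" "emgft s (t + u)"
 shows "rM s (t + u) = rM s t ** rM s u"
proof -
 have "ennreal (rM s (t + u)$i$k) = ennreal ((rM s t ** rM s u)$i$k)" for i k
  using nM_add[OF st, of s i k] st e
  by (simp add: nM_eq_rM matrix_mult_entry ennreal_mult[symmetric] rM_nonneg sum_nonneg)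
 then show ?thesis
  by (simp add: vec_eq_iff rM_nonneg matrix_mult_entry sum_nonneg)
qed

lemma emgft_add:
 assumes st: "0 <= t" "0 <= u" and e: "emgft s t" "emgft s u"
 shows "emgft s (t + u)"
 unfolding emgft_def
proof
 fix j
 have "nM s (t + u) j k < \<infinity>" for k
  unfolding nM_add[OF st] using st e by (auto simp: nM_eq_rM less_top[symmetric] ennreal_mult_eq_top_iff)
 then show "integrable (P j) (%w. exp (s * X (t + u) w))"
  using st by (simp add: integrable_iff_nM)
qed

lemma cM_add:
 assumes st: "0 <= t" "0 <= u" and e: "emgft (Re z) t" "emgft (Re z) u"
 shows "cM z (t + u) = cM z t ** cM z u"
proof -
 have e': "emgft (Re z) (t + u)" by (rule emgft_add[OF st e])
 have main: "(\<integral>w. exp (z * of_real (X (t + u) w)) * (indicator {l} (J t w) * indicator {k} (J (t + u) w)) \<partial>P i)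
   = cM z t$i$l * cM z u$l$k" for i l k
 proof -
  have [measurable]: "X (t + u) \<in> borel_measurable (P i)" "X t \<in> borel_measurable (P i)"
   "J (t + u) \<in> measurable (P i) (count_space UNIV)" "J t \<in> measurable (P i) (count_space UNIV)"
   using st by (auto intro: measurable_X measurable_J)
  have [simp]: "complex_of_real (of_bool b) = of_bool b" for b by (cases b) auto
  define M1 where "M1 = distr (density (P i) (%w. indicator {l} (J t w))) borel (X t)"
  define M2 where "M2 = distr (density (P l) (%w. indicator {k} (J u w))) borel (X u)"
  define W where "W = density (P i) (%w. indicator {l} (J t w) * indicator {k} (J (t + u) w))"
  define M3 where "M3 = distr W (borel \<Otimes>\<^sub>M borel) (%w. (X t w, X (t + u) w - X t w))"
  interpret Pi: prob_space "P i" by (rule prob_space_P)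
  interpret Pl: prob_space "P l" by (rule prob_space_P)
  have e1: "emeasure M1 A = (\<integral>\<^sup>+w. indicator A (X t w) * indicator {l} (J t w) \<partial>P i)" if "A \<in> sets borel" for A
   using that st unfolding M1_def
   by (subst emeasure_distr, simp, simp, subst emeasure_density)
     (auto intro!: nn_integral_cong simp: indicator_def measurable_sets)
  have e2: "emeasure M2 A = (\<integral>\<^sup>+w. indicator A (X u w) * indicator {k} (J u w) \<partial>P l)" if "A \<in> sets borel" for A
   using that st unfolding M2_def
   by (subst emeasure_distr, simp, simp, subst emeasure_density)
     (auto intro!: nn_integral_cong simp: indicator_def measurable_sets)
  have fm: "finite_measure M1" "finite_measure M2"
  proof -
   have "emeasure M1 UNIV <= (\<integral>\<^sup>+w. 1 \<partial>P i)"
    by (subst e1) (auto intro!: nn_integral_mono simp: indicator_def simp del: nn_integral_const)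
   then show "finite_measure M1" by (intro finite_measureI) (auto simp: Pi.emeasure_space_1 top_unique M1_def)
   have "emeasure M2 UNIV <= (\<integral>\<^sup>+w. 1 \<partial>P l)"
    by (subst e2) (auto intro!: nn_integral_mono simp: indicator_def simp del: nn_integral_const)
   then show "finite_measure M2" by (intro finite_measureI) (auto simp: Pl.emeasure_space_1 top_unique M2_def)
  qed
  have sets_eq: "sets M1 = sets borel" "sets M2 = sets borel" by (auto simp: M1_def M2_def)
  have prod: "M1 \<Otimes>\<^sub>M M2 = M3"
  proof (rule pair_measure_eqI)
   show "sigma_finite_measure M1" "sigma_finite_measure M2" using fm by (auto intro: finite_measure.axioms)
   show "sets (M1 \<Otimes>\<^sub>M M2) = sets M3" unfolding M3_def sets_distr by (rule sets_pair_measure_cong[OF sets_eq])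
   fix A B assume "A \<in> sets M1" "B \<in> sets M2"
   then have AB[measurable]: "A \<in> sets borel" "B \<in> sets borel" by (auto simp: sets_eq)
   have mW: "(%w. (X t w, X (t + u) w - X t w)) \<in> measurable W (borel \<Otimes>\<^sub>M borel)"
    unfolding W_def by measurable
   have "emeasure M3 (A \<times> B) = emeasure W ((%w. (X t w, X (t + u) w - X t w)) -` (A \<times> B) \<inter> space W)"
    unfolding M3_def by (rule emeasure_distr[OF mW]) simp
   also have "\<dots> = (\<integral>\<^sup>+w. indicator {l} (J t w) * indicator {k} (J (t + u) w) *
     indicator ((%w. (X t w, X (t + u) w - X t w)) -` (A \<times> B) \<inter> space W) w \<partial>P i)"
   proof -
    have "(%w. (X t w, X (t + u) w - X t w)) -` (A \<times> B) \<inter> space W \<in> sets W" by (rule measurable_sets[OF mW]) simp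
    then show ?thesis unfolding W_def using st by (subst emeasure_density) auto
   qed
   also have "\<dots> = (\<integral>\<^sup>+w. indicator A (X t w) * indicator {l} (J t w) * (indicator B (X (t + u) w - X t w) * indicator {k} (J (t + u) w)) \<partial>P i)"
    by (intro nn_integral_cong) (auto simp: indicator_def W_def)
   also have "\<dots> = emeasure M1 A * emeasure M2 B"
    unfolding e1[OF AB(1)] e2[OF AB(2)] by (rule markov_product[OF st(2,1)]) auto
   finally show "emeasure M1 A * emeasure M2 B = emeasure M3 (A \<times> B)" by simp
  qed
  have [measurable]: "(%x. exp (z * complex_of_real x)) \<in> borel_measurable borel" by measurable
  have i1: "integrable M1 (%x. exp (z * complex_of_real x))" "(\<integral>x. exp (z * complex_of_real x) \<partial>M1) = cM z t$i$l"
  proof -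
   have d: "density (P i) (%w. indicator {l} (J t w)) = density (P i) (%w. ennreal (indicator {l} (J t w)))"
    by (intro density_cong) (use st in \<open>auto simp: indicator_def\<close>)
   show "integrable M1 (%x. exp (z * complex_of_real x))"
    unfolding M1_def d using st integrable_exp_J[OF st(1) e(1), of i l]
    by (subst integrable_distr_eq) (auto simp: integrable_density indicator_def scaleR_conv_of_real mult.commute)
   show "(\<integral>x. exp (z * complex_of_real x) \<partial>M1) = cM z t$i$l"
    unfolding M1_def d using st
    by (subst integral_distr, simp, simp, subst integral_density)
      (auto simp: cM_def indicator_def scaleR_conv_of_real intro!: Bochner_Integration.integral_cong)
  qed
  have i2: "integrable M2 (%x. exp (z * complex_of_real x))" "(\<integral>x. exp (z * complex_of_real x) \<partial>M2) = cM z u$l$k"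
  proof -
   have d: "density (P l) (%w. indicator {k} (J u w)) = density (P l) (%w. ennreal (indicator {k} (J u w)))"
    by (intro density_cong) (use st in \<open>auto simp: indicator_def\<close>)
   show "integrable M2 (%x. exp (z * complex_of_real x))"
    unfolding M2_def d using st integrable_exp_J[OF st(2) e(2), of l k]
    by (subst integrable_distr_eq) (auto simp: integrable_density indicator_def scaleR_conv_of_real mult.commute)
   show "(\<integral>x. exp (z * complex_of_real x) \<partial>M2) = cM z u$l$k"
    unfolding M2_def d using st
    by (subst integral_distr, simp, simp, subst integral_density)
      (auto simp: cM_def indicator_def scaleR_conv_of_real intro!: Bochner_Integration.integral_cong)
  qed
  have "cM z t$i$l * cM z u$l$k = (\<integral>x. exp (z * complex_of_real (fst x)) * exp (z * complex_of_real (snd x)) \<partial>M3)"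
   using integral_pair_mult[OF fm i1(1) i2(1)] unfolding prod i1(2) i2(2) by simp
  also have "\<dots> = (\<integral>w. exp (z * of_real (X t w)) * exp (z * of_real (X (t + u) w - X t w)) \<partial>W)"
   unfolding M3_def by (subst integral_distr) (use st in \<open>auto simp: W_def\<close>)
  also have "\<dots> = (\<integral>w. exp (z * of_real (X (t + u) w)) \<partial>W)"
   by (intro Bochner_Integration.integral_cong) (auto simp: algebra_simps simp flip: exp_add)
  also have "\<dots> = (\<integral>w. exp (z * of_real (X (t + u) w)) * (indicator {l} (J t w) * indicator {k} (J (t + u) w)) \<partial>P i)"
  proof -
   have d: "W = density (P i) (%w. ennreal (indicator {l} (J t w) * indicator {k} (J (t + u) w)))"
    unfolding W_def by (intro density_cong) (use st in \<open>auto simp: indicator_def\<close>)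
   show ?thesis unfolding d using st
    by (subst integral_density) (auto simp: indicator_def scaleR_conv_of_real intro!: Bochner_Integration.integral_cong)
  qed
  finally show ?thesis by simp
 qed
 show ?thesis
 proof (simp add: vec_eq_iff matrix_mult_entry, intro allI)
  fix i k
  have "cM z (t + u)$i$k = (\<integral>w. (\<Sum>l\<in>UNIV. exp (z * of_real (X (t + u) w)) * (indicator {l} (J t w) * indicator {k} (J (t + u) w))) \<partial>P i)"
   unfolding cM_def vec_lambda_beta
   by (intro Bochner_Integration.integral_cong)
     (auto simp: indicator_def if_distrib[of "%x. _ * x"] if_distrib[of "%x. x * _"] cong: if_cong)
  also have "\<dots> = (\<Sum>l\<in>UNIV. \<integral>w. exp (z * of_real (X (t + u) w)) * (indicator {l} (J t w) * indicator {k} (J (t + u) w)) \<partial>P i)"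
   using st by (intro Bochner_Integration.integral_sum Bochner_Integration.integrable_bound[OF emgftD[OF e', of i]])
     (auto simp: indicator_def)
  also have "\<dots> = (\<Sum>l\<in>UNIV. cM z t$i$l * cM z u$l$k)" by (simp only: main)
  finally show "cM z (t + u)$i$k = (\<Sum>l\<in>UNIV. cM z t$i$l * cM z u$l$k)" .
 qed
qed

section \<open>The modulating chain\<close>

definition p :: "real => 'n => 'n => real" where "p t i k = measure (P i) {w \<in> space (P i). J t w = k}"

lemma p_mexp: "0 <= t ==> p t i k = mexp (t *\<^sub>R G)$i$k"
 unfolding p_def by (rule transition)

lemma p_zero: "p 0 i k = (if i = k then 1 else 0)"
 using mexp_zero[of G i k] by (simp add: p_mexp)

lemma p_nonneg: "0 <= p t i k" by (simp add: p_def)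

lemma p_le_1: "p t i k <= 1"
proof -
 interpret prob_space "P i" by (rule prob_space_P)
 show ?thesis unfolding p_def by simp
qed

lemma rM_zero: "0 <= t ==> rM 0 t$i$k = p t i k"
proof -
 assume t: "0 <= t"
 interpret prob_space "P i" by (rule prob_space_P)
 have "rM 0 t$i$k = (\<integral>w. indicator {w \<in> space (P i). J t w = k} w \<partial>P i)"
  unfolding rM_def vec_lambda_beta by (intro Bochner_Integration.integral_cong) (auto simp: indicator_def)
 then show ?thesis using t by (simp add: p_def)
qed

lemma emgft_zero: "emgft 0 t"
proof -
 have "integrable (P j) (%w. 1 :: real)" for j
 proof -
  interpret prob_space "P j" by (rule prob_space_P)
  show ?thesis by simp
 qed
 then show ?thesis by (simp add: emgft_def)
qed

lemma p_add: "0 <= t ==> 0 <= u ==> p (t + u) i k = (\<Sum>l\<in>UNIV. p t i l * p u l k)"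
 using rM_add[of t u 0] emgft_zero by (simp add: vec_eq_iff matrix_mult_entry rM_zero)

lemma p_deriv: "(%n. (p (c * e n) i k - (if i = k then 1 else 0)) / e n) \<longlonglongrightarrow> c * G$i$k"
 if e: "e \<longlonglongrightarrow> 0" "\<And>n. 0 < e n" and c: "0 < c" for e :: "nat => real" and c :: real
proof -
 have "((%h. (mexp (h *\<^sub>R G)$i$k - mexp (0 *\<^sub>R G)$i$k) / (h - 0)) \<longlongrightarrow> G$i$k) (at 0)"
  using mexp_scaleR_deriv_0[of G i k] unfolding has_field_derivative_iff by simp
 moreover have "filterlim (%n. c * e n) (at 0) sequentially"
  using e c tendsto_mult[OF tendsto_const e(1), of c] by (auto simp: filterlim_at less_imp_neq[symmetric] intro!: always_eventually)
 ultimately have "(%n. (mexp ((c * e n) *\<^sub>R G)$i$k - mexp (0 *\<^sub>R G)$i$k) / (c * e n - 0)) \<longlonglongrightarrow> G$i$k"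
  by (rule filterlim_compose)
 then have "(%n. c * ((mexp ((c * e n) *\<^sub>R G)$i$k - mexp (0 *\<^sub>R G)$i$k) / (c * e n - 0))) \<longlonglongrightarrow> c * G$i$k"
  by (intro tendsto_intros)
 moreover have "c * ((mexp ((c * e n) *\<^sub>R G)$i$k - mexp (0 *\<^sub>R G)$i$k) / (c * e n - 0)) = (p (c * e n) i k - (if i = k then 1 else 0)) / e n" for n
  using c e(2)[of n] by (simp only: p_mexp[of "c * e n", symmetric] mexp_zero mult_nonneg_nonneg less_imp_le) simp
 ultimately show ?thesis by simp
qed

lemma p_pow_le: "0 <= h ==> p h j j ^ n <= p (real n * h) j j"
proof (induction n)
 case (Suc n)
 have "p h j j ^ Suc n <= p h j j * p (real n * h) j j"
  using Suc by (auto intro!: mult_left_mono p_nonneg)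
 also have "\<dots> <= (\<Sum>l\<in>UNIV. p h j l * p (real n * h) l j)"
  by (rule member_le_sum[where f = "%l. p h j l * p (real n * h) l j"]) (auto intro!: mult_nonneg_nonneg p_nonneg)
 also have "\<dots> = p (real (Suc n) * h) j j"
  using Suc.prems by (subst p_add[symmetric]) (auto simp: algebra_simps)
 finally show ?case .
qed (simp add: p_zero)

lemma p_diag_pos: assumes t: "0 <= t" shows "0 < p t j j"
proof (cases "t = 0")
 case False
 then have t: "0 < t" using t by simp
 have e: "(%n. 1 / real (Suc n)) \<longlonglongrightarrow> 0" by real_asymp
 have "(%n. (p (t * (1 / real (Suc n))) j j - 1) / (1 / real (Suc n))) \<longlonglongrightarrow> t * G$j$j"
  using p_deriv[OF e _ t, of j j] by simp
 from tendsto_mult[OF this e] have "(%n. p (t * (1 / real (Suc n))) j j - 1) \<longlonglongrightarrow> 0" by simp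
 then have "\<forall>\<^sub>F n in sequentially. -1 < p (t * (1 / real (Suc n))) j j - 1" by (rule order_tendstoD) simp
 then obtain n where "0 < p (t * (1 / real (Suc n))) j j" by (auto dest!: eventually_happens)
 then have "0 < p (t * (1 / real (Suc n))) j j ^ Suc n" by simp
 also have "\<dots> <= p (real (Suc n) * (t * (1 / real (Suc n)))) j j" using t by (intro p_pow_le) auto
 finally show ?thesis by simp
qed (simp add: p_zero)

lemma p_pos: assumes t: "0 < t" shows "0 < p t j k"
proof -
 have "(j, k) \<in> {(a, b). a \<noteq> b \<and> 0 < G$a$b}\<^sup>*" using generator unfolding irreducible_generator_def by blast
 then have "\<forall>t>0. 0 < p t j k"
 proof (induction rule: rtrancl_induct)
  case base then show ?case using p_diag_pos by simp
 next
  case (step b c)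
  then have bc: "b \<noteq> c" "0 < G$b$c" by auto
  show ?case
  proof (intro allI impI)
   fix t :: real assume t: "0 < t"
   have e: "(%n. 1 / real (Suc n)) \<longlonglongrightarrow> 0" by real_asymp
   have "(%n. (p (t * (1 / real (Suc n))) b c) / (1 / real (Suc n))) \<longlonglongrightarrow> t * G$b$c"
    using p_deriv[OF e _ t, of b c] bc by simp
   then have "\<forall>\<^sub>F n in sequentially. 0 < (p (t * (1 / real (Suc n))) b c) / (1 / real (Suc n))"
    by (rule order_tendstoD) (use t bc in simp)
   then have "\<forall>\<^sub>F n in sequentially. 0 < (p (t * (1 / real (Suc n))) b c) / (1 / real (Suc n)) \<and> 0 < n"
    using eventually_gt_at_top[of 0] by eventually_elim auto
   then obtain n where n: "0 < (p (t * (1 / real (Suc n))) b c) / (1 / real (Suc n))" "0 < n"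
    by (auto dest!: eventually_happens)
   define h where "h = t * (1 / real (Suc n))"
   have h: "0 < h" "h < t" using n t by (auto simp: h_def field_simps)
   have "0 < p h b c" using n(1) pos_less_divide_eq[of "1 / real (Suc n)" 0 "p h b c"] by (simp add: h_def)
   note h = h this
   have "0 < p (t - h) j b * p h b c" using step.IH h by simp
   also have "\<dots> <= (\<Sum>l\<in>UNIV. p (t - h) j l * p h l c)"
    by (rule member_le_sum[where f = "%l. p (t - h) j l * p h l c"]) (auto intro!: mult_nonneg_nonneg p_nonneg)
   also have "\<dots> = p t j c" using h by (subst p_add[symmetric]) auto
   finally show "0 < p t j c" .
  qed
 qed
 then show ?thesis using t by blast
qed

lemma nM_pos: assumes t: "0 <= t" and p: "0 < p t i k" shows "0 < nM s t i k"
proof -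
 interpret prob_space "P i" by (rule prob_space_P)
 have "nM s t i k \<noteq> 0"
 proof
  assume "nM s t i k = 0"
  then have "AE w in P i. ennreal (exp (s * X t w)) * indicator {k} (J t w) = 0"
   unfolding nM_def using t by (subst (asm) nn_integral_0_iff_AE) auto
  then have "AE w in P i. J t w \<noteq> k" by eventually_elim (auto simp: indicator_def split: if_splits)
  then have "p t i k = 0" unfolding p_def using t
   by (subst measure_eq_0_null_sets) (auto simp: null_sets_def AE_iff_measurable[OF _ refl])
  then show False using p by simp
 qed
 then show ?thesis by (simp add: zero_less_iff_neq_zero)
qed

lemma rM_pos: assumes "0 < t" "emgft s t" shows "0 < rM s t$i$k"
 using nM_pos[of t i k s] p_pos[of t i k] assms by (simp add: nM_eq_rM)

lemma emgft_le_1: assumes e: "emgf s" and t: "0 <= t" "t <= 1" shows "emgft s t"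
 unfolding emgft_def
proof
 fix i
 have "nM s t i l < \<infinity>" for l
 proof -
  have "nM s t i l * nM s (1 - t) l l <= (\<Sum>m\<in>UNIV. nM s t i m * nM s (1 - t) m l)"
   by (rule member_le_sum[where f = "%m. nM s t i m * nM s (1 - t) m l"]) auto
  also have "\<dots> = nM s 1 i l" using nM_add[of t "1 - t" s i l] t by simp
  also have "\<dots> < \<infinity>" using e integrable_iff_nM[of 1 i s] by (simp add: emgf_def)
  finally have "nM s t i l * nM s (1 - t) l l < \<infinity>" .
  moreover have "0 < nM s (1 - t) l l" using t by (intro nM_pos p_diag_pos) auto
  ultimately show ?thesis by (auto simp: ennreal_mult_less_top)
 qed
 then show "integrable (P i) (%w. exp (s * X t w))" using t by (simp add: integrable_iff_nM)
qed

lemma emgft_nat: assumes e: "emgf s" shows "emgft s (real n)"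
proof (induction n)
 case 0 show ?case using emgft_le_1[OF e, of 0] by simp
next
 case (Suc n)
 then show ?case using emgft_add[of "real n" 1 s] emgft_le_1[OF e, of 1] by (simp add: add.commute)
qed

lemma emgft_all: assumes e: "emgf s" and t: "0 <= t" shows "emgft s t"
proof -
 define n where "n = nat \<lfloor>t\<rfloor>"
 have n: "t = real n + (t - real n)" "0 <= t - real n" "t - real n <= 1" using t unfolding n_def by linarith+
 show ?thesis
  by (subst n(1), rule emgft_add[OF _ n(2) emgft_nat[OF e] emgft_le_1[OF e n(2,3)]]) simp
qed

text \<open>Finiteness at one time gives finiteness at all times, since all entries of the chain's transition matrix are positive and the
entries of the semigroup multiply.\<close>

lemma emgf_iff_mgf_domain: "emgf s \<longleftrightarrow> s \<in> mgf_domain P X"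
proof
 show "s \<in> mgf_domain P X ==> emgf s" by (auto simp: mgf_domain_def emgf_def)
 show "emgf s ==> s \<in> mgf_domain P X"
  using emgft_all unfolding emgft_def mgf_domain_def by auto
qed

lemma emgf_mono: assumes e: "emgf s" and s: "0 <= r" "r <= s" shows "emgf r"
 unfolding emgf_def
proof
 fix j
 interpret prob_space "P j" by (rule prob_space_P)
 have i: "integrable (P j) (%w. 1 + exp (s * X 1 w))" using e by (auto simp: emgf_def)
 show "integrable (P j) (%w. exp (r * X 1 w))"
 proof (rule Bochner_Integration.integrable_bound[OF i])
  have "exp (r * x) <= 1 + exp (s * x)" for x
  proof (cases "0 <= x")
   case True
   then have "exp (r * x) <= exp (s * x)" using s by (auto intro: mult_right_mono)
   then show ?thesis using exp_gt_zero[of "s * x"] by linarith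
  next
   case False
   then have "exp (r * x) <= 1" using s by (auto intro: mult_nonneg_nonpos)
   then show ?thesis using exp_gt_zero[of "s * x"] by linarith
  qed
  then show "AE w in P j. norm (exp (r * X 1 w)) <= norm (1 + exp (s * X 1 w))"
   by (auto intro!: AE_I2 order_trans[OF _ abs_ge_self])
 qed auto
qed

lemma cM_0: "cM z 0 = mat 1"
proof -
 have main: "(\<integral>w. exp (z * of_real (X 0 w)) * indicator {k} (J 0 w) \<partial>P i) = (if i = k then 1 else 0)" for i k
 proof -
  interpret prob_space "P i" by (rule prob_space_P)
  have "(\<integral>w. exp (z * of_real (X 0 w)) * indicator {k} (J 0 w) \<partial>P i) = (\<integral>w. (if i = k then 1 else 0) \<partial>P i)"
   by (rule integral_cong_AE, simp, simp, use start_P[of i] in eventually_elim) auto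
  then show ?thesis by (simp add: prob_space)
 qed
 show ?thesis by (simp add: vec_eq_iff mat_1_entry cM_def main)
qed

lemma cM_power: assumes e: "emgf (Re z)" and h: "0 <= h" shows "matpow (cM z h) n = cM z (real n * h)"
proof (induction n)
 case (Suc n)
 have "matpow (cM z h) (Suc n) = cM z h ** cM z (real n * h)" by (simp add: Suc)
 also have "\<dots> = cM z (h + real n * h)"
  using h e by (intro cM_add[symmetric] emgft_all) auto
 finally show ?case by (simp add: algebra_simps)
qed (simp add: cM_0)

lemma rM_power: assumes e: "emgf s" and h: "0 <= h" shows "matpow (rM s h) n = rM s (real n * h)"
proof (induction n)
 case 0
 have "of_real (rM s 0$i$k) = (of_real (mat 1$i$k) :: complex)" for i k
  using arg_cong[OF cM_0[of "of_real s"], of "%A. A$i$k"] by (simp add: cM_of_real mat_1_entry)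
 then show ?case by (simp add: vec_eq_iff)
next
 case (Suc n)
 have "matpow (rM s h) (Suc n) = rM s h ** rM s (real n * h)" by (simp add: Suc)
 also have "\<dots> = rM s (h + real n * h)"
  using h e by (intro rM_add[symmetric] emgft_all) auto
 finally show ?case by (simp add: algebra_simps)
qed

end

section \<open>Step paths and limits of exponential moments\<close>

section \<open>Limits under an exponential moment bound\<close>

lemma norm_exp_minus_1_le: "norm (exp w - 1) <= exp (norm w) - 1" for w :: complex
proof (rule norm_sums_le)
 show "(%n. w ^ n /\<^sub>R fact n - (if n = 0 then 1 else 0)) sums (exp w - 1)"
  using sums_single[of 0 "%_. 1 :: complex"] by (intro sums_diff exp_converges) simp
 show "(%n. norm w ^ n /\<^sub>R fact n - (if n = 0 then 1 else 0)) sums (exp (norm w) - 1)"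
  using sums_single[of 0 "%_. 1 :: real"] by (intro sums_diff exp_converges) simp
 show "norm (w ^ n /\<^sub>R fact n - (if n = 0 then 1 else 0)) <= norm w ^ n /\<^sub>R fact n - (if n = 0 then 1 else 0)" for n
  by (auto simp: norm_power)
qed

lemma exp_moment_truncation:
 fixes z :: complex
 assumes z: "0 <= Re z" "Re z <= s" and a: "0 <= a"
 shows "norm (exp (z * of_real x) - exp (z * of_real (min x a))) <= 2 * exp (- (s - Re z) * a) * exp (s * x)"
proof (cases "x <= a")
 case False
 have "norm (exp (z * of_real x) - exp (z * of_real (min x a))) <= exp (Re z * x) + exp (Re z * a)"
  using False by (intro order_trans[OF norm_triangle_ineq4]) simp
 also have "\<dots> <= 2 * exp (Re z * x)" using False z by (auto intro!: mult_left_mono)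
 also have "Re z * x <= - (s - Re z) * a + s * x"
 proof -
  have "(s - Re z) * a <= (s - Re z) * x" using False z by (intro mult_left_mono) auto
  then show ?thesis by (simp add: algebra_simps)
 qed
 then have "2 * exp (Re z * x) <= 2 * (exp (- (s - Re z) * a) * exp (s * x))" by (simp flip: exp_add)
 finally show ?thesis by simp
qed simp

text \<open>A bounded exponential moment of order \<open>s > Re z\<close> makes the family \<open>exp (z Z_n)\<close> uniformly integrable.\<close>

lemma exp_moment_limit:
 fixes Z :: "nat => 'a => real" and z :: complex
 assumes M: "finite_measure M"
  and Zm[measurable]: "\<And>n. Z n \<in> borel_measurable M" "Z0 \<in> borel_measurable M"
  and Am[measurable]: "\<And>n. A n \<in> sets M" "A0 \<in> sets M"
  and conv: "AE w in M. (w \<in> A0 \<longrightarrow> (\<forall>\<^sub>F n in sequentially. w \<in> A n) \<and> (%n. Z n w) \<longlonglongrightarrow> Z0 w) \<and>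
    (w \<notin> A0 \<longrightarrow> (\<forall>\<^sub>F n in sequentially. w \<notin> A n))"
  and z: "0 <= Re z" "Re z < s"
  and int: "\<And>n. integrable M (%w. indicator (A n) w * exp (s * Z n w))"
  and C: "\<And>n. (\<integral>w. indicator (A n) w * exp (s * Z n w) \<partial>M) <= C"
 shows "(%n. \<integral>w. indicator (A n) w * exp (z * of_real (Z n w)) \<partial>M) \<longlonglongrightarrow> (\<integral>w. indicator A0 w * exp (z * of_real (Z0 w)) \<partial>M)"
  "integrable M (%w. indicator A0 w * exp (s * Z0 w))"
  "(\<integral>w. indicator A0 w * exp (s * Z0 w) \<partial>M) <= C"
proof -
 interpret finite_measure M by fact
 have lim: "AE w in M. (%n. indicator (A n) w * \<phi> (Z n w)) \<longlonglongrightarrow> indicator A0 w * \<phi> (Z0 w)"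
  if "continuous_on UNIV \<phi>" for \<phi> :: "real => 'b::real_normed_field"
  using conv
 proof eventually_elim
  case (elim w)
  show ?case
  proof (cases "w \<in> A0")
   case True
   have "(%n. \<phi> (Z n w)) \<longlonglongrightarrow> \<phi> (Z0 w)"
    using elim True that by (auto intro: continuous_on_tendsto_compose)
   moreover have "\<forall>\<^sub>F n in sequentially. \<phi> (Z n w) = indicator (A n) w * \<phi> (Z n w)"
    using elim True by (auto elim!: eventually_mono)
   ultimately show ?thesis using True by (auto intro: Lim_transform_eventually)
  next
   case False
   then have "\<forall>\<^sub>F n in sequentially. indicator (A n) w * \<phi> (Z n w) = 0"
    using elim by (auto elim!: eventually_mono)
   then show ?thesis using False by (auto intro: tendsto_eventually)
  qed
 qed
 have "AE w in M. (%n. indicator (A n) w * exp (s * Z n w)) \<longlonglongrightarrow> indicator A0 w * exp (s * Z0 w)"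
  using lim[of "%x. exp (s * x)"] by (simp add: continuous_intros)
 from integrable_of_bounded_nonneg_limit[OF int _ _ this C]
 show int0: "integrable M (%w. indicator A0 w * exp (s * Z0 w))"
  and C0: "(\<integral>w. indicator A0 w * exp (s * Z0 w) \<partial>M) <= C" by auto
 define T where "T = (%a x. exp (z * complex_of_real (min x a)))"
 have Tc: "continuous_on UNIV (T a)" for a unfolding T_def by (intro continuous_intros)
 have [measurable]: "T a \<in> borel_measurable borel" for a by (rule borel_measurable_continuous_onI[OF Tc])
 have Tb: "norm (T a x) <= exp (Re z * a)" for a x unfolding T_def using z by (auto intro!: mult_left_mono)
 have close: "norm ((\<integral>w. indicator B w * exp (z * of_real (Y w)) \<partial>M) - (\<integral>w. indicator B w * T a (Y w) \<partial>M))
   <= 2 * exp (- (s - Re z) * a) * C"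
  if [measurable]: "Y \<in> borel_measurable M" "B \<in> sets M" and i: "integrable M (%w. indicator B w * exp (s * Y w))"
   and c: "(\<integral>w. indicator B w * exp (s * Y w) \<partial>M) <= C" and a: "0 <= a" for B Y a
 proof -
  have le: "norm (indicator B w * exp (z * of_real (Y w)) - indicator B w * T a (Y w))
    <= 2 * exp (- (s - Re z) * a) * (indicator B w * exp (s * Y w))" for w
   using exp_moment_truncation[OF z(1) less_imp_le[OF z(2)] a, of "Y w"] by (auto simp: T_def indicator_def)
  have i2: "integrable M (%w. indicator B w * T a (Y w))"
   by (rule integrable_const_bound[of _ "exp (Re z * a)"]) (auto simp: norm_mult indicator_def Tb)
  have i3: "integrable M (%w. indicator B w * exp (z * of_real (Y w)))"
  proof -
   have "integrable M (%w. indicator B w * exp (z * of_real (Y w)) - indicator B w * T a (Y w))"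
    by (rule Bochner_Integration.integrable_bound[OF integrable_mult_right[OF i, of "2 * exp (- (s - Re z) * a)"]])
      (auto intro!: AE_I2 order_trans[OF le])
   from Bochner_Integration.integrable_add[OF this i2] show ?thesis by simp
  qed
  have "norm ((\<integral>w. indicator B w * exp (z * of_real (Y w)) \<partial>M) - (\<integral>w. indicator B w * T a (Y w) \<partial>M)) =
   norm (\<integral>w. indicator B w * exp (z * of_real (Y w)) - indicator B w * T a (Y w) \<partial>M)"
   by (simp only: Bochner_Integration.integral_diff[OF i3 i2])
  also have "\<dots> <= (\<integral>w. norm (indicator B w * exp (z * of_real (Y w)) - indicator B w * T a (Y w)) \<partial>M)"
   by (rule integral_norm_bound)
  also have "\<dots> <= (\<integral>w. 2 * exp (- (s - Re z) * a) * (indicator B w * exp (s * Y w)) \<partial>M)"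
   by (intro integral_mono integrable_norm Bochner_Integration.integrable_diff i2 i3 integrable_mult_right i le)
  also have "\<dots> <= 2 * exp (- (s - Re z) * a) * C" using c by simp
  finally show ?thesis .
 qed
 show "(%n. \<integral>w. indicator (A n) w * exp (z * of_real (Z n w)) \<partial>M) \<longlonglongrightarrow> (\<integral>w. indicator A0 w * exp (z * of_real (Z0 w)) \<partial>M)"
 proof (rule tendstoI)
  let ?I = "%n. \<integral>w. indicator (A n) w * exp (z * of_real (Z n w)) \<partial>M"
  let ?Lim = "\<integral>w. indicator A0 w * exp (z * of_real (Z0 w)) \<partial>M"
  fix e :: real assume e: "0 < e"
  have "((%a. 2 * exp (- (s - Re z) * a) * C) \<longlongrightarrow> 2 * 0 * C) at_top"
  proof (intro tendsto_intros filterlim_compose[OF exp_at_bot])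
   show "LIM a at_top. - (s - Re z) * a :> at_bot"
    using z by (intro filterlim_tendsto_neg_mult_at_bot[OF tendsto_const] filterlim_ident) auto
  qed
  then have "\<forall>\<^sub>F a in at_top. 2 * exp (- (s - Re z) * a) * C < e / 3"
   using e by (intro order_tendstoD(2)[where y = 0]) auto
  then have "\<forall>\<^sub>F a in at_top. 2 * exp (- (s - Re z) * a) * C < e / 3 \<and> 0 <= a"
   using eventually_ge_at_top[of 0] by eventually_elim auto
  then obtain a where a: "2 * exp (- (s - Re z) * a) * C < e / 3" "0 <= a" by (auto dest!: eventually_happens)
  have "(%n. \<integral>w. indicator (A n) w * T a (Z n w) \<partial>M) \<longlonglongrightarrow> (\<integral>w. indicator A0 w * T a (Z0 w) \<partial>M)"
  proof (rule integral_dominated_convergence)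
   show "integrable M (%w. exp (Re z * a))" by simp
   show "AE w in M. norm (indicator (A n) w * T a (Z n w)) <= exp (Re z * a)" for n
    by (auto simp: norm_mult indicator_def Tb)
  qed (use lim[OF Tc] in auto)
  from tendstoD[OF this, of "e / 3"] e
  have "\<forall>\<^sub>F n in sequentially. dist (\<integral>w. indicator (A n) w * T a (Z n w) \<partial>M) (\<integral>w. indicator A0 w * T a (Z0 w) \<partial>M) < e / 3" by simp
  then show "\<forall>\<^sub>F n in sequentially. dist (?I n) ?Lim < e"
  proof eventually_elim
   case (elim n)
   have "dist (?I n) (\<integral>w. indicator (A n) w * T a (Z n w) \<partial>M) < e / 3"
    unfolding dist_norm using close[OF Zm(1) Am(1) int C a(2), of n] a(1) by linarith
   moreover have "dist (\<integral>w. indicator A0 w * T a (Z0 w) \<partial>M) ?Lim < e / 3"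
    using close[OF Zm(2) Am(2) int0 C0 a(2)] a(1) by (simp add: dist_norm norm_minus_commute)
   ultimately show ?case using elim by (meson dist_triangle_third)
  qed
 qed
qed

section \<open>Step paths on dyadic grids\<close>

lemma dyadic_between:
 assumes t: "0 < t" and a: "0 <= a" "a < b" "b <= t"
 obtains m i where "i <= 2 ^ m" "a < real i * (t / 2 ^ m)" "real i * (t / 2 ^ m) < b"
proof -
 obtain m where m: "t / (b - a) < 2 ^ m" using real_arch_pow[of 2 "t / (b - a)"] by auto
 define h where "h = t / 2 ^ m"
 have h: "0 < h" "h < b - a" using m t a by (auto simp: h_def field_simps)
 define i where "i = Suc (nat \<lfloor>a / h\<rfloor>)"
 have "real (nat \<lfloor>a / h\<rfloor>) = of_int \<lfloor>a / h\<rfloor>" using a h by simp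
 then have i1: "a / h < real i" "real i <= a / h + 1" unfolding i_def by linarith+
 have i2: "a < real i * h" using i1(1) h by (simp add: field_simps)
 have i3: "real i * h <= a + h" using i1(2) h by (simp add: field_simps)
 then have i4: "real i * h < b" using h by linarith
 have "real i * (t / 2 ^ m) < t" using i4 a by (simp add: h_def)
 then have "real i < 2 ^ m" using t by (simp add: field_simps)
 then have "i <= 2 ^ m" by (metis less_imp_le of_nat_le_iff of_nat_numeral of_nat_power)
 then show ?thesis using i2 i4 by (intro that[of i m]) (auto simp: h_def)
qed

lemma right_constant_grid_point:
 fixes c :: "real => 'n"
 assumes rc: "\<forall>\<^sub>F v in at_right u. c v = c u" and u: "0 <= u" "u < b" "b <= t"
 obtains m i where "i <= 2 ^ m" "u < real i * (t / 2 ^ m)" "real i * (t / 2 ^ m) < b" "c (real i * (t / 2 ^ m)) = c u"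
proof -
 obtain d where d: "u < d" "\<And>v. u < v ==> v < d ==> c v = c u"
  using rc unfolding eventually_at_right_field by blast
 obtain m i where "i <= 2 ^ m" "u < real i * (t / 2 ^ m)" "real i * (t / 2 ^ m) < min d b"
  by (rule dyadic_between[of t u "min d b"]) (use u d(1) in auto)
 then show ?thesis using d(2) by (intro that[of i m]) auto
qed

text \<open>A right-continuous step path is determined by its values on a dense set, so path events are countable intersections.\<close>

lemma step_path_constant:
 fixes c :: "real => 'n"
 assumes t: "0 < t" and rc: "\<And>u. 0 <= u ==> \<forall>\<^sub>F v in at_right u. c v = c u"
  and grid: "\<And>m i. i <= 2 ^ m ==> c (real i * (t / 2 ^ m)) = j" and u: "0 <= u" "u <= t"
 shows "c u = j"
proof (cases "u = t")
 case True
 then show ?thesis using grid[of 1 0] by simp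
next
 case False
 then obtain m i where "i <= 2 ^ m" "c (real i * (t / 2 ^ m)) = c u"
  using right_constant_grid_point[OF rc[OF u(1)] u(1), of t t] u by (metis less_le order_refl)
 then show ?thesis using grid by simp
qed

lemma step_path_one_jump:
 fixes c :: "real => 'n"
 assumes t: "0 < t" and jk: "j \<noteq> k" and rc: "\<And>u. 0 <= u ==> \<forall>\<^sub>F v in at_right u. c v = c u"
  and grid: "\<And>m. \<exists>i<2^m. (\<forall>l\<le>i. c (real l * (t / 2 ^ m)) = j) \<and> (\<forall>l. i < l \<and> l <= 2 ^ m \<longrightarrow> c (real l * (t / 2 ^ m)) = k)"
 obtains \<tau> where "0 < \<tau>" "\<tau> <= t" "\<And>u. 0 <= u ==> u < \<tau> ==> c u = j" "\<And>u. \<tau> <= u ==> u <= t ==> c u = k"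
proof -
 have gjk: "c (real l * (t / 2 ^ m)) \<in> {j, k}" if "l <= 2 ^ m" for l m
  using grid[of m] that by (metis insertCI not_le)
 have gmono: "c y = k" if x: "x = real a * (t / 2 ^ m)" "a <= 2 ^ m" and y: "y = real b * (t / 2 ^ n)" "b <= 2 ^ n"
  and xy: "x <= y" and cx: "c x = k" for x y a b m n
 proof -
  have x': "x = real (a * 2 ^ n) * (t / 2 ^ (m + n))" "a * 2 ^ n <= 2 ^ (m + n)" using x by (auto simp: power_add)
  have y': "y = real (b * 2 ^ m) * (t / 2 ^ (m + n))" "b * 2 ^ m <= 2 ^ (m + n)" using y by (auto simp: power_add)
  have "real (a * 2 ^ n) <= real (b * 2 ^ m)" using xy t unfolding x'(1) y'(1) by (subst (asm) mult_le_cancel_right_pos) auto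
  then have le: "a * 2 ^ n <= b * 2 ^ m" by linarith
  obtain i where i: "\<forall>l\<le>i. c (real l * (t / 2 ^ (m+n))) = j" "\<forall>l. i < l \<and> l <= 2 ^ (m+n) \<longrightarrow> c (real l * (t / 2 ^ (m+n))) = k"
   using grid[of "m + n"] by blast
  have "i < a * 2 ^ n" using i(1) cx jk x'(1) by (metis not_le)
  then have "i < b * 2 ^ m" using le by linarith
  then show ?thesis unfolding y'(1) using i(2) y'(2) by blast
 qed
 have ct: "c t = k" using grid[of 0] by auto
 have c0: "c 0 = j" using grid[of 0] by auto
 have cjk: "c u \<in> {j, k}" if h: "0 <= u" "u <= t" for u
 proof (cases "u = t")
  case False
  then obtain m i where "i <= 2 ^ m" "c (real i * (t / 2 ^ m)) = c u"
   using right_constant_grid_point[OF rc[OF h(1)] h(1), of t t] h by (metis less_le order_refl)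
  then show ?thesis using gjk by metis
 qed (use ct in simp)
 have mono: "c v = k" if h: "0 <= u" "u <= v" "v <= t" "c u = k" for u v
 proof (cases "u = v \<or> v = t")
  case False
  then have uv: "u < v" "v < t" using h by auto
  obtain m i where x: "i <= 2 ^ m" "real i * (t / 2 ^ m) < v" "c (real i * (t / 2 ^ m)) = c u"
   using right_constant_grid_point[OF rc[OF h(1)] h(1) uv(1) h(3)] by metis
  obtain n l where y: "l <= 2 ^ n" "v < real l * (t / 2 ^ n)" "c (real l * (t / 2 ^ n)) = c v"
   using right_constant_grid_point[OF rc _ uv(2), of t] h by (metis order_refl order_trans)
  have "c (real l * (t / 2 ^ n)) = k"
   by (rule gmono[OF refl x(1) refl y(1)]) (use x y h in auto)
  then show ?thesis using y(3) by simp
 qed (use h ct in auto)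
 define K where "K = {u. 0 <= u \<and> u <= t \<and> c u = k}"
 define \<tau> where "\<tau> = Inf K"
 have tK: "t \<in> K" using ct t by (simp add: K_def)
 have bdd: "bdd_below K" by (rule bdd_belowI[of _ 0]) (auto simp: K_def)
 have tau: "0 <= \<tau>" "\<tau> <= t" unfolding \<tau>_def using tK bdd by (auto intro!: cInf_greatest cInf_lower simp: K_def)
 have ck: "c \<tau> = k"
 proof (rule ccontr)
  assume nk: "c \<tau> \<noteq> k"
  obtain d where d: "\<tau> < d" "\<And>v. \<tau> < v ==> v < d ==> c v = c \<tau>"
   using rc[OF tau(1)] unfolding eventually_at_right_field by blast
  obtain v where v: "v \<in> K" "v < d" using cInf_lessD[of K d] tK d(1) unfolding \<tau>_def by auto
  have "\<tau> <= v" unfolding \<tau>_def by (rule cInf_lower[OF v(1) bdd])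
  moreover have "v \<noteq> \<tau>" using v(1) nk by (auto simp: K_def)
  ultimately have "c v = c \<tau>" using d(2) v by simp
  then show False using v nk by (simp add: K_def)
 qed
 show ?thesis
 proof (rule that[of \<tau>])
  have "\<tau> \<noteq> 0" using ck c0 jk by auto
  then show "0 < \<tau>" using tau by simp
  show "c u = j" if "0 <= u" "u < \<tau>" for u
  proof -
   have "c u \<noteq> k"
   proof
    assume "c u = k"
    then have "u \<in> K" using that tau by (simp add: K_def)
    then have "\<tau> <= u" unfolding \<tau>_def by (rule cInf_lower[OF _ bdd])
    then show False using that by simp
   qed
   then show ?thesis using cjk[of u] that tau by auto
  qed
  show "c u = k" if "\<tau> <= u" "u <= t" for u using mono[OF tau(1) that ck] .
 qed (rule tau)
qed

lemma jump_count_first_jump: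
 fixes c :: "real => 'n"
 assumes "0 < \<tau>" and j: "\<And>u. 0 <= u ==> u < \<tau> ==> c u = j" and k: "c \<tau> = k" and jk: "j \<noteq> k"
 shows "jump_count c \<tau> = 1"
proof -
 have at: "\<forall>\<^sub>F u in at_left v. c u = j" if "0 < v" "v <= \<tau>" for v
  unfolding eventually_at_left_field by (intro exI[of _ 0]) (use that j in auto)
 have "jumps_at c \<tau>"
  unfolding jumps_at_def
 proof (intro conjI notI assms(1))
  assume "\<forall>\<^sub>F u in at_left \<tau>. c u = c \<tau>"
  with at[OF assms(1) order_refl] have "\<forall>\<^sub>F u in at_left \<tau>. False"
   by eventually_elim (use k jk in auto)
  then show False by (simp add: trivial_limit_at_left_real)
 qed
 moreover have "\<not> jumps_at c v" if "v < \<tau>" for v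
  using at[of v] j[of v] that by (cases "0 < v") (auto simp: jumps_at_def)
 ultimately have "{v. v <= \<tau> \<and> jumps_at c v} = {\<tau>}" by (auto simp: order_le_less)
 then show ?thesis by (simp add: jump_count_def)
qed

section \<open>Independence, and the events of no jump and of one jump\<close>

context markov_modulated_levy
begin

section \<open>Independent noise sources\<close>

definition noiseM :: "'n => 'n noise_source => 'w measure" where
 "noiseM i s = sigma (space (P i)) (noise_sets (space (P i)) J L V s)"

lemma levyD:
 shows levy_measurable: "0 <= t ==> L j t \<in> borel_measurable (P i)"
  and levy_start: "AE w in P i. L j 0 w = 0"
  and levy_right: "AE w in P i. \<forall>t\<ge>0. ((%u. L j u w) \<longlongrightarrow> L j t w) (at_right t)"
  and levy_stationary: "0 <= s ==> 0 <= t ==> distr (P i) borel (%w. L j (s + t) w - L j s w) = distr (P i) borel (L j t)"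
  and levy_transform: "0 <= t ==> integrable (P i) (%w. exp (Re z * L j 1 w)) ==>
    (\<integral>w. exp (z * of_real (L j t w)) \<partial>P i) = exp (of_real t * levy_exponent (\<mu> j) (\<sigma> j) (\<nu> j) z)"
 using levy[of i j] unfolding levy_process_def by (auto elim!: AE_mp)

lemma noise_sets_events: "noise_sets (space (P i)) J L V s \<subseteq> sets (P i)"
proof -
 interpret prob_space "P i" by (rule prob_space_P)
 show ?thesis using independent[of i] unfolding indep_sets_def by auto
qed

lemma sets_noiseM: "sets (noiseM i s) = sigma_sets (space (P i)) (noise_sets (space (P i)) J L V s)"
 unfolding noiseM_def using noise_sets_events[of i s] sets.sets_into_space by (intro sets_measure_of) auto

lemma space_noiseM: "space (noiseM i s) = space (P i)"
 unfolding noiseM_def using noise_sets_events[of i s] sets.sets_into_space by (intro space_measure_of) auto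

lemma noise_events: "A \<in> sets (noiseM i s) ==> A \<in> sets (P i)"
 unfolding sets_noiseM using sets.sigma_sets_subset[OF noise_sets_events[of i s]] by auto

lemma noise_measurable: assumes f: "f \<in> measurable (noiseM i s) N" shows "f \<in> measurable (P i) N"
proof (rule measurableI)
 show "x \<in> space (P i) ==> f x \<in> space N" for x using measurable_space[OF f] by (simp add: space_noiseM)
 show "A \<in> sets N ==> f -` A \<inter> space (P i) \<in> sets (P i)" for A
  using noise_events[OF measurable_sets[OF f]] by (simp add: space_noiseM)
qed

lemma Int_stable_noise: "Int_stable (noise_sets (space (P i)) J L V s)"
proof -
 have *: "Int_stable (sigma_sets (space (P i)) G)" if "G \<subseteq> Pow (space (P i))" for G
 proof -
  interpret sigma_algebra "space (P i)" "sigma_sets (space (P i)) G" by (rule sigma_algebra_sigma_sets[OF that])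
  show ?thesis by (auto simp: Int_stable_def)
 qed
 show ?thesis
 proof (cases s)
  case (Jump j k n)
  have "(V j k n -` S \<inter> space (P i)) \<inter> (V j k n -` T \<inter> space (P i)) = V j k n -` (S \<inter> T) \<inter> space (P i)" for S T by auto
  then show ?thesis unfolding Jump Int_stable_def noise_sets.simps by (safe, metis sets.Int)
 qed (simp_all, (rule *, auto)+)
qed

text \<open>Each noise source is a sigma-algebra of its own; independence passes to any variables measurable with respect to them.\<close>

lemma indep_vars_noise:
 assumes Z: "\<And>s. s \<in> I ==> Z s \<in> borel_measurable (noiseM i s)"
 shows "prob_space.indep_vars (P i) (%_. borel) Z I"
proof -
 interpret prob_space "P i" by (rule prob_space_P)
 have "indep_sets (noise_sets (space (P i)) J L V) I"
  by (rule indep_sets_mono_index[OF _ independent]) simp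
 then have "indep_sets (%s. sigma_sets (space (P i)) (noise_sets (space (P i)) J L V s)) I"
  by (rule indep_sets_sigma) (rule Int_stable_noise)
 then have "indep_sets (%s. {Z s -` A \<inter> space (P i) | A. A \<in> sets borel}) I"
 proof (rule indep_sets_mono_sets)
  fix s assume "s \<in> I"
  show "{Z s -` A \<inter> space (P i) | A. A \<in> sets borel} \<subseteq> sigma_sets (space (P i)) (noise_sets (space (P i)) J L V s)"
   using measurable_sets[OF Z[OF \<open>s \<in> I\<close>]] by (auto simp: sets_noiseM space_noiseM)
 qed
 then show ?thesis
  unfolding indep_vars_def2 using noise_measurable[OF Z] by auto
qed

lemma J_noise: assumes "0 <= t" shows "J t \<in> measurable (noiseM i noise_source.Chain) (count_space UNIV)"
proof (rule measurableI)
 fix S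
 show "J t -` S \<inter> space (noiseM i noise_source.Chain) \<in> sets (noiseM i noise_source.Chain)"
  unfolding space_noiseM sets_noiseM using assms by (intro sigma_sets.Basic) (auto intro!: sigma_sets.Basic)
qed simp

lemma L_noise: assumes "0 <= t" shows "L j t \<in> borel_measurable (noiseM i (Levy j))"
proof (rule measurableI)
 fix S :: "real set" assume "S \<in> sets borel"
 then show "L j t -` S \<inter> space (noiseM i (Levy j)) \<in> sets (noiseM i (Levy j))"
  unfolding space_noiseM sets_noiseM using assms by (intro sigma_sets.Basic) (auto intro!: sigma_sets.Basic)
qed simp

lemma V_noise: "V j k n \<in> borel_measurable (noiseM i (Jump j k n))"
proof (rule measurableI)
 fix S :: "real set" assume "S \<in> sets borel"
 then show "V j k n -` S \<inter> space (noiseM i (Jump j k n)) \<in> sets (noiseM i (Jump j k n))"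
  unfolding space_noiseM sets_noiseM by (intro sigma_sets.Basic) auto
qed simp

lemma independent_product:
 fixes f g F :: "real => 'b::{real_normed_field, banach, second_countable_topology}"
 assumes jk: "j \<noteq> k" and E: "E \<in> sets (noiseM i noise_source.Chain)" and ab: "0 <= a" "0 <= b" "0 <= c"
  and m[measurable]: "f \<in> borel_measurable borel" "g \<in> borel_measurable borel" "F \<in> borel_measurable borel"
  and int: "integrable (P i) (%w. F (V j k n w))" "integrable (P i) (%w. f (L j a w))"
   "integrable (P i) (%w. g (L k c w - L k b w))"
 shows "integrable (P i) (%w. indicator E w * (F (V j k n w) * (f (L j a w) * g (L k c w - L k b w))))"
  "(\<integral>w. indicator E w * (F (V j k n w) * (f (L j a w) * g (L k c w - L k b w))) \<partial>P i) =
   of_real (measure (P i) E) * ((\<integral>w. F (V j k n w) \<partial>P i) * ((\<integral>w. f (L j a w) \<partial>P i) * (\<integral>w. g (L k c w - L k b w) \<partial>P i)))"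
proof -
 interpret prob_space "P i" by (rule prob_space_P)
 define I where "I = {noise_source.Chain, Levy j, Levy k, Jump j k n}"
 define Z :: "'n noise_source => 'w => 'b" where
  "Z = (%s w. case s of noise_source.Chain => indicator E w | Levy l => if l = j then f (L j a w) else g (L k c w - L k b w) | Jump _ _ _ => F (V j k n w))"
 note [measurable] = V_noise L_noise[OF ab(1)] L_noise[OF ab(2)] L_noise[OF ab(3)] E
 have m: "Z s \<in> borel_measurable (noiseM i s)" if "s \<in> I" for s
  using that jk unfolding I_def Z_def by auto
 have Ei: "E \<in> sets (P i)" by (rule noise_events[OF E])
 have Ebi: "has_bochner_integral (P i) (indicator E :: 'w => 'b) (of_real (measure (P i) E))"
 proof -
  have "has_bochner_integral (P i) (%x. indicator E x *\<^sub>R (1 :: 'b)) (measure (P i) E *\<^sub>R 1)"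
   using Ei by (intro has_bochner_integral_indicator) (auto simp: emeasure_eq_measure)
  moreover have "(%x. indicator E x *\<^sub>R (1 :: 'b)) = indicator E" by (auto simp: indicator_def)
  ultimately show ?thesis by (simp add: of_real_def)
 qed
 then have Eint: "integrable (P i) (indicator E :: 'w => 'b)" "(\<integral>w. indicator E w \<partial>P i) = (of_real (measure (P i) E) :: 'b)"
  by (auto simp: has_bochner_integral_iff)
 have i: "integrable (P i) (Z s)" if "s \<in> I" for s
  using that jk int Eint unfolding I_def Z_def by auto
 have fin: "finite I" by (simp add: I_def)
 note indep = indep_vars_noise[OF m]
 have "(\<Prod>s\<in>I. Z s w) = indicator E w * (F (V j k n w) * (f (L j a w) * g (L k c w - L k b w)))" for w
  unfolding I_def using jk by (simp add: Z_def ac_simps)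
 then show "integrable (P i) (%w. indicator E w * (F (V j k n w) * (f (L j a w) * g (L k c w - L k b w))))"
  "(\<integral>w. indicator E w * (F (V j k n w) * (f (L j a w) * g (L k c w - L k b w))) \<partial>P i) =
   of_real (measure (P i) E) * ((\<integral>w. F (V j k n w) \<partial>P i) * ((\<integral>w. f (L j a w) \<partial>P i) * (\<integral>w. g (L k c w - L k b w) \<partial>P i)))"
  using indep_vars_integrable[OF fin indep i] indep_vars_lebesgue_integral[OF fin indep i] Eint jk
  unfolding I_def by (simp_all add: Z_def ac_simps)
qed

section \<open>noise_source.Chain events on dyadic grids\<close>

text \<open>The chain sits at \<open>j\<close> at all dyadic times, which for step paths means at all times in \<open>[0, t]\<close>. As a
countable intersection the event is measurable.\<close>

definition no_jump :: "'n => 'n => real => 'w set" where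
 "no_jump i j t = {w \<in> space (P i). \<forall>m l. l <= 2 ^ m \<longrightarrow> J (real l * (t / 2 ^ m)) w = j}"

definition jump_cell :: "'n => 'n => 'n => real => nat => nat => 'w set" where
 "jump_cell i j k t m r = {w \<in> space (P i). \<forall>l\<le>2 ^ m. J (real l * (t / 2 ^ m)) w = (if l <= r then j else k)}"

definition jump_level :: "'n => 'n => 'n => real => nat => 'w set" where
 "jump_level i j k t m = (\<Union>r<2 ^ m. jump_cell i j k t m r)"

text \<open>At every dyadic resolution the chain is at \<open>j\<close> up to some grid point and at \<open>k\<close> afterwards.\<close>

definition one_jump :: "'n => 'n => 'n => real => 'w set" where
 "one_jump i j k t = (\<Inter>m. jump_level i j k t m)"

lemma grid_event:
 assumes t: "0 <= h" shows "{w \<in> space (P i). \<forall>l\<le>m. J (real l * h) w = a l} \<in> sets (noiseM i noise_source.Chain)"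
proof -
 have "{w \<in> space (P i). \<forall>l\<le>m. J (real l * h) w = a l} = (\<Inter>l\<in>{..m}. {w \<in> space (noiseM i noise_source.Chain). J (real l * h) w = a l})"
  by (auto simp: space_noiseM)
 also have "\<dots> \<in> sets (noiseM i noise_source.Chain)"
 proof (intro sets.finite_INT)
  fix l
  have [measurable]: "J (real l * h) \<in> measurable (noiseM i noise_source.Chain) (count_space UNIV)" using t by (intro J_noise) simp
  show "{w \<in> space (noiseM i noise_source.Chain). J (real l * h) w = a l} \<in> sets (noiseM i noise_source.Chain)" by measurable
 qed auto
 finally show ?thesis .
qed

lemma grid_event_prob:
 assumes h: "0 <= h"
 shows "measure (P i) {w \<in> space (P i). \<forall>l\<le>m. J (real l * h) w = a l} =
   (if a 0 = i then \<Prod>l<m. p h (a l) (a (Suc l)) else 0)"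
proof (induction m)
 case 0
 have "measure (P i) {w \<in> space (P i). \<forall>l\<le>0. J (real l * h) w = a l} = p 0 i (a 0)" by (simp add: p_def)
 then show ?case by (auto simp: p_zero)
next
 case (Suc m)
 interpret prob_space "P i" by (rule prob_space_P)
 let ?E = "%m. {w \<in> space (P i). \<forall>l\<le>m. J (real l * h) w = a l}"
 have Ef: "?E m \<in> sets (Fil (real m * h) i)"
 proof -
  have "?E m = (\<Inter>l\<in>{..m}. {w \<in> space (Fil (real m * h) i). J (real l * h) w = a l})" by (auto simp: space_Fil)
  also have "\<dots> \<in> sets (Fil (real m * h) i)"
  proof (intro sets.finite_INT)
   fix l assume "l \<in> {..m}"
   then have [measurable]: "J (real l * h) \<in> measurable (Fil (real m * h) i) (count_space UNIV)"
    using h by (intro J_Fil mult_right_mono) auto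
   show "{w \<in> space (Fil (real m * h) i). J (real l * h) w = a l} \<in> sets (Fil (real m * h) i)" by measurable
  qed auto
  finally show ?thesis .
 qed
 have Es: "?E n \<in> events" for n by (rule noise_events[OF grid_event[OF h]])
 have eq: "real m * h + h = real (Suc m) * h" by (simp add: algebra_simps)
 have "ennreal (prob (?E (Suc m))) = (\<integral>\<^sup>+w. indicator (?E m) w * (1 * indicator {a (Suc m)} (J (real m * h + h) w)) \<partial>P i)"
 proof -
  have Q: "(\<forall>l\<le>Suc m. Q l) \<longleftrightarrow> (\<forall>l\<le>m. Q l) \<and> Q (Suc m)" for Q by (auto simp: le_Suc_eq)
  have "ennreal (prob (?E (Suc m))) = (\<integral>\<^sup>+w. indicator (?E (Suc m)) w \<partial>P i)"
   unfolding emeasure_eq_measure[symmetric] by (rule nn_integral_indicator[OF Es, symmetric])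
  also have "\<dots> = (\<integral>\<^sup>+w. indicator (?E m) w * (1 * indicator {a (Suc m)} (J (real m * h + h) w)) \<partial>P i)"
   unfolding eq by (intro nn_integral_cong) (simp only: Q indicator_def, simp)
  finally show ?thesis .
 qed
 also have "\<dots> = (\<integral>\<^sup>+w. indicator (?E m) w * (\<integral>\<^sup>+w'. 1 * indicator {a (Suc m)} (J h w') \<partial>P (J (real m * h) w)) \<partial>P i)"
  by (rule markov_nn[where f = "%_. 1", OF h _ _ borel_measurable_indicator[OF Ef]]) (use h in auto)
 also have "\<dots> = (\<integral>\<^sup>+w. ennreal (p h (a m) (a (Suc m))) * indicator (?E m) w \<partial>P i)"
 proof (intro nn_integral_cong)
  fix w
  have "(\<integral>\<^sup>+w'. indicator {a (Suc m)} (J h w') \<partial>P (a m)) = ennreal (p h (a m) (a (Suc m)))"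
  proof -
   interpret A: prob_space "P (a m)" by (rule prob_space_P)
   have "(\<integral>\<^sup>+w'. indicator {a (Suc m)} (J h w') \<partial>P (a m)) = (\<integral>\<^sup>+w'. indicator {w \<in> space (P (a m)). J h w = a (Suc m)} w' \<partial>P (a m))"
    by (intro nn_integral_cong) (auto simp: indicator_def)
   also have "\<dots> = ennreal (p h (a m) (a (Suc m)))"
    unfolding p_def A.emeasure_eq_measure[symmetric] using h by (intro nn_integral_indicator J_event)
   finally show ?thesis .
  qed
  then show "indicator (?E m) w * (\<integral>\<^sup>+w'. 1 * indicator {a (Suc m)} (J h w') \<partial>P (J (real m * h) w)) =
    ennreal (p h (a m) (a (Suc m))) * indicator (?E m) w"
   by (auto simp: indicator_def)
 qed
 also have "\<dots> = ennreal (p h (a m) (a (Suc m)) * prob (?E m))"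
  by (subst nn_integral_cmult_indicator[OF Es]) (simp only: emeasure_eq_measure ennreal_mult[OF p_nonneg measure_nonneg])
 finally have "prob (?E (Suc m)) = p h (a m) (a (Suc m)) * prob (?E m)"
  by (simp add: p_nonneg)
 then show ?case using Suc by auto
qed

lemma no_jump_eq: "no_jump i j t = (\<Inter>m. {w \<in> space (P i). \<forall>l\<le>2 ^ m. J (real l * (t / 2 ^ m)) w = j})"
 by (auto simp: no_jump_def)

lemma no_jump_chain: "0 <= t ==> no_jump i j t \<in> sets (noiseM i noise_source.Chain)"
 unfolding no_jump_eq by (intro sets.countable_INT image_subsetI grid_event) auto

lemma jump_cell_chain: "0 <= t ==> jump_cell i j k t m r \<in> sets (noiseM i noise_source.Chain)"
 unfolding jump_cell_def by (rule grid_event) simp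

lemma jump_level_chain: "0 <= t ==> jump_level i j k t m \<in> sets (noiseM i noise_source.Chain)"
 unfolding jump_level_def by (intro sets.finite_UN jump_cell_chain) auto

lemma one_jump_chain: "0 <= t ==> one_jump i j k t \<in> sets (noiseM i noise_source.Chain)"
 unfolding one_jump_def using jump_level_chain by (intro sets.countable_INT) auto

lemma jump_cell_disjoint:
 assumes jk: "j \<noteq> k" and "w \<in> jump_cell i j k t m r" "w \<in> jump_cell i j k t m r'" "r < 2 ^ m" "r' < 2 ^ m"
 shows "r = r'"
proof (rule ccontr)
 have *: False if "w \<in> jump_cell i j k t m r" "w \<in> jump_cell i j k t m r'" "r < r'" "r' < 2 ^ m" for r r'
  using that jk unfolding jump_cell_def by (auto dest!: spec[of _ r'])
 assume "r \<noteq> r'"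
 then show False using *[of r r'] *[of r' r] assms by (cases "r < r'") auto
qed

lemma jump_level_Suc: "jump_level i j k t (Suc m) \<subseteq> jump_level i j k t m"
proof
 fix w assume "w \<in> jump_level i j k t (Suc m)"
 then obtain r where r: "r < 2 ^ Suc m" "w \<in> space (P i)"
  "\<And>l. l <= 2 ^ Suc m ==> J (real l * (t / 2 ^ Suc m)) w = (if l <= r then j else k)"
  by (auto simp: jump_level_def jump_cell_def)
 have "J (real l * (t / 2 ^ m)) w = (if l <= r div 2 then j else k)" if "l <= 2 ^ m" for l
 proof -
  have "real l * (t / 2 ^ m) = real (2 * l) * (t / 2 ^ Suc m)" by simp
  moreover have "2 * l <= r \<longleftrightarrow> l <= r div 2" by auto
  ultimately show ?thesis using r(3)[of "2 * l"] that by simp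
 qed
 then have "w \<in> jump_cell i j k t m (r div 2)" using r(2) by (auto simp: jump_cell_def)
 moreover have "r div 2 < 2 ^ m" using r(1) by auto
 ultimately show "w \<in> jump_level i j k t m" by (auto simp: jump_level_def)
qed

lemma jump_level_decseq: "decseq (jump_level i j k t)"
 by (rule decseq_SucI) (rule jump_level_Suc)

lemma no_jump_subset: "no_jump i j t \<subseteq> {\<omega> \<in> space (P i). J t \<omega> = j}"
proof
 fix \<omega> assume w: "\<omega> \<in> no_jump i j t"
 have "\<forall>m l. l <= 2 ^ m \<longrightarrow> J (real l * (t / 2 ^ m)) \<omega> = j"
  using w unfolding no_jump_def by blast
 from this[rule_format, of 1 0] have "J t \<omega> = j" by simp
 then show "\<omega> \<in> {\<omega> \<in> space (P i). J t \<omega> = j}" using w by (simp add: no_jump_def)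
qed

lemma one_jump_subset: "one_jump i j k t \<subseteq> {\<omega> \<in> space (P i). J t \<omega> = k}"
proof
 fix \<omega> assume "\<omega> \<in> one_jump i j k t"
 then have "\<omega> \<in> jump_level i j k t 0" unfolding one_jump_def by blast
 then have w: "\<omega> \<in> jump_cell i j k t 0 0" by (auto simp: jump_level_def)
 have "\<forall>l\<le>2 ^ 0. J (real l * (t / 2 ^ 0)) \<omega> = (if l <= 0 then j else k)"
  using w unfolding jump_cell_def by blast
 from this[rule_format, of 1] have "J t \<omega> = k" by simp
 then show "\<omega> \<in> {\<omega> \<in> space (P i). J t \<omega> = k}" using w by (simp add: jump_cell_def)
qed

lemma half_power_tendsto: "(%m. 1 / 2 ^ m :: real) \<longlonglongrightarrow> 0"
 using LIMSEQ_power_zero[of "1 / 2 :: real"] by (simp add: power_one_over)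

lemma no_jump_prob_ge: assumes t: "0 < t" shows "exp (t * G$j$j) <= measure (P j) (no_jump j j t)"
proof -
 interpret prob_space "P j" by (rule prob_space_P)
 let ?E = "%m. {\<omega> \<in> space (P j). \<forall>l\<le>2 ^ m. J (real l * (t / 2 ^ m)) \<omega> = j}"
 let ?q = "%m. p (t / 2 ^ m) j j"
 have dec: "decseq ?E"
 proof (rule decseq_SucI, rule subsetI)
  fix m \<omega> assume w: "\<omega> \<in> ?E (Suc m)"
  have "J (real l * (t / 2 ^ m)) \<omega> = j" if "l <= 2 ^ m" for l
  proof -
   have "real l * (t / 2 ^ m) = real (2 * l) * (t / 2 ^ Suc m)" by simp
   moreover have "2 * l <= 2 ^ Suc m" using that by simp
   ultimately show ?thesis using w by (metis (mono_tags, lifting) mem_Collect_eq)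
  qed
  then show "\<omega> \<in> ?E m" using w by auto
 qed
 have ev: "range ?E \<subseteq> events" using noise_events[OF grid_event[of "t / 2 ^ _" j "2 ^ _" "%_. j"]] t by auto
 have lim: "(%m. prob (?E m)) \<longlonglongrightarrow> prob (no_jump j j t)"
  unfolding no_jump_eq by (rule finite_Lim_measure_decseq[OF ev dec])
 have pr: "prob (?E m) = ?q m ^ 2 ^ m" for m
  using t by (subst grid_event_prob) auto
 have q0: "0 < ?q m" for m using t by (intro p_diag_pos) simp
 have d: "(%m. (?q m - 1) / (1 / 2 ^ m)) \<longlonglongrightarrow> t * G$j$j"
  using p_deriv[OF half_power_tendsto _ t, of j j] by simp
 have q1: "?q \<longlonglongrightarrow> 1"
 proof -
  have "(%m. (?q m - 1) / (1 / 2 ^ m) * (1 / 2 ^ m) + 1) \<longlonglongrightarrow> t * G$j$j * 0 + 1"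
   by (intro tendsto_intros d half_power_tendsto)
  then show ?thesis by simp
 qed
 have "(%m. exp ((?q m - 1) / (1 / 2 ^ m) / ?q m)) \<longlonglongrightarrow> exp (t * G$j$j / 1)"
  by (intro tendsto_intros d q1) simp
 moreover have "exp ((?q m - 1) / (1 / 2 ^ m) / ?q m) <= prob (?E m)" for m
 proof -
  have "ln (1 / ?q m) <= 1 / ?q m - 1" using q0[of m] by (intro ln_le_minus_one) simp
  then have "1 - 1 / ?q m <= ln (?q m)" using q0[of m] by (simp add: ln_div)
  then have "2 ^ m * (1 - 1 / ?q m) <= 2 ^ m * ln (?q m)" by (intro mult_left_mono) auto
  moreover have "(?q m - 1) / (1 / 2 ^ m) / ?q m = 2 ^ m * (1 - 1 / ?q m)" using q0[of m] by (simp add: field_simps)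
  ultimately have "exp ((?q m - 1) / (1 / 2 ^ m) / ?q m) <= exp (2 ^ m * ln (?q m))" by simp
  also have "\<dots> = ?q m ^ 2 ^ m" using q0[of m] exp_of_nat_mult[of "2 ^ m" "ln (?q m)"] by simp
  finally show ?thesis by (simp only: pr)
 qed
 ultimately show ?thesis using LIMSEQ_le[OF _ lim] by fastforce
qed

lemma jump_cell_prob: assumes t: "0 < t" and jk: "j \<noteq> k" and r: "r < 2 ^ m"
 shows "p (t / 2 ^ m) j k * (min (p (t / 2 ^ m) j j) (p (t / 2 ^ m) k k)) ^ 2 ^ m <= measure (P j) (jump_cell j j k t m r)"
proof -
 let ?h = "t / 2 ^ m" and ?N = "2 ^ m :: nat"
 let ?a = "%l. if l <= r then j else k"
 let ?q = "min (p ?h j j) (p ?h k k)"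
 have q: "0 <= ?q" "?q <= 1" using p_nonneg p_le_1 by (auto simp: min_def)
 have "measure (P j) (jump_cell j j k t m r) = (\<Prod>l<?N. p ?h (?a l) (?a (Suc l)))"
  unfolding jump_cell_def using t by (subst grid_event_prob) auto
 also have "\<dots> = p ?h j k * (\<Prod>l\<in>{..<?N} - {r}. p ?h (?a l) (?a (Suc l)))"
  using r by (subst prod.remove[of _ r]) auto
 also have "\<dots> \<ge> p ?h j k * (\<Prod>l\<in>{..<?N} - {r}. ?q)"
  using q by (intro mult_left_mono prod_mono conjI p_nonneg) auto
 also have "(\<Prod>l\<in>{..<?N} - {r}. ?q) = ?q ^ (?N - 1)" using r by simp
 also have "p ?h j k * ?q ^ (?N - 1) \<ge> p ?h j k * ?q ^ ?N"
  using q by (intro mult_left_mono power_decreasing p_nonneg) auto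
 finally show ?thesis .
qed

text \<open>Sum over the grid cell of the jump; each cell costs one transition and no jump elsewhere, and the mesh tends to zero.\<close>

lemma one_jump_prob_ge: assumes t: "0 < t" and jk: "j \<noteq> k"
 shows "t * G$j$k * (1 + t * min (G$j$j) (G$k$k)) <= measure (P j) (one_jump j j k t)"
proof -
 interpret prob_space "P j" by (rule prob_space_P)
 have ev: "range (jump_level j j k t) \<subseteq> events" using noise_events[OF jump_level_chain] t by auto
 have lim: "(%m. prob (jump_level j j k t m)) \<longlonglongrightarrow> prob (one_jump j j k t)"
  unfolding one_jump_def by (rule finite_Lim_measure_decseq[OF ev jump_level_decseq])
 let ?a = "%m. p (t / 2 ^ m) j k / (1 / 2 ^ m)"
 let ?d = "%m l. (p (t / 2 ^ m) l l - 1) / (1 / 2 ^ m)"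
 have da: "?a \<longlonglongrightarrow> t * G$j$k" using p_deriv[OF half_power_tendsto _ t, of j k] jk by simp
 have dd: "(%m. ?d m l) \<longlonglongrightarrow> t * G$l$l" for l
  using p_deriv[OF half_power_tendsto _ t, of l l] by simp
 have "(%m. ?a m * (1 + min (?d m j) (?d m k))) \<longlonglongrightarrow> t * G$j$k * (1 + min (t * G$j$j) (t * G$k$k))"
  by (intro tendsto_intros da tendsto_min dd)
 moreover have "?a m * (1 + min (?d m j) (?d m k)) <= prob (jump_level j j k t m)" for m
 proof -
  let ?q = "min (p (t / 2 ^ m) j j) (p (t / 2 ^ m) k k)"
  have q: "0 <= ?q" using p_nonneg by simp
  have "1 + real (2 ^ m) * (?q - 1) <= (1 + (?q - 1)) ^ 2 ^ m" using q by (intro Bernoulli_inequality) auto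
  moreover have "min (?d m j) (?d m k) = real (2 ^ m) * (?q - 1)" by (auto simp: min_def field_simps)
  ultimately have "?a m * (1 + min (?d m j) (?d m k)) <= ?a m * ?q ^ 2 ^ m"
   by (intro mult_left_mono divide_nonneg_nonneg p_nonneg) auto
  also have "\<dots> = (\<Sum>r<(2::nat) ^ m. p (t / 2 ^ m) j k * ?q ^ 2 ^ m)" by simp
  also have "\<dots> <= (\<Sum>r<(2::nat) ^ m. prob (jump_cell j j k t m r))"
   by (intro sum_mono jump_cell_prob[OF t jk]) auto
  also have "\<dots> = prob (jump_level j j k t m)"
   unfolding jump_level_def
   by (rule finite_measure_finite_Union[symmetric])
     (use noise_events[OF jump_cell_chain[OF less_imp_le[OF t]]] jump_cell_disjoint[OF jk] in \<open>auto simp: disjoint_family_on_def\<close>)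
  finally show ?thesis .
 qed
 ultimately have "t * G$j$k * (1 + min (t * G$j$j) (t * G$k$k)) <= prob (one_jump j j k t)"
  using LIMSEQ_le[OF _ lim] by fastforce
 then show ?thesis using t by (simp add: min_mult_distrib_left)
qed

end

section \<open>The position of the process on these events\<close>

lemma real_distribution_expI: "prob_space M ==> f \<in> borel_measurable M ==> real_distribution (distr M borel f)"
 by (simp add: prob_space.real_distribution_distr)

context markov_modulated_levy
begin

abbreviation psi :: "'n => complex => complex" where
 "psi j \<equiv> levy_exponent (\<mu> j) (\<sigma> j) (\<nu> j)"

abbreviation Ups :: "'n => 'n => complex => complex" where
 "Ups j k \<equiv> transition_jump_mgf (\<rho> j k) (U j k)"

section \<open>Pathwise description of the first jump\<close>

lemma right_constant_paths: "AE w in P i. \<forall>u\<ge>0. \<forall>\<^sub>F v in at_right u. J v w = J u w"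
 using step_paths[of i] by (auto elim!: AE_mp)

lemma no_jump_path: assumes t: "0 < t"
 shows "AE \<omega> in P j. \<omega> \<in> no_jump j j t \<longrightarrow> X t \<omega> = L j t \<omega>"
 using right_constant_paths[of j] evolution[of j] start_P[of j] levy_start[of j j]
proof eventually_elim
 case (elim \<omega>)
 show ?case
 proof
  assume w: "\<omega> \<in> no_jump j j t"
  have "J u \<omega> = j" if "0 <= u" "u <= t" for u
   by (rule step_path_constant[OF t _ _ that, where c = "%u. J u \<omega>"]) (use elim(1) w in \<open>auto simp: no_jump_def\<close>)
  then have "X t \<omega> - X 0 \<omega> = L j t \<omega> - L j 0 \<omega>"
   using elim(2)[rule_format, of 0 t j] t by auto
  then show "X t \<omega> = L j t \<omega>" using elim by simp
 qed
qed

definition before_jump :: "'n => 'n => real => nat => 'w => real" where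
 "before_jump j k t m w = (\<Sum>r<2 ^ m. indicator (jump_cell j j k t m r) w * L j (real r * (t / 2 ^ m)) w)"

definition after_jump :: "'n => 'n => real => nat => 'w => real" where
 "after_jump j k t m w = (\<Sum>r<2 ^ m. indicator (jump_cell j j k t m r) w * (L k t w - L k (real (Suc r) * (t / 2 ^ m)) w))"

lemma cell_sum:
 fixes f :: "nat => 'b::{semiring_1}"
 assumes jk: "j \<noteq> k" and r: "w \<in> jump_cell i j k t m r" "r < 2 ^ m"
 shows "(\<Sum>r<2 ^ m. indicator (jump_cell i j k t m r) w * f r) = f r"
proof -
 have "(\<Sum>r'<2 ^ m. indicator (jump_cell i j k t m r') w * f r') = (\<Sum>r'<2 ^ m. if r' = r then f r else 0)"
 proof (rule sum.cong[OF refl])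
  fix r' :: nat assume r': "r' \<in> {..<2 ^ m}"
  show "indicator (jump_cell i j k t m r') w * f r' = (if r' = r then f r else 0)"
  proof (cases "r' = r")
   case False
   then have "w \<notin> jump_cell i j k t m r'" using jump_cell_disjoint[OF jk r(1) _ r(2)] r' by blast
   then show ?thesis using False by simp
  qed (use r(1) in simp)
 qed
 then show ?thesis using r by simp
qed

text \<open>The grid approximations use the Levy processes only before and after the cell of the jump, which keeps them independent
given the cell; right-continuity and left limits give the position in the limit.\<close>

lemma one_jump_path:
 assumes t: "0 < t" and jk: "j \<noteq> k"
 shows "AE \<omega> in P j. \<omega> \<in> one_jump j j k t \<longrightarrow>
  (\<exists>u w. (%m. before_jump j k t m \<omega>) \<longlonglongrightarrow> u \<and> (%m. after_jump j k t m \<omega>) \<longlonglongrightarrow> w \<and> X t \<omega> = V j k 1 \<omega> + u + w)"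
 using right_constant_paths[of j] evolution[of j] start_P[of j] levy_start[of j j] levy_right[where i = j and j = k] jumps[of j]
proof eventually_elim
 case (elim \<omega>)
 define c where "c = (%u. J u \<omega>)"
 show ?case
 proof
  assume w: "\<omega> \<in> one_jump j j k t"
  have "\<forall>m. \<exists>r. r < 2 ^ m \<and> \<omega> \<in> jump_cell j j k t m r"
   using w by (auto simp: one_jump_def jump_level_def)
  then obtain r where r: "\<And>m. r m < 2 ^ m" "\<And>m. \<omega> \<in> jump_cell j j k t m (r m)" by metis
  have cell: "c (real l * (t / 2 ^ m)) = (if l <= r m then j else k)" if "l <= 2 ^ m" for l m
   using r(2)[of m] that unfolding jump_cell_def c_def by blast
  obtain \<tau> where \<tau>: "0 < \<tau>" "\<tau> <= t" "\<And>u. 0 <= u ==> u < \<tau> ==> c u = j" "\<And>u. \<tau> <= u ==> u <= t ==> c u = k"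
  proof (rule step_path_one_jump[OF t jk, of c])
   show "\<forall>\<^sub>F v in at_right u. c v = c u" if "0 <= u" for u using elim(1) that by (simp add: c_def)
   show "\<exists>i<2^m. (\<forall>l\<le>i. c (real l * (t / 2 ^ m)) = j) \<and> (\<forall>l. i < l \<and> l <= 2 ^ m \<longrightarrow> c (real l * (t / 2 ^ m)) = k)" for m
   proof (intro exI[of _ "r m"] conjI allI impI r(1))
    show "c (real l * (t / 2 ^ m)) = j" if "l <= r m" for l
     using cell[of l m] that r(1)[of m] by simp
    show "c (real l * (t / 2 ^ m)) = k" if "r m < l \<and> l <= 2 ^ m" for l
     using cell[of l m] that by simp
   qed
  qed blast
  define h where "h = (%m. t / 2 ^ m)"
  define a where "a = (%m. real (r m) * h m)"
  define b where "b = (%m. real (Suc (r m)) * h m)"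
  have h0: "0 < h m" for m using t by (simp add: h_def)
  have hlim: "h \<longlonglongrightarrow> 0"
   using tendsto_mult[OF tendsto_const half_power_tendsto, of t] by (simp add: h_def)
  have le_t: "real l * h m <= t" if "l <= 2 ^ m" for l m
  proof -
   have "real l <= 2 ^ m" using that by (metis of_nat_le_iff of_nat_numeral of_nat_power)
   then have "real l * h m <= 2 ^ m * h m" using h0[of m] by (intro mult_right_mono) auto
   then show ?thesis by (simp add: h_def)
  qed
  have ab: "b m = a m + h m" "0 <= a m" for m using h0[of m] by (auto simp: a_def b_def algebra_simps)
  have at: "a m < \<tau>" for m
  proof (rule ccontr)
   assume "\<not> a m < \<tau>"
   then have "c (a m) = k" using \<tau>(4) le_t[of "r m" m] r(1)[of m] by (simp add: a_def)
   moreover have "c (a m) = j" using cell[of "r m" m] r(1)[of m] by (simp add: a_def h_def)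
   ultimately show False using jk by simp
  qed
  have bt: "\<tau> <= b m" "b m <= t" for m
  proof -
   show "b m <= t" using le_t[of "Suc (r m)" m] r(1)[of m] by (simp add: b_def)
   show "\<tau> <= b m"
   proof (rule ccontr)
    assume "\<not> \<tau> <= b m"
    then have "c (b m) = j" using \<tau>(3)[of "b m"] ab[of m] h0[of m] by simp
    moreover have "c (b m) = k" using cell[of "Suc (r m)" m] r(1)[of m] by (simp add: b_def h_def)
    ultimately show False using jk by simp
   qed
  qed
  have alim: "a \<longlonglongrightarrow> \<tau>"
  proof (rule tendsto_sandwich[OF always_eventually always_eventually _ tendsto_const])
   show "\<forall>m. \<tau> - h m <= a m" using bt ab by (metis add.commute diff_le_eq)
   show "\<forall>m. a m <= \<tau>" using at by (simp add: less_imp_le)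
   show "(%m. \<tau> - h m) \<longlonglongrightarrow> \<tau>" using tendsto_diff[OF tendsto_const hlim, of \<tau>] by simp
  qed
  have blim: "b \<longlonglongrightarrow> \<tau>" using tendsto_add[OF alim hlim] by (simp add: ab(1)[abs_def])
  have aleft: "filterlim a (at_left \<tau>) sequentially"
   unfolding filterlim_at using alim at by (auto intro!: always_eventually)
  have jc: "jump_count c \<tau> = 1"
   by (rule jump_count_first_jump[OF \<tau>(1,3) _ jk]) (use \<tau> in auto)
  have "\<forall>\<^sub>F v in at_left \<tau>. c v = j"
   unfolding eventually_at_left_field by (intro exI[of _ 0]) (use \<tau> in auto)
  then have "((%v. X v \<omega>) \<longlongrightarrow> X \<tau> \<omega> - V j k (jump_count c \<tau>) \<omega>) (at_left \<tau>)"
   using elim(6)[rule_format, of \<tau> j k] \<tau> jk unfolding c_def by auto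
  then have Xl: "(%m. X (a m) \<omega>) \<longlonglongrightarrow> X \<tau> \<omega> - V j k 1 \<omega>"
   unfolding jc by (rule filterlim_compose[OF _ aleft])
  have Xa: "X (a m) \<omega> = L j (a m) \<omega>" for m
  proof -
   have "\<forall>u\<in>{0..a m}. J u \<omega> = j" using \<tau>(3) at[of m] by (auto simp: c_def)
   then have "X (a m) \<omega> - X 0 \<omega> = L j (a m) \<omega> - L j 0 \<omega>"
    using elim(2)[rule_format, of 0 "a m" j] ab(2)[of m] by auto
   then show ?thesis using elim by simp
  qed
  have "before_jump j k t m \<omega> = L j (a m) \<omega>" for m
   unfolding before_jump_def a_def h_def by (rule cell_sum[OF jk r(2) r(1)])
  then have l1: "(%m. before_jump j k t m \<omega>) \<longlonglongrightarrow> X \<tau> \<omega> - V j k 1 \<omega>" using Xl Xa by simp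
  have "continuous (at \<tau> within {\<tau>..}) (%u. L k u \<omega>)"
   using elim(5) \<tau>(1) by (simp add: continuous_within at_within_Ici_at_right)
  then have "(%m. L k (b m) \<omega>) \<longlonglongrightarrow> L k \<tau> \<omega>"
   by (rule continuous_within_tendsto_compose') (use bt blim in auto)
  moreover have "after_jump j k t m \<omega> = L k t \<omega> - L k (b m) \<omega>" for m
   unfolding after_jump_def b_def h_def by (rule cell_sum[OF jk r(2) r(1)])
  ultimately have l2: "(%m. after_jump j k t m \<omega>) \<longlonglongrightarrow> L k t \<omega> - L k \<tau> \<omega>"
   by (simp add: tendsto_diff)
  have "\<forall>u\<in>{\<tau>..t}. J u \<omega> = k" using \<tau>(4) by (auto simp: c_def)
  then have "X t \<omega> - X \<tau> \<omega> = L k t \<omega> - L k \<tau> \<omega>"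
   using elim(2)[rule_format, of \<tau> t k] \<tau> by auto
  then have "X t \<omega> = V j k 1 \<omega> + (X \<tau> \<omega> - V j k 1 \<omega>) + (L k t \<omega> - L k \<tau> \<omega>)" by simp
  with l1 l2 show "\<exists>u w. (%m. before_jump j k t m \<omega>) \<longlonglongrightarrow> u \<and> (%m. after_jump j k t m \<omega>) \<longlonglongrightarrow> w \<and> X t \<omega> = V j k 1 \<omega> + u + w"
   by blast
 qed
qed

lemma event_P:
 "0 <= t ==> no_jump i j t \<in> sets (P i)" "0 <= t ==> jump_cell i j k t m r \<in> sets (P i)"
 "0 <= t ==> jump_level i j k t m \<in> sets (P i)" "0 <= t ==> one_jump i j k t \<in> sets (P i)"
 by (auto intro!: noise_events no_jump_chain jump_cell_chain jump_level_chain one_jump_chain)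

section \<open>Exponential moments of the components\<close>

lemma levy_law: "distr (P i) borel (L j 1) = distr (P i') borel (L j 1)"
proof (rule Levy_uniqueness)
 have rd: "real_distribution (distr (P i) borel (L j 1))" for i
  by (rule real_distribution_expI[OF prob_space_P levy_measurable]) simp
 then show "real_distribution (distr (P i) borel (L j 1))" "real_distribution (distr (P i') borel (L j 1))" by auto
 have "char (distr (P i) borel (L j 1)) \<theta> = exp (psi j (\<i> * of_real \<theta>))" for i \<theta>
 proof -
  interpret prob_space "P i" by (rule prob_space_P)
  have "char (distr (P i) borel (L j 1)) \<theta> = (\<integral>w. exp (\<i> * of_real \<theta> * of_real (L j 1 w)) \<partial>P i)"
   unfolding char_def using levy_measurable[of 1 j i]
   by (subst integral_distr) (auto simp: mult.assoc)
  also have "\<dots> = exp (of_real 1 * psi j (\<i> * of_real \<theta>))"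
   by (rule levy_transform) auto
  finally show ?thesis by simp
 qed
 then show "char (distr (P i) borel (L j 1)) = char (distr (P i') borel (L j 1))" by (auto simp: fun_eq_iff)
qed

lemma levy_integrable_transfer:
 "integrable (P i) (%w. exp (s * L j 1 w)) \<longleftrightarrow> integrable (P i') (%w. exp (s * L j 1 w))"
proof -
 have "integrable (P i) (%w. exp (s * L j 1 w)) \<longleftrightarrow> integrable (distr (P i) borel (L j 1)) (%x. exp (s * x))" for i
  by (rule integrable_distr_eq[symmetric]) (use levy_measurable[of 1 j i] in auto)
 then show ?thesis using levy_law[of i j i'] by simp
qed

lemma levy_integrable: assumes e: "emgf s" shows "integrable (P i) (%w. exp (s * L j 1 w))"
proof -
 interpret prob_space "P j" by (rule prob_space_P)
 define E where "E = no_jump j j 1"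
 define I where "I = {noise_source.Chain, Levy j}"
 define Z :: "'n noise_source => 'w => ennreal" where
  "Z = (%s' w. case s' of noise_source.Chain => indicator E w | _ => ennreal (exp (s * L j 1 w)))"
 have Ec: "E \<in> sets (noiseM j noise_source.Chain)" unfolding E_def by (rule no_jump_chain) simp
 have Es: "E \<in> events" by (rule noise_events[OF Ec])
 note [measurable] = Ec L_noise[OF zero_le_one]
 have m: "Z s' \<in> borel_measurable (noiseM j s')" if "s' \<in> I" for s'
  using that unfolding I_def Z_def by auto
 have fin: "finite I" by (simp add: I_def)
 have "(\<integral>\<^sup>+w. indicator E w * ennreal (exp (s * L j 1 w)) \<partial>P j) = (\<integral>\<^sup>+w. (\<Prod>s'\<in>I. Z s' w) \<partial>P j)"
  unfolding I_def by (simp add: Z_def)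
 also have "\<dots> = (\<Prod>s'\<in>I. \<integral>\<^sup>+w. Z s' w \<partial>P j)"
  by (rule indep_vars_nn_integral[OF fin indep_vars_noise[OF m]]) auto
 also have "\<dots> = emeasure (P j) E * (\<integral>\<^sup>+w. ennreal (exp (s * L j 1 w)) \<partial>P j)"
  unfolding I_def using Es by (simp add: Z_def)
 finally have "emeasure (P j) E * (\<integral>\<^sup>+w. ennreal (exp (s * L j 1 w)) \<partial>P j) =
   (\<integral>\<^sup>+w. indicator E w * ennreal (exp (s * L j 1 w)) \<partial>P j)" by simp
 also have "\<dots> = (\<integral>\<^sup>+w. indicator E w * ennreal (exp (s * X 1 w)) \<partial>P j)"
  by (rule nn_integral_cong_AE, use no_jump_path[OF zero_less_one, of j] in eventually_elim) (auto simp: E_def indicator_def)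
 also have "\<dots> <= (\<integral>\<^sup>+w. ennreal (exp (s * X 1 w)) \<partial>P j)"
  by (intro nn_integral_mono) (auto simp: indicator_def)
 also have "\<dots> < \<infinity>" using e unfolding emgf_def integrable_iff_bounded by (auto simp: less_top)
 finally have fin: "emeasure (P j) E * (\<integral>\<^sup>+w. ennreal (exp (s * L j 1 w)) \<partial>P j) < \<infinity>" .
 have "0 < prob E" using no_jump_prob_ge[of 1 j] unfolding E_def by (smt (verit) exp_gt_zero)
 then have "(\<integral>\<^sup>+w. ennreal (exp (s * L j 1 w)) \<partial>P j) < \<infinity>"
  using fin by (auto simp: ennreal_mult_less_top emeasure_eq_measure)
 then have "integrable (P j) (%w. exp (s * L j 1 w))"
  using levy_measurable[of 1 j j] by (subst integrable_iff_bounded) auto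
 then show ?thesis by (subst levy_integrable_transfer[of _ _ _ j])
qed

lemma levy_exp_integrable:
 assumes e: "integrable (P i) (%w. exp (Re z * L j 1 w))" and t: "0 <= t"
 shows "integrable (P i) (%w. exp (z * of_real (L j t w)))"
proof (rule ccontr)
 assume "\<not> ?thesis"
 then have "(\<integral>w. exp (z * of_real (L j t w)) \<partial>P i) = 0" by (rule not_integrable_integral_eq)
 then show False using levy_transform[OF t e] by simp
qed

lemma levy_increment:
 assumes e: "integrable (P i) (%w. exp (Re z * L j 1 w))" and t: "0 <= b" "b <= t"
 shows "integrable (P i) (%w. exp (z * of_real (L j t w - L j b w)))"
  "(\<integral>w. exp (z * of_real (L j t w - L j b w)) \<partial>P i) = exp (of_real (t - b) * psi j z)"
proof -
 have d: "distr (P i) borel (%w. L j t w - L j b w) = distr (P i) borel (L j (t - b))"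
  using levy_stationary[of b "t - b" i j] t by simp
 note [measurable] = levy_measurable[of t j i] levy_measurable[of b j i] levy_measurable[of "t - b" j i]
 have m1: "(%w. L j t w - L j b w) \<in> borel_measurable (P i)" using t by simp
 have m2: "L j (t - b) \<in> borel_measurable (P i)" using t by simp
 have i1: "integrable (P i) (%w. exp (z * of_real (L j t w - L j b w))) \<longleftrightarrow>
   integrable (distr (P i) borel (%w. L j t w - L j b w)) (%x. exp (z * of_real x))"
  by (rule integrable_distr_eq[symmetric, OF m1]) simp
 have i2: "integrable (P i) (%w. exp (z * of_real (L j (t - b) w))) \<longleftrightarrow>
   integrable (distr (P i) borel (L j (t - b))) (%x. exp (z * of_real x))"
  by (rule integrable_distr_eq[symmetric, OF m2]) simp
 have i3: "integrable (P i) (%w. exp (z * of_real (L j (t - b) w)))"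
  by (rule levy_exp_integrable[OF e]) (use t in simp)
 show "integrable (P i) (%w. exp (z * of_real (L j t w - L j b w)))"
  unfolding i1 d using i2 i3 by simp
 have "(\<integral>w. exp (z * of_real (L j t w - L j b w)) \<partial>P i) = (\<integral>x. exp (z * of_real x) \<partial>distr (P i) borel (%w. L j t w - L j b w))"
  by (rule integral_distr[symmetric, OF m1]) simp
 also have "\<dots> = (\<integral>w. exp (z * of_real (L j (t - b) w)) \<partial>P i)"
  unfolding d by (rule integral_distr[OF m2]) simp
 also have "\<dots> = exp (of_real (t - b) * psi j z)" using levy_transform[OF _ e, of "t - b"] t by simp
 finally show "(\<integral>w. exp (z * of_real (L j t w - L j b w)) \<partial>P i) = exp (of_real (t - b) * psi j z)" .
qed

lemma V_integral:
 fixes f :: "real => 'b::{banach, second_countable_topology}"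
 assumes [measurable]: "f \<in> borel_measurable borel"
 shows "integrable (P i) (%w. f (V j k n w)) \<longleftrightarrow> integrable (transition_jump_law (\<rho> j k) (U j k)) f"
  "(\<integral>w. f (V j k n w) \<partial>P i) = (\<integral>x. f x \<partial>transition_jump_law (\<rho> j k) (U j k))"
 using integrable_distr_eq[OF measurable_V, of f i j k n] integral_distr[OF measurable_V, of f i j k n]
 by (auto simp: jump_law)

lemma no_jump_transform:
 assumes e: "emgf (Re z)" and t: "0 < t"
 shows "(\<integral>w. indicator (no_jump j j t) w * exp (z * of_real (X t w)) \<partial>P j)
  = of_real (measure (P j) (no_jump j j t)) * exp (of_real t * psi j z)"
proof -
 interpret prob_space "P j" by (rule prob_space_P)
 note li = levy_integrable[OF e, of j j]
 obtain k :: 'n where True by simp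
 define E where "E = no_jump j j t"
 define I where "I = {noise_source.Chain, Levy j}"
 define Z :: "'n noise_source => 'w => complex" where
  "Z = (%s' w. case s' of noise_source.Chain => indicator E w | _ => exp (z * of_real (L j t w)))"
 have Ec: "E \<in> sets (noiseM j noise_source.Chain)" unfolding E_def by (rule no_jump_chain) (use t in simp)
 have Es[measurable]: "E \<in> events" by (rule noise_events[OF Ec])
 note [measurable] = Ec L_noise[OF less_imp_le[OF t]]
 have m: "Z s' \<in> borel_measurable (noiseM j s')" if "s' \<in> I" for s'
  using that unfolding I_def Z_def by auto
 have ind: "integrable (P j) (indicator E :: 'w => complex)" "(\<integral>w. indicator E w \<partial>P j) = complex_of_real (prob E)"
 proof -
  show "integrable (P j) (indicator E :: 'w => complex)"
   by (rule integrable_const_bound[of _ 1]) (auto simp: indicator_def)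
  have "(\<integral>w. indicator E w \<partial>P j) = (\<integral>w. complex_of_real (indicator E w) \<partial>P j)"
   by (intro Bochner_Integration.integral_cong) (auto simp: indicator_def)
  also have "\<dots> = complex_of_real (prob E)" by (subst integral_complex_of_real) simp
  finally show "(\<integral>w. indicator E w \<partial>P j) = complex_of_real (prob E)" .
 qed
 have i: "integrable (P j) (Z s')" if "s' \<in> I" for s'
  using that ind levy_exp_integrable[OF li, of t] t unfolding I_def Z_def by auto
 have fin: "finite I" by (simp add: I_def)
 have "(\<integral>w. indicator E w * exp (z * of_real (X t w)) \<partial>P j) = (\<integral>w. indicator E w * exp (z * of_real (L j t w)) \<partial>P j)"
  using t levy_measurable[of t j j]
  by (intro integral_cong_AE, simp, simp, use no_jump_path[OF t, of j] in eventually_elim) (auto simp: E_def indicator_def)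
 also have "\<dots> = (\<integral>w. (\<Prod>s'\<in>I. Z s' w) \<partial>P j)"
  unfolding I_def by (simp add: Z_def)
 also have "\<dots> = (\<Prod>s'\<in>I. \<integral>w. Z s' w \<partial>P j)"
  by (rule indep_vars_lebesgue_integral[OF fin indep_vars_noise[OF m] i])
 also have "\<dots> = of_real (prob E) * exp (of_real t * psi j z)"
  unfolding I_def using ind levy_transform[OF less_imp_le[OF t] li] by (simp add: Z_def)
 finally show ?thesis by (simp add: E_def)
qed

lemma before_after_measurable:
 assumes t: "0 < t"
 shows "before_jump j k t m \<in> borel_measurable (P j)" "after_jump j k t m \<in> borel_measurable (P j)"
proof -
 have [measurable]: "jump_cell j j k t m r \<in> sets (P j)" for r by (rule event_P) (use t in simp)
 have [measurable]: "L l (real r * (t / 2 ^ m)) \<in> borel_measurable (P j)" "L l t \<in> borel_measurable (P j)" for l r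
  using t by (auto intro!: levy_measurable)
 show "before_jump j k t m \<in> borel_measurable (P j)" "after_jump j k t m \<in> borel_measurable (P j)"
  unfolding before_jump_def[abs_def] after_jump_def[abs_def] by measurable
qed

lemma level_indicator:
 fixes \<phi> :: "real => real => 'b::{semiring_1}"
 assumes jk: "j \<noteq> k"
 shows "indicator (jump_level j j k t m) w * \<phi> (before_jump j k t m w) (after_jump j k t m w) =
  (\<Sum>r<2 ^ m. indicator (jump_cell j j k t m r) w *
    \<phi> (L j (real r * (t / 2 ^ m)) w) (L k t w - L k (real (Suc r) * (t / 2 ^ m)) w))"
proof (cases "w \<in> jump_level j j k t m")
 case True
 then obtain r where r: "w \<in> jump_cell j j k t m r" "r < 2 ^ m" by (auto simp: jump_level_def)
 show ?thesis
  using True by (simp add: before_jump_def after_jump_def cell_sum[OF jk r] cell_sum[OF jk r, where f = "%r. \<phi> _ _"] cong del: sum.cong_simp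
   del: of_nat_Suc)
next
 case False
 then have "w \<notin> jump_cell j j k t m r" if "r < 2 ^ m" for r using that by (auto simp: jump_level_def)
 then show ?thesis using False by simp
qed

lemma level_product:
 fixes f g F :: "real => 'b::{real_normed_field, banach, second_countable_topology}"
 assumes jk: "j \<noteq> k" and t: "0 < t"
  and m: "f \<in> borel_measurable borel" "g \<in> borel_measurable borel" "F \<in> borel_measurable borel"
  and int: "integrable (P j) (%\<omega>. F (V j k 1 \<omega>))" "\<And>a. 0 <= a ==> a <= t ==> integrable (P j) (%\<omega>. f (L j a \<omega>))"
   "\<And>b. 0 <= b ==> b <= t ==> integrable (P j) (%\<omega>. g (L k t \<omega> - L k b \<omega>))"
 shows "integrable (P j) (%\<omega>. indicator (jump_level j j k t m) \<omega> * (F (V j k 1 \<omega>) * (f (before_jump j k t m \<omega>) * g (after_jump j k t m \<omega>))))"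
  "(\<integral>\<omega>. indicator (jump_level j j k t m) \<omega> * (F (V j k 1 \<omega>) * (f (before_jump j k t m \<omega>) * g (after_jump j k t m \<omega>))) \<partial>P j)
   = (\<integral>\<omega>. F (V j k 1 \<omega>) \<partial>P j) * (\<Sum>r<2 ^ m. of_real (measure (P j) (jump_cell j j k t m r)) *
    ((\<integral>\<omega>. f (L j (real r * (t / 2 ^ m)) \<omega>) \<partial>P j) * (\<integral>\<omega>. g (L k t \<omega> - L k (real (Suc r) * (t / 2 ^ m)) \<omega>) \<partial>P j)))"
proof -
 have le: "0 <= real l * (t / 2 ^ m)" "real l * (t / 2 ^ m) <= t" if "l <= 2 ^ m" for l
 proof -
  have "real l <= 2 ^ m" using that by (metis of_nat_le_iff of_nat_numeral of_nat_power)
  then have "real l * (t / 2 ^ m) <= 2 ^ m * (t / 2 ^ m)" using t by (intro mult_right_mono) auto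
  then show "real l * (t / 2 ^ m) <= t" by simp
 qed (use t in simp)
 have eq: "indicator (jump_level j j k t m) \<omega> * (F (V j k 1 \<omega>) * (f (before_jump j k t m \<omega>) * g (after_jump j k t m \<omega>)))
   = (\<Sum>r<2 ^ m. indicator (jump_cell j j k t m r) \<omega> * (F (V j k 1 \<omega>) *
    (f (L j (real r * (t / 2 ^ m)) \<omega>) * g (L k t \<omega> - L k (real (Suc r) * (t / 2 ^ m)) \<omega>))))" for \<omega>
  by (rule level_indicator[OF jk, where \<phi> = "%u w. F (V j k 1 \<omega>) * (f u * g w)"])
 have P: "integrable (P j) (%\<omega>. indicator (jump_cell j j k t m r) \<omega> * (F (V j k 1 \<omega>) *
    (f (L j (real r * (t / 2 ^ m)) \<omega>) * g (L k t \<omega> - L k (real (Suc r) * (t / 2 ^ m)) \<omega>))))"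
  "(\<integral>\<omega>. indicator (jump_cell j j k t m r) \<omega> * (F (V j k 1 \<omega>) *
    (f (L j (real r * (t / 2 ^ m)) \<omega>) * g (L k t \<omega> - L k (real (Suc r) * (t / 2 ^ m)) \<omega>))) \<partial>P j) =
   of_real (measure (P j) (jump_cell j j k t m r)) * ((\<integral>\<omega>. F (V j k 1 \<omega>) \<partial>P j) *
    ((\<integral>\<omega>. f (L j (real r * (t / 2 ^ m)) \<omega>) \<partial>P j) * (\<integral>\<omega>. g (L k t \<omega> - L k (real (Suc r) * (t / 2 ^ m)) \<omega>) \<partial>P j)))"
  if r: "r < 2 ^ m" for r
 proof -
  have r': "r <= 2 ^ m" "Suc r <= 2 ^ m" using r by auto
  note ip = independent_product[OF jk jump_cell_chain[OF less_imp_le[OF t]] le(1)[OF r'(1)] le(1)[OF r'(2)] less_imp_le[OF t] m int(1)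
   int(2)[OF le[OF r'(1)]] int(3)[OF le[OF r'(2)]]]
  show "integrable (P j) (%\<omega>. indicator (jump_cell j j k t m r) \<omega> * (F (V j k 1 \<omega>) *
    (f (L j (real r * (t / 2 ^ m)) \<omega>) * g (L k t \<omega> - L k (real (Suc r) * (t / 2 ^ m)) \<omega>))))" by (rule ip(1))
  show "(\<integral>\<omega>. indicator (jump_cell j j k t m r) \<omega> * (F (V j k 1 \<omega>) *
    (f (L j (real r * (t / 2 ^ m)) \<omega>) * g (L k t \<omega> - L k (real (Suc r) * (t / 2 ^ m)) \<omega>))) \<partial>P j) =
   of_real (measure (P j) (jump_cell j j k t m r)) * ((\<integral>\<omega>. F (V j k 1 \<omega>) \<partial>P j) *
    ((\<integral>\<omega>. f (L j (real r * (t / 2 ^ m)) \<omega>) \<partial>P j) * (\<integral>\<omega>. g (L k t \<omega> - L k (real (Suc r) * (t / 2 ^ m)) \<omega>) \<partial>P j)))" by (rule ip(2))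
 qed
 show "integrable (P j) (%\<omega>. indicator (jump_level j j k t m) \<omega> * (F (V j k 1 \<omega>) * (f (before_jump j k t m \<omega>) * g (after_jump j k t m \<omega>))))"
  unfolding eq by (rule Bochner_Integration.integrable_sum) (rule P(1), simp)
 show "(\<integral>\<omega>. indicator (jump_level j j k t m) \<omega> * (F (V j k 1 \<omega>) * (f (before_jump j k t m \<omega>) * g (after_jump j k t m \<omega>))) \<partial>P j)
   = (\<integral>\<omega>. F (V j k 1 \<omega>) \<partial>P j) * (\<Sum>r<2 ^ m. of_real (measure (P j) (jump_cell j j k t m r)) *
    ((\<integral>\<omega>. f (L j (real r * (t / 2 ^ m)) \<omega>) \<partial>P j) * (\<integral>\<omega>. g (L k t \<omega> - L k (real (Suc r) * (t / 2 ^ m)) \<omega>) \<partial>P j)))"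
  unfolding eq
  by (subst Bochner_Integration.integral_sum, rule P(1), simp)
    (unfold sum_distrib_left, intro sum.cong refl, subst P(2), simp, simp only: mult.left_commute)
qed

end

section \<open>Exponential moments on the one-jump event\<close>

context markov_modulated_levy
begin

section \<open>The generator of the transform semigroup\<close>

lemma before_after_limits:
 assumes t: "0 < t" and jk: "j \<noteq> k"
 shows "AE \<omega> in P j. (\<omega> \<in> one_jump j j k t \<longrightarrow> (\<forall>\<^sub>F m in sequentially. \<omega> \<in> jump_level j j k t m) \<and>
   (%m. V j k 1 \<omega> + before_jump j k t m \<omega> + after_jump j k t m \<omega>) \<longlonglongrightarrow> X t \<omega>) \<and>
   (\<omega> \<notin> one_jump j j k t \<longrightarrow> (\<forall>\<^sub>F m in sequentially. \<omega> \<notin> jump_level j j k t m))"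
 using one_jump_path[OF t jk]
proof eventually_elim
 case (elim \<omega>)
 show ?case
 proof (intro conjI impI)
  assume w: "\<omega> \<in> one_jump j j k t"
  then have "\<omega> \<in> jump_level j j k t m" for m by (auto simp: one_jump_def)
  then show "\<forall>\<^sub>F m in sequentially. \<omega> \<in> jump_level j j k t m" by simp
  obtain u v where uv: "(%m. before_jump j k t m \<omega>) \<longlonglongrightarrow> u" "(%m. after_jump j k t m \<omega>) \<longlonglongrightarrow> v" "X t \<omega> = V j k 1 \<omega> + u + v"
   using elim w by blast
  then show "(%m. V j k 1 \<omega> + before_jump j k t m \<omega> + after_jump j k t m \<omega>) \<longlonglongrightarrow> X t \<omega>"
   using tendsto_add[OF tendsto_add[OF tendsto_const uv(1), of "V j k 1 \<omega>"] uv(2)] by (simp only: uv(3))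
 next
  assume "\<omega> \<notin> one_jump j j k t"
  then obtain n where n: "\<omega> \<notin> jump_level j j k t n" by (auto simp: one_jump_def)
  have "\<omega> \<notin> jump_level j j k t m" if "n <= m" for m
   using decseqD[OF jump_level_decseq that, of j j k t] n by blast
  then show "\<forall>\<^sub>F m in sequentially. \<omega> \<notin> jump_level j j k t m"
   unfolding eventually_sequentially by blast
 qed
qed

text \<open>The jump is visible in \<open>X_t\<close> on an event of positive probability, on which it is independent of the rest. The Levy factors
have positive exponential moments, so an infinite moment of the jump would make that of \<open>X_t\<close> infinite.\<close>

lemma jump_exp_integrable:
 assumes e: "emgf s" and s: "0 <= s" and jk: "j \<noteq> k" and G: "0 < G$j$k"
 shows "integrable (P i) (%\<omega>. exp (s * V j k n \<omega>))"
proof -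
 interpret prob_space "P j" by (rule prob_space_P)
 define mi where "mi = \<bar>min (G$j$j) (G$k$k)\<bar>"
 define t where "t = 1 / (2 * (1 + mi))"
 have mi: "0 <= mi" by (simp add: mi_def)
 have t: "0 < t" using mi by (simp add: t_def)
 have "- (1/2) <= t * min (G$j$j) (G$k$k)"
 proof -
  have "t * mi <= 1 / 2" using mi by (simp add: t_def field_simps)
  moreover have "- (t * mi) <= t * min (G$j$j) (G$k$k)"
   using t unfolding mi_def by (metis abs_ge_minus_self abs_minus_cancel abs_of_pos abs_mult minus_le_iff)
  ultimately show ?thesis by linarith
 qed
 then have "0 < t * G$j$k * (1 + t * min (G$j$j) (G$k$k))" using t G by (intro mult_pos_pos) auto
 then have pos: "0 < prob (one_jump j j k t)" using one_jump_prob_ge[OF t jk] by linarith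
 have int: "integrable (P j) (%\<omega>. exp (s * X t \<omega>))" using emgft_all[OF e, of t] t by (simp add: emgft_def)
 define c where "c = (%x. min 1 (exp (s * x)))"
 have c: "0 < c x" "c x <= 1" "c x <= exp (s * x)" for x by (auto simp: c_def)
 have [measurable]: "c \<in> borel_measurable borel" unfolding c_def by measurable
 have cc: "continuous_on UNIV c" unfolding c_def by (intro continuous_intros)
 define lu where "lu = (%\<omega>. lim (%m. before_jump j k t m \<omega>))"
 define lw where "lw = (%\<omega>. lim (%m. after_jump j k t m \<omega>))"
 note [measurable] = before_after_measurable[OF t, of j k] event_P(3)[OF less_imp_le[OF t], of j j k] event_P(4)[OF less_imp_le[OF t], of j j k]
  measurable_X[OF less_imp_le[OF t], of j] measurable_V[of j k 1 j] measurable_V[of j k "Suc 0" j]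
 have lm[measurable]: "lu \<in> borel_measurable (P j)" "lw \<in> borel_measurable (P j)"
  unfolding lu_def lw_def by measurable
 have path: "AE \<omega> in P j. \<omega> \<in> one_jump j j k t \<longrightarrow> (%m. before_jump j k t m \<omega>) \<longlonglongrightarrow> lu \<omega> \<and>
   (%m. after_jump j k t m \<omega>) \<longlonglongrightarrow> lw \<omega> \<and> X t \<omega> = V j k 1 \<omega> + lu \<omega> + lw \<omega>"
  using one_jump_path[OF t jk] unfolding lu_def lw_def by eventually_elim (auto simp: limI)
 define \<gamma> where "\<gamma> = (\<integral>\<omega>. indicator (one_jump j j k t) \<omega> * (c (lu \<omega>) * c (lw \<omega>)) \<partial>P j)"
 have ig: "integrable (P j) (%\<omega>. indicator (one_jump j j k t) \<omega> * (c (lu \<omega>) * c (lw \<omega>)))"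
  by (rule integrable_const_bound[of _ 1]) (auto simp: indicator_def abs_mult less_imp_le[OF c(1)] intro!: mult_le_one c(2))
 have g: "0 < \<gamma>"
 proof -
  have nn: "AE \<omega> in P j. 0 <= indicator (one_jump j j k t) \<omega> * (c (lu \<omega>) * c (lw \<omega>))"
   by (auto simp: less_imp_le[OF c(1)])
  have "\<gamma> \<noteq> 0"
  proof
   assume "\<gamma> = 0"
   then have "AE \<omega> in P j. indicator (one_jump j j k t) \<omega> * (c (lu \<omega>) * c (lw \<omega>)) = 0"
    unfolding \<gamma>_def using integral_nonneg_eq_0_iff_AE[OF ig nn] by simp
   then have "AE \<omega> in P j. \<omega> \<notin> one_jump j j k t"
    by eventually_elim (use c(1) in \<open>auto simp: indicator_def less_imp_neq[symmetric] split: if_splits\<close>)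
   then have "prob (one_jump j j k t) = 0" by (subst prob_eq_0) auto
   then show False using pos by simp
  qed
  moreover have "0 <= \<gamma>" unfolding \<gamma>_def by (rule integral_nonneg_AE[OF nn])
  ultimately show ?thesis by simp
 qed
 define K where "K = (\<integral>\<omega>. exp (s * X t \<omega>) \<partial>P j)"
 have bM: "(\<integral>\<omega>. min (real N) (exp (s * V j k 1 \<omega>)) \<partial>P j) <= K / \<gamma>" for N
 proof -
  let ?F = "%x. min (real N) (exp (s * x))"
  have F: "0 <= ?F x" "?F x <= real N" for x by auto
  have [measurable]: "?F \<in> borel_measurable borel" by measurable
  have Fc: "integrable (P j) (%\<omega>. F' (V j k 1 \<omega>))" if "\<And>x. 0 <= F' x" "\<And>x. F' x <= B" "F' \<in> borel_measurable borel" for F' :: "real => real" and B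
   by (rule integrable_const_bound[of _ B]) (use that measurable_V[of j k 1 j] in auto)
  have lev: "integrable (P j) (%\<omega>. c (L l a \<omega>))" "integrable (P j) (%\<omega>. c (L l t \<omega> - L l a \<omega>))" if "0 <= a" for l a
   by (rule integrable_const_bound[of _ 1]; use that t levy_measurable[of a l j] levy_measurable[of t l j] c in \<open>auto simp: less_imp_le\<close>)+
  have m: "c \<in> borel_measurable borel" "?F \<in> borel_measurable borel" "(%x. 1::real) \<in> borel_measurable borel" by measurable
  have p1: "(\<integral>\<omega>. indicator (jump_level j j k t m) \<omega> * (?F (V j k 1 \<omega>) * (c (before_jump j k t m \<omega>) * c (after_jump j k t m \<omega>))) \<partial>P j)
   = (\<integral>\<omega>. ?F (V j k 1 \<omega>) \<partial>P j) *
    (\<integral>\<omega>. indicator (jump_level j j k t m) \<omega> * (c (before_jump j k t m \<omega>) * c (after_jump j k t m \<omega>)) \<partial>P j)" for m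
   using level_product(2)[OF jk t m(1,1,2) Fc[OF F m(2)] lev(1) lev(2), of m]
    level_product(2)[OF jk t m(1,1,3) _ lev(1) lev(2), of m]
   by (simp add: prob_space)
  have conv: "AE \<omega> in P j. (%m. indicator (jump_level j j k t m) \<omega> * (q \<omega> * (c (before_jump j k t m \<omega>) * c (after_jump j k t m \<omega>))))
    \<longlonglongrightarrow> indicator (one_jump j j k t) \<omega> * (q \<omega> * (c (lu \<omega>) * c (lw \<omega>)))" for q :: "'w => real"
   using before_after_limits[OF t jk] path
  proof eventually_elim
   case (elim \<omega>)
   show ?case
   proof (cases "\<omega> \<in> one_jump j j k t")
    case True
    then have l: "(%m. before_jump j k t m \<omega>) \<longlonglongrightarrow> lu \<omega>" "(%m. after_jump j k t m \<omega>) \<longlonglongrightarrow> lw \<omega>" using elim by auto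
    have "(%m. q \<omega> * (c (before_jump j k t m \<omega>) * c (after_jump j k t m \<omega>))) \<longlonglongrightarrow> q \<omega> * (c (lu \<omega>) * c (lw \<omega>))"
     by (intro tendsto_intros continuous_on_tendsto_compose[OF cc] l) auto
    moreover have "\<omega> \<in> jump_level j j k t m" for m using True by (auto simp: one_jump_def)
    ultimately show ?thesis using True by simp
   next
    case False
    then have "\<forall>\<^sub>F m in sequentially. indicator (jump_level j j k t m) \<omega> * (q \<omega> * (c (before_jump j k t m \<omega>) * c (after_jump j k t m \<omega>))) = 0"
     using elim by (auto elim!: eventually_mono)
    then show ?thesis using False by (auto intro: tendsto_eventually)
   qed
  qed
  have l1: "(%m. \<integral>\<omega>. indicator (jump_level j j k t m) \<omega> * (?F (V j k 1 \<omega>) * (c (before_jump j k t m \<omega>) * c (after_jump j k t m \<omega>))) \<partial>P j)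
    \<longlonglongrightarrow> (\<integral>\<omega>. indicator (one_jump j j k t) \<omega> * (?F (V j k 1 \<omega>) * (c (lu \<omega>) * c (lw \<omega>))) \<partial>P j)"
  proof (rule integral_dominated_convergence[where w = "%_. real N"])
   show "AE \<omega> in P j. norm (indicator (jump_level j j k t m) \<omega> * (?F (V j k 1 \<omega>) * (c (before_jump j k t m \<omega>) * c (after_jump j k t m \<omega>)))) <= real N" for m
   proof (rule AE_I2)
    fix \<omega>
    have "?F (V j k 1 \<omega>) * (c (before_jump j k t m \<omega>) * c (after_jump j k t m \<omega>)) <= real N * (1 * 1)"
     by (intro mult_mono c F mult_nonneg_nonneg less_imp_le[OF c(1)]) auto
    moreover have "0 <= ?F (V j k 1 \<omega>) * (c (before_jump j k t m \<omega>) * c (after_jump j k t m \<omega>))"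
     by (intro mult_nonneg_nonneg F less_imp_le[OF c(1)])
    ultimately show "norm (indicator (jump_level j j k t m) \<omega> * (?F (V j k 1 \<omega>) * (c (before_jump j k t m \<omega>) * c (after_jump j k t m \<omega>)))) <= real N"
     by (simp add: indicator_def)
   qed
  qed (use conv[of "%\<omega>. ?F (V j k 1 \<omega>)"] in auto)
  have l2: "(%m. \<integral>\<omega>. indicator (jump_level j j k t m) \<omega> * (c (before_jump j k t m \<omega>) * c (after_jump j k t m \<omega>)) \<partial>P j) \<longlonglongrightarrow> \<gamma>"
   unfolding \<gamma>_def
  proof (rule integral_dominated_convergence[where w = "%_. 1"])
   show "AE \<omega> in P j. norm (indicator (jump_level j j k t m) \<omega> * (c (before_jump j k t m \<omega>) * c (after_jump j k t m \<omega>))) <= 1" for m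
    by (auto simp: indicator_def abs_mult less_imp_le[OF c(1)] intro!: mult_le_one c(2))
  qed (use conv[of "%\<omega>. 1"] in auto)
  have "(\<integral>\<omega>. ?F (V j k 1 \<omega>) \<partial>P j) * \<gamma> = (\<integral>\<omega>. indicator (one_jump j j k t) \<omega> * (?F (V j k 1 \<omega>) * (c (lu \<omega>) * c (lw \<omega>))) \<partial>P j)"
   using LIMSEQ_unique[OF tendsto_mult[OF tendsto_const l2] l1[unfolded p1]] .
  also have "\<dots> <= K"
   unfolding K_def
  proof (rule integral_mono_AE')
   show "AE \<omega> in P j. indicator (one_jump j j k t) \<omega> * (?F (V j k 1 \<omega>) * (c (lu \<omega>) * c (lw \<omega>))) <= exp (s * X t \<omega>)"
    using path
   proof eventually_elim
    case (elim \<omega>)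
    show ?case
    proof (cases "\<omega> \<in> one_jump j j k t")
     case True
     then have x: "X t \<omega> = V j k 1 \<omega> + lu \<omega> + lw \<omega>" using elim by simp
     have "?F (V j k 1 \<omega>) * (c (lu \<omega>) * c (lw \<omega>)) <= exp (s * V j k 1 \<omega>) * (exp (s * lu \<omega>) * exp (s * lw \<omega>))"
      by (intro mult_mono c mult_nonneg_nonneg less_imp_le[OF c(1)]) auto
     also have "\<dots> = exp (s * X t \<omega>)" unfolding x by (simp add: algebra_simps flip: exp_add)
     finally show ?thesis using True by simp
    qed simp
   qed
   show "AE \<omega> in P j. 0 <= exp (s * X t \<omega>)" by simp
  qed (rule int)
  finally show ?thesis using g by (simp add: field_simps)
 qed
 have "integrable (P j) (%\<omega>. exp (s * V j k 1 \<omega>))"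
 proof (rule integrable_of_bounded_nonneg_limit(1)[OF _ _ _ _ bM])
  show "integrable (P j) (%\<omega>. min (real N) (exp (s * V j k 1 \<omega>)))" for N
   by (rule integrable_const_bound[of _ "real N"]) auto
  have "(%N. min (real N) x) \<longlonglongrightarrow> x" for x :: real
  proof (rule tendsto_eventually)
   obtain N where "x <= real N" using real_arch_simple by blast
   then show "\<forall>\<^sub>F N in sequentially. min (real N) x = x"
    unfolding eventually_sequentially by (intro exI[of _ N]) (auto simp: min_def)
  qed
  then show "AE \<omega> in P j. (%N. min (real N) (exp (s * V j k 1 \<omega>))) \<longlonglongrightarrow> exp (s * V j k 1 \<omega>)" by simp
 qed auto
 then show ?thesis using V_integral(1)[of "%x. exp (s * x)"] by simp
qed

lemma level_transform:
 assumes e: "emgf (Re z)" and z: "0 <= Re z" and t: "0 < t" and jk: "j \<noteq> k" and G: "0 < G$j$k"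
 shows "integrable (P j) (%w. indicator (jump_level j j k t m) w * exp (z * of_real (V j k 1 w + before_jump j k t m w + after_jump j k t m w)))"
  "(\<integral>w. indicator (jump_level j j k t m) w * exp (z * of_real (V j k 1 w + before_jump j k t m w + after_jump j k t m w)) \<partial>P j)
   = Ups j k z * (\<Sum>r<2 ^ m. of_real (measure (P j) (jump_cell j j k t m r)) *
     exp (of_real (real r * (t / 2 ^ m)) * psi j z + of_real (t - real (Suc r) * (t / 2 ^ m)) * psi k z))"
proof -
 have Vi: "integrable (P j) (%w. exp (z * of_real (V j k 1 w)))"
  by (rule Bochner_Integration.integrable_bound[OF jump_exp_integrable[OF e z jk G, of j 1]])
    (use measurable_V[of j k 1 j] in auto)
 have le: "0 <= real l * (t / 2 ^ m)" "real l * (t / 2 ^ m) <= t" if "l <= 2 ^ m" for l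
 proof -
  have "real l <= 2 ^ m" using that by (metis of_nat_le_iff of_nat_numeral of_nat_power)
  then have "real l * (t / 2 ^ m) <= 2 ^ m * (t / 2 ^ m)" using t by (intro mult_right_mono) auto
  then show "real l * (t / 2 ^ m) <= t" by simp
 qed (use t in simp)
 have eq: "indicator (jump_level j j k t m) w * (exp (z * of_real (V j k 1 w)) * (exp (z * of_real (before_jump j k t m w)) * exp (z * of_real (after_jump j k t m w))))
  = indicator (jump_level j j k t m) w * exp (z * of_real (V j k 1 w + before_jump j k t m w + after_jump j k t m w))" for w
  by (simp add: algebra_simps flip: exp_add)
 have mm: "(%x. exp (z * complex_of_real x)) \<in> borel_measurable borel" by measurable
 note li = levy_integrable[OF e]
 have Li: "integrable (P j) (%w. exp (z * of_real (L j a w)))" if "0 <= a" "a <= t" for a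
  by (rule levy_exp_integrable[OF li that(1)])
 have Ii: "integrable (P j) (%w. exp (z * of_real (L k t w - L k b w)))" if "0 <= b" "b <= t" for b
  by (rule levy_increment(1)[OF li that])
 note lp = level_product[OF jk t mm mm mm Vi Li Ii, of m, unfolded eq]
 show "integrable (P j) (%w. indicator (jump_level j j k t m) w * exp (z * of_real (V j k 1 w + before_jump j k t m w + after_jump j k t m w)))"
  by (rule lp(1))
 show "(\<integral>w. indicator (jump_level j j k t m) w * exp (z * of_real (V j k 1 w + before_jump j k t m w + after_jump j k t m w)) \<partial>P j)
   = Ups j k z * (\<Sum>r<2 ^ m. of_real (measure (P j) (jump_cell j j k t m r)) *
     exp (of_real (real r * (t / 2 ^ m)) * psi j z + of_real (t - real (Suc r) * (t / 2 ^ m)) * psi k z))"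
  unfolding eq[symmetric]
 proof (rule trans[OF level_product(2)[OF jk t mm mm mm Vi Li Ii]], assumption, assumption, assumption, assumption,
   rule arg_cong2[where f = "(*)"])
  show "(\<integral>w. exp (z * of_real (V j k 1 w)) \<partial>P j) = Ups j k z"
   unfolding transition_jump_mgf_def by (rule V_integral(2)[OF mm])
  show "(\<Sum>r<2 ^ m. of_real (measure (P j) (jump_cell j j k t m r)) *
    ((\<integral>w. exp (z * of_real (L j (real r * (t / 2 ^ m)) w)) \<partial>P j) * (\<integral>w. exp (z * of_real (L k t w - L k (real (Suc r) * (t / 2 ^ m)) w)) \<partial>P j)))
   = (\<Sum>r<2 ^ m. of_real (measure (P j) (jump_cell j j k t m r)) *
     exp (of_real (real r * (t / 2 ^ m)) * psi j z + of_real (t - real (Suc r) * (t / 2 ^ m)) * psi k z))"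
  proof (rule sum.cong[OF refl])
   fix r :: nat assume "r \<in> {..<2 ^ m}"
   then have r: "r <= 2 ^ m" "Suc r <= 2 ^ m" by auto
   show "of_real (measure (P j) (jump_cell j j k t m r)) *
    ((\<integral>w. exp (z * of_real (L j (real r * (t / 2 ^ m)) w)) \<partial>P j) * (\<integral>w. exp (z * of_real (L k t w - L k (real (Suc r) * (t / 2 ^ m)) w)) \<partial>P j))
    = of_real (measure (P j) (jump_cell j j k t m r)) *
     exp (of_real (real r * (t / 2 ^ m)) * psi j z + of_real (t - real (Suc r) * (t / 2 ^ m)) * psi k z)"
    unfolding levy_transform[OF le(1)[OF r(1)] li] levy_increment(2)[OF li le[OF r(2)]] exp_add ..
  qed
 qed
qed

text \<open>The factors \<open>exp (a \<psi>_j + b \<psi>_k)\<close> with \<open>a + b \<le> t\<close> differ from \<open>1\<close> by at most the last factor of the bound.\<close>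

lemma one_jump_transform:
 assumes e: "emgf s" and z: "0 <= Re z" "Re z < s" and t: "0 < t" and jk: "j \<noteq> k" and G: "0 < G$j$k"
 shows "norm ((\<integral>w. indicator (one_jump j j k t) w * exp (z * of_real (X t w)) \<partial>P j) - Ups j k z * of_real (measure (P j) (one_jump j j k t)))
  <= norm (Ups j k z) * measure (P j) (one_jump j j k t) * (exp (t * (norm (psi j z) + norm (psi k z))) - 1)"
proof -
 interpret prob_space "P j" by (rule prob_space_P)
 have ez: "emgf (Re z)" using emgf_mono[OF e z(1)] z by simp
 have t0: "0 <= t" using t by simp
 let ?Z = "%m w. V j k 1 w + before_jump j k t m w + after_jump j k t m w"
 let ?p = "%m r. prob (jump_cell j j k t m r)"
 let ?x = "%z m r. of_real (real r * (t / 2 ^ m)) * psi j z + of_real (t - real (Suc r) * (t / 2 ^ m)) * psi k z"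
 have psum: "(\<Sum>r<(2::nat) ^ m. ?p m r) = prob (jump_level j j k t m)" for m
  unfolding jump_level_def
  by (rule finite_measure_finite_Union[symmetric])
    (use event_P(2)[OF t0] jump_cell_disjoint[OF jk] in \<open>auto simp: disjoint_family_on_def\<close>)
 have xle: "norm (?x z m r) <= t * (norm (psi j z) + norm (psi k z))" if "r < 2 ^ m" for z m r
 proof -
  have le: "0 <= real l * (t / 2 ^ m)" "real l * (t / 2 ^ m) <= t" if "l <= 2 ^ m" for l
  proof -
   have "real l <= 2 ^ m" using that by (metis of_nat_le_iff of_nat_numeral of_nat_power)
   then have "real l * (t / 2 ^ m) <= 2 ^ m * (t / 2 ^ m)" using t by (intro mult_right_mono) auto
   then show "real l * (t / 2 ^ m) <= t" by simp
  qed (use t in simp)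
  have "norm (?x z m r) <= \<bar>real r * (t / 2 ^ m)\<bar> * norm (psi j z) + \<bar>t - real (Suc r) * (t / 2 ^ m)\<bar> * norm (psi k z)"
   by (rule order_trans[OF norm_triangle_ineq]) (simp only: norm_mult norm_of_real order_refl)
  also have "\<dots> <= t * norm (psi j z) + t * norm (psi k z)"
   using le[of r] le[of "Suc r"] that by (intro add_mono mult_right_mono) auto
  finally show ?thesis by (simp add: distrib_left)
 qed
 let ?I = "%m. \<integral>w. indicator (jump_level j j k t m) w * exp (z * of_real (?Z m w)) \<partial>P j"
 define C where "C = norm (Ups j k (of_real s)) * exp (t * (norm (psi j (of_real s)) + norm (psi k (of_real s))))"
 have es: "emgf (Re (of_real s))" "0 <= Re (complex_of_real s)" using e z by auto
 note lt = level_transform[OF es t jk G]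
 have cr: "indicator A w * exp (complex_of_real s * complex_of_real x) = complex_of_real (indicator A w * exp (s * x))" for A w x
  by (simp add: indicator_def flip: of_real_mult exp_of_real)
 have ints: "integrable (P j) (%w. indicator (jump_level j j k t m) w * exp (s * ?Z m w))" for m
  using lt(1)[of m] unfolding cr complex_of_real_integrable_eq .
 have bnds: "(\<integral>w. indicator (jump_level j j k t m) w * exp (s * ?Z m w) \<partial>P j) <= C" for m
 proof -
  have "(\<integral>w. indicator (jump_level j j k t m) w * exp (s * ?Z m w) \<partial>P j) \<le>
    norm (complex_of_real (\<integral>w. indicator (jump_level j j k t m) w * exp (s * ?Z m w) \<partial>P j))" by simp
  also have "complex_of_real (\<integral>w. indicator (jump_level j j k t m) w * exp (s * ?Z m w) \<partial>P j) =
   Ups j k (of_real s) * (\<Sum>r<2 ^ m. of_real (?p m r) * exp (?x (of_real s) m r))"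
   using lt(2)[of m] unfolding cr integral_complex_of_real .
  also have "norm \<dots> <= norm (Ups j k (of_real s)) * (\<Sum>r<2 ^ m. ?p m r * exp (t * (norm (psi j (of_real s)) + norm (psi k (of_real s)))))"
   unfolding norm_mult
  proof (intro mult_left_mono order_trans[OF norm_sum] sum_mono)
   fix r :: nat assume "r \<in> {..<2 ^ m}"
   then have "norm (exp (?x (of_real s) m r)) <= exp (t * (norm (psi j (of_real s)) + norm (psi k (of_real s))))"
    using xle[of r m "of_real s"] norm_exp[of "?x (of_real s) m r"] by (meson exp_le_cancel_iff lessThan_iff order_trans)
   then show "norm (of_real (?p m r) * exp (?x (of_real s) m r)) <= ?p m r * exp (t * (norm (psi j (of_real s)) + norm (psi k (of_real s))))"
    unfolding norm_mult by (intro mult_mono) auto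
  qed auto
  also have "\<dots> = norm (Ups j k (of_real s)) * (prob (jump_level j j k t m) * exp (t * (norm (psi j (of_real s)) + norm (psi k (of_real s)))))"
   unfolding sum_distrib_right[symmetric] psum ..
  also have "\<dots> <= norm (Ups j k (of_real s)) * (1 * exp (t * (norm (psi j (of_real s)) + norm (psi k (of_real s)))))"
   by (intro mult_left_mono mult_right_mono) auto
  finally show ?thesis by (simp add: C_def)
 qed
 note [measurable] = before_after_measurable[OF t, of j k] event_P(3)[OF t0, of j j k] event_P(4)[OF t0, of j j k]
  measurable_X[OF t0, of j] measurable_V[of j k 1 j] measurable_V[of j k "Suc 0" j]
 have lim: "?I \<longlonglongrightarrow> (\<integral>w. indicator (one_jump j j k t) w * exp (z * of_real (X t w)) \<partial>P j)"
  by (rule exp_moment_limit(1)[OF finite_measure_axioms _ _ _ _ before_after_limits[OF t jk] z ints bnds]) measurable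
 have plim: "(%m. prob (jump_level j j k t m)) \<longlonglongrightarrow> prob (one_jump j j k t)"
  unfolding one_jump_def by (rule finite_Lim_measure_decseq[OF _ jump_level_decseq]) auto
 have "(%m. norm (?I m - Ups j k z * of_real (prob (jump_level j j k t m)))) \<longlonglongrightarrow>
   norm ((\<integral>w. indicator (one_jump j j k t) w * exp (z * of_real (X t w)) \<partial>P j) - Ups j k z * of_real (prob (one_jump j j k t)))"
  by (intro tendsto_intros lim plim)
 moreover have "(%m. norm (Ups j k z) * prob (jump_level j j k t m) * (exp (t * (norm (psi j z) + norm (psi k z))) - 1)) \<longlonglongrightarrow>
   norm (Ups j k z) * prob (one_jump j j k t) * (exp (t * (norm (psi j z) + norm (psi k z))) - 1)"
  by (intro tendsto_intros plim)
 moreover have "norm (?I m - Ups j k z * of_real (prob (jump_level j j k t m))) \<le>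
   norm (Ups j k z) * prob (jump_level j j k t m) * (exp (t * (norm (psi j z) + norm (psi k z))) - 1)" for m
 proof -
  let ?E = "exp (t * (norm (psi j z) + norm (psi k z))) - 1"
  have eq: "?I m - Ups j k z * of_real (prob (jump_level j j k t m)) = Ups j k z * (\<Sum>r<2 ^ m. of_real (?p m r) * (exp (?x z m r) - 1))"
   by (simp only: level_transform(2)[OF ez z(1) t jk G] psum[symmetric] of_real_sum right_diff_distrib sum_subtractf mult_1_right)
  have "norm (\<Sum>r<2 ^ m. of_real (?p m r) * (exp (?x z m r) - 1)) <= (\<Sum>r<2 ^ m. ?p m r * ?E)"
  proof (intro order_trans[OF norm_sum] sum_mono)
   fix r :: nat assume "r \<in> {..<2 ^ m}"
   then have "exp (norm (?x z m r)) <= exp (t * (norm (psi j z) + norm (psi k z)))" using xle[of r m z] by simp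
   then have "norm (exp (?x z m r) - 1) <= ?E"
    using norm_exp_minus_1_le[of "?x z m r"] by linarith
   then show "norm (of_real (?p m r) * (exp (?x z m r) - 1)) <= ?p m r * ?E"
    unfolding norm_mult by (intro mult_mono) auto
  qed
  then have "norm (\<Sum>r<2 ^ m. of_real (?p m r) * (exp (?x z m r) - 1)) <= prob (jump_level j j k t m) * ?E"
   by (simp only: sum_distrib_right[symmetric] psum)
  then show ?thesis unfolding eq norm_mult mult.assoc by (rule mult_left_mono) simp
 qed
 ultimately show ?thesis by (intro LIMSEQ_le) auto
qed

end

section \<open>Moment generating functions as holomorphic functions\<close>

section \<open>Analyticity of moment generating functions\<close>

lemma power_exp_bound: "\<bar>x\<bar> ^ n / fact n <= exp \<bar>x\<bar>" for x :: real
proof -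
 have "\<bar>x\<bar> ^ n /\<^sub>R fact n <= (\<Sum>i. \<bar>x\<bar> ^ i /\<^sub>R fact i)"
  using sum_le_suminf[OF summable_exp_generic[of "\<bar>x\<bar>"], of "{n}"] by auto
 then show ?thesis by (simp add: exp_def divide_inverse mult.commute)
qed

lemma mgf_power_series:
 fixes f g :: "'a => real"
 assumes [measurable]: "f \<in> borel_measurable M" "g \<in> borel_measurable M" and g: "\<And>x. 0 <= g x"
  and i1: "integrable M (%x. g x * exp ((Re z0 + r) * f x))" and i2: "integrable M (%x. g x * exp ((Re z0 - r) * f x))"
  and w: "w \<in> ball z0 r"
 shows "integrable M (%x. of_real (g x) * exp (w * of_real (f x)))"
  "(%n. (\<integral>x. of_real (g x) * exp (z0 * of_real (f x)) * of_real (f x) ^ n / fact n \<partial>M) * (w - z0) ^ n) sums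
   (\<integral>x. of_real (g x) * exp (w * of_real (f x)) \<partial>M)"
proof -
 define F where "F = (%n x. of_real (g x) * exp (z0 * of_real (f x)) * of_real (f x) ^ n / fact n * (w - z0) ^ n)"
 define B where "B = (%x. g x * exp ((Re z0 + r) * f x) + g x * exp ((Re z0 - r) * f x))"
 define d where "d = norm (w - z0)"
 have d: "0 <= d" "d < r" using w by (auto simp: d_def dist_norm norm_minus_commute)
 have Bi: "integrable M B" unfolding B_def by (intro Bochner_Integration.integrable_add i1 i2)
 have nF: "norm (F n x) = g x * exp (Re z0 * f x) * ((d * \<bar>f x\<bar>) ^ n / fact n)" for n x
  using g[of x] by (simp add: F_def norm_mult norm_divide norm_power d_def power_mult_distrib)
 have ee: "g x * exp (Re z0 * f x) * exp (d * \<bar>f x\<bar>) <= B x" for x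
 proof -
  have "Re z0 * f x + d * \<bar>f x\<bar> <= (Re z0 + r) * f x \<or> Re z0 * f x + d * \<bar>f x\<bar> <= (Re z0 - r) * f x"
  proof (cases "0 <= f x")
   case True
   then have "d * f x <= r * f x" using d by (intro mult_right_mono) auto
   then show ?thesis using True by (simp add: algebra_simps)
  next
   case False
   then have "d * \<bar>f x\<bar> <= r * \<bar>f x\<bar>" using d by (intro mult_right_mono) auto
   then show ?thesis using False by (simp add: algebra_simps)
  qed
  then have "exp (Re z0 * f x + d * \<bar>f x\<bar>) <= exp ((Re z0 + r) * f x) + exp ((Re z0 - r) * f x)"
   using exp_gt_zero[of "(Re z0 + r) * f x"] exp_gt_zero[of "(Re z0 - r) * f x"] by (smt (verit) exp_le_cancel_iff)
  then have "g x * exp (Re z0 * f x + d * \<bar>f x\<bar>) <= g x * (exp ((Re z0 + r) * f x) + exp ((Re z0 - r) * f x))"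
   by (rule mult_left_mono[OF _ g])
  then show ?thesis by (simp add: B_def exp_add distrib_left mult.assoc)
 qed
 have es: "(%n. norm (F n x)) sums (g x * exp (Re z0 * f x) * exp (d * \<bar>f x\<bar>))" for x
  unfolding nF using exp_converges[of "d * \<bar>f x\<bar>"] by (intro sums_mult) (simp add: divide_inverse mult.commute)
 have nb: "norm (F n x) <= B x" for n x
 proof -
  have "norm (F n x) <= (\<Sum>i. norm (F i x))"
   using sum_le_suminf[OF sums_summable[OF es[of x]], of "{n}"] by simp
  then show ?thesis using ee[of x] sums_unique[OF es[of x]] by simp
 qed
 have Fi: "integrable M (F n)" for n
 proof (rule Bochner_Integration.integrable_bound[OF Bi])
  show "AE x in M. norm (F n x) <= norm (B x)"
   using order_trans[OF nb abs_ge_self] by (intro AE_I2) (simp only: real_norm_def)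
 qed (simp add: F_def)
 have Fs: "(%n. F n x) sums (of_real (g x) * exp (w * of_real (f x)))" for x
 proof -
  have "(%n. of_real (g x) * exp (z0 * of_real (f x)) * (((w - z0) * of_real (f x)) ^ n /\<^sub>R fact n)) sums
   (of_real (g x) * exp (z0 * of_real (f x)) * exp ((w - z0) * of_real (f x)))"
   by (intro sums_mult exp_converges)
  moreover have "exp (z0 * of_real (f x)) * exp ((w - z0) * of_real (f x)) = exp (w * complex_of_real (f x))"
   by (simp add: algebra_simps flip: exp_add)
  moreover have "F n x = of_real (g x) * exp (z0 * of_real (f x)) * (((w - z0) * of_real (f x)) ^ n /\<^sub>R fact n)" for n
   by (simp add: F_def power_mult_distrib scaleR_conv_of_real divide_inverse)
  ultimately show ?thesis by (simp add: mult.assoc)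
 qed
 have sumn: "summable (%n. \<integral>x. norm (F n x) \<partial>M)"
 proof (rule summableI_nonneg_bounded)
  show "0 <= (\<integral>x. norm (F n x) \<partial>M)" for n by simp
  show "(\<Sum>i<n. \<integral>x. norm (F i x) \<partial>M) <= (\<integral>x. B x \<partial>M)" for n
  proof -
   have "(\<Sum>i<n. \<integral>x. norm (F i x) \<partial>M) = (\<integral>x. (\<Sum>i<n. norm (F i x)) \<partial>M)"
    by (rule Bochner_Integration.integral_sum[symmetric]) (intro integrable_norm Fi)
   also have "\<dots> <= (\<integral>x. B x \<partial>M)"
   proof (rule integral_mono)
    show "(\<Sum>i<n. norm (F i x)) <= B x" for x
     using sum_le_suminf[OF sums_summable[OF es[of x]], of "{..<n}"] sums_unique[OF es[of x]] ee[of x] by simp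
   qed (intro Bochner_Integration.integrable_sum integrable_norm Fi, rule Bi)
   finally show ?thesis .
  qed
 qed
 have sx: "AE x in M. summable (%n. norm (F n x))" using es by (auto intro: sums_summable)
 have eq: "(%x. \<Sum>n. F n x) = (%x. of_real (g x) * exp (w * of_real (f x)))"
  using Fs by (auto simp: sums_iff fun_eq_iff)
 show "integrable M (%x. of_real (g x) * exp (w * of_real (f x)))"
  using integrable_suminf[OF Fi sx sumn] unfolding eq .
 have "(%n. \<integral>x. F n x \<partial>M) sums (\<integral>x. of_real (g x) * exp (w * of_real (f x)) \<partial>M)"
  using sums_integral[OF Fi sx sumn] unfolding eq .
 then show "(%n. (\<integral>x. of_real (g x) * exp (z0 * of_real (f x)) * of_real (f x) ^ n / fact n \<partial>M) * (w - z0) ^ n) sums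
   (\<integral>x. of_real (g x) * exp (w * of_real (f x)) \<partial>M)"
  unfolding F_def by simp
qed

lemma mgf_holomorphic:
 fixes f g :: "'a => real"
 assumes m: "f \<in> borel_measurable M" "g \<in> borel_measurable M" and g: "\<And>x. 0 <= g x"
  and i: "\<And>s. a < s ==> s < b ==> integrable M (%x. g x * exp (s * f x))"
 shows "(%z. \<integral>x. of_real (g x) * exp (z * of_real (f x)) \<partial>M) holomorphic_on {z. a < Re z \<and> Re z < b}"
proof -
 have "(%z. \<integral>x. of_real (g x) * exp (z * of_real (f x)) \<partial>M) field_differentiable (at z)" if z: "a < Re z" "Re z < b" for z
 proof -
  define r where "r = min (Re z - a) (b - Re z) / 2"
  have r: "0 < r" "a < Re z - r" "Re z + r < b" using z by (auto simp: r_def min_def field_simps)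
  have "(%z. \<integral>x. of_real (g x) * exp (z * of_real (f x)) \<partial>M) holomorphic_on ball z r"
   by (rule power_series_holomorphic, rule mgf_power_series(2)[OF m g]) (use r in \<open>auto intro!: i\<close>)
  then show ?thesis using r(1) by (auto simp: holomorphic_on_open field_differentiable_def)
 qed
 then show ?thesis by (auto simp: holomorphic_on_def intro: field_differentiable_at_within)
qed

lemma power_series_coeffs_unique:
 fixes a b :: "nat => complex"
 assumes r: "0 < r" and "\<And>w. w \<in> ball z r ==> (%n. a n * (w - z) ^ n) sums h w"
  "\<And>w. w \<in> ball z r ==> (%n. b n * (w - z) ^ n) sums h w"
 shows "a n = b n"
proof (rule ccontr)
 assume ne: "a n \<noteq> b n"
 have s: "(%n. (a n - b n) * (w - z) ^ n) sums 0" if "w \<in> ball z r" for w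
  using sums_diff[OF assms(2,3)[OF that]] by (simp add: left_diff_distrib)
 have "a 0 - b 0 = 0" using s[of z] r by (simp add: sums_iff)
 then have n: "0 < n" using ne by (cases n) auto
 obtain t where "0 < t" "\<And>w. w \<in> cball z t - {z} ==> (%_. 0) w \<noteq> (0 :: complex)"
  by (rule powser_0_nonzero[where f = "%_. 0" and r = r and a = "%n. a n - b n" and \<xi> = z and m = n])
    (use r s n ne in \<open>auto simp: dist_norm norm_minus_commute\<close>)
 moreover have "z + of_real t \<in> cball z t - {z}" using \<open>0 < t\<close> by (simp add: dist_norm)
 ultimately show False by blast
qed

text \<open>Landau's theorem. Expand at a point below \<open>\<alpha>\<close>. The power series of the holomorphic function converges past \<open>\<alpha>\<close> and has moments
as coefficients; evaluated at a real point it is a series of nonnegative terms that may be summed under the integral.\<close>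

lemma mgf_extends_past_singularity:
 fixes f g :: "'a => real" and H :: "complex => complex"
 assumes m[measurable]: "f \<in> borel_measurable M" "g \<in> borel_measurable M" and g: "\<And>x. 0 <= g x" and gi: "integrable M g"
  and \<alpha>: "0 < \<alpha>" and r: "0 < r" "r <= \<alpha>" and i\<alpha>: "\<And>s. 0 <= s ==> s < \<alpha> ==> integrable M (%x. g x * exp (s * f x))"
  and H: "H holomorphic_on ball (of_real \<alpha>) r"
  and eq: "\<And>s. \<alpha> - r < s ==> s < \<alpha> ==> H (of_real s) = of_real (\<integral>x. g x * exp (s * f x) \<partial>M)"
  and s: "0 <= s" "s < \<alpha> + r"
 shows "integrable M (%x. g x * exp (s * f x))"
proof (cases "s < \<alpha>")
 case True then show ?thesis using i\<alpha> s by simp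
next
 case False
 define gp where "gp = (%x. g x * indicator {0<..} (f x))"
 define gn where "gn = (%x. g x * indicator {..0} (f x))"
 have gsplit: "g x = gp x + gn x" for x by (auto simp: gp_def gn_def indicator_def)
 have [measurable]: "gp \<in> borel_measurable M" "gn \<in> borel_measurable M" unfolding gp_def gn_def by measurable
 have gp0: "0 <= gp x" and gn0: "0 <= gn x" for x using g by (auto simp: gp_def gn_def)
 have in1: "integrable M (%x. gn x * exp (s * f x))" if "0 <= s" for s
  by (rule Bochner_Integration.integrable_bound[OF gi])
    (use g that in \<open>auto simp: gn_def indicator_def abs_mult mult_nonneg_nonpos intro!: AE_I2 mult_right_le_one_le\<close>)
 have ip1: "integrable M (%x. gp x * exp (s * f x))" if "s < \<alpha>" for s
 proof (cases "0 <= s")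
  case True
  show ?thesis
   by (rule Bochner_Integration.integrable_bound[OF i\<alpha>[OF True that]])
     (use g in \<open>auto simp: gp_def indicator_def\<close>)
 next
  case False
  show ?thesis
   by (rule Bochner_Integration.integrable_bound[OF gi])
     (use g False in \<open>auto simp: gp_def indicator_def abs_mult mult_nonpos_nonneg intro!: AE_I2 mult_right_le_one_le\<close>)
 qed
 define a where "a = \<alpha> - (\<alpha> + r - s) / 4"
 define R where "R = r - (\<alpha> - a)"
 define q where "q = (\<alpha> - a) / 2"
 have a: "a < \<alpha>" "0 < R" "s < a + R" "0 < q" "q < R" "a + q < \<alpha>" "\<alpha> - r <= a - R" "0 <= a - R" "0 < a"
  using s r False unfolding q_def R_def a_def by (auto simp: field_simps)
 define \<phi> where "\<phi> = (%z. \<integral>x. complex_of_real (gp x) * exp (z * of_real (f x)) \<partial>M)"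
 define \<chi>' where "\<chi>' = (%z. \<integral>x. complex_of_real (gn x) * exp (z * of_real (f x)) \<partial>M)"
 define K where "K = (%z. H z - \<chi>' z)"
 have sub: "ball (complex_of_real a) R \<subseteq> ball (of_real \<alpha>) r"
 proof
  fix w assume "w \<in> ball (complex_of_real a) R"
  then have "dist (complex_of_real a) w < R" by simp
  moreover have "dist (complex_of_real \<alpha>) (of_real a) = \<alpha> - a" using a(1) unfolding dist_of_real by (simp add: dist_real_def)
  ultimately have "dist (complex_of_real \<alpha>) w < (\<alpha> - a) + R"
   using dist_triangle[of "complex_of_real \<alpha>" w "of_real a"] by linarith
  then show "w \<in> ball (of_real \<alpha>) r" by (simp add: R_def)
 qed
 have re: "0 < Re w" if "w \<in> ball (complex_of_real a) R" for w
 proof -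
  have "\<bar>Re (of_real a - w)\<bar> < R" using that abs_Re_le_cmod[of "of_real a - w"] by (auto simp: dist_norm)
  then show ?thesis using a by simp
 qed
 have "\<chi>' holomorphic_on {z. 0 < Re z \<and> Re z < \<alpha> + 2 * r}"
  unfolding \<chi>'_def by (rule mgf_holomorphic) (use gn0 in1 in auto)
 then have Kh: "K holomorphic_on ball (of_real a) R"
 proof -
  assume h: "\<chi>' holomorphic_on {z. 0 < Re z \<and> Re z < \<alpha> + 2 * r}"
  have "Re w < \<alpha> + 2 * r" if "w \<in> ball (complex_of_real \<alpha>) r" for w
   using that abs_Re_le_cmod[of "of_real \<alpha> - w"] r by (auto simp: dist_norm)
  then have "ball (complex_of_real a) R \<subseteq> {z. 0 < Re z \<and> Re z < \<alpha> + 2 * r}" using sub re by blast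
  then show ?thesis unfolding K_def by (intro holomorphic_on_diff holomorphic_on_subset[OF H sub] holomorphic_on_subset[OF h])
 qed
 define c where "c = (%n. \<integral>x. complex_of_real (gp x) * exp (of_real a * of_real (f x)) * of_real (f x) ^ n / fact n \<partial>M)"
 have \<phi>s: "(%n. c n * (w - of_real a) ^ n) sums \<phi> w" if "w \<in> ball (of_real a) q" for w
  unfolding c_def \<phi>_def by (rule mgf_power_series(2)[OF _ _ gp0]) (use that a in \<open>auto intro!: ip1\<close>)
 have \<phi>h: "\<phi> holomorphic_on ball (of_real a) q" by (rule power_series_holomorphic[OF \<phi>s])
 have real_eq: "K (of_real t) = \<phi> (of_real t)" if t: "a - q < t" "t < a + q" for t
 proof -
  have tt: "\<alpha> - r < t" "t < \<alpha>" "0 <= t" using t a by auto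
  have "(\<integral>x. g x * exp (t * f x) \<partial>M) = (\<integral>x. gp x * exp (t * f x) + gn x * exp (t * f x) \<partial>M)"
   by (simp add: gsplit distrib_right)
  also have "\<dots> = (\<integral>x. gp x * exp (t * f x) \<partial>M) + (\<integral>x. gn x * exp (t * f x) \<partial>M)"
   by (rule Bochner_Integration.integral_add[OF ip1[OF tt(2)] in1[OF tt(3)]])
  finally have "H (of_real t) = of_real (\<integral>x. gp x * exp (t * f x) \<partial>M) + of_real (\<integral>x. gn x * exp (t * f x) \<partial>M)"
   by (simp add: eq[OF tt(1,2)])
  moreover have "of_real (\<integral>x. gp x * exp (t * f x) \<partial>M) = \<phi> (of_real t)" "of_real (\<integral>x. gn x * exp (t * f x) \<partial>M) = \<chi>' (of_real t)"
   unfolding \<phi>_def \<chi>'_def integral_complex_of_real[symmetric] by (simp_all add: exp_of_real flip: of_real_mult)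
  ultimately show ?thesis by (simp add: K_def)
 qed
 have K\<phi>: "K w = \<phi> w" if w: "w \<in> ball (of_real a) q" for w
 proof -
  let ?U = "of_real ` {a - q<..<a + q} :: complex set"
  have sub2: "ball (complex_of_real a) q \<subseteq> ball (of_real a) R" using a by (intro subset_ball) simp
  have "K w - \<phi> w = 0"
  proof (rule analytic_continuation[where S = "ball (of_real a) q" and U = ?U and \<xi> = "of_real a" and f = "%w. K w - \<phi> w"])
   show "(%w. K w - \<phi> w) holomorphic_on ball (of_real a) q"
    by (intro holomorphic_on_diff \<phi>h holomorphic_on_subset[OF Kh sub2])
   show "?U \<subseteq> ball (of_real a) q" by (auto simp: dist_of_real dist_real_def abs_less_iff)
   show "complex_of_real a islimpt ?U"
   proof (rule islimptI)
    fix T assume T: "complex_of_real a \<in> T" "open T"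
    then obtain e where e: "0 < e" "ball (complex_of_real a) e \<subseteq> T" by (meson openE)
    define t where "t = a + min e q / 2"
    have "complex_of_real t \<in> ball (complex_of_real a) e" "t \<in> {a - q<..<a + q}" "t \<noteq> a"
     unfolding mem_ball dist_of_real using e a by (auto simp: t_def dist_real_def min_def)
    then show "\<exists>y\<in>?U. y \<in> T \<and> y \<noteq> complex_of_real a" using e by (intro bexI[of _ "of_real t"]) auto
   qed
  qed (use w a real_eq in auto)
  then show ?thesis by simp
 qed
 define k where "k = (%n. (deriv ^^ n) K (of_real a) / fact n)"
 have Ks: "(%n. k n * (w - of_real a) ^ n) sums K w" if "w \<in> ball (of_real a) R" for w
  unfolding k_def by (rule holomorphic_power_series[OF Kh that])
 have kc: "k n = c n" for n
 proof (rule power_series_coeffs_unique[of q "of_real a" k K c])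
  show "(%n. k n * (w - of_real a) ^ n) sums K w" if "w \<in> ball (of_real a) q" for w
   using that a by (intro Ks) auto
  show "(%n. c n * (w - of_real a) ^ n) sums K w" if "w \<in> ball (of_real a) q" for w
   using \<phi>s[OF that] K\<phi>[OF that] by simp
 qed (rule a)
 define cr where "cr = (%n. \<integral>x. gp x * exp (a * f x) * f x ^ n / fact n \<partial>M)"
 have c_real: "c n = of_real (cr n)" for n
 proof -
  have "exp (of_real a * of_real (f x)) = complex_of_real (exp (a * f x))" for x
   by (simp add: exp_of_real flip: of_real_mult)
  then show ?thesis unfolding c_def cr_def integral_complex_of_real[symmetric] by simp
 qed
 have ci: "integrable M (%x. gp x * exp (a * f x) * f x ^ n / fact n)" for n
 proof (rule Bochner_Integration.integrable_bound[OF integrable_mult_left[OF ip1[OF a(6)], of "inverse (q ^ n)"]])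
  have "norm (gp x * exp (a * f x) * f x ^ n / fact n) <= norm (gp x * exp ((a + q) * f x) * inverse (q ^ n))" for x
  proof (cases "0 < f x")
   case True
   have "(q * f x) ^ n / fact n <= exp (q * f x)" using power_exp_bound[of "q * f x" n] True a by simp
   then have "f x ^ n / fact n <= exp (q * f x) * inverse (q ^ n)" using a by (simp add: power_mult_distrib field_simps)
   then have "gp x * exp (a * f x) * (f x ^ n / fact n) <= gp x * exp (a * f x) * (exp (q * f x) * inverse (q ^ n))"
    using gp0 by (intro mult_left_mono) auto
   then show ?thesis using True gp0[of x] a by (simp add: distrib_right exp_add mult.assoc)
  qed (auto simp: gp_def)
  then show "AE x in M. norm (gp x * exp (a * f x) * f x ^ n / fact n) <= norm (gp x * exp ((a + q) * f x) * inverse (q ^ n))" by simp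
 qed measurable
 have nn: "0 <= gp x * exp (a * f x) * f x ^ n / fact n * (s - a) ^ n" for n x
  using gp0[of x] a False by (cases "0 < f x") (auto simp: gp_def)
 have sreal: "(%n. cr n * (s - a) ^ n) sums Re (K (of_real s))"
 proof -
  have "(of_real s :: complex) \<in> ball (of_real a) R" using a False by (simp add: dist_of_real dist_real_def)
  from sums_Re[OF Ks[OF this]] show ?thesis
   by (simp add: kc c_real flip: of_real_diff of_real_power of_real_mult)
 qed
 have "(\<integral>\<^sup>+x. ennreal (gp x * exp (s * f x)) \<partial>M) = (\<integral>\<^sup>+x. (\<Sum>n. ennreal (gp x * exp (a * f x) * f x ^ n / fact n * (s - a) ^ n)) \<partial>M)"
 proof (rule nn_integral_cong)
  fix x
  have "(%n. gp x * exp (a * f x) * (((s - a) * f x) ^ n /\<^sub>R fact n)) sums (gp x * exp (a * f x) * exp ((s - a) * f x))"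
   by (intro sums_mult exp_converges)
  moreover have "gp x * exp (a * f x) * exp ((s - a) * f x) = gp x * exp (s * f x)"
   by (simp add: mult.assoc left_diff_distrib flip: exp_add)
  moreover have "gp x * exp (a * f x) * (((s - a) * f x) ^ n /\<^sub>R fact n) = gp x * exp (a * f x) * f x ^ n / fact n * (s - a) ^ n" for n
   by (simp add: power_mult_distrib divide_inverse)
  ultimately have "(%n. gp x * exp (a * f x) * f x ^ n / fact n * (s - a) ^ n) sums (gp x * exp (s * f x))" by simp
  then show "ennreal (gp x * exp (s * f x)) = (\<Sum>n. ennreal (gp x * exp (a * f x) * f x ^ n / fact n * (s - a) ^ n))"
   by (rule suminf_ennreal_eq[OF nn, symmetric])
 qed
 also have "\<dots> = (\<Sum>n. \<integral>\<^sup>+x. ennreal (gp x * exp (a * f x) * f x ^ n / fact n * (s - a) ^ n) \<partial>M)"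
  by (rule nn_integral_suminf) measurable
 also have "\<dots> = (\<Sum>n. ennreal (cr n * (s - a) ^ n))"
 proof (rule suminf_cong)
  fix n
  show "(\<integral>\<^sup>+x. ennreal (gp x * exp (a * f x) * f x ^ n / fact n * (s - a) ^ n) \<partial>M) = ennreal (cr n * (s - a) ^ n)"
   unfolding cr_def integral_mult_left_zero[symmetric]
   by (rule nn_integral_eq_integral[OF integrable_mult_left[OF ci[of n]] AE_I2[OF nn]])
 qed
 also have "\<dots> = ennreal (Re (K (of_real s)))"
 proof (rule suminf_ennreal_eq[OF _ sreal])
  show "0 <= cr n * (s - a) ^ n" for n
   unfolding cr_def integral_mult_left_zero[symmetric] by (rule integral_nonneg_AE[OF AE_I2[OF nn]])
 qed
 also have "\<dots> < \<infinity>" by simp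
 finally have "(\<integral>\<^sup>+x. ennreal (gp x * exp (s * f x)) \<partial>M) < \<infinity>" .
 then have "integrable M (%x. gp x * exp (s * f x))"
  using gp0 by (intro integrableI_nonneg) auto
 from Bochner_Integration.integrable_add[OF this in1[OF s(1)]] show ?thesis
  by (simp add: gsplit distrib_right)
qed

section \<open>The matrix exponent as an infinitesimal generator\<close>

lemma matpow_nonneg:
 fixes M :: "real^'n^'n"
 assumes M: "\<And>j k. 0 <= M$j$k"
 shows "0 <= matpow M n$a$b"
 by (induction n arbitrary: a b) (auto simp: mat_1_entry matrix_mult_entry M intro!: sum_nonneg)

lemma matpow_diag_ge:
 fixes M :: "real^'n^'n"
 assumes M: "\<And>j k. 0 <= M$j$k"
 shows "M$k$k ^ n <= matpow M n$k$k"
proof (induction n)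
 case (Suc n)
 have "M$k$k ^ Suc n <= M$k$k * matpow M n$k$k" using Suc M by (auto intro: mult_left_mono)
 also have "\<dots> <= (\<Sum>l\<in>UNIV. M$k$l * matpow M n$l$k)"
  by (rule member_le_sum[where f = "%l. M$k$l * matpow M n$l$k"]) (auto intro!: mult_nonneg_nonneg M matpow_nonneg)
 finally show ?case by (simp add: matrix_mult_entry)
qed (simp add: mat_1_entry)

text \<open>Count the paths that move from \<open>j\<close> to \<open>k\<close> once and stay otherwise.\<close>

lemma matpow_offdiag_ge:
 fixes M :: "real^'n^'n"
 assumes M: "\<And>j k. 0 <= M$j$k" and jk: "j \<noteq> k"
 shows "(\<Sum>i<n. M$j$j ^ i * M$j$k * M$k$k ^ (n - 1 - i)) <= matpow M n$j$k"
proof -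
 note nn = matpow_nonneg[OF M] and diag = matpow_diag_ge[OF M]
 show "(\<Sum>i<n. M$j$j ^ i * M$j$k * M$k$k ^ (n - 1 - i)) <= matpow M n$j$k"
 proof (induction n)
  case 0 show ?case using nn[of 0 j k] by simp
 next
  case (Suc n)
  have "(\<Sum>i<Suc n. M$j$j ^ i * M$j$k * M$k$k ^ (Suc n - 1 - i)) =
   M$j$k * M$k$k ^ n + M$j$j * (\<Sum>i<n. M$j$j ^ i * M$j$k * M$k$k ^ (n - 1 - i))"
   by (subst sum.lessThan_Suc_shift) (simp add: sum_distrib_left mult.assoc)
  also have "\<dots> <= M$j$k * matpow M n$k$k + M$j$j * matpow M n$j$k"
   by (intro add_mono mult_left_mono diag Suc M)
  also have "\<dots> = (\<Sum>l\<in>{j, k}. M$j$l * matpow M n$l$k)" using jk by simp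
  also have "\<dots> <= (\<Sum>l\<in>UNIV. M$j$l * matpow M n$l$k)"
   by (rule sum_mono2) (auto intro!: mult_nonneg_nonneg M nn)
  finally show ?case by (simp add: matrix_mult_entry)
 qed
qed

lemma bounded_of_tendsto: fixes f :: "nat => real" assumes "f \<longlonglongrightarrow> l" obtains C where "\<And>n. f n <= C"
proof -
 have "Bseq f" using assms by (intro convergent_imp_Bseq convergentI)
 then obtain K where "\<And>n. norm (f n) <= K" by (elim BseqE) blast
 then show ?thesis by (intro that[of K]) (metis abs_le_D1 real_norm_def)
qed

context markov_modulated_levy
begin

abbreviation Mx :: "complex => complex^'n^'n" where "Mx \<equiv> matrix_exponent G \<mu> \<sigma> \<nu> \<rho> U"

abbreviation MLx :: "complex => complex^'n^'n" where "MLx \<equiv> matrix_laplace_exponent G \<mu> \<sigma> \<nu> \<rho> U"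

abbreviation step :: "nat => real" where "step n \<equiv> 1 / real (Suc n)"

lemma no_jump_real_transform:
 assumes e: "emgf s" and t: "0 < t"
 shows "(\<integral>w. indicator (no_jump j j t) w * exp (s * X t w) \<partial>P j) = measure (P j) (no_jump j j t) * exp (t * Re (psi j (of_real s)))"
proof -
 have cr: "indicator A w * exp (complex_of_real s * complex_of_real x) = complex_of_real (indicator A w * exp (s * x))" for A and w :: 'w and x
  by (simp add: indicator_def flip: of_real_mult exp_of_real)
 have "complex_of_real (\<integral>w. indicator (no_jump j j t) w * exp (s * X t w) \<partial>P j)
   = of_real (measure (P j) (no_jump j j t)) * exp (of_real t * psi j (of_real s))"
  using no_jump_transform[of "of_real s" t j] e t unfolding cr integral_complex_of_real by simp
 then have "norm (complex_of_real (\<integral>w. indicator (no_jump j j t) w * exp (s * X t w) \<partial>P j))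
   = measure (P j) (no_jump j j t) * exp (t * Re (psi j (of_real s)))"
  by (simp add: norm_mult)
 moreover have "0 <= (\<integral>w. indicator (no_jump j j t) w * exp (s * X t w) \<partial>P j)" by (intro integral_nonneg_AE) auto
 ultimately show ?thesis by simp
qed

lemma rM_diag_ge:
 assumes e: "emgf s" and t: "0 < t"
 shows "(\<integral>w. indicator (no_jump j j t) w * exp (s * X t w) \<partial>P j) <= rM s t$j$j"
  "exp (t * (G$j$j + Re (psi j (of_real s)))) <= (\<integral>w. indicator (no_jump j j t) w * exp (s * X t w) \<partial>P j)"
proof -
 have t0: "0 <= t" using t by simp
 have et: "emgft s t" by (rule emgft_all[OF e t0])
 show "(\<integral>w. indicator (no_jump j j t) w * exp (s * X t w) \<partial>P j) <= rM s t$j$j"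
  unfolding rM_def vec_lambda_beta
  by (rule integral_mono_AE'[OF integrable_rexp_J[OF t0 et]])
    (use no_jump_subset[of j j t] in \<open>auto simp: indicator_def\<close>)
 have "exp (t * (G$j$j + Re (psi j (of_real s)))) = exp (t * G$j$j) * exp (t * Re (psi j (of_real s)))"
  by (simp add: distrib_left exp_add)
 also have "\<dots> <= measure (P j) (no_jump j j t) * exp (t * Re (psi j (of_real s)))"
  by (intro mult_right_mono no_jump_prob_ge t) simp
 finally show "exp (t * (G$j$j + Re (psi j (of_real s)))) <= (\<integral>w. indicator (no_jump j j t) w * exp (s * X t w) \<partial>P j)"
  unfolding no_jump_real_transform[OF e t] .
qed

text \<open>Moments of order \<open>s\<close> over a step of length \<open>1/n\<close> are \<open>O(1/n)\<close> away from the explicit events. No upper bound for short times is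
given, but the \<open>n\<close>-th power of the step matrix is the finite matrix at time \<open>1\<close>, which dominates \<open>n\<close> times a step.\<close>

lemma rM_step_bounds:
 assumes e: "emgf s"
 obtains C where "\<And>n j k. j \<noteq> k ==> real (Suc n) * rM s (step n)$j$k <= C"
  "\<And>n j. real (Suc n) * (rM s (step n)$j$j - (\<integral>w. indicator (no_jump j j (step n)) w * exp (s * X (step n) w) \<partial>P j)) <= C"
proof -
 have pw: "matpow (rM s (step n)) (Suc n) = rM s 1" for n
  using rM_power[OF e, of "step n" "Suc n"] by simp
 have s0: "0 < step n" for n by simp
 let ?c = "%j. G$j$j + Re (psi j (of_real s))"
 have "\<exists>C. \<forall>n. real (Suc n) * rM s (step n)$j$k <= C" if jk: "j \<noteq> k" for j k
 proof (intro exI allI)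
  fix n
  let ?M = "rM s (step n)"
  have low: "exp (- \<bar>?c l\<bar>) <= ?M$l$l ^ i" if "i <= Suc n" for l i
  proof -
   have "- \<bar>?c l\<bar> <= real i * (step n * ?c l)"
   proof -
    have "real i * step n <= 1" using that by simp
    then have "\<bar>real i * step n * ?c l\<bar> <= 1 * \<bar>?c l\<bar>" unfolding abs_mult by (intro mult_right_mono) auto
    from abs_le_D2[OF this] have "- (real i * step n * ?c l) <= \<bar>?c l\<bar>" by (simp only: mult_1_left)
    then have "- \<bar>?c l\<bar> <= real i * step n * ?c l" by (simp only: minus_le_iff)
    then show ?thesis by (simp only: mult.assoc)
   qed
   then have "exp (- \<bar>?c l\<bar>) <= exp (step n * ?c l) ^ i" by (simp add: exp_of_nat_mult[symmetric])
   also have "\<dots> <= ?M$l$l ^ i"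
    using order_trans[OF rM_diag_ge(2)[OF e s0[of n], of l] rM_diag_ge(1)[OF e s0[of n], of l]] by (rule power_mono) simp
   finally show ?thesis .
  qed
  have "real (Suc n) * (exp (- \<bar>?c j\<bar>) * ?M$j$k * exp (- \<bar>?c k\<bar>)) = (\<Sum>i<Suc n. exp (- \<bar>?c j\<bar>) * ?M$j$k * exp (- \<bar>?c k\<bar>))"
   by simp
  also have "\<dots> <= (\<Sum>i<Suc n. ?M$j$j ^ i * ?M$j$k * ?M$k$k ^ (Suc n - 1 - i))"
   by (intro sum_mono mult_mono low rM_nonneg mult_nonneg_nonneg zero_le_power) auto
  also have "\<dots> <= matpow ?M (Suc n)$j$k" by (rule matpow_offdiag_ge[OF rM_nonneg jk])
  also have "\<dots> = rM s 1$j$k" by (simp only: pw)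
  finally show "real (Suc n) * ?M$j$k <= rM s 1$j$k * exp (\<bar>?c j\<bar>) * exp (\<bar>?c k\<bar>)"
   by (simp add: exp_minus field_simps)
 qed
 then obtain C1 where C1: "\<And>n j k. j \<noteq> k ==> real (Suc n) * rM s (step n)$j$k <= C1 j k" by metis
 have "\<exists>C. \<forall>n. real (Suc n) * (rM s (step n)$j$j - (\<integral>w. indicator (no_jump j j (step n)) w * exp (s * X (step n) w) \<partial>P j)) <= C" for j
 proof -
  define l where "l = ln (rM s 1$j$j)"
  have m: "0 < rM s 1$j$j" using rM_pos[of 1 s j j] emgft_all[OF e, of 1] by simp
  have "(%n. real (Suc n) * (exp (l / real (Suc n)) - exp (?c j / real (Suc n)))) \<longlonglongrightarrow> l - ?c j"
   by real_asymp
  then obtain C where C: "\<And>n. real (Suc n) * (exp (l / real (Suc n)) - exp (?c j / real (Suc n))) <= C"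
   using bounded_of_tendsto by blast
  have "real (Suc n) * (rM s (step n)$j$j - (\<integral>w. indicator (no_jump j j (step n)) w * exp (s * X (step n) w) \<partial>P j)) <= C" for n
  proof -
   have d0: "0 < rM s (step n)$j$j" using rM_pos[of "step n" s j j] emgft_all[OF e, of "step n"] by simp
   have "rM s (step n)$j$j ^ Suc n <= rM s 1$j$j"
    unfolding pw[symmetric, of n] by (rule matpow_diag_ge[OF rM_nonneg])
   then have "ln (rM s (step n)$j$j ^ Suc n) <= l" unfolding l_def using d0 m by (subst ln_le_cancel_iff) auto
   then have "real (Suc n) * ln (rM s (step n)$j$j) <= l" using d0 by (simp add: ln_realpow del: power_Suc)
   then have "ln (rM s (step n)$j$j) <= l / real (Suc n)" by (simp add: pos_le_divide_eq mult.commute)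
   then have "rM s (step n)$j$j <= exp (l / real (Suc n))" using d0 by (metis exp_le_cancel_iff exp_ln)
   then have "rM s (step n)$j$j - (\<integral>w. indicator (no_jump j j (step n)) w * exp (s * X (step n) w) \<partial>P j)
     <= exp (l / real (Suc n)) - exp (?c j / real (Suc n))"
    using rM_diag_ge(2)[OF e s0[of n], of j] by (simp add: field_simps)
   then show ?thesis using C[of n] by (meson mult_left_mono of_nat_0_le_iff order_trans)
  qed
  then show ?thesis by blast
 qed
 then obtain C2 where C2: "\<And>n j. real (Suc n) * (rM s (step n)$j$j - (\<integral>w. indicator (no_jump j j (step n)) w * exp (s * X (step n) w) \<partial>P j)) <= C2 j"
  by metis
 define C where "C = max (Max (range (%(j, k). C1 j k))) (Max (range C2))"
 have "C1 j k <= C" "C2 j <= C" for j k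
  unfolding C_def by (auto simp: le_max_iff_disj intro!: disjI1 Max_ge rev_image_eqI[of "(j, k)"])
 then show ?thesis using that[of C] C1 C2 by (meson order_trans)
qed

text \<open>Split at height \<open>a\<close>: below, the probability is \<open>o(1/n)\<close>; above, the moment of order \<open>s\<close> gains the factor \<open>exp (-(s - \<sigma>') a)\<close>.\<close>

lemma rest_tendsto_0:
 assumes e: "emgf s" and z: "0 <= \<sigma>'" "\<sigma>' < s" and Q: "\<And>n. Q n \<in> sets (P j)"
  and p: "(%n. real (Suc n) * measure (P j) (Q n)) \<longlonglongrightarrow> 0"
  and C: "\<And>n. real (Suc n) * (\<integral>w. indicator (Q n) w * exp (s * X (step n) w) \<partial>P j) <= C"
 shows "(%n. real (Suc n) * (\<integral>w. indicator (Q n) w * exp (\<sigma>' * X (step n) w) \<partial>P j)) \<longlonglongrightarrow> 0"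
proof (rule tendstoI)
 fix \<epsilon> :: real assume ep: "0 < \<epsilon>"
 interpret prob_space "P j" by (rule prob_space_P)
 have e': "emgf \<sigma>'" using emgf_mono[OF e z(1)] z by simp
 let ?I = "%\<sigma>' n. \<integral>w. indicator (Q n) w * exp (\<sigma>' * X (step n) w) \<partial>P j"
 have int: "integrable (P j) (%w. indicator (Q n) w * exp (\<sigma>' * X (step n) w))" if "emgf \<sigma>'" for \<sigma>' n
  by (rule Bochner_Integration.integrable_bound[OF emgftD[OF emgft_all[OF that], of "step n" j]])
    (use Q measurable_X[of "step n" j] in \<open>auto simp: indicator_def\<close>)
 have nn: "0 <= ?I \<sigma>' n" for \<sigma>' n by (intro integral_nonneg_AE) auto
 have split: "real (Suc n) * ?I \<sigma>' n <= exp (\<sigma>' * a) * (real (Suc n) * prob (Q n)) + exp (- (s - \<sigma>') * a) * C" if a: "0 <= a" for a n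
 proof -
  have "?I \<sigma>' n <= (\<integral>w. exp (\<sigma>' * a) * indicator (Q n) w + exp (- (s - \<sigma>') * a) * (indicator (Q n) w * exp (s * X (step n) w)) \<partial>P j)"
  proof (rule integral_mono[OF int[OF e']])
   show "integrable (P j) (%w. exp (\<sigma>' * a) * indicator (Q n) w + exp (- (s - \<sigma>') * a) * (indicator (Q n) w * exp (s * X (step n) w)))"
    using Q[of n] by (intro Bochner_Integration.integrable_add integrable_mult_right int[OF e]) (auto simp: emeasure_eq_measure)
   fix w
   have "exp (\<sigma>' * x) <= exp (\<sigma>' * a) + exp (- (s - \<sigma>') * a) * exp (s * x)" for x
   proof (cases "x <= a")
    case True
    then have "exp (\<sigma>' * x) <= exp (\<sigma>' * a)" using z by (auto intro: mult_left_mono)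
    then show ?thesis by (simp add: add_increasing2)
   next
    case False
    have "(s - \<sigma>') * a <= (s - \<sigma>') * x" using False z by (intro mult_left_mono) auto
    then have "exp (\<sigma>' * x) <= exp (- (s - \<sigma>') * a + s * x)" by (simp add: algebra_simps)
    then show ?thesis by (simp only: exp_add) (simp add: add_increasing)
   qed
   then show "indicator (Q n) w * exp (\<sigma>' * X (step n) w) <= exp (\<sigma>' * a) * indicator (Q n) w + exp (- (s - \<sigma>') * a) * (indicator (Q n) w * exp (s * X (step n) w))"
    by (auto simp: indicator_def)
  qed
  also have "\<dots> = exp (\<sigma>' * a) * prob (Q n) + exp (- (s - \<sigma>') * a) * ?I s n"
   using Q[of n] int[OF e, of n] by (subst Bochner_Integration.integral_add) (auto simp: emeasure_eq_measure)
  finally have "real (Suc n) * ?I \<sigma>' n <= real (Suc n) * (exp (\<sigma>' * a) * prob (Q n) + exp (- (s - \<sigma>') * a) * ?I s n)"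
   by (intro mult_left_mono) auto
  also have "\<dots> = exp (\<sigma>' * a) * (real (Suc n) * prob (Q n)) + exp (- (s - \<sigma>') * a) * (real (Suc n) * ?I s n)"
   by (simp only: distrib_left mult.left_commute)
  also have "\<dots> <= exp (\<sigma>' * a) * (real (Suc n) * prob (Q n)) + exp (- (s - \<sigma>') * a) * C"
   using C[of n] by (intro add_left_mono mult_left_mono) auto
  finally show ?thesis .
 qed
 have "((%a. exp (- (s - \<sigma>') * a) * C) \<longlongrightarrow> 0 * C) at_top"
 proof (intro tendsto_intros filterlim_compose[OF exp_at_bot])
  show "LIM a at_top. - (s - \<sigma>') * a :> at_bot"
   using z by (intro filterlim_tendsto_neg_mult_at_bot[OF tendsto_const] filterlim_ident) auto
 qed
 then have "\<forall>\<^sub>F a in at_top. exp (- (s - \<sigma>') * a) * C < \<epsilon> / 2"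
  using ep by (intro order_tendstoD(2)[where y = 0]) auto
 then have "\<forall>\<^sub>F a in at_top. exp (- (s - \<sigma>') * a) * C < \<epsilon> / 2 \<and> 0 <= a"
  using eventually_ge_at_top[of 0] by eventually_elim auto
 then obtain a where a: "exp (- (s - \<sigma>') * a) * C < \<epsilon> / 2" "0 <= a" by (auto dest!: eventually_happens)
 have "(%n. exp (\<sigma>' * a) * (real (Suc n) * prob (Q n))) \<longlonglongrightarrow> exp (\<sigma>' * a) * 0" by (intro tendsto_intros p)
 then have "\<forall>\<^sub>F n in sequentially. exp (\<sigma>' * a) * (real (Suc n) * prob (Q n)) < \<epsilon> / 2"
  using ep by (intro order_tendstoD(2)[where y = 0]) auto
 then show "\<forall>\<^sub>F n in sequentially. dist (real (Suc n) * ?I \<sigma>' n) 0 < \<epsilon>"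
 proof eventually_elim
  case (elim n)
  have "real (Suc n) * ?I \<sigma>' n < \<epsilon>" using split[OF a(2), of n] elim a(1) by linarith
  moreover have "0 <= real (Suc n) * ?I \<sigma>' n" by (intro mult_nonneg_nonneg nn) simp
  ultimately show ?case by (simp add: dist_norm)
 qed
qed

lemma step_tendsto: "step \<longlonglongrightarrow> 0" by real_asymp

lemma p_step_deriv: "(%n. real (Suc n) * (p (step n) i k - (if i = k then 1 else 0))) \<longlonglongrightarrow> G$i$k"
 using p_deriv[OF step_tendsto _ zero_less_one, of i k] by (simp add: mult.commute)

lemma exp_step_deriv: "(%n. of_real (real (Suc n)) * (exp (of_real (step n) * w) - 1)) \<longlonglongrightarrow> w" for w :: complex
proof -
 have "((%h. exp (h * w)) has_field_derivative w) (at 0)"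
  by (auto intro!: derivative_eq_intros)
 then have "((%h. (exp (h * w) - 1) / h) \<longlongrightarrow> w) (at 0)"
  unfolding has_field_derivative_iff by simp
 moreover have "filterlim (%n. complex_of_real (step n)) (at 0) sequentially"
  unfolding filterlim_at using tendsto_of_real[OF step_tendsto, where 'a = complex] by (auto intro!: always_eventually simp del: of_nat_Suc)
 ultimately have "(%n. (exp (complex_of_real (step n) * w) - 1) / complex_of_real (step n)) \<longlonglongrightarrow> w" by (rule filterlim_compose)
 then show ?thesis by (simp add: mult.commute)
qed

lemma Ups_diag: "Ups j j z = 1"
proof -
 have "\<rho> j j = 0" using no_transition[of j j] by simp
 interpret U: real_distribution "U j j" by (rule jump_sizes)
 have sp: "(%b. if b then U j j else return borel 0) \<in> measurable (count_space UNIV) (subprob_algebra borel)"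
  by (auto simp: space_subprob_algebra U.subprob_space_axioms subprob_space_return)
 have "measure_pmf (bernoulli_pmf 0) = return (count_space UNIV) False"
 proof -
  have "bernoulli_pmf 0 = return_pmf False" by (rule pmf_eqI) (auto simp: indicator_def split: bool.split)
  then show ?thesis by (simp add: return_pmf.rep_eq)
 qed
 then have "transition_jump_law (\<rho> j j) (U j j) = return borel 0"
  unfolding transition_jump_law_def \<open>\<rho> j j = 0\<close> using bind_return[OF sp, of False] by simp
 then show ?thesis unfolding transition_jump_mgf_def by (simp add: integral_return)
qed

text \<open>Split according to no jump, one jump, and the rest. The diagonal gives the Levy exponent and the rate of leaving, one jump
gives \<open>g_{jk} E exp (z V_{jk})\<close>, and the rest is negligible because moments of slightly higher order are finite.\<close>

theorem generator_limit:
 assumes e: "emgf s" and z: "0 <= Re z" "Re z < s"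
 shows "(%n. of_real (real (Suc n)) * (cM z (step n) - mat 1)$j$k) \<longlonglongrightarrow> Mx z$j$k"
proof -
 interpret prob_space "P j" by (rule prob_space_P)
 have ez: "emgf (Re z)" using emgf_mono[OF e z(1)] z by simp
 have s0: "0 < step n" "0 <= step n" for n by auto
 obtain C where C: "\<And>n j k. j \<noteq> k ==> real (Suc n) * rM s (step n)$j$k <= C"
  "\<And>n j. real (Suc n) * (rM s (step n)$j$j - (\<integral>w. indicator (no_jump j j (step n)) w * exp (s * X (step n) w) \<partial>P j)) <= C"
  using rM_step_bounds[OF e] by blast
 let ?J = "%n k. {w \<in> space (P j). J (step n) w = k}"
 have Jev[measurable]: "?J n k \<in> events" for n k by (rule J_event) simp
 have Xm[measurable]: "X (step n) \<in> borel_measurable (P j)" for n by (rule measurable_X) simp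
 have rint: "integrable (P j) (%w. indicator A w * exp (s' * X (step n) w))" if "A \<in> events" "emgf s'" for A n s'
  by (rule Bochner_Integration.integrable_bound[OF emgftD[OF emgft_all[OF that(2)], of "step n" j]])
    (use that in \<open>auto simp: indicator_def\<close>)
 have cint: "integrable (P j) (%w. indicator A w * exp (z * of_real (X (step n) w)))" if "A \<in> events" for A n
  by (rule Bochner_Integration.integrable_bound[OF emgftD[OF emgft_all[OF ez], of "step n" j]])
    (use that in \<open>auto simp: indicator_def\<close>)
 have cMJ: "cM z (step n)$j$k = (\<integral>w. indicator (?J n k) w * exp (z * of_real (X (step n) w)) \<partial>P j)" for n k
  unfolding cM_def vec_lambda_beta by (intro Bochner_Integration.integral_cong) (auto simp: indicator_def)
 have rMJ: "rM s' (step n)$j$k = (\<integral>w. indicator (?J n k) w * exp (s' * X (step n) w) \<partial>P j)" for n k s'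
  unfolding rM_def vec_lambda_beta by (intro Bochner_Integration.integral_cong) (auto simp: indicator_def)
 have rest: "(%n. of_real (real (Suc n)) * (\<integral>w. indicator (Q n) w * exp (z * of_real (X (step n) w)) \<partial>P j)) \<longlonglongrightarrow> 0"
  if Q: "\<And>n. Q n \<in> events" and p: "(%n. real (Suc n) * prob (Q n)) \<longlonglongrightarrow> 0"
   and C: "\<And>n. real (Suc n) * (\<integral>w. indicator (Q n) w * exp (s * X (step n) w) \<partial>P j) <= C" for Q
 proof (rule Lim_null_comparison[OF always_eventually rest_tendsto_0[OF e z Q p C]], rule allI)
  fix n
  have "norm (\<integral>w. indicator (Q n) w * exp (z * of_real (X (step n) w)) \<partial>P j) <= (\<integral>w. norm (indicator (Q n) w * exp (z * of_real (X (step n) w))) \<partial>P j)"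
   by (rule integral_norm_bound)
  also have "\<dots> = (\<integral>w. indicator (Q n) w * exp (Re z * X (step n) w) \<partial>P j)"
   by (intro Bochner_Integration.integral_cong) (auto simp: norm_mult indicator_def)
  finally show "norm (of_real (real (Suc n)) * (\<integral>w. indicator (Q n) w * exp (z * of_real (X (step n) w)) \<partial>P j))
    <= real (Suc n) * (\<integral>w. indicator (Q n) w * exp (Re z * X (step n) w) \<partial>P j)"
   unfolding norm_mult norm_of_real by (simp add: mult_left_mono)
 qed
 have csplit: "(\<integral>w. indicator B w * exp (z * of_real (X (step n) w)) \<partial>P j) =
   (\<integral>w. indicator A w * exp (z * of_real (X (step n) w)) \<partial>P j) + (\<integral>w. indicator (B - A) w * exp (z * of_real (X (step n) w)) \<partial>P j)"
  if "A \<in> events" "B \<in> events" "A \<subseteq> B" for A B n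
 proof -
  have "(\<integral>w. indicator B w * exp (z * of_real (X (step n) w)) \<partial>P j) =
   (\<integral>w. indicator A w * exp (z * of_real (X (step n) w)) + indicator (B - A) w * exp (z * of_real (X (step n) w)) \<partial>P j)"
   using that by (intro Bochner_Integration.integral_cong) (auto simp: indicator_def)
  then show ?thesis using cint[OF that(1)] cint[OF sets.Diff[OF that(2,1)]] by simp
 qed
 have rsplit: "(\<integral>w. indicator (B - A) w * exp (s * X (step n) w) \<partial>P j) =
   (\<integral>w. indicator B w * exp (s * X (step n) w) \<partial>P j) - (\<integral>w. indicator A w * exp (s * X (step n) w) \<partial>P j)"
  if "A \<in> events" "B \<in> events" "A \<subseteq> B" for A B n
 proof -
  have "(\<integral>w. indicator (B - A) w * exp (s * X (step n) w) \<partial>P j) =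
   (\<integral>w. indicator B w * exp (s * X (step n) w) - indicator A w * exp (s * X (step n) w) \<partial>P j)"
   using that by (intro Bochner_Integration.integral_cong) (auto simp: indicator_def)
  then show ?thesis using rint[OF that(1) e] rint[OF that(2) e] by simp
 qed
 show ?thesis
 proof (cases "j = k")
  case False
  then have pd: "(%n. real (Suc n) * p (step n) j k) \<longlonglongrightarrow> G$j$k" using p_step_deriv[of j k] by simp
  have G0: "0 <= G$j$k" using generator False unfolding irreducible_generator_def by blast
  have me: "Mx z$j$k = of_real (G$j$k) * Ups j k z" using False by (simp add: matrix_exponent_def)
  have ent: "(cM z (step n) - mat 1)$j$k = cM z (step n)$j$k" for n using False by (simp add: mat_1_entry)
  show ?thesis
  proof (cases "G$j$k = 0")
   case True
   have "(%n. of_real (real (Suc n)) * cM z (step n)$j$k) \<longlonglongrightarrow> 0"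
    unfolding cMJ
    by (rule rest) (use pd True C(1)[OF False] in \<open>auto simp: p_def[symmetric] rMJ[symmetric] simp del: of_nat_Suc\<close>)
   then show ?thesis unfolding ent me using True by simp
  next
   case nz: False
   then have G: "0 < G$j$k" using G0 by simp
   let ?O = "%n. one_jump j j k (step n)"
   have Oev: "?O n \<in> events" for n by (rule event_P) simp
   have Osub: "?O n \<subseteq> ?J n k" for n by (rule one_jump_subset)
   have Ople: "prob (?O n) <= p (step n) j k" for n
    unfolding p_def using Osub Jev by (intro finite_measure_mono) auto
   let ?m = "min (G$j$j) (G$k$k)"
   have low: "G$j$k * (1 + step n * ?m) <= real (Suc n) * prob (?O n)" for n
   proof -
    have "real (Suc n) * (step n * G$j$k * (1 + step n * ?m)) <= real (Suc n) * prob (?O n)"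
     by (intro mult_left_mono one_jump_prob_ge[OF s0(1) False]) auto
    then show ?thesis by simp
   qed
   have Olim: "(%n. real (Suc n) * prob (?O n)) \<longlonglongrightarrow> G$j$k"
   proof (rule tendsto_sandwich[OF always_eventually always_eventually _ pd])
    show "\<forall>n. G$j$k * (1 + step n * ?m) <= real (Suc n) * prob (?O n)" using low by blast
    show "\<forall>n. real (Suc n) * prob (?O n) <= real (Suc n) * p (step n) j k" using Ople by (auto intro: mult_left_mono)
    have "(%n. G$j$k * (1 + step n * ?m)) \<longlonglongrightarrow> G$j$k * (1 + 0 * ?m)" by (intro tendsto_intros step_tendsto)
    then show "(%n. G$j$k * (1 + step n * ?m)) \<longlonglongrightarrow> G$j$k" by simp
   qed
   have Qlim: "(%n. real (Suc n) * prob (?J n k - ?O n)) \<longlonglongrightarrow> 0"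
   proof -
    have "prob (?J n k - ?O n) = p (step n) j k - prob (?O n)" for n
     unfolding p_def by (rule finite_measure_Diff[OF Jev Oev Osub])
    then have "(%n. real (Suc n) * prob (?J n k - ?O n)) = (%n. real (Suc n) * p (step n) j k - real (Suc n) * prob (?O n))"
     by (simp add: right_diff_distrib)
    then show ?thesis using tendsto_diff[OF pd Olim] by simp
   qed
   have r0: "(%n. of_real (real (Suc n)) * (\<integral>w. indicator (?J n k - ?O n) w * exp (z * of_real (X (step n) w)) \<partial>P j)) \<longlonglongrightarrow> 0"
   proof (rule rest[OF _ Qlim])
    fix n
    have "(\<integral>w. indicator (?J n k - ?O n) w * exp (s * X (step n) w) \<partial>P j) <= rM s (step n)$j$k"
     unfolding rsplit[OF Oev Jev Osub] rMJ by (simp add: integral_nonneg_AE)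
    then have "real (Suc n) * (\<integral>w. indicator (?J n k - ?O n) w * exp (s * X (step n) w) \<partial>P j) <= real (Suc n) * rM s (step n)$j$k"
     by (intro mult_left_mono) auto
    then show "real (Suc n) * (\<integral>w. indicator (?J n k - ?O n) w * exp (s * X (step n) w) \<partial>P j) <= C" using C(1)[OF False, of n] by linarith
   qed (use Oev in auto)
   let ?T = "%n. \<integral>w. indicator (?O n) w * exp (z * of_real (X (step n) w)) \<partial>P j"
   let ?c = "norm (psi j z) + norm (psi k z)"
   have T0: "(%n. of_real (real (Suc n)) * (?T n - Ups j k z * of_real (prob (?O n)))) \<longlonglongrightarrow> 0"
   proof (rule Lim_null_comparison[OF always_eventually], rule allI)
    fix n
    show "norm (of_real (real (Suc n)) * (?T n - Ups j k z * of_real (prob (?O n)))) \<le>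
      norm (Ups j k z) * (real (Suc n) * prob (?O n)) * (exp (step n * ?c) - 1)"
     using mult_left_mono[OF one_jump_transform[OF e z s0(1) False G, of n], of "real (Suc n)"]
     by (simp only: norm_mult norm_of_real abs_of_nat of_nat_0_le_iff mult.assoc mult.left_commute)
    have "(%n. norm (Ups j k z) * (real (Suc n) * prob (?O n)) * (exp (step n * ?c) - 1)) \<longlonglongrightarrow> norm (Ups j k z) * G$j$k * (exp (0 * ?c) - 1)"
     by (intro tendsto_intros Olim step_tendsto)
    then show "(%n. norm (Ups j k z) * (real (Suc n) * prob (?O n)) * (exp (step n * ?c) - 1)) \<longlonglongrightarrow> 0" by simp
   qed
   have "(%n. of_real (real (Suc n)) * (?T n - Ups j k z * of_real (prob (?O n))) + Ups j k z * of_real (real (Suc n) * prob (?O n)) +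
     of_real (real (Suc n)) * (\<integral>w. indicator (?J n k - ?O n) w * exp (z * of_real (X (step n) w)) \<partial>P j))
     \<longlonglongrightarrow> 0 + Ups j k z * of_real (G$j$k) + 0"
    by (intro tendsto_intros T0 Olim r0)
   moreover have "of_real (real (Suc n)) * (?T n - Ups j k z * of_real (prob (?O n))) + Ups j k z * of_real (real (Suc n) * prob (?O n)) +
     of_real (real (Suc n)) * (\<integral>w. indicator (?J n k - ?O n) w * exp (z * of_real (X (step n) w)) \<partial>P j)
     = of_real (real (Suc n)) * cM z (step n)$j$k" for n
    unfolding cMJ csplit[OF Oev Jev Osub] by (simp add: algebra_simps del: of_nat_Suc)
   ultimately show ?thesis unfolding ent me by (simp add: mult.commute)
  qed
 next
  case True
  let ?N = "%n. no_jump j j (step n)"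
  have Nev: "?N n \<in> events" for n by (rule event_P) simp
  have Nsub: "?N n \<subseteq> ?J n j" for n by (rule no_jump_subset)
  have pd: "(%n. real (Suc n) * (p (step n) j j - 1)) \<longlonglongrightarrow> G$j$j" using p_step_deriv[of j j] by simp
  have Nple: "prob (?N n) <= p (step n) j j" for n
   unfolding p_def using Nsub Jev by (intro finite_measure_mono) auto
  have Nlim: "(%n. real (Suc n) * (prob (?N n) - 1)) \<longlonglongrightarrow> G$j$j"
  proof (rule tendsto_sandwich[OF always_eventually always_eventually _ pd])
   show "\<forall>n. real (Suc n) * (exp (step n * G$j$j) - 1) <= real (Suc n) * (prob (?N n) - 1)"
    using no_jump_prob_ge[OF s0(1)] by (auto intro!: mult_left_mono)
   show "\<forall>n. real (Suc n) * (prob (?N n) - 1) <= real (Suc n) * (p (step n) j j - 1)" using Nple by (auto intro!: mult_left_mono)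
   show "(%n. real (Suc n) * (exp (step n * G$j$j) - 1)) \<longlonglongrightarrow> G$j$j" by real_asymp
  qed
  have Qlim: "(%n. real (Suc n) * prob (?J n j - ?N n)) \<longlonglongrightarrow> 0"
  proof -
   have "prob (?J n j - ?N n) = (p (step n) j j - 1) - (prob (?N n) - 1)" for n
    unfolding p_def using finite_measure_Diff[OF Jev Nev Nsub] by simp
   then have "(%n. real (Suc n) * prob (?J n j - ?N n)) = (%n. real (Suc n) * (p (step n) j j - 1) - real (Suc n) * (prob (?N n) - 1))"
    by (simp add: right_diff_distrib)
   then show ?thesis using tendsto_diff[OF pd Nlim] by simp
  qed
  have r0: "(%n. of_real (real (Suc n)) * (\<integral>w. indicator (?J n j - ?N n) w * exp (z * of_real (X (step n) w)) \<partial>P j)) \<longlonglongrightarrow> 0"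
  proof (rule rest[OF _ Qlim])
   fix n
   show "real (Suc n) * (\<integral>w. indicator (?J n j - ?N n) w * exp (s * X (step n) w) \<partial>P j) <= C"
    using C(2)[of n j] unfolding rsplit[OF Nev Jev Nsub] rMJ .
  qed (use Nev in auto)
  let ?\<psi> = "psi j z"
  have ex: "(%n. exp (of_real (step n) * ?\<psi>)) \<longlonglongrightarrow> exp (of_real 0 * ?\<psi>)" by (intro tendsto_intros step_tendsto)
  have "(%n. of_real (real (Suc n) * (prob (?N n) - 1)) * exp (of_real (step n) * ?\<psi>) +
    of_real (real (Suc n)) * (exp (of_real (step n) * ?\<psi>) - 1) +
    of_real (real (Suc n)) * (\<integral>w. indicator (?J n j - ?N n) w * exp (z * of_real (X (step n) w)) \<partial>P j))
    \<longlonglongrightarrow> of_real (G$j$j) * exp (of_real 0 * ?\<psi>) + ?\<psi> + 0"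
   by (intro tendsto_add tendsto_mult tendsto_of_real Nlim ex exp_step_deriv r0)
  moreover have "of_real (real (Suc n) * (prob (?N n) - 1)) * exp (of_real (step n) * ?\<psi>) +
    of_real (real (Suc n)) * (exp (of_real (step n) * ?\<psi>) - 1) +
    of_real (real (Suc n)) * (\<integral>w. indicator (?J n j - ?N n) w * exp (z * of_real (X (step n) w)) \<partial>P j)
    = of_real (real (Suc n)) * (cM z (step n) - mat 1)$j$j" for n
   unfolding vector_minus_component cMJ csplit[OF Nev Jev Nsub] no_jump_transform[OF ez s0(1)]
   by (simp add: mat_1_entry algebra_simps del: of_nat_Suc)
  ultimately show ?thesis using True by (simp add: matrix_exponent_def Ups_diag)
 qed
qed

end

section \<open>Exponential moments beyond the critical exponent\<close>

lemma matpow_of_real: "matpow (\<chi> j k. complex_of_real (M$j$k)) n$a$b = of_real (matpow M n$a$b)"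
 by (induction n arbitrary: a b) (auto simp: mat_1_entry matrix_mult_entry)

lemma matrix_exponential_series_holomorphic:
 fixes F :: "complex => complex^'n^'n"
 assumes S: "open S" and F: "\<And>j k. (%z. F z$j$k) holomorphic_on S"
 shows "(%z. \<Sum>i. matpow (F z) i$j$k / fact i) holomorphic_on S"
proof (rule holomorphic_uniform_sequence[OF S, where f = "%n z. \<Sum>i<n. matpow (F z) i$j$k / fact i"])
 have pw: "(%z. matpow (F z) i$j$k) holomorphic_on S" for i j k
  by (induction i arbitrary: j k) (auto simp: mat_1_entry matrix_mult_entry intro!: holomorphic_intros F)
 show "(%z. \<Sum>i<n. matpow (F z) i$j$k / fact i) holomorphic_on S" for n
  by (intro holomorphic_intros pw) auto
 fix z assume "z \<in> S"
 then obtain d where d: "0 < d" "cball z d \<subseteq> S" using S open_contains_cball by blast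
 have "continuous_on (cball z d) (%w. \<Sum>k\<in>UNIV. \<Sum>j\<in>UNIV. norm (F w$j$k))"
  by (intro continuous_intros holomorphic_on_imp_continuous_on holomorphic_on_subset[OF F d(2)])
 then have "compact ((%w. \<Sum>k\<in>UNIV. \<Sum>j\<in>UNIV. norm (F w$j$k)) ` cball z d)" by (intro compact_continuous_image) auto
 from compact_imp_bounded[OF this] obtain c where c: "\<And>w. w \<in> cball z d ==> norm (\<Sum>k\<in>UNIV. \<Sum>j\<in>UNIV. norm (F w$j$k)) <= c"
  unfolding bounded_iff by blast
 have row: "(\<Sum>k\<in>UNIV. norm (F w$j$k)) <= c" if "w \<in> cball z d" for w j
 proof -
  have "(\<Sum>k\<in>UNIV. norm (F w$j$k)) <= (\<Sum>k\<in>UNIV. \<Sum>j\<in>UNIV. norm (F w$j$k))"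
   by (intro sum_mono member_le_sum[where f = "%j. norm (F w$j$k)" for k]) auto
  then show ?thesis using c[OF that] by simp
 qed
 have "uniform_limit (cball z d) (%n w. \<Sum>i<n. matpow (F w) i$j$k / fact i) (%w. \<Sum>i. matpow (F w) i$j$k / fact i) sequentially"
 proof (rule Weierstrass_m_test)
  show "norm (matpow (F w) n$j$k / fact n) <= c ^ n / fact n" if "w \<in> cball z d" for n w
   using matpow_entry_le[of "F w" c n j k, OF row[OF that]] by (simp add: norm_divide divide_right_mono)
  show "summable (%n. c ^ n / fact n)" using summable_exp[of c] by (simp add: field_simps)
 qed
 then show "\<exists>d>0. cball z d \<subseteq> S \<and> uniform_limit (cball z d) (%n w. \<Sum>i<n. matpow (F w) i$j$k / fact i) (%w. \<Sum>i. matpow (F w) i$j$k / fact i) sequentially"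
  using d by blast
qed

lemma matrix_has_vector_derivative:
 fixes f :: "real => real^'n^'m"
 assumes "\<And>j k. ((%s. f s$j$k) has_real_derivative D$j$k) (at a)"
 shows "(f has_vector_derivative D) (at a)"
 unfolding has_vector_derivative_def
proof (subst has_derivative_componentwise_within, rule ballI)
 fix i :: "real^'n^'m" assume "i \<in> Basis"
 then obtain j k where i: "i = axis j (axis k 1)" by (auto simp: Basis_vec_def)
 have "((%s. f s$j$k) has_derivative (%h. h * D$j$k)) (at a)"
  using assms[of j k] unfolding has_field_derivative_def by (simp add: mult.commute[of _ "D$j$k"])
 then show "((%s. f s \<bullet> i) has_derivative (%h. (h *\<^sub>R D) \<bullet> i)) (at a)"
  by (simp add: i inner_axis)
qed

context markov_modulated_levy
begin

definition Am :: "real => real^'n^'n" where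
 "Am s = (\<chi> j k. Re (Mx (of_real s)$j$k))"

lemma Ups_real: "Ups j k (of_real s) = of_real (\<integral>x. exp (s * x) \<partial>transition_jump_law (\<rho> j k) (U j k))"
 unfolding transition_jump_mgf_def by (simp add: exp_of_real integral_complex_of_real del: of_real_mult flip: of_real_mult)

lemma psi_real: "psi j (of_real s) = of_real (Re (psi j (of_real s)))"
proof -
 have eq: "exp (complex_of_real s * of_real x) - 1 - of_real s * of_real x * of_real (indicator {-1..1} x)
   = of_real (exp (s * x) - 1 - s * x * indicator {-1..1} x)" for x by (simp add: exp_of_real flip: of_real_mult)
 have "psi j (of_real s) = of_real (\<mu> j * s + (\<sigma> j)\<^sup>2 * s\<^sup>2 / 2 + (\<integral>x. (exp (s * x) - 1 - s * x * indicator {-1..1} x) \<partial>\<nu> j))"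
  unfolding levy_exponent_def eq integral_complex_of_real by simp
 then show ?thesis by (metis Re_complex_of_real)
qed

lemma Am_entry: "Am s$j$k = G$j$k * Re (Ups j k (of_real s)) + (if j = k then Re (psi j (of_real s)) else 0)"
 unfolding Am_def matrix_exponent_def by simp

lemma matrix_exponent_real: "Mx (of_real s)$j$k = of_real (Am s$j$k)"
 unfolding Am_entry matrix_exponent_def using Ups_real[of j k s] psi_real[of j s] by (auto simp: complex_eq_iff)

lemma G_offdiag: "j \<noteq> k ==> 0 <= G$j$k" using generator unfolding irreducible_generator_def by blast

lemma Am_offdiag: assumes "j \<noteq> k" shows "0 <= Am s$j$k"
 unfolding Am_entry Ups_real using G_offdiag[OF assms] assms by (auto intro!: mult_nonneg_nonneg integral_nonneg_AE)

lemma Ups_pos: assumes "emgf s" "0 <= s" "j \<noteq> k" "0 < G$j$k" shows "0 < Re (Ups j k (of_real s))"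
proof -
 interpret prob_space "P j" by (rule prob_space_P)
 have "0 < expectation (%w. exp (s * V j k 0 w))"
  by (rule expectation_greater[OF jump_exp_integrable[OF assms, of j 0]]) auto
 then show ?thesis unfolding Ups_real by (subst (asm) V_integral(2)) auto
qed

lemma Am_irreducible: assumes e: "emgf s" "0 <= s" shows "(j, k) \<in> {(a, b). a \<noteq> b \<and> 0 < Am s$a$b}\<^sup>*"
proof -
 have "{(a, b). a \<noteq> b \<and> 0 < G$a$b} \<subseteq> {(a, b). a \<noteq> b \<and> 0 < Am s$a$b}"
  using Ups_pos[OF e] by (auto simp: Am_entry)
 from rtrancl_mono[OF this] show ?thesis using generator unfolding irreducible_generator_def by blast
qed

lemma rM_step_limit:
 assumes e: "emgf s0" and s: "0 <= s" "s < s0"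
 shows "(%n. real (Suc n) * (rM s (step n) - mat 1)$j$k) \<longlonglongrightarrow> Am s$j$k"
proof -
 have "of_real (real (Suc n)) * (cM (of_real s) (step n) - mat 1)$j$k = of_real (real (Suc n) * (rM s (step n) - mat 1)$j$k)" for n
  by (simp add: cM_of_real mat_1_entry del: of_nat_Suc)
 then show ?thesis using tendsto_Re[OF generator_limit[OF e, of "of_real s" j k]] s
  by (simp only: matrix_exponent_real Re_complex_of_real)
qed

lemma rM_one_step: assumes "emgf s" shows "matpow (rM s (step n)) (Suc n) = rM s 1"
 using rM_power[OF assms, of "step n" "Suc n"] by simp

text \<open>The \<open>n\<close>-th power of the step matrix is constant in \<open>n\<close>, and by the generator limit it tends to the exponential.\<close>

lemma mexp_Am_shift:
 assumes e: "emgf s0" and s: "0 <= s" "s < s0"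
 shows "mexp (c *\<^sub>R mat 1 + Am s)$j$k = exp c * rM s 1$j$k"
proof -
 have es: "emgf s" using emgf_mono[OF e] s by simp
 have ex: "(%n. real (Suc n) * (exp (c * step n) - 1)) \<longlonglongrightarrow> c" by real_asymp
 have e1: "(%n. exp (c * step n)) \<longlonglongrightarrow> 1" by real_asymp
 have lim: "(%n. real (Suc n) * (exp (c * step n) *\<^sub>R rM s (step n) - mat 1)$a$b) \<longlonglongrightarrow> (c *\<^sub>R mat 1 + Am s)$a$b" for a b
 proof -
  have "(%n. exp (c * step n) * (real (Suc n) * (rM s (step n) - mat 1)$a$b) + real (Suc n) * (exp (c * step n) - 1) * mat 1$a$b)
    \<longlonglongrightarrow> 1 * Am s$a$b + c * mat 1$a$b"
   by (intro tendsto_intros ex e1 rM_step_limit[OF e s])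
  moreover have "exp (c * step n) * (real (Suc n) * (rM s (step n) - mat 1)$a$b) + real (Suc n) * (exp (c * step n) - 1) * mat 1$a$b
    = real (Suc n) * (exp (c * step n) *\<^sub>R rM s (step n) - mat 1)$a$b" for n
   unfolding vector_minus_component vector_scaleR_component by (simp only: algebra_simps real_scaleR_def)
  ultimately show ?thesis by (simp add: add.commute)
 qed
 have eq: "matpow (exp (c * step n) *\<^sub>R rM s (step n)) (Suc n)$j$k = exp c * rM s 1$j$k" for n
  unfolding matpow_scaleR rM_one_step[OF es] by (simp add: exp_of_nat_mult[symmetric] del: power_Suc)
 have "(%n. exp c * rM s 1$j$k) \<longlonglongrightarrow> mexp (c *\<^sub>R mat 1 + Am s)$j$k"
  using mexp_limit[of "%n. exp (c * step n) *\<^sub>R rM s (step n)", OF lim, of j k] unfolding eq .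
 then show ?thesis using LIMSEQ_unique tendsto_const by blast
qed

lemma cM_one: "cM z 1$j$k = (\<integral>w. of_real (indicator {k} (J 1 w)) * exp (z * of_real (X 1 w)) \<partial>P j)"
 unfolding cM_def vec_lambda_beta by (intro Bochner_Integration.integral_cong) (auto simp: indicator_def)

text \<open>The exponential of the extended exponent is holomorphic near \<open>\<alpha>\<close> and agrees below \<open>\<alpha>\<close> with the moment generating function of \<open>X_1\<close>
on \<open>{J_1 = k}\<close>; Landau's theorem applies to each of these finite measures.\<close>

lemma emgf_beyond:
 assumes \<alpha>: "0 < \<alpha>" "emgf \<alpha>"
  and ext: "extends_holomorphically (MLx) (laplace_domain P X) {-\<alpha>..0}"
 obtains \<epsilon> where "0 < \<epsilon>" "emgf (\<alpha> + \<epsilon>)"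
proof -
 obtain S F where S: "open S" "complex_of_real ` {-\<alpha>..0} \<subseteq> S" and F: "\<And>j k. (%z. F z$j$k) holomorphic_on S"
  and FA: "\<And>z. z \<in> S ==> Re z \<in> laplace_domain P X ==> F z = MLx z"
  using ext unfolding extends_holomorphically_def by blast
 have "complex_of_real (-\<alpha>) \<in> S" using S(2) \<alpha> by (auto simp: image_subset_iff simp del: of_real_minus)
 then obtain d where d: "0 < d" "ball (complex_of_real (-\<alpha>)) d \<subseteq> S" using S(1) open_contains_ball by blast
 define r where "r = min d \<alpha>"
 have r: "0 < r" "r <= \<alpha>" "r <= d" using d \<alpha> by (auto simp: r_def)
 have mem: "- z \<in> S" if "z \<in> ball (complex_of_real \<alpha>) r" for z
 proof -
  have "dist (complex_of_real (-\<alpha>)) (- z) = dist (of_real \<alpha>) z" by (simp add: dist_minus)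
  then have "- z \<in> ball (complex_of_real (-\<alpha>)) d" using that r by simp
  then show ?thesis using d by blast
 qed
 let ?s = "\<alpha> + r / 2"
 have "integrable (P j) (%w. indicator {k} (J 1 w) * exp (?s * X 1 w))" for j k
 proof (rule mgf_extends_past_singularity[OF _ _ _ _ \<alpha>(1) r(1,2)])
  let ?H = "%z. \<Sum>i. matpow (F (- z)) i$j$k / fact i"
  interpret prob_space "P j" by (rule prob_space_P)
  have mJ: "(%w. indicator {k} (J 1 w) :: real) \<in> borel_measurable (P j)"
   by (rule measurable_compose[OF measurable_J]) auto
  show "X 1 \<in> borel_measurable (P j)" by (rule measurable_X) simp
  show "(%w. indicator {k} (J 1 w) :: real) \<in> borel_measurable (P j)" by (rule mJ)
  show "integrable (P j) (%w. indicator {k} (J 1 w) :: real)"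
   by (rule integrable_const_bound[of _ 1]) (use mJ in \<open>auto simp: indicator_def\<close>)
  show "integrable (P j) (%w. indicator {k} (J 1 w) * exp (s * X 1 w))" if "0 <= s" "s < \<alpha>" for s
   using integrable_rexp_J[of 1 s j k] emgft_all[OF emgf_mono[OF \<alpha>(2), of s], of 1] that by (simp add: mult.commute)
  show "?H holomorphic_on ball (of_real \<alpha>) r"
   by (rule matrix_exponential_series_holomorphic)
     (use mem in \<open>auto intro!: holomorphic_on_compose_gen[OF _ F, unfolded o_def] holomorphic_intros\<close>)
  show "?H (of_real s) = of_real (\<integral>w. indicator {k} (J 1 w) * exp (s * X 1 w) \<partial>P j)" if s: "\<alpha> - r < s" "s < \<alpha>" for s
  proof -
   have s0: "0 <= s" using s r by simp
   have "F (- of_real s) = MLx (- of_real s)"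
    using mem[of "of_real s"] s emgf_mono[OF \<alpha>(2), of s] s0 emgf_iff_mgf_domain
    by (intro FA) (auto simp: dist_real_def laplace_domain_def)
   then have "F (- of_real s) = (\<chi> j k. of_real (Am s$j$k))"
    by (simp add: matrix_laplace_exponent_def vec_eq_iff matrix_exponent_real)
   then have "?H (of_real s) = (\<Sum>i. of_real (matpow (Am s) i$j$k / fact i))"
    by (simp add: matpow_of_real)
   also have "\<dots> = of_real (mexp (Am s)$j$k)"
    by (rule sums_unique[symmetric]) (rule sums_of_real[OF mexp_sums])
   also have "mexp (Am s)$j$k = rM s 1$j$k"
    using mexp_Am_shift[OF \<alpha>(2) s0 s(2), of 0 j k] by simp
   finally show ?thesis unfolding rM_def vec_lambda_beta by (simp add: mult.commute)
  qed
 qed (use r \<alpha> in auto)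
 then have "integrable (P j) (%w. \<Sum>k\<in>UNIV. indicator {k} (J 1 w) * exp (?s * X 1 w))" for j
  by (intro Bochner_Integration.integrable_sum)
 then have "emgf ?s" unfolding emgf_def by (simp add: sum_distrib_right[symmetric] indicator_def)
 then show ?thesis using that[of "r / 2"] r by simp
qed

lemma cM_holomorphic:
 assumes e: "emgf s0"
 shows "(%z. cM z 1$j$k) holomorphic_on {z. 0 < Re z \<and> Re z < s0}"
 unfolding cM_one
proof (rule mgf_holomorphic)
 show "X 1 \<in> borel_measurable (P j)" by (rule measurable_X) simp
 show "(%w. indicator {k} (J 1 w) :: real) \<in> borel_measurable (P j)" by (rule measurable_compose[OF measurable_J]) auto
 show "integrable (P j) (%w. indicator {k} (J 1 w) * exp (s * X 1 w))" if "0 < s" "s < s0" for s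
  using integrable_rexp_J[of 1 s j k] emgft_all[OF emgf_mono[OF e, of s], of 1] that by (simp add: mult.commute)
qed simp

definition rM' :: "real => real^'n^'n" where
 "rM' s = (\<chi> j k. Re (deriv (%z. cM z 1$j$k) (of_real s)))"

lemma cM_has_derivative:
 assumes e: "emgf s0" and s: "0 < s" "s < s0"
 shows "((%z. cM z 1$j$k) has_field_derivative deriv (%z. cM z 1$j$k) (of_real s)) (at (of_real s))"
proof (rule holomorphic_derivI[OF cM_holomorphic[OF e]])
 show "open {z::complex. 0 < Re z \<and> Re z < s0}" by (intro open_Collect_conj open_Collect_less continuous_intros)
qed (use s in auto)

lemma rM_has_derivative:
 assumes e: "emgf s0" and s: "0 < s" "s < s0"
 shows "((%s. rM s 1$j$k) has_real_derivative rM' s$j$k) (at s)"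
proof -
 have "((%x. cM (of_real x) 1$j$k) has_vector_derivative deriv (%z. cM z 1$j$k) (of_real s)) (at s)"
  by (rule has_vector_derivative_real_field[OF cM_has_derivative[OF assms]])
 from bounded_linear.has_vector_derivative[OF bounded_linear_Re this] show ?thesis
  unfolding has_real_derivative_iff_has_vector_derivative rM'_def by (simp add: cM_of_real)
qed

lemma deriv_cM_real:
 assumes e: "emgf s0" and s: "0 < s" "s < s0"
 shows "deriv (%z. cM z 1$j$k) (of_real s) = of_real (rM' s$j$k)"
proof -
 have v: "((%x. cM (of_real x) 1$j$k) has_vector_derivative deriv (%z. cM z 1$j$k) (of_real s)) (at s)"
  by (rule has_vector_derivative_real_field[OF cM_has_derivative[OF assms]])
 have "((%x. Im (cM (of_real x) 1$j$k)) has_vector_derivative Im (deriv (%z. cM z 1$j$k) (of_real s))) (at s)"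
  by (rule bounded_linear.has_vector_derivative[OF bounded_linear_Im v])
 then have "((%x. 0::real) has_vector_derivative Im (deriv (%z. cM z 1$j$k) (of_real s))) (at s)"
  by (simp add: cM_of_real)
 moreover have "((%x. 0::real) has_vector_derivative 0) (at s)" by simp
 ultimately have "Im (deriv (%z. cM z 1$j$k) (of_real s)) = 0"
  by (rule vector_derivative_unique_at)
 then show ?thesis by (simp add: rM'_def complex_eq_iff)
qed

lemma discounted_exponential_eq:
 assumes e: "emgf s0" and s: "0 <= s" "s < s0" and q: "q < 1"
 shows "discounted_exponential q (MLx) (- s)$j$k = (1 - q) * rM s 1$j$k"
proof -
 have "(\<chi> j k. Re (MLx (complex_of_real (- s))$j$k)) = Am s"
  by (simp add: matrix_laplace_exponent_def Am_def)
 then show ?thesis using mexp_Am_shift[OF e s, of "ln (1 - q)" j k] q by (simp add: discounted_exponential_def)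
qed

lemma discounted_exponential_derivative:
 assumes e: "emgf s0" and s: "0 < s" "s < s0" and q: "q < 1"
 shows "vector_derivative (discounted_exponential q (MLx)) (at (- s)) = - ((1 - q) *\<^sub>R rM' s)"
proof (rule vector_derivative_at[OF matrix_has_vector_derivative])
 fix j k
 let ?B = "discounted_exponential q (MLx)"
 have "((%t. (1 - q) * rM (- t) 1$j$k) has_real_derivative (1 - q) * (rM' s$j$k * - 1)) (at (- s))"
  by (intro DERIV_cmult DERIV_chain2[where f = "%s. rM s 1$j$k"] derivative_eq_intros) (use rM_has_derivative[OF e s] in auto)
 then have "((%t. ?B t$j$k) has_real_derivative (1 - q) * (rM' s$j$k * - 1)) (at (- s))"
 proof (rule has_field_derivative_transform_within_open[of _ _ _ "{- s0<..<0}"])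
  show "(1 - q) * rM (- t) 1$j$k = ?B t$j$k" if "t \<in> {- s0<..<0}" for t
   using discounted_exponential_eq[OF e, of "- t" q j k] that q by simp
 qed (use s in auto)
 then show "((%t. ?B t$j$k) has_real_derivative (- ((1 - q) *\<^sub>R rM' s))$j$k) (at (- s))" by simp
qed

text \<open>Jensen for the concave power \<open>l\<close> of \<open>exp (s X_1) x(J_1)\<close>, whose mean is \<open>r x_j\<close>.\<close>

lemma rM_jensen:
 assumes es: "emgf s" and s: "0 < s" and x: "\<And>j. 0 < x$j" "\<And>j. (\<Sum>k\<in>UNIV. rM s 1$j$k * x$k) = r * x$j"
  and l: "0 <= l" "l <= 1" and r: "0 < r"
 shows "(\<Sum>k\<in>UNIV. rM (l * s) 1$j$k * x$k powr l) <= (r * x$j) powr l"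
proof -
 interpret prob_space "P j" by (rule prob_space_P)
 let ?f = "%w. \<Sum>k\<in>UNIV. x$k * (exp (s * X 1 w) * indicator {k} (J 1 w))"
 have fJ: "?f w = x$J 1 w * exp (s * X 1 w)" for w
  by (subst sum.remove[of _ "J 1 w"]) (auto simp: indicator_def intro!: sum.neutral)
 have i: "integrable (P j) (%w. x$k * (exp (s * X 1 w) * indicator {k} (J 1 w)))" for k
  using integrable_rexp_J[of 1 s j k] emgft_all[OF es, of 1] by simp
 have ex: "expectation ?f = r * x$j"
  unfolding x(2)[symmetric] by (subst Bochner_Integration.integral_sum[OF i]) (simp add: rM_def mult.commute)
 have fn: "0 <= ?f w" for w unfolding fJ using x(1)[of "J 1 w"] by simp
 have ls: "emgf (l * s)" using emgf_mono[OF es, of "l * s"] l s by (simp add: mult_left_le_one_le)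
 have i': "integrable (P j) (%w. x$k powr l * (exp (l * s * X 1 w) * indicator {k} (J 1 w)))" for k
  using integrable_rexp_J[of 1 "l * s" j k] emgft_all[OF ls, of 1] by simp
 have pw: "?f w powr l = (\<Sum>k\<in>UNIV. x$k powr l * (exp (l * s * X 1 w) * indicator {k} (J 1 w)))" for w
 proof -
  have "(\<Sum>k\<in>UNIV. x$k powr l * (exp (l * s * X 1 w) * indicator {k} (J 1 w))) = x$J 1 w powr l * exp (l * s * X 1 w)"
   by (subst sum.remove[of _ "J 1 w"]) (auto simp: indicator_def intro!: sum.neutral)
  then show ?thesis unfolding fJ using x(1)[of "J 1 w"] by (simp add: powr_mult exp_powr_real mult_ac)
 qed
 have "expectation (%w. ?f w powr l) <= expectation ?f powr l"
  by (rule jensen_powr(2)[OF Bochner_Integration.integrable_sum[OF i] fn _ l]) (use x r in \<open>simp add: ex\<close>)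
 also have "expectation (%w. ?f w powr l) = (\<Sum>k\<in>UNIV. rM (l * s) 1$j$k * x$k powr l)"
  unfolding pw by (subst Bochner_Integration.integral_sum[OF i']) (simp add: rM_def mult.commute)
 finally show ?thesis unfolding ex .
qed

text \<open>The function \<open>g\<close> of \<open>l\<close> below is nonpositive on \<open>[0, 1]\<close> and vanishes at \<open>1\<close>, so its derivative there is nonnegative. The weights
\<open>y_j x_j^{1-l}\<close> are chosen so that the logarithms of the entries of \<open>x\<close> cancel in this derivative, leaving
\<open>s y' M' x - r ln r (y' x)\<close>.\<close>

lemma perron_derivative_pos:
 assumes e: "emgf s0" and s: "0 < s" "s < s0"
  and x: "\<And>j. 0 < x$j" "\<And>j. (\<Sum>k\<in>UNIV. rM s 1$j$k * x$k) = r * x$j"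
  and y: "\<And>j. 0 < y$j" "\<And>k. (\<Sum>j\<in>UNIV. y$j * rM s 1$j$k) = r * y$k" and r: "1 < r"
 shows "0 < (\<Sum>j\<in>UNIV. \<Sum>k\<in>UNIV. y$j * rM' s$j$k * x$k)"
proof -
 have es: "emgf s" using emgf_mono[OF e] s by simp
 have jen: "(\<Sum>k\<in>UNIV. rM (l * s) 1$j$k * x$k powr l) <= (r * x$j) powr l" if "0 <= l" "l <= 1" for l j
  using rM_jensen[OF es s(1) x that] r by simp
 define g where "g l = (\<Sum>j\<in>UNIV. \<Sum>k\<in>UNIV. y$j * x$j powr (1 - l) * (rM (l * s) 1$j$k * x$k powr l)) - r powr l * (\<Sum>j\<in>UNIV. y$j * x$j)" for l
 have g_neg: "g l <= 0" if l: "0 <= l" "l <= 1" for l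
 proof -
  have "(\<Sum>j\<in>UNIV. \<Sum>k\<in>UNIV. y$j * x$j powr (1 - l) * (rM (l * s) 1$j$k * x$k powr l)) \<le>
    (\<Sum>j\<in>UNIV. y$j * x$j powr (1 - l) * (r * x$j) powr l)"
   unfolding sum_distrib_left[symmetric] by (intro sum_mono mult_left_mono jen l) (simp add: less_imp_le[OF y(1)])
  also have "\<dots> = (\<Sum>j\<in>UNIV. r powr l * (y$j * x$j))"
  proof (rule sum.cong[OF refl])
   fix j
   have "x$j powr (1 - l) * x$j powr l = x$j" using x(1)[of j] by (simp add: powr_add[symmetric])
   then show "y$j * x$j powr (1 - l) * (r * x$j) powr l = r powr l * (y$j * x$j)"
    using x(1)[of j] r by (simp add: powr_mult mult_ac)
  qed
  finally show ?thesis by (simp add: g_def sum_distrib_left)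
 qed
 have row: "(\<Sum>j\<in>UNIV. \<Sum>k\<in>UNIV. y$j * rM s 1$j$k * (x$k * ln (x$k))) = r * (\<Sum>k\<in>UNIV. y$k * (x$k * ln (x$k)))"
  using eigen_pairing[OF y(2), of "%k. x$k * ln (x$k)"] by (simp add: sum_distrib_left mult.assoc)
 have col: "(\<Sum>j\<in>UNIV. \<Sum>k\<in>UNIV. y$j * ln (x$j) * (rM s 1$j$k * x$k)) = r * (\<Sum>j\<in>UNIV. y$j * (x$j * ln (x$j)))"
  unfolding sum_distrib_left[symmetric] x(2) by (simp add: sum_distrib_left mult_ac)
 let ?D = "\<Sum>j\<in>UNIV. \<Sum>k\<in>UNIV. y$j * rM' s$j$k * x$k"
 have d1: "((%l. rM (l * s) 1$j$k) has_real_derivative rM' s$j$k * s) (at 1)" for j k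
  by (rule DERIV_chain2[where f = "%s. rM s 1$j$k"]) (use rM_has_derivative[OF e s] in \<open>auto intro!: derivative_eq_intros\<close>)
 have d2: "((%l. x$j powr (1 - l)) has_real_derivative - ln (x$j)) (at 1)" for j
  using x(1)[of j] by (auto intro!: derivative_eq_intros)
 have d3: "((%l. c powr l) has_real_derivative c * ln c) (at 1)" if "0 < c" for c :: real
  using that by (auto intro!: derivative_eq_intros)
 have trm: "((%l. y$j * x$j powr (1 - l) * (rM (l * s) 1$j$k * x$k powr l)) has_real_derivative
   (s * (y$j * rM' s$j$k * x$k) + y$j * rM s 1$j$k * (x$k * ln (x$k)) - y$j * ln (x$j) * (rM s 1$j$k * x$k))) (at 1)" for j k
  by (rule derivative_eq_intros d1 d2 d3 x refl)+ (use x(1)[of j] x(1)[of k] in \<open>simp add: algebra_simps\<close>)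
 have g': "(g has_real_derivative
   ((\<Sum>j\<in>UNIV. \<Sum>k\<in>UNIV. s * (y$j * rM' s$j$k * x$k) + y$j * rM s 1$j$k * (x$k * ln (x$k)) - y$j * ln (x$j) * (rM s 1$j$k * x$k))
   - r * ln r * (\<Sum>j\<in>UNIV. y$j * x$j))) (at 1)"
  unfolding g_def using r by (intro DERIV_diff DERIV_sum trm DERIV_cmult_right d3) auto
 have deq: "(\<Sum>j\<in>UNIV. \<Sum>k\<in>UNIV. s * (y$j * rM' s$j$k * x$k) + y$j * rM s 1$j$k * (x$k * ln (x$k)) - y$j * ln (x$j) * (rM s 1$j$k * x$k))
   = s * ?D"
  unfolding sum_subtractf sum.distrib row col by (simp add: sum_distrib_left)
 have g1: "g 1 = 0"
 proof -
  have "(\<Sum>j\<in>UNIV. y$j * (\<Sum>k\<in>UNIV. rM s 1$j$k * x$k)) = r * (\<Sum>j\<in>UNIV. y$j * x$j)"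
   unfolding x(2) by (simp add: sum_distrib_left mult_ac)
  moreover have "x$j powr (1 - 1) = 1" "x$j powr 1 = x$j" for j using x(1)[of j] by auto
  ultimately show ?thesis using r by (simp only: g_def mult_1 mult_1_right sum_distrib_left[symmetric]) simp
 qed
 have "0 <= s * ?D - r * ln r * (\<Sum>j\<in>UNIV. y$j * x$j)"
 proof (rule ccontr)
  assume "\<not> ?thesis"
  then obtain d where d: "0 < d" "\<And>h. 0 < h ==> h < d ==> g 1 < g (1 - h)"
   using DERIV_neg_dec_left[OF g'[unfolded deq]] by auto
  have "g 1 < g (1 - min 1 (d / 2))" using d by (intro d) auto
  then show False using g_neg[of "1 - min 1 (d / 2)"] g1 d by auto
 qed
 moreover have "0 < r * ln r * (\<Sum>j\<in>UNIV. y$j * x$j)"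
  using r x y by (intro mult_pos_pos sum_pos) auto
 ultimately have "0 < s * ?D" by linarith
 then show ?thesis using s by (simp add: zero_less_mult_iff)
qed

end

section \<open>Uniqueness, and lattice laws\<close>

lemma lattice_of_maximal_modulus:
 assumes \<mu>: "real_distribution \<mu>" and i: "integrable \<mu> (%x. exp (a * x))" and \<theta>: "\<theta> \<noteq> 0"
  and eq: "norm (\<integral>x. exp (Complex a \<theta> * of_real x) \<partial>\<mu>) = (\<integral>x. exp (a * x) \<partial>\<mu>)"
 shows "lattice_distribution \<mu>"
proof -
 interpret real_distribution \<mu> by (rule \<mu>)
 define I where "I = (\<integral>x. exp (Complex a \<theta> * of_real x) \<partial>\<mu>)"
 have ii: "integrable \<mu> (%x. exp (Complex a \<theta> * of_real x))"
  by (rule Bochner_Integration.integrable_bound[OF i]) auto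
 have "Re (exp (- \<i> * of_real (Arg I)) * I) = norm I"
 proof -
  have "I = of_real (norm I) * exp (\<i> * of_real (Arg I))"
   using Arg_eq[of I] by (cases "I = 0") auto
  then have "exp (- \<i> * of_real (Arg I)) * I = exp (- \<i> * of_real (Arg I)) * (of_real (norm I) * exp (\<i> * of_real (Arg I)))" by simp
  also have "\<dots> = of_real (norm I) * (exp (- \<i> * of_real (Arg I)) * exp (\<i> * of_real (Arg I)))" by (simp only: mult_ac)
  also have "\<dots> = of_real (norm I)" by (simp add: exp_minus)
  finally show ?thesis by simp
 qed
 then have n: "(\<integral>x. Re (exp (- \<i> * of_real (Arg I)) * exp (Complex a \<theta> * of_real x)) \<partial>\<mu>) = (\<integral>x. exp (a * x) \<partial>\<mu>)"
  using ii eq by (simp only: I_def integral_Re integrable_mult_right integral_mult_right_zero)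
 have re: "Re (exp (- \<i> * of_real (Arg I)) * exp (Complex a \<theta> * of_real x)) = exp (a * x) * cos (\<theta> * x - Arg I)" for x
  unfolding exp_add[symmetric] by (simp add: Re_exp)
 have ic: "integrable \<mu> (%x. exp (a * x) * cos (\<theta> * x - Arg I))"
  by (rule Bochner_Integration.integrable_bound[OF i]) (auto simp: abs_mult)
 have "(\<integral>x. exp (a * x) - exp (a * x) * cos (\<theta> * x - Arg I) \<partial>\<mu>) = 0"
  using n i ic unfolding re by simp
 then have "AE x in \<mu>. exp (a * x) - exp (a * x) * cos (\<theta> * x - Arg I) = 0"
  by (subst (asm) integral_nonneg_eq_0_iff_AE) (use i ic in auto)
 then have "AE x in \<mu>. \<exists>k::int. x = Arg I / \<theta> + 2 * pi / \<bar>\<theta>\<bar> * of_int k"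
 proof eventually_elim
  fix x assume "exp (a * x) - exp (a * x) * cos (\<theta> * x - Arg I) = 0"
  then have "cos (\<theta> * x - Arg I) = 1" by simp
  then obtain n :: int where "\<theta> * x - Arg I = of_int n * 2 * pi" by (auto simp: cos_one_2pi_int)
  then have "x = Arg I / \<theta> + 2 * pi / \<bar>\<theta>\<bar> * of_int (if \<theta> < 0 then - n else n)"
   using \<theta> by (auto simp: field_simps abs_if)
  then show "\<exists>k::int. x = Arg I / \<theta> + 2 * pi / \<bar>\<theta>\<bar> * of_int k" by blast
 qed
 then show ?thesis unfolding lattice_distribution_def using \<theta> by (intro exI[of _ "Arg I / \<theta>"] exI[of _ "2 * pi / \<bar>\<theta>\<bar>"]) auto
qed

text \<open>The values on the imaginary axis form the characteristic function, which determines the law.\<close>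

lemma nonlattice_mgf_law:
 assumes m: "is_mgf_of \<phi> m" and n: "nonlattice_mgf \<phi>"
 shows "\<not> lattice_distribution m"
proof -
 obtain m' where m': "is_mgf_of \<phi> m'" "\<not> lattice_distribution m'" using n unfolding nonlattice_mgf_def by blast
 have ch: "char k t = \<phi> (\<i> * of_real t)" if k: "is_mgf_of \<phi> k" for k t
 proof -
  interpret real_distribution k using k unfolding is_mgf_of_def by simp
  have "(\<integral>x. exp (\<i> * of_real t * complex_of_real x) \<partial>k) = \<phi> (\<i> * of_real t)"
   using k unfolding is_mgf_of_def by simp
  then show ?thesis by (simp add: char_def mult.assoc)
 qed
 have "m = m'"
 proof (rule Levy_uniqueness)
  show "real_distribution m" "real_distribution m'" using m m' unfolding is_mgf_of_def by auto
  show "char m = char m'" using ch[OF m] ch[OF m'(1)] by auto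
 qed
 then show ?thesis using m' by simp
qed

lemma lattice_unimodular:
 assumes m: "real_distribution m" "lattice_distribution m"
 obtains \<theta> where "\<theta> \<noteq> 0" "norm (\<integral>x. exp (\<i> * of_real \<theta> * complex_of_real x) \<partial>m) = 1"
proof -
 interpret real_distribution m by fact
 obtain a h where h: "0 < h" "AE x in m. \<exists>k::int. x = a + h * of_int k" using m(2) unfolding lattice_distribution_def by blast
 let ?\<theta> = "2 * pi / h"
 have "AE x in m. exp (\<i> * of_real ?\<theta> * complex_of_real x) = exp (\<i> * of_real ?\<theta> * of_real a)"
  using h(2)
 proof eventually_elim
  fix x assume "\<exists>k::int. x = a + h * of_int k"
  then obtain k :: int where x: "x = a + h * of_int k" by blast
  have "\<i> * of_real ?\<theta> * complex_of_real x = \<i> * of_real ?\<theta> * of_real a + of_int (2 * k) * pi * \<i>"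
   unfolding x using h by (simp add: field_simps)
  then show "exp (\<i> * of_real ?\<theta> * complex_of_real x) = exp (\<i> * of_real ?\<theta> * of_real a)"
   unfolding exp_eq by blast
 qed
 then have "(\<integral>x. exp (\<i> * of_real ?\<theta> * complex_of_real x) \<partial>m) = (\<integral>x. exp (\<i> * of_real ?\<theta> * of_real a) \<partial>m)"
  by (intro integral_cong_AE) auto
 also have "\<dots> = exp (\<i> * of_real ?\<theta> * of_real a)" using prob_space by simp
 finally have "norm (\<integral>x. exp (\<i> * of_real ?\<theta> * complex_of_real x) \<partial>m) = 1" by simp
 then show ?thesis using that[of ?\<theta>] h by simp
qed

lemma scaled_norm_limit:
 fixes c :: "nat => complex"
 assumes c: "(%n. of_real (real (Suc n)) * (c n - 1)) \<longlonglongrightarrow> l"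
 shows "(%n. real (Suc n) * ((norm (c n))\<^sup>2 - 1)) \<longlonglongrightarrow> 2 * Re l"
proof -
 let ?d = "%n. of_real (real (Suc n)) * (c n - 1)"
 have "(%n. 2 * Re (?d n) + (norm (?d n))\<^sup>2 * (1 / real (Suc n))) \<longlonglongrightarrow> 2 * Re l + (norm l)\<^sup>2 * 0"
  by (intro tendsto_intros c) real_asymp
 moreover have "2 * Re (?d n) + (norm (?d n))\<^sup>2 * (1 / real (Suc n)) = real (Suc n) * ((norm (c n))\<^sup>2 - 1)" for n
 proof -
  have "(norm (c n))\<^sup>2 - 1 = 2 * Re (c n - 1) + (norm (c n - 1))\<^sup>2"
   unfolding cmod_power2 by (simp add: power2_eq_square algebra_simps)
  moreover have "(norm (?d n))\<^sup>2 * (1 / real (Suc n)) = real (Suc n) * (norm (c n - 1))\<^sup>2"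
   unfolding norm_mult norm_of_real by (simp add: power2_eq_square field_simps)
  moreover have "Re (?d n) = real (Suc n) * Re (c n - 1)" by simp
  ultimately show ?thesis by (simp only: distrib_left mult.left_commute)
 qed
 ultimately show ?thesis by simp
qed

context markov_modulated_levy
begin

definition levy_dist :: "'n => real measure" where "levy_dist j = distr (P j) borel (L j 1)"

lemma levy_dist: "real_distribution (levy_dist j)"
 unfolding levy_dist_def by (intro prob_space.real_distribution_distr prob_space_P levy_measurable) simp

lemma levy_dist_integral:
 fixes f :: "real => 'b::{banach, second_countable_topology}"
 assumes "f \<in> borel_measurable borel"
 shows "integrable (levy_dist j) f \<longleftrightarrow> integrable (P j) (%w. f (L j 1 w))" "(\<integral>x. f x \<partial>levy_dist j) = (\<integral>w. f (L j 1 w) \<partial>P j)"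
 unfolding levy_dist_def using levy_measurable[of 1 j j] assms by (auto simp: integrable_distr_eq integral_distr)

lemma levy_dist_mgf: "is_mgf_of (%z. exp (psi j z)) (levy_dist j)"
 unfolding is_mgf_of_def
proof (intro conjI allI impI levy_dist)
 fix z assume "integrable (levy_dist j) (%x. exp (Re z * x))"
 then have "integrable (P j) (%w. exp (Re z * L j 1 w))" by (subst (asm) levy_dist_integral) auto
 from levy_transform[OF zero_le_one this] show "(\<integral>x. exp (z * complex_of_real x) \<partial>levy_dist j) = exp (psi j z)"
  by (subst levy_dist_integral) auto
qed

abbreviation jump_dist :: "'n => 'n => real measure" where "jump_dist j k \<equiv> transition_jump_law (\<rho> j k) (U j k)"

lemma jump_dist: "real_distribution (jump_dist j k)"
 using prob_space.real_distribution_distr[OF prob_space_P measurable_V, of j j k 0] by (simp add: jump_law)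

lemma jump_dist_mgf: "is_mgf_of (Ups j k) (jump_dist j k)"
 unfolding is_mgf_of_def by (simp add: jump_dist transition_jump_mgf_def)

lemma jump_dist_integrable:
 assumes "emgf s" "0 <= s" "j \<noteq> k" "0 < G$j$k" shows "integrable (jump_dist j k) (%x. exp (s * x))"
 using jump_exp_integrable[OF assms, of j 0] by (subst (asm) V_integral(1)) auto

lemma levy_dist_integrable: "emgf s ==> integrable (levy_dist j) (%x. exp (s * x))"
 by (subst levy_dist_integral) (auto intro: levy_integrable)

lemma levy_dist_real_mgf: assumes "emgf s" shows "(\<integral>x. exp (s * x) \<partial>levy_dist j) = exp (Re (psi j (of_real s)))"
proof -
 have "complex_of_real (\<integral>x. exp (s * x) \<partial>levy_dist j) = (\<integral>x. exp (of_real s * of_real x) \<partial>levy_dist j)"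
  by (simp add: exp_of_real integral_complex_of_real del: of_real_mult flip: of_real_mult)
 also have "\<dots> = exp (psi j (of_real s))"
  using levy_dist_mgf[of j] levy_dist_integrable[OF assms, of j] unfolding is_mgf_of_def by simp
 also have "\<dots> = exp (of_real (Re (psi j (of_real s))))" using psi_real[of j s] by simp
 finally show ?thesis by (simp only: exp_of_real of_real_eq_iff)
qed

text \<open>The Gaussian factor keeps the modulus of the characteristic function below one away from zero.\<close>

lemma gaussian_part_nonlattice:
 assumes \<sigma>: "0 < (\<sigma> j)\<^sup>2"
 shows "nonlattice_mgf (%z. exp (psi j z))"
proof -
 have "\<not> lattice_distribution (levy_dist j)"
 proof
  assume "lattice_distribution (levy_dist j)"
  then obtain \<theta> where t: "\<theta> \<noteq> 0" "norm (\<integral>x. exp (\<i> * of_real \<theta> * complex_of_real x) \<partial>levy_dist j) = 1"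
   using lattice_unimodular[OF levy_dist] by blast
  interpret real_distribution "levy_dist j" by (rule levy_dist)
  let ?f = "%x. exp (\<i> * of_real \<theta> * complex_of_real x) - 1 - \<i> * of_real \<theta> * of_real x * of_real (indicator {-1..1} x)"
  have "(\<integral>x. exp (\<i> * of_real \<theta> * complex_of_real x) \<partial>levy_dist j) = exp (psi j (\<i> * of_real \<theta>))"
   using levy_dist_mgf[of j] unfolding is_mgf_of_def by simp
  then have "Re (psi j (\<i> * of_real \<theta>)) = 0" using t(2) by simp
  moreover have "Re (psi j (\<i> * of_real \<theta>)) = - (\<sigma> j)\<^sup>2 * \<theta>\<^sup>2 / 2 + Re (\<integral>x. ?f x \<partial>\<nu> j)"
   unfolding levy_exponent_def by (simp add: power_mult_distrib power2_eq_square)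
  moreover have "Re (\<integral>x. ?f x \<partial>\<nu> j) <= 0"
  proof (cases "integrable (\<nu> j) ?f")
   case True
   have "0 <= (\<integral>x. - Re (?f x) \<partial>\<nu> j)" by (rule integral_nonneg_AE) (auto simp: Re_exp)
   then show ?thesis by (simp only: integral_minus integral_Re[OF True])
  qed (simp add: not_integrable_integral_eq)
  moreover have "0 < (\<sigma> j)\<^sup>2 * \<theta>\<^sup>2" using \<sigma> t by simp
  ultimately show False by linarith
 qed
 then show ?thesis unfolding nonlattice_mgf_def using levy_dist_mgf by blast
qed

lemma Am_perron:
 assumes e: "emgf s" and s: "0 < s"
  and d: "dominant_real_eigenvalue (MLx (of_real (- s))) r"
 obtains x y where "\<And>j. 0 < x$j" "\<And>j. (\<Sum>k\<in>UNIV. Am s$j$k * x$k) = r * x$j"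
  "\<And>j. 0 < y$j" "\<And>k. (\<Sum>j\<in>UNIV. y$j * Am s$j$k) = r * y$k"
proof (rule perron_pair[of "Am s"])
 show "0 <= Am s$j$k" if "j \<noteq> k" for j k by (rule Am_offdiag[OF that])
 show "(j, k) \<in> {(a, b). a \<noteq> b \<and> 0 < Am s$a$b}\<^sup>*" for j k by (rule Am_irreducible[OF e less_imp_le[OF s]])
 fix x y K assume xy: "\<And>j. 0 < x$j" "\<And>j. (\<Sum>k\<in>UNIV. Am s$j$k * x$k) = K * x$j"
  "\<And>j. 0 < y$j" "\<And>k. (\<Sum>j\<in>UNIV. y$j * Am s$j$k) = K * y$k"
 have "dominant_real_eigenvalue (\<chi> j k. of_real (Am s$j$k)) r"
  using d by (simp add: matrix_laplace_exponent_def flip: matrix_exponent_real)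
 then have "r = K" using dominant_real_eigenvalue_perron[OF _ xy] Am_offdiag by blast
 then show thesis using that xy by blast
qed

text \<open>With \<open>l = a / b < 1\<close>, log-convexity bounds \<open>A(a)\<close> on the vector \<open>x^l\<close> by \<open>l r\<close>, although pairing with the left Perron vector
of \<open>A(a)\<close> gives exactly \<open>r > 0\<close>.\<close>

lemma dominant_exponent_unique_less:
 assumes e: "emgf b" and ab: "0 < a" "a < b" and r: "0 < r"
  and d: "dominant_real_eigenvalue (MLx (of_real (- a))) r"
   "dominant_real_eigenvalue (MLx (of_real (- b))) r"
 shows False
proof -
 have ea: "emgf a" using emgf_mono[OF e] ab by simp
 obtain x where x: "\<And>j. 0 < x$j" "\<And>j. (\<Sum>k\<in>UNIV. Am b$j$k * x$k) = r * x$j"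
  using Am_perron[OF e _ d(2)] ab by (metis less_trans)
 obtain y where y: "\<And>j. 0 < y$j" "\<And>k. (\<Sum>j\<in>UNIV. y$j * Am a$j$k) = r * y$k"
  using Am_perron[OF ea ab(1) d(1)] by metis
 define l where "l = a / b"
 have l: "0 <= l" "l <= 1" "l < 1" "l * b = a" using ab by (auto simp: l_def)
 have jen: "(\<integral>x. exp (a * x) \<partial>m) <= (\<integral>x. exp (b * x) \<partial>m) powr l"
  if m: "real_distribution m" "integrable m (%x. exp (b * x))" for m
 proof -
  interpret real_distribution m by fact
  have "exp (b * x) powr l = exp (a * x)" for x using l by (simp add: exp_powr_real mult_ac)
  then show ?thesis using jensen_powr(2)[OF m(2) _ expectation_greater[OF m(2)] l(1,2)] by simp
 qed
 have "(\<Sum>k\<in>UNIV. Am a$j$k * (x$k powr l)) <= l * r * (x$j powr l)" for j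
 proof (rule generator_log_convex[where G = G and u = "%j k. Re (Ups j k (of_real a))" and v = "%j k. Re (Ups j k (of_real b))"
    and a = "%j. Re (psi j (of_real a))" and b = "%j. Re (psi j (of_real b))", OF G_offdiag _ Am_entry Am_entry _ _ _ _ l(1,2) x])
  show "(\<Sum>k\<in>UNIV. G$j$k) = 0" for j using generator unfolding irreducible_generator_def by blast
  show "Re (Ups j k (of_real a)) <= Re (Ups j k (of_real b)) powr l \<and> 0 <= Re (Ups j k (of_real b))" if jk: "j \<noteq> k" "0 < G$j$k" for j k
   using jen[OF jump_dist jump_dist_integrable[OF e _ jk]] ab by (simp add: Ups_real integral_nonneg_AE)
  show "Re (psi j (of_real a)) <= l * Re (psi j (of_real b))" for j
  proof -
   have "exp (Re (psi j (of_real a))) <= exp (Re (psi j (of_real b))) powr l"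
    using jen[OF levy_dist levy_dist_integrable[OF e]] by (simp add: levy_dist_real_mgf e ea)
   then show ?thesis by (simp add: exp_powr_real mult.commute)
  qed
 qed (auto simp: Ups_diag)
 then have "(\<Sum>j\<in>UNIV. y$j * (\<Sum>k\<in>UNIV. Am a$j$k * (x$k powr l))) <= (\<Sum>j\<in>UNIV. y$j * (l * r * (x$j powr l)))"
  by (intro sum_mono mult_left_mono) (auto intro: less_imp_le y)
 also have "\<dots> = l * r * (\<Sum>j\<in>UNIV. y$j * x$j powr l)" by (simp add: sum_distrib_left mult_ac)
 finally have "r * (\<Sum>j\<in>UNIV. y$j * x$j powr l) <= l * r * (\<Sum>j\<in>UNIV. y$j * x$j powr l)"
  by (simp only: eigen_pairing[OF y(2), where v = "%k. x$k powr l"])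
 moreover have "0 < (\<Sum>j\<in>UNIV. y$j * x$j powr l)" using x y by (intro sum_pos) (auto simp: less_le[of 0])
 ultimately have "r <= l * r" by (rule mult_right_le_imp_le)
 then show False using r l by simp
qed

text \<open>A strict inequality at time \<open>h\<close> would survive multiplication by the positive matrix at time \<open>1 - h\<close>.\<close>

lemma short_time_modulus:
 assumes ez: "emgf (Re z)" and eq: "\<And>j k. norm (cM z 1$j$k) = rM (Re z) 1$j$k" and h: "0 < h" "h < 1"
 shows "norm (cM z h$j$l) = rM (Re z) h$j$l"
proof (rule ccontr)
 assume ne: "norm (cM z h$j$l) \<noteq> rM (Re z) h$j$l"
 have em: "emgft (Re z) t" if "0 <= t" for t using emgft_all[OF ez that] .
 have le: "norm (cM z t$a$b) <= rM (Re z) t$a$b" if "0 <= t" for t a b using cM_norm_le[OF that em[OF that]] .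
 have "norm (cM z 1$j$l) = norm (\<Sum>m\<in>UNIV. cM z h$j$m * cM z (1 - h)$m$l)"
  using cM_add[of h "1 - h" z] em h by (simp add: matrix_mult_entry)
 also have "\<dots> <= (\<Sum>m\<in>UNIV. norm (cM z h$j$m) * norm (cM z (1 - h)$m$l))"
  by (rule order_trans[OF norm_sum]) (simp add: norm_mult)
 also have "\<dots> < (\<Sum>m\<in>UNIV. rM (Re z) h$j$m * rM (Re z) (1 - h)$m$l)"
 proof (rule sum_strict_mono_ex1)
  show "\<forall>m\<in>UNIV. norm (cM z h$j$m) * norm (cM z (1 - h)$m$l) <= rM (Re z) h$j$m * rM (Re z) (1 - h)$m$l"
   using h by (auto intro!: mult_mono le rM_nonneg)
  have "norm (cM z h$j$l) * norm (cM z (1 - h)$l$l) <= norm (cM z h$j$l) * rM (Re z) (1 - h)$l$l"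
   using h by (intro mult_left_mono le) auto
  also have "\<dots> < rM (Re z) h$j$l * rM (Re z) (1 - h)$l$l"
   using ne le[of h j l] rM_pos[of "1 - h" "Re z" l l] em h by (intro mult_strict_right_mono) auto
  finally show "\<exists>m\<in>UNIV. norm (cM z h$j$m) * norm (cM z (1 - h)$m$l) < rM (Re z) h$j$m * rM (Re z) (1 - h)$m$l"
   by blast
 qed simp
 also have "\<dots> = rM (Re z) 1$j$l"
  using rM_add[of h "1 - h" "Re z"] em h by (simp add: matrix_mult_entry)
 finally show False using eq[of j l] by simp
qed

text \<open>Equality of moduli at all times \<open>1/n\<close> passes to the generator: \<open>|A_{jk}(z)| = A_{jk}(Re z)\<close> off the diagonal and
\<open>Re A_{jj}(z) = A_{jj}(Re z)\<close> on it. Both say that a tilted law has a characteristic function of modulus one at \<open>Im z\<close>.\<close>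

lemma no_peripheral_eigenvalue:
 assumes e: "emgf s0" and z: "0 < Re z" "Re z < s0" "Im z \<noteq> 0" and r: "0 < r"
  and y: "\<And>j. 0 < y$j" "\<And>k. (\<Sum>j\<in>UNIV. y$j * (r * rM (Re z) 1$j$k)) = y$k"
  and nl: "(\<exists>j. nonlattice_mgf (%z. exp (psi j z))) \<or> (\<exists>j k. 0 < \<rho> j k \<and> nonlattice_mgf (Ups j k))"
 shows "det (mat 1 - (\<chi> j k. of_real r * cM z 1$j$k)) \<noteq> 0"
proof (rule det_nonzeroI, rule ccontr)
 fix v assume "(mat 1 - (\<chi> j k. of_real r * cM z 1$j$k)) *v v = 0" "v \<noteq> 0"
 then have v: "(\<chi> j k. of_real r * cM z 1$j$k) *v v = v" "v \<noteq> 0" by (auto simp: matrix_vector_mult_diff_rdistrib)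
 have ez: "emgf (Re z)" using emgf_mono[OF e] z by simp
 have em: "emgft (Re z) t" if "0 <= t" for t using emgft_all[OF ez that] .
 have "norm ((\<chi> j k. of_real r * cM z 1$j$k)$j$k) = (\<chi> j k. r * rM (Re z) 1$j$k)$j$k" for j k
  by (rule peripheral_eigenvector_modulus[OF _ _ y(1) _ v])
    (use cM_norm_le[OF _ em[of 1]] rM_pos[OF _ em[of 1]] r y(2) in \<open>auto simp: norm_mult\<close>)
 then have "norm (cM z 1$j$k) = rM (Re z) 1$j$k" for j k using r by (simp add: norm_mult)
 note mod = short_time_modulus[OF ez this]
 have ev: "\<forall>\<^sub>F n in sequentially. norm (cM z (step n)$j$k) = rM (Re z) (step n)$j$k" for j k
  using eventually_gt_at_top[of 0] by eventually_elim (rule mod; simp)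
 note gz = generator_limit[OF e less_imp_le[OF z(1)] z(2)]
 note gr = rM_step_limit[OF e less_imp_le[OF z(1)] z(2)]
 have off: "norm (Mx z$j$k) = Am (Re z)$j$k" if "j \<noteq> k" for j k
 proof (rule LIMSEQ_unique)
  show "(%n. norm (of_real (real (Suc n)) * (cM z (step n) - mat 1)$j$k)) \<longlonglongrightarrow> norm (Mx z$j$k)"
   by (intro tendsto_norm gz)
  show "(%n. norm (of_real (real (Suc n)) * (cM z (step n) - mat 1)$j$k)) \<longlonglongrightarrow> Am (Re z)$j$k"
  proof (rule Lim_transform_eventually[OF gr])
   show "\<forall>\<^sub>F n in sequentially. real (Suc n) * (rM (Re z) (step n) - mat 1)$j$k = norm (of_real (real (Suc n)) * (cM z (step n) - mat 1)$j$k)"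
    using ev[of j k] by eventually_elim (use that in \<open>simp add: mat_1_entry norm_mult del: of_nat_Suc\<close>)
  qed
 qed
 have diag: "Re (Mx z$j$j) = Am (Re z)$j$j" for j
 proof -
  have "(%n. of_real (real (Suc n)) * (cM z (step n)$j$j - 1)) \<longlonglongrightarrow> Mx z$j$j"
   using gz[of j j] by (simp add: mat_1_entry)
  from scaled_norm_limit[OF this] have 1: "(%n. real (Suc n) * ((norm (cM z (step n)$j$j))\<^sup>2 - 1)) \<longlonglongrightarrow> 2 * Re (Mx z$j$j)" .
  have "of_real (real (Suc n)) * (complex_of_real (rM (Re z) (step n)$j$j) - 1) = of_real (real (Suc n) * (rM (Re z) (step n) - mat 1)$j$j)" for n
   by (simp add: mat_1_entry del: of_nat_Suc)
  then have "(%n. of_real (real (Suc n)) * (complex_of_real (rM (Re z) (step n)$j$j) - 1)) \<longlonglongrightarrow> of_real (Am (Re z)$j$j)"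
   using tendsto_of_real[OF gr[of j j], where 'a = complex] by (simp add: mat_1_entry)
  from scaled_norm_limit[OF this] have 2: "(%n. real (Suc n) * ((rM (Re z) (step n)$j$j)\<^sup>2 - 1)) \<longlonglongrightarrow> 2 * Am (Re z)$j$j"
   by simp
  have "(%n. real (Suc n) * ((norm (cM z (step n)$j$j))\<^sup>2 - 1)) \<longlonglongrightarrow> 2 * Am (Re z)$j$j"
   by (rule Lim_transform_eventually[OF 2]) (use ev[of j j] in eventually_elim, simp)
  then show ?thesis using LIMSEQ_unique[OF 1] by fastforce
 qed
 have zc: "Complex (Re z) (Im z) = z" by simp
 from nl show False
 proof
  assume "\<exists>j. nonlattice_mgf (%z. exp (psi j z))"
  then obtain j where j: "nonlattice_mgf (%z. exp (psi j z))" by blast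
  have "Re (psi j z) = Re (psi j (of_real (Re z)))" using diag[of j] by (simp add: matrix_exponent_def Am_entry Ups_diag)
  moreover have "(\<integral>x. exp (z * of_real x) \<partial>levy_dist j) = exp (psi j z)"
   using levy_dist_mgf[of j] levy_dist_integrable[OF ez, of j] unfolding is_mgf_of_def by simp
  ultimately have "lattice_distribution (levy_dist j)"
   using lattice_of_maximal_modulus[OF levy_dist levy_dist_integrable[OF ez] z(3)] by (simp add: zc levy_dist_real_mgf[OF ez])
  then show False using nonlattice_mgf_law[OF levy_dist_mgf j] by simp
 next
  assume "\<exists>j k. 0 < \<rho> j k \<and> nonlattice_mgf (Ups j k)"
  then obtain j k where jk: "0 < \<rho> j k" "nonlattice_mgf (Ups j k)" by blast
  then have ne: "j \<noteq> k" "G$j$k \<noteq> 0" using no_transition[of j k] by auto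
  then have G: "0 < G$j$k" using G_offdiag[of j k] by simp
  have "norm (Ups j k z) = Re (Ups j k (of_real (Re z)))" using off[OF ne(1)] G ne by (simp add: matrix_exponent_def Am_entry norm_mult)
  then have "lattice_distribution (jump_dist j k)"
   using lattice_of_maximal_modulus[OF jump_dist jump_dist_integrable[OF ez less_imp_le[OF z(1)] ne(1) G] z(3)]
   unfolding Ups_real by (simp add: zc transition_jump_mgf_def)
  then show False using nonlattice_mgf_law[OF jump_dist_mgf jk(2)] by simp
 qed
qed

end

section \<open>Resolvents near a simple eigenvalue\<close>

lemma det_holomorphic:
 fixes F :: "complex => complex^'n^'n"
 assumes "\<And>j k. (%z. F z$j$k) holomorphic_on S"
 shows "(%z. det (F z)) holomorphic_on S"
 unfolding det_def by (intro holomorphic_on_sum holomorphic_on_mult holomorphic_on_const holomorphic_on_prod assms)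

lemma linear_system_holomorphic:
 fixes F :: "complex => complex^'n^'n" and b :: "complex^'n"
 assumes W: "open W" and F: "\<And>j k. (%z. F z$j$k) holomorphic_on W"
 obtains u where "open {z \<in> W. det (F z) \<noteq> 0}" "\<And>k. (%z. u z$k) holomorphic_on {z \<in> W. det (F z) \<noteq> 0}"
  "\<And>z. z \<in> W ==> det (F z) \<noteq> 0 ==> F z *v u z = b"
proof
 let ?O = "{z \<in> W. det (F z) \<noteq> 0}"
 let ?u = "%z. (\<chi> k. det (\<chi> i j. if j = k then b$i else F z$i$j) / det (F z))"
 have "continuous_on W (%z. det (F z))" by (intro holomorphic_on_imp_continuous_on det_holomorphic F)
 from continuous_open_preimage[OF this W, of "- {0}"] have "open (W \<inter> (%z. det (F z)) -` (- {0}))" by auto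
 moreover have "W \<inter> (%z. det (F z)) -` (- {0}) = ?O" by auto
 ultimately show "open ?O" by simp
 have F': "(%z. F z$i$j) holomorphic_on ?O" for i j by (rule holomorphic_on_subset[OF F]) auto
 have c: "(%z. (\<chi> i j. if j = k then b$i else F z$i$j)$i$j) holomorphic_on ?O" for i j k
  by (cases "j = k") (simp_all add: F')
 show "(%z. ?u z$k) holomorphic_on ?O" for k
  unfolding vec_lambda_beta by (intro holomorphic_on_divide det_holomorphic[OF c] det_holomorphic F') auto
 show "F z *v ?u z = b" if "det (F z) \<noteq> 0" for z using cramer[OF that, of "?u z" b] by blast
qed

lemma neumann_series:
 fixes Q :: "complex^'n^'n"
 assumes Q: "\<And>j k. norm (Q$j$k) <= S j k" and x: "\<And>j. 0 < x$j" and S: "\<And>j. (\<Sum>k\<in>UNIV. S j k * x$k) <= r * x$j"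
  and r: "0 <= r" "r < 1"
 shows "summable (%t. norm (\<Sum>k\<in>UNIV. matpow Q t$j$k))"
  "(mat 1 - Q) *v (\<chi> j. \<Sum>t. \<Sum>k\<in>UNIV. matpow Q t$j$k) = (\<chi> j. 1)"
proof -
 define v where "v t = (\<chi> j. \<Sum>k\<in>UNIV. matpow Q t$j$k)" for t
 define K where "K = (\<Sum>j\<in>UNIV. 1 / x$j)"
 have K0: "0 <= K" unfolding K_def using x by (intro sum_nonneg) (auto simp: less_imp_le)
 have v0: "v 0$j = 1" for j by (simp add: v_def mat_1_entry)
 have vS: "v (Suc t) = Q *v v t" for t
 proof -
  have "(\<Sum>k\<in>UNIV. \<Sum>l\<in>UNIV. Q$j$l * matpow Q t$l$k) = (\<Sum>l\<in>UNIV. Q$j$l * (\<Sum>k\<in>UNIV. matpow Q t$l$k))" for j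
   by (subst sum.swap) (simp add: sum_distrib_left)
  then show ?thesis by (simp add: v_def vec_eq_iff matrix_mult_entry matrix_vector_mult_def)
 qed
 have b: "norm (v t$j) <= r ^ t * K * x$j" for t j
 proof (induction t arbitrary: j)
  case 0
  have "1 / x$j <= K" unfolding K_def by (rule member_le_sum) (auto intro: less_imp_le x)
  then have "1 <= K * x$j" using x[of j] by (simp add: divide_le_eq)
  then show ?case by (simp add: v0)
 next
  case (Suc t)
  show ?case using dominated_matrix_contracts[OF Q x S Suc, of j] K0 r by (simp add: vS mult.assoc)
 qed
 have sm: "summable (%t. norm (v t$j))" for j
 proof (rule summable_comparison_test')
  show "summable (%t. r ^ t * (K * x$j))" using r by (intro summable_mult2 summable_geometric) auto
  show "norm (norm (v t$j)) <= r ^ t * (K * x$j)" if "0 <= t" for t using b[of t j] by (simp add: mult.assoc)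
 qed
 then show "summable (%t. norm (\<Sum>k\<in>UNIV. matpow Q t$j$k))" by (simp add: v_def)
 note sc = summable_norm_cancel[OF sm]
 have "(\<Sum>k\<in>UNIV. Q$j$k * (\<Sum>t. v t$k)) = (\<Sum>t. v t$j) - 1" for j
 proof -
  have "(\<Sum>k\<in>UNIV. Q$j$k * (\<Sum>t. v t$k)) = (\<Sum>k\<in>UNIV. \<Sum>t. Q$j$k * v t$k)" by (simp add: suminf_mult sc)
  also have "\<dots> = (\<Sum>t. \<Sum>k\<in>UNIV. Q$j$k * v t$k)" by (rule suminf_sum[symmetric]) (intro summable_mult sc)
  also have "\<dots> = (\<Sum>t. v (Suc t)$j)" by (simp add: vS matrix_vector_mult_def)
  also have "\<dots> = (\<Sum>t. v t$j) - 1" using suminf_split_head[OF sc[of j]] by (simp add: v0)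
  finally show ?thesis .
 qed
 then have "(mat 1 - Q) *v (\<chi> j. \<Sum>t. v t$j) = (\<chi> j. 1)"
  by (simp add: matrix_vector_mult_diff_rdistrib vec_eq_iff matrix_vector_mult_def[of Q])
 then show "(mat 1 - Q) *v (\<chi> j. \<Sum>t. \<Sum>k\<in>UNIV. matpow Q t$j$k) = (\<chi> j. 1)" by (simp add: v_def)
qed

text \<open>Put \<open>K(z) = (Q(a) - Q(z)) / (a - z)\<close>, so that \<open>(I - Q(z)) x = (a - z) K(z) x\<close>. If \<open>w\<close> solves the bordered system with matrix
\<open>N(z) = I - Q(z) + (1 - (a - z)) K(z) x y'\<close> and \<open>g = y' w\<close>, then \<open>(g / (a - z)) x + w - g x\<close> solves the original one. The matrix \<open>N\<close>
is regular wherever \<open>I - Q\<close> is, and also at \<open>a\<close>, because \<open>y' K(a) x = D\<close> is nonzero.\<close>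

lemma resolvent_pole:
 fixes Q :: "complex => complex^'n^'n" and x y :: "complex^'n" and a D :: complex
 assumes W: "open W" "a \<in> W" and Q: "\<And>j k. (%z. Q z$j$k) holomorphic_on W"
  and x: "Q a *v x = x" and y: "\<And>k. (\<Sum>j\<in>UNIV. y$j * Q a$j$k) = y$k" and yx: "(\<Sum>k\<in>UNIV. y$k * x$k) = 1"
  and simple: "\<And>v. Q a *v v = v ==> \<exists>c. v = c *s x"
  and D: "(\<Sum>j\<in>UNIV. \<Sum>k\<in>UNIV. y$j * deriv (%z. Q z$j$k) a * x$k) = D" "D \<noteq> 0"
 obtains E g v where "open E" "E \<subseteq> W" "a \<in> E" "\<And>z. z \<in> W ==> z \<noteq> a ==> det (mat 1 - Q z) \<noteq> 0 ==> z \<in> E"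
  "g holomorphic_on E" "\<And>k. (%z. v z$k) holomorphic_on E" "g a = (\<Sum>j\<in>UNIV. y$j) / D"
  "\<And>z. z \<in> E ==> z \<noteq> a ==> (mat 1 - Q z) *v ((g z / (a - z)) *s x + v z) = (\<chi> j. 1)"
proof -
 define K where "K z = (\<chi> j k. if z = a then deriv (%z. Q z$j$k) a else (Q z$j$k - Q a$j$k) / (z - a))" for z
 have Kh: "(%z. K z$j$k) holomorphic_on W" for j k
  unfolding K_def vec_lambda_beta by (rule pole_lemma_open[OF Q W(1)])
 have Kz: "(a - z) * K z$j$k = Q a$j$k - Q z$j$k" for z j k
  by (cases "z = a") (simp_all add: K_def field_simps)
 define k where "k z = K z *v x" for z
 have kz: "k z$j = (\<Sum>l\<in>UNIV. K z$j$l * x$l)" for z j by (simp add: k_def matrix_vector_mult_def)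
 have IQx: "(mat 1 - Q z) *v x = (a - z) *s k z" for z
 proof -
  have "(a - z) * k z$j = (\<Sum>l\<in>UNIV. (Q a$j$l - Q z$j$l) * x$l)" for j
   unfolding kz Kz[symmetric] by (simp add: sum_distrib_left mult.assoc)
  then have "(a - z) *s k z = (Q a - Q z) *v x" unfolding vec_eq_iff by (simp only: matrix_vector_mult_def vec_lambda_beta vector_smult_component vector_minus_component simp_thms)
  then show ?thesis using x by (simp add: matrix_vector_mult_diff_rdistrib)
 qed
 define N where "N z = (\<chi> i j. (mat 1 - Q z)$i$j + (1 - (a - z)) * k z$i * y$j)" for z
 let ?y = "%v. \<Sum>j\<in>UNIV. y$j * v$j"
 have Nv: "N z *v v = (mat 1 - Q z) *v v + ((1 - (a - z)) * ?y v) *s k z" for z v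
  by (simp add: N_def matrix_vector_mult_def vec_eq_iff distrib_right distrib_left sum.distrib sum_distrib_left sum_distrib_right mult_ac)
 have Nh: "(%z. N z$i$j) holomorphic_on W" for i j
  unfolding N_def vec_lambda_beta kz vector_minus_component by (intro holomorphic_intros Q Kh)
 obtain w where w: "open {z \<in> W. det (N z) \<noteq> 0}" "\<And>k. (%z. w z$k) holomorphic_on {z \<in> W. det (N z) \<noteq> 0}"
  "\<And>z. z \<in> W ==> det (N z) \<noteq> 0 ==> N z *v w z = (\<chi> j. 1)"
  by (rule linear_system_holomorphic[OF W(1) Nh, where b = "\<chi> j. 1"]) blast
 have solve: "(mat 1 - Q z) *v ((?y v / (a - z)) *s x + (v - ?y v *s x)) = N z *v v" if "z \<noteq> a" for z v
 proof -
  have e: "(?y v / (a - z)) *s ((a - z) *s k z) = ?y v *s k z"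
  proof -
   have "c / d * (d * u) = c * u" if "d \<noteq> 0" for c d u :: complex using that by simp
   then show ?thesis unfolding vec_eq_iff vector_smult_component using that by (intro allI) (simp only: right_minus_eq not_sym)
  qed
  show ?thesis
   unfolding Nv matrix_vector_right_distrib matrix_vector_mult_diff_distrib vector_scalar_commute IQx e
   by (simp add: vec_eq_iff algebra_simps)
 qed
 have y0: "?y ((mat 1 - Q a) *v v) = 0" for v
 proof -
  have "?y (Q a *v v) = (\<Sum>k\<in>UNIV. (\<Sum>j\<in>UNIV. y$j * Q a$j$k) * v$k)"
   by (simp add: matrix_vector_mult_def sum_distrib_left sum_distrib_right mult.assoc) (rule sum.swap)
  then show ?thesis using y by (simp add: matrix_vector_mult_diff_rdistrib right_diff_distrib sum_subtractf)
 qed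
 have yk: "?y (k a) = D"
  unfolding D(1)[symmetric] kz by (simp add: K_def sum_distrib_left mult.assoc)
 have yNa: "?y (N a *v v) = ?y v * D" for v
  unfolding Nv using y0[of v] by (simp add: distrib_left sum.distrib sum_distrib_left yk[symmetric] mult_ac)
 have ya: "y' = 0" if "?y (c *s x) = 0" "y' = c *s x" for c y'
  using that yx by (simp add: mult.left_commute sum_distrib_left[symmetric])
 have aO: "det (N a) \<noteq> 0"
 proof (rule det_nonzeroI)
  fix v assume v: "N a *v v = 0"
  then have g: "?y v = 0" using yNa[of v] D(2) by simp
  then have "(mat 1 - Q a) *v v = 0" using v unfolding Nv by simp
  then have "Q a *v v = v" by (simp add: matrix_vector_mult_diff_rdistrib)
  then show "v = 0" using simple ya g by metis
 qed
 have zO: "det (N z) \<noteq> 0" if z: "z \<noteq> a" "det (mat 1 - Q z) \<noteq> 0" for z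
 proof (rule det_nonzeroI)
  fix v assume v: "N z *v v = 0"
  let ?u = "(?y v / (a - z)) *s x + (v - ?y v *s x)"
  have u: "?u = 0" using solve[OF z(1), of v] v det_nonzeroD[OF z(2)] by metis
  have yl: "?y (c *s x + (v - d *s x)) = c * ?y x + (?y v - d * ?y x)" for c d
   by (simp add: distrib_left right_diff_distrib sum.distrib sum_subtractf sum_distrib_left mult_ac)
  have "?y v / (a - z) = 0" using yl[of "?y v / (a - z)" "?y v"] unfolding u yx by simp
  then have "?y v = 0" using z(1) by simp
  then show "v = 0" using u by simp
 qed
 show thesis
 proof (rule that[of "{z \<in> W. det (N z) \<noteq> 0}" "%z. ?y (w z)" "%z. w z - ?y (w z) *s x"])
  show "(%z. ?y (w z)) holomorphic_on {z \<in> W. det (N z) \<noteq> 0}" by (intro holomorphic_intros w)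
  show "(%z. (w z - ?y (w z) *s x)$k) holomorphic_on {z \<in> W. det (N z) \<noteq> 0}" for k
   unfolding vector_minus_component vector_smult_component by (intro holomorphic_intros w)
  show "?y (w a) = (\<Sum>j\<in>UNIV. y$j) / D" using yNa[of "w a"] w(3)[OF W(2) aO] D(2) by (simp add: field_simps)
  show "(mat 1 - Q z) *v ((?y (w z) / (a - z)) *s x + (w z - ?y (w z) *s x)) = (\<chi> j. 1)"
   if "z \<in> {z \<in> W. det (N z) \<noteq> 0}" "z \<noteq> a" for z using solve[OF that(2), of "w z"] w(3) that(1) by simp
 qed (use w W aO zO in auto)
qed

lemma exp_integral_below:
 assumes z: "0 < Re z"
 shows "integrable lborel (%y. indicator {..<m} y *\<^sub>R exp (z * complex_of_real y))"
  "(\<integral>y. indicator {..<m} y *\<^sub>R exp (z * complex_of_real y) \<partial>lborel) = exp (z * of_real m) / z"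
proof -
 have h: "has_bochner_integral lborel (%y. indicator {0..} y *\<^sub>R exp (- z * complex_of_real y)) (1 / z)"
  using exp_half_line_integral[of "- z"] z by (simp add: has_bochner_integral_iff)
 have "has_bochner_integral lborel (%y. indicator {0..} (m + (- 1) * y) *\<^sub>R exp (- z * complex_of_real (m + (- 1) * y))) (1 / z)"
  using h by (subst (asm) lborel_has_bochner_integral_real_affine_iff[of "-1" _ _ m]) auto
 then have "has_bochner_integral lborel (%y. exp (z * of_real m) * (indicator {0..} (m + (- 1) * y) *\<^sub>R exp (- z * complex_of_real (m + (- 1) * y)))) (exp (z * of_real m) * (1 / z))"
  by (rule has_bochner_integral_mult_right)
 moreover have "AE y in lborel. exp (z * of_real m) * (indicator {0..} (m + (- 1) * y) *\<^sub>R exp (- z * complex_of_real (m + (- 1) * y))) = indicator {..<m} y *\<^sub>R exp (z * complex_of_real y)"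
  using AE_lborel_singleton[of m]
 proof eventually_elim
  fix y :: real assume "y \<noteq> m"
  then have i: "(indicator {0..} (m + (- 1) * y) :: real) = indicator {..<m} y" by (auto simp: indicator_def)
  have "exp (z * of_real m) * exp (- z * complex_of_real (m + (- 1) * y)) = exp (z * complex_of_real y)"
   by (simp add: exp_add[symmetric] algebra_simps)
  then show "exp (z * of_real m) * (indicator {0..} (m + (- 1) * y) *\<^sub>R exp (- z * complex_of_real (m + (- 1) * y))) = indicator {..<m} y *\<^sub>R exp (z * complex_of_real y)"
   unfolding i by (simp only: mult_scaleR_right)
 qed
 ultimately have "has_bochner_integral lborel (%y. indicator {..<m} y *\<^sub>R exp (z * complex_of_real y)) (exp (z * of_real m) * (1 / z))"
  by (subst (asm) has_bochner_integral_cong_AE) auto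
 then show "integrable lborel (%y. indicator {..<m} y *\<^sub>R exp (z * complex_of_real y))"
  "(\<integral>y. indicator {..<m} y *\<^sub>R exp (z * complex_of_real y) \<partial>lborel) = exp (z * of_real m) / z"
  by (auto simp: has_bochner_integral_iff)
qed

lemma (in prob_space) tail_laplace_transform:
 fixes Y :: "'a => real"
 assumes Y[measurable]: "Y \<in> borel_measurable M" and i: "integrable M (%w. exp (Re z * Y w))" and z: "0 < Re z"
 shows "integrable lborel (%y. exp (z * complex_of_real y) * of_real (prob {w \<in> space M. y < Y w}))"
  "(\<integral>y. exp (z * complex_of_real y) * of_real (prob {w \<in> space M. y < Y w}) \<partial>lborel) = (\<integral>w. exp (z * of_real (Y w)) \<partial>M) / z"
proof -
 interpret pair_sigma_finite M lborel ..
 let ?f = "%(w, y). indicator {..<Y w} y *\<^sub>R exp (z * complex_of_real y)"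
 have nz: "z \<noteq> 0" using z by auto
 have nf: "norm (indicator {..<Y w} y *\<^sub>R exp (z * complex_of_real y)) = Re (indicator {..<Y w} y *\<^sub>R exp (complex_of_real (Re z) * complex_of_real y))" for w y
  by (simp add: indicator_def Re_exp)
 have inn: "(\<integral>y. norm (?f (w, y)) \<partial>lborel) = exp (Re z * Y w) / Re z" for w
 proof -
  have "(\<integral>y. norm (?f (w, y)) \<partial>lborel) = Re (exp (of_real (Re z) * of_real (Y w)) / of_real (Re z))"
   unfolding case_prod_conv nf using exp_integral_below[of "of_real (Re z)" "Y w"] z by (simp only: integral_Re Re_complex_of_real)
  also have "\<dots> = exp (Re z * Y w) / Re z" unfolding of_real_mult[symmetric] exp_of_real of_real_divide[symmetric] by simp
  finally show ?thesis .
 qed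
 have fi: "integrable (M \<Otimes>\<^sub>M lborel) ?f"
 proof (rule Fubini_integrable)
  have [measurable]: "{p. snd p < Y (fst p)} \<inter> space (M \<Otimes>\<^sub>M lborel) \<in> sets (M \<Otimes>\<^sub>M lborel)"
  proof -
   have "{p \<in> space (M \<Otimes>\<^sub>M lborel). snd p < Y (fst p)} \<in> sets (M \<Otimes>\<^sub>M lborel)" by measurable
   then show ?thesis by (simp add: Int_def conj_commute)
  qed
  have eq: "?f = (%p. indicator {p. snd p < Y (fst p)} p *\<^sub>R exp (z * complex_of_real (snd p)))" by (auto simp: fun_eq_iff indicator_def)
  show "?f \<in> borel_measurable (M \<Otimes>\<^sub>M lborel)" unfolding eq
   by (intro borel_measurable_scaleR borel_measurable_indicator') (auto intro!: measurable_compose[OF measurable_snd] borel_measurable_exp simp: space_pair_measure)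
  show "integrable M (%w. \<integral>y. norm (?f (w, y)) \<partial>lborel)" unfolding inn using i by simp
  show "AE w in M. integrable lborel (%y. ?f (w, y))" using exp_integral_below(1)[OF z] by simp
 qed
 have outer: "(\<integral>w. ?f (w, y) \<partial>M) = exp (z * complex_of_real y) * of_real (prob {w \<in> space M. y < Y w})" for y
 proof -
  have "(\<integral>w. ?f (w, y) \<partial>M) = (\<integral>w. indicator {w \<in> space M. y < Y w} w *\<^sub>R exp (z * complex_of_real y) \<partial>M)"
   by (intro Bochner_Integration.integral_cong) (auto simp: indicator_def)
  also have "\<dots> = prob {w \<in> space M. y < Y w} *\<^sub>R exp (z * complex_of_real y)"
   by (subst integral_scaleR_left) (auto intro!: integrable_real_indicator simp: emeasure_eq_measure)
  finally show ?thesis by (simp add: scaleR_conv_of_real mult.commute)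
 qed
 show "integrable lborel (%y. exp (z * complex_of_real y) * of_real (prob {w \<in> space M. y < Y w}))"
  using integrable_snd[OF fi] by (simp only: case_prod_conv outer[unfolded case_prod_conv])
 have "(\<integral>y. \<integral>w. ?f (w, y) \<partial>M \<partial>lborel) = (\<integral>w. \<integral>y. ?f (w, y) \<partial>lborel \<partial>M)"
  using Fubini_integral[of "%w y. ?f (w, y)"] fi by (simp add: case_prod_beta')
 also have "\<dots> = (\<integral>w. exp (z * of_real (Y w)) / z \<partial>M)" unfolding case_prod_conv exp_integral_below(2)[OF z] ..
 finally show "(\<integral>y. exp (z * complex_of_real y) * of_real (prob {w \<in> space M. y < Y w}) \<partial>lborel) = (\<integral>w. exp (z * of_real (Y w)) \<partial>M) / z"
  unfolding outer by simp
qed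

section \<open>The law of the process at the trade time\<close>

lemma matpow_scale: "matpow (\<chi> j k. c * M$j$k) n$a$b = c ^ n * matpow M n$a$b" for c :: complex
 by (induction n arbitrary: a b) (auto simp: mat_1_entry matrix_mult_entry sum_distrib_left mult_ac)

locale geometric_trade_time = markov_modulated_levy P X J G \<mu> \<sigma> \<nu> \<rho> U L V
 for P :: "'n::finite => 'w measure" and X J G \<mu> \<sigma> \<nu> \<rho> U L V +
 fixes w0 :: "real^'n" and Pr :: "'w measure" and \<tau> :: nat and pp qq :: "nat => real" and T :: "'w => nat" and \<alpha> s0 :: real
 assumes w0: "\<And>j. 0 <= w0$j" "(\<Sum>j\<in>UNIV. w0$j) = 1"
  and Pr_space: "prob_space Pr" "\<And>j. sets Pr = sets (P j)"
  and Pr_law: "\<And>S. S \<in> sets Pr ==> measure Pr S = (\<Sum>j\<in>UNIV. w0$j * measure (P j) S)"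
  and tau: "1 <= \<tau>" and pp: "0 < pp 1" "strict_mono_on {1..\<tau>} pp" "pp \<tau> < 1"
  and qq: "\<And>j. j \<in> {1..\<tau>} ==> 0 < qq j" "(\<Sum>j = 1..\<tau>. qq j) = 1"
  and T_indep: "prob_space.indep_set Pr {T -` S \<inter> space Pr | S. True} (process_sets (space Pr) X J)"
  and T_law: "\<And>t. 1 <= t ==> measure Pr {w \<in> space Pr. T w = t} = (\<Sum>j = 1..\<tau>. qq j * (1 - pp j) ^ (t - 1) * pp j)"
  and alpha: "0 < \<alpha>" "\<alpha> < s0" "emgf s0"
  and dominant: "dominant_real_eigenvalue (matrix_laplace_exponent G \<mu> \<sigma> \<nu> \<rho> U (of_real (- \<alpha>))) (- ln (1 - pp 1))"
begin

lemma pp_range: assumes "l \<in> {1..\<tau>}" shows "0 < pp l" "pp l < 1" "l \<noteq> 1 ==> pp 1 < pp l"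
proof -
 have m: "pp a <= pp b" if "a \<in> {1..\<tau>}" "b \<in> {1..\<tau>}" "a <= b" for a b
  using strict_mono_onD[OF pp(2) that(1,2)] that(3) by (cases "a = b") auto
 show "0 < pp l" "pp l < 1" using m[of 1 l] m[of l \<tau>] assms pp tau by auto
 show "pp 1 < pp l" if "l \<noteq> 1" using strict_mono_onD[OF pp(2), of 1 l] assms that by auto
qed

lemma pp1: "0 < pp 1" "pp 1 < 1" using pp_range[of 1] tau by auto

definition mass :: "nat => real" where
 "mass t = (if t = 0 then 0 else \<Sum>j = 1..\<tau>. qq j * (1 - pp j) ^ (t - 1) * pp j)"

lemma mass_nonneg: "0 <= mass t"
proof -
 have "0 <= qq j * (1 - pp j) ^ (t - 1) * pp j" if "j \<in> {1..\<tau>}" for j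
  using pp_range[OF that] qq(1)[OF that] by simp
 then show ?thesis unfolding mass_def by (auto intro: sum_nonneg)
qed

definition tail :: "real => real => real" where
 "tail t y = (\<Sum>j\<in>UNIV. w0$j * measure (P j) {w \<in> space (P j). y < X t w})"

lemma tail_nonneg: "0 <= tail t y" unfolding tail_def using w0 by (intro sum_nonneg mult_nonneg_nonneg) auto

definition H :: "real => real" where "H y = measure Pr {w \<in> space Pr. y < X (real (T w)) w}"

lemma space_Pr: "space Pr = space (P j)" by (rule sets_eq_imp_space_eq[OF Pr_space(2)])

lemma trade_time_events: "{w \<in> space Pr. T w = t} \<in> sets Pr"
proof -
 interpret prob_space Pr by (rule Pr_space)
 have "{w \<in> space Pr. T w = t} = T -` {t} \<inter> space Pr" by auto
 then show ?thesis using indep_setD_ev1[OF T_indep] by blast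
qed

lemma trade_time_mass: "measure Pr {w \<in> space Pr. T w = t} = mass t"
proof (cases "t = 0")
 case False
 then show ?thesis using T_law[of t] by (simp add: mass_def)
next
 case True
 interpret prob_space Pr by (rule Pr_space)
 let ?E = "%t. {w \<in> space Pr. T w = t}"
 have "(%t. prob (?E t)) sums prob (\<Union>t. ?E t)"
  by (rule finite_measure_UNION) (use trade_time_events in \<open>auto simp: disjoint_family_on_def\<close>)
 also have "(\<Union>t. ?E t) = space Pr" by auto
 finally have s1: "(%t. prob (?E t)) sums 1" by (simp add: prob_space)
 have "(%t. \<Sum>j = 1..\<tau>. qq j * pp j * (1 - pp j) ^ t) sums (\<Sum>j = 1..\<tau>. qq j * pp j * (1 / (1 - (1 - pp j))))"
 proof (intro sums_sum sums_mult geometric_sums)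
  fix j assume "j \<in> {1..\<tau>}" then show "norm (1 - pp j) < 1" using pp_range[of j] by auto
 qed
 also have "(\<Sum>j = 1..\<tau>. qq j * pp j * (1 / (1 - (1 - pp j)))) = (\<Sum>j = 1..\<tau>. qq j)"
  using pp_range(1) by (intro sum.cong) (auto simp: less_imp_neq[THEN not_sym])
 finally have "(%t. \<Sum>j = 1..\<tau>. qq j * pp j * (1 - pp j) ^ t) sums 1" using qq(2) by simp
 moreover have "prob (?E (Suc t)) = (\<Sum>j = 1..\<tau>. qq j * pp j * (1 - pp j) ^ t)" for t
  using T_law[of "Suc t"] by (simp add: mult_ac)
 ultimately have "(%t. prob (?E (Suc t))) sums 1" by simp
 then have "(%t. prob (?E t)) sums (1 + prob (?E 0))" by (subst (asm) sums_Suc_iff) simp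
 from sums_unique2[OF this s1] show ?thesis using True by (simp add: mass_def)
qed

text \<open>The sum is over the values of \<open>T\<close>, which is independent of the process.\<close>

lemma H_sums: "(%t. mass t * tail (real t) y) sums H y"
proof -
 interpret prob_space Pr by (rule Pr_space)
 let ?E = "%t. {w \<in> space Pr. T w = t}" and ?B = "%t. {w \<in> space Pr. y < X (real t) w}"
 have B: "?B t \<in> process_sets (space Pr) X J" for t
 proof -
  have "?B t = X (real t) -` {y<..} \<inter> space Pr" by auto
  moreover have "X (real t) -` {y<..} \<inter> space Pr \<in> process_sets (space Pr) X J"
   unfolding process_sets_def by (rule sigma_sets.Basic, rule UnI1, rule CollectI, rule exI[of _ "real t"], rule exI[of _ "{y<..}"]) auto
  ultimately show ?thesis by simp
 qed
 have Bev: "?B t \<in> events" for t using indep_setD_ev2[OF T_indep] B by blast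
 have EB: "prob (?E t \<inter> ?B t) = mass t * tail (real t) y" for t
 proof -
  have "?E t = T -` {t} \<inter> space Pr" by auto
  then have "prob (?E t \<inter> ?B t) = prob (?E t) * prob (?B t)"
   by (intro indep_setD[OF T_indep _ B]) blast
  also have "prob (?B t) = tail (real t) y"
   unfolding Pr_law[OF Bev] tail_def by (intro sum.cong refl) (metis space_Pr)
  finally show ?thesis by (simp add: trade_time_mass)
 qed
 have "(%t. prob (?E t \<inter> ?B t)) sums prob (\<Union>t. ?E t \<inter> ?B t)"
  by (rule finite_measure_UNION) (use trade_time_events Bev in \<open>auto simp: disjoint_family_on_def\<close>)
 also have "(\<Union>t. ?E t \<inter> ?B t) = {w \<in> space Pr. y < X (real (T w)) w}" by auto
 finally show ?thesis by (simp only: EB H_def)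
qed

lemma H_set: "{w \<in> space Pr. y < X (real (T w)) w} \<in> sets Pr"
proof -
 have "{w \<in> space Pr. y < X (real (T w)) w} = (\<Union>t. {w \<in> space Pr. T w = t} \<inter> {w \<in> space Pr. y < X (real t) w})" by auto
 moreover have "{w \<in> space Pr. y < X (real t) w} \<in> sets Pr" for t
 proof -
  obtain j :: 'n where True by simp
  have "{w \<in> space (P j). y < X (real t) w} \<in> sets (P j)" using measurable_X[of "real t" j] by measurable
  then show ?thesis by (simp add: space_Pr[of j] Pr_space(2)[of j])
 qed
 ultimately show ?thesis using trade_time_events by auto
qed

lemma H_props: "0 <= H y" "H y <= 1" "x <= y ==> H y <= H x" "H \<in> borel_measurable borel"
proof -
 interpret prob_space Pr by (rule Pr_space)
 show "0 <= H y" "H y <= 1" by (simp_all add: H_def)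
 have m: "H y <= H x" if "x <= y" for x y
  unfolding H_def by (rule finite_measure_mono[OF _ H_set]) (use that in auto)
 then show "x <= y ==> H y <= H x" .
 have "mono (%y. - H y)" using m by (auto intro: monoI)
 from borel_measurable_uminus[OF borel_measurable_mono[OF this]] show "H \<in> borel_measurable borel" by simp
qed

lemma emgf_upto: "0 <= s ==> s < s0 ==> emgf s" using emgf_mono[OF alpha(3)] by simp

definition total :: "complex => nat => complex" where
 "total z t = (\<Sum>j\<in>UNIV. of_real (w0$j) * (\<Sum>k\<in>UNIV. cM z (real t)$j$k))"

lemma tail_transform:
 assumes z: "0 < Re z" "Re z < s0"
 shows "integrable lborel (%y. exp (z * complex_of_real y) * of_real (tail (real t) y))"
  "(\<integral>y. exp (z * complex_of_real y) * of_real (tail (real t) y) \<partial>lborel) = total z t / z"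
proof -
 have em: "emgft (Re z) (real t)" using emgft_all[OF emgf_upto] z by simp
 let ?m = "%j y. measure (P j) {w \<in> space (P j). y < X (real t) w}"
 have lt: "integrable lborel (%y. exp (z * complex_of_real y) * of_real (?m j y))"
  "(\<integral>y. exp (z * complex_of_real y) * of_real (?m j y) \<partial>lborel) = (\<Sum>k\<in>UNIV. cM z (real t)$j$k) / z" for j
 proof -
  interpret prob_space "P j" by (rule prob_space_P)
  have i: "integrable (P j) (%w. exp (Re z * X (real t) w))" by (rule emgftD[OF em])
  have Xm: "X (real t) \<in> borel_measurable (P j)" by (rule measurable_X) simp
  show "integrable lborel (%y. exp (z * complex_of_real y) * of_real (?m j y))" by (rule tail_laplace_transform(1)[OF Xm i z(1)])
  have ij: "integrable (P j) (%w. exp (z * of_real (X (real t) w)) * indicator {k} (J (real t) w))" for k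
   by (rule integrable_exp_J[OF _ em]) simp
  have s: "(\<Sum>k\<in>UNIV. exp (z * of_real (X (real t) w)) * indicator {k} (J (real t) w)) = exp (z * of_real (X (real t) w))" for w
   by (simp add: sum_distrib_left[symmetric] indicator_def)
  have "(\<Sum>k\<in>UNIV. cM z (real t)$j$k) = (\<integral>w. exp (z * of_real (X (real t) w)) \<partial>P j)"
   unfolding cM_def vec_lambda_beta Bochner_Integration.integral_sum[OF ij, symmetric] s ..
  then show "(\<integral>y. exp (z * complex_of_real y) * of_real (?m j y) \<partial>lborel) = (\<Sum>k\<in>UNIV. cM z (real t)$j$k) / z"
   using tail_laplace_transform(2)[OF Xm i z(1)] by simp
 qed
 have eq: "exp (z * complex_of_real y) * of_real (tail (real t) y) = (\<Sum>j\<in>UNIV. of_real (w0$j) * (exp (z * complex_of_real y) * of_real (?m j y)))" for y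
  by (simp add: tail_def sum_distrib_left mult_ac)
 show "integrable lborel (%y. exp (z * complex_of_real y) * of_real (tail (real t) y))"
  unfolding eq by (intro Bochner_Integration.integrable_sum integrable_mult_right lt)
 show "(\<integral>y. exp (z * complex_of_real y) * of_real (tail (real t) y) \<partial>lborel) = total z t / z"
  unfolding eq total_def by (subst Bochner_Integration.integral_sum, (intro integrable_mult_right lt)[1], subst sum_divide_distrib) (simp add: lt)
qed

definition Q :: "nat => complex => complex^'n^'n" where
 "Q l z = (\<chi> j k. of_real (1 - pp l) * cM z 1$j$k)"

lemma Q_holomorphic: "(%z. Q l z$j$k) holomorphic_on {z. 0 < Re z \<and> Re z < s0}"
 unfolding Q_def vec_lambda_beta by (intro holomorphic_intros cM_holomorphic[OF alpha(3)])

lemma matpow_Q: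
 assumes "0 < Re z" "Re z < s0" shows "matpow (Q l z) t$j$k = of_real ((1 - pp l) ^ t) * cM z (real t)$j$k"
 unfolding Q_def matpow_scale using cM_power[of z 1 t] emgf_upto[of "Re z"] assms by simp

definition xv :: "real^'n" where
 "xv = (SOME x. (\<forall>j. 0 < x$j) \<and> (\<forall>j. (\<Sum>k\<in>UNIV. Am \<alpha>$j$k * x$k) = - ln (1 - pp 1) * x$j))"
definition yv :: "real^'n" where
 "yv = (SOME y. (\<forall>j. 0 < y$j) \<and> (\<forall>k. (\<Sum>j\<in>UNIV. y$j * Am \<alpha>$j$k) = - ln (1 - pp 1) * y$k) \<and> (\<Sum>k\<in>UNIV. y$k * xv$k) = 1)"

text \<open>The eigenvalue is \<open>exp (- ln (1 - p_1))\<close>, and \<open>y\<close> is normalised by \<open>y' x = 1\<close>.\<close>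

lemma perron: "0 < xv$j" "(\<Sum>k\<in>UNIV. rM \<alpha> 1$j$k * xv$k) = 1 / (1 - pp 1) * xv$j"
 "0 < yv$j" "(\<Sum>j\<in>UNIV. yv$j * rM \<alpha> 1$j$k) = 1 / (1 - pp 1) * yv$k" "(\<Sum>k\<in>UNIV. yv$k * xv$k) = 1"
proof -
 have ea: "emgf \<alpha>" using emgf_upto alpha by simp
 obtain x y where xy: "\<And>j. 0 < x$j" "\<And>j. (\<Sum>k\<in>UNIV. Am \<alpha>$j$k * x$k) = - ln (1 - pp 1) * x$j"
  "\<And>j. 0 < y$j" "\<And>k. (\<Sum>j\<in>UNIV. y$j * Am \<alpha>$j$k) = - ln (1 - pp 1) * y$k"
  by (rule Am_perron[OF ea alpha(1) dominant]) blast
 have xv: "(\<forall>j. 0 < xv$j) \<and> (\<forall>j. (\<Sum>k\<in>UNIV. Am \<alpha>$j$k * xv$k) = - ln (1 - pp 1) * xv$j)"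
  unfolding xv_def by (rule someI[of _ x]) (use xy in blast)
 define n where "n = (\<Sum>k\<in>UNIV. y$k * xv$k)"
 have n: "0 < n" unfolding n_def using xy(3) xv by (intro sum_pos) auto
 have yv: "(\<forall>j. 0 < yv$j) \<and> (\<forall>k. (\<Sum>j\<in>UNIV. yv$j * Am \<alpha>$j$k) = - ln (1 - pp 1) * yv$k) \<and> (\<Sum>k\<in>UNIV. yv$k * xv$k) = 1"
  unfolding yv_def
 proof (rule someI[of _ "(1 / n) *\<^sub>R y"], intro conjI allI)
  show "0 < ((1 / n) *\<^sub>R y)$j" for j using n xy(3) by simp
  show "(\<Sum>j\<in>UNIV. ((1 / n) *\<^sub>R y)$j * Am \<alpha>$j$k) = - ln (1 - pp 1) * ((1 / n) *\<^sub>R y)$k" for k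
   using arg_cong[OF xy(4)[of k], of "%u. u / n"] by (simp add: sum_divide_distrib)
  show "(\<Sum>k\<in>UNIV. ((1 / n) *\<^sub>R y)$k * xv$k) = 1" using n by (simp add: n_def sum_divide_distrib[symmetric])
 qed
 have M: "mexp (Am \<alpha>) = rM \<alpha> 1" unfolding vec_eq_iff using mexp_Am_shift[OF alpha(3), of \<alpha> 0] alpha by simp
 have ex: "exp (- ln (1 - pp 1)) = 1 / (1 - pp 1)" using pp1 by (simp add: exp_minus field_simps)
 show "0 < xv$j" "0 < yv$j" "(\<Sum>k\<in>UNIV. yv$k * xv$k) = 1" using xv yv by auto
 show "(\<Sum>k\<in>UNIV. rM \<alpha> 1$j$k * xv$k) = 1 / (1 - pp 1) * xv$j"
  using mexp_eigenvector[of "Am \<alpha>" xv "- ln (1 - pp 1)" j] xv unfolding M ex by simp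
 show "(\<Sum>j\<in>UNIV. yv$j * rM \<alpha> 1$j$k) = 1 / (1 - pp 1) * yv$k"
  using mexp_left_eigenvector[of yv "Am \<alpha>" "- ln (1 - pp 1)" k] yv unfolding M ex by simp
qed

text \<open>The weights are the powers \<open>x^b\<close> of the Perron vector at \<open>\<alpha>\<close>, with \<open>b = Re z / \<alpha>\<close>; Jensen bounds the factor by
\<open>(1 - p_l) (1 - p_1)^{-b}\<close>.\<close>

lemma contraction:
 assumes l: "l \<in> {1..\<tau>}" and z: "0 < Re z" "Re z <= \<alpha>" and c: "Re z < \<alpha> \<or> l \<noteq> 1"
 obtains S x r where "\<And>j k. norm (Q l z$j$k) <= S j k" "\<And>j. 0 < (x :: real^'n)$j" "\<And>j. (\<Sum>k\<in>UNIV. S j k * x$k) <= r * x$j" "0 <= r" "r < 1"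
proof -
 define b where "b = Re z / \<alpha>"
 have b: "0 <= b" "b <= 1" "b * \<alpha> = Re z" "Re z < \<alpha> ==> b < 1" using z alpha by (auto simp: b_def)
 have ea: "emgf \<alpha>" using emgf_upto alpha by simp
 note pl = pp_range[OF l]
 have one: "1 < 1 / (1 - pp 1)" using pp1 by simp
 let ?r = "(1 - pp l) * (1 / (1 - pp 1)) powr b"
 show thesis
 proof (rule that[of "%j k. (1 - pp l) * rM (Re z) 1$j$k" "\<chi> j. xv$j powr b" ?r])
  show "norm (Q l z$j$k) <= (1 - pp l) * rM (Re z) 1$j$k" for j k
   unfolding Q_def using cM_norm_le[of 1 z j k] emgft_all[OF emgf_upto, of "Re z" 1] z alpha pl
   by (auto simp: norm_mult simp flip: of_real_diff intro!: mult_left_mono)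
  show "0 < (\<chi> j. xv$j powr b)$j" for j using perron(1)[of j] by simp
  show "(\<Sum>k\<in>UNIV. (1 - pp l) * rM (Re z) 1$j$k * (\<chi> j. xv$j powr b)$k) <= ?r * (\<chi> j. xv$j powr b)$j" for j
  proof -
   have "(\<Sum>k\<in>UNIV. rM (Re z) 1$j$k * xv$k powr b) <= (1 / (1 - pp 1) * xv$j) powr b"
    using rM_jensen[OF ea alpha(1) perron(1) perron(2) b(1,2), of j] one pp1 unfolding b(3) by simp
   also have "\<dots> = (1 / (1 - pp 1)) powr b * xv$j powr b"
    using perron(1)[of j] one by (simp only: powr_mult less_imp_le)
   finally have "(1 - pp l) * (\<Sum>k\<in>UNIV. rM (Re z) 1$j$k * xv$k powr b) <= (1 - pp l) * ((1 / (1 - pp 1)) powr b * xv$j powr b)"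
    using pl by (intro mult_left_mono) auto
   then show ?thesis by (simp add: sum_distrib_left mult.assoc)
  qed
  show "0 <= ?r" using pl by simp
  have le: "(1 / (1 - pp 1)) powr b <= 1 / (1 - pp 1)"
   using powr_mono[OF b(2), of "1 / (1 - pp 1)"] one pp1 by simp
  show "?r < 1"
  proof (cases "l = 1")
   case True
   then have "b < 1" using c b(4) by simp
   from powr_less_mono[OF this one] have "(1 / (1 - pp 1)) powr b < 1 / (1 - pp 1)" using one pp1 by simp
   from mult_strict_left_mono[OF this, of "1 - pp 1"] show ?thesis using True pp1 by simp
  next
   case False
   have "?r <= (1 - pp l) * (1 / (1 - pp 1))" using le pl by (intro mult_left_mono) auto
   also have "\<dots> < 1" using pl(3)[OF False] pp1 by (simp add: divide_less_eq)
   finally show ?thesis .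
  qed
 qed
qed

definition coef :: "nat => real" where "coef l = qq l * pp l / (1 - pp l)"

definition usol :: "nat => complex => complex^'n" where
 "usol l z = (\<chi> j. \<Sum>t. \<Sum>k\<in>UNIV. matpow (Q l z) t$j$k)"

abbreviation start_mean :: "complex^'n => complex" where "start_mean v \<equiv> \<Sum>j\<in>UNIV. of_real (w0$j) * v$j"

definition \<phi> :: "complex => complex" where
 "\<phi> z = (\<Sum>l = 1..\<tau>. of_real (coef l) * (start_mean (usol l z) - 1))"

lemma usol:
 assumes l: "l \<in> {1..\<tau>}" and z: "0 < Re z" "Re z < \<alpha>"
 shows "summable (%t. norm (\<Sum>k\<in>UNIV. matpow (Q l z) t$j$k))" "(mat 1 - Q l z) *v usol l z = (\<chi> j. 1)"
  "det (mat 1 - Q l z) \<noteq> 0"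
proof -
 obtain S r and x :: "real^'n" where c: "\<And>j k. norm (Q l z$j$k) <= S j k" "\<And>j. 0 < x$j" "\<And>j. (\<Sum>k\<in>UNIV. S j k * x$k) <= r * x$j" "0 <= r" "r < 1"
  by (rule contraction[OF l z(1) less_imp_le[OF z(2)] disjI1[OF z(2)]]) blast
 show "summable (%t. norm (\<Sum>k\<in>UNIV. matpow (Q l z) t$j$k))" "(mat 1 - Q l z) *v usol l z = (\<chi> j. 1)"
  unfolding usol_def by (rule neumann_series[OF c])+
 show "det (mat 1 - Q l z) \<noteq> 0" by (rule dominated_matrix_det_nonzero[OF c(1,2,3,5)])
qed

lemma mass_total:
 assumes z: "0 < Re z" "Re z < \<alpha>"
 shows "(%t. of_real (mass t) * total z t) sums \<phi> z" "summable (%t. norm (of_real (mass t) * total z t))"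
proof -
 have zs: "Re z < s0" using z alpha by simp
 let ?f = "%l t. of_real (coef l) * start_mean (\<chi> j. \<Sum>k\<in>UNIV. matpow (Q l z) t$j$k)"
 have f: "?f l t = of_real (coef l * (1 - pp l) ^ t) * total z t" for l t
  unfolding vec_lambda_beta matpow_Q[OF z(1) zs] total_def by (simp add: sum_distrib_left mult_ac)
 have t0: "total z 0 = 1"
  using w0(2) by (simp add: total_def cM_0 mat_1_entry flip: of_real_sum)
 have "?f l sums (of_real (coef l) * start_mean (usol l z))" "summable (%t. norm (?f l t))" if l: "l \<in> {1..\<tau>}" for l
 proof -
  have s: "(%t. \<Sum>k\<in>UNIV. matpow (Q l z) t$j$k) sums (usol l z$j)" for j
   unfolding usol_def vec_lambda_beta by (rule summable_sums[OF summable_norm_cancel[OF usol(1)[OF l z]]])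
  show "?f l sums (of_real (coef l) * start_mean (usol l z))"
   unfolding vec_lambda_beta by (intro sums_mult sums_sum s)
  have "summable (%t. norm (of_real (coef l) :: complex) * (\<Sum>j\<in>UNIV. norm (of_real (w0$j) :: complex) * norm (\<Sum>k\<in>UNIV. matpow (Q l z) t$j$k)))"
   by (intro summable_mult summable_sum usol(1)[OF l z])
  then show "summable (%t. norm (?f l t))"
   by (rule summable_comparison_test'[where N = 0]) (auto simp: norm_mult intro!: mult_left_mono order_trans[OF norm_sum] sum_mono)
 qed
 note fl = this
 have m: "of_real (mass (Suc t)) * total z (Suc t) = (\<Sum>l = 1..\<tau>. ?f l (Suc t))" for t
 proof -
  have "mass (Suc t) = (\<Sum>l = 1..\<tau>. coef l * (1 - pp l) ^ Suc t)"
  proof -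
   have g: "q * r ^ t * p = q * p / r * (r * r ^ t)" if "r \<noteq> 0" for p q r :: real using that by simp
   show ?thesis unfolding mass_def coef_def
    using g[of "1 - pp l" "qq l" "pp l" for l] pp_range(2) by (auto intro!: sum.cong simp: less_imp_neq[THEN not_sym])
  qed
  then show ?thesis unfolding f by (simp only: of_real_sum sum_distrib_right)
 qed
 have "(%t. ?f l (Suc t)) sums (of_real (coef l) * (start_mean (usol l z) - 1))" if "l \<in> {1..\<tau>}" for l
 proof -
  have "?f l sums (of_real (coef l) * (start_mean (usol l z) - 1) + ?f l 0)"
   using fl(1)[OF that] unfolding f t0 by (simp add: algebra_simps)
  then show ?thesis by (subst sums_Suc_iff)
 qed
 then have "(%t. \<Sum>l = 1..\<tau>. ?f l (Suc t)) sums \<phi> z" unfolding \<phi>_def by (rule sums_sum)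
 then have "(%t. of_real (mass (Suc t)) * total z (Suc t)) sums \<phi> z" unfolding m .
 then show "(%t. of_real (mass t) * total z t) sums \<phi> z" by (subst (asm) sums_Suc_iff) (simp add: mass_def)
 have "summable (%t. norm (of_real (mass (Suc t)) * total z (Suc t)))"
  unfolding m
 proof (rule summable_comparison_test'[where N = 0])
  show "summable (%t. \<Sum>l = 1..\<tau>. norm (?f l (Suc t)))"
  proof (rule summable_sum)
   show "summable (%t. norm (?f l (Suc t)))" if "l \<in> {1..\<tau>}" for l
    using fl(2)[OF that] by (subst summable_Suc_iff[of "%t. norm (?f l t)"])
  qed
  show "norm (norm (\<Sum>l = 1..\<tau>. ?f l (Suc t))) <= (\<Sum>l = 1..\<tau>. norm (?f l (Suc t)))" for t
   using norm_sum by simp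
 qed
 then show "summable (%t. norm (of_real (mass t) * total z t))" by (subst (asm) summable_Suc_iff)
qed

lemma H_transform:
 assumes z: "0 < Re z" "Re z < \<alpha>"
 shows "integrable lborel (%y. exp (z * complex_of_real y) * of_real (H y))"
  "(\<integral>y. exp (z * complex_of_real y) * of_real (H y) \<partial>lborel) = \<phi> z / z"
proof -
 have zs: "Re z < s0" using z alpha by simp
 let ?f = "%t y. of_real (mass t) * (exp (z * complex_of_real y) * of_real (tail (real t) y))"
 have fi: "integrable lborel (?f t)" for t by (intro integrable_mult_right tail_transform(1)[OF z(1) zs])
 have nf: "norm (?f t y) = exp (Re z * y) * (mass t * tail (real t) y)" for t y
  using mass_nonneg[of t] tail_nonneg[of "real t" y] by (simp add: norm_mult mult_ac)
 have sumf: "(%t. ?f t y) sums (exp (z * complex_of_real y) * of_real (H y))" for y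
  using sums_mult[OF sums_of_real[OF H_sums[of y]], of "exp (z * complex_of_real y)"] by (simp add: mult_ac)
 have ae: "AE y in lborel. summable (%t. norm (?f t y))"
  unfolding nf by (intro AE_I2 summable_mult sums_summable[OF H_sums])
 have ni: "(\<integral>y. norm (?f t y) \<partial>lborel) <= norm (of_real (mass t) * total (of_real (Re z)) t) / Re z" for t
 proof -
  have "norm (?f t y) = Re (of_real (mass t) * (exp (of_real (Re z) * complex_of_real y) * of_real (tail (real t) y)))" for y
   unfolding nf by (simp add: Re_exp)
  then have "(\<integral>y. norm (?f t y) \<partial>lborel) = Re (of_real (mass t) * (total (of_real (Re z)) t / of_real (Re z)))"
   using tail_transform[of "of_real (Re z)" t] z zs by (simp only: integral_Re integrable_mult_right integral_mult_right_zero Re_complex_of_real)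
  also have "\<dots> <= norm (of_real (mass t) * (total (of_real (Re z)) t / of_real (Re z)))" by (rule complex_Re_le_cmod)
  also have "\<dots> = norm (of_real (mass t) * total (of_real (Re z)) t) / Re z" using z by (simp add: norm_mult norm_divide)
  finally show ?thesis .
 qed
 have sm: "summable (%t. \<integral>y. norm (?f t y) \<partial>lborel)"
 proof (rule summable_comparison_test'[where N = 0])
  show "summable (%t. norm (of_real (mass t) * total (of_real (Re z)) t) / Re z)"
   by (intro summable_divide mass_total(2)) (use z in auto)
  show "norm (\<integral>y. norm (?f t y) \<partial>lborel) <= norm (of_real (mass t) * total (of_real (Re z)) t) / Re z" for t
   using ni[of t] by (subst real_norm_def, subst abs_of_nonneg) (auto intro: integral_nonneg_AE)
 qed
 have sH: "(\<Sum>t. ?f t y) = exp (z * complex_of_real y) * of_real (H y)" for y using sums_unique[OF sumf] by simp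
 show "integrable lborel (%y. exp (z * complex_of_real y) * of_real (H y))"
  using integrable_suminf[OF fi ae sm] unfolding sH .
 have I: "(%t. \<integral>y. ?f t y \<partial>lborel) sums (\<integral>y. exp (z * complex_of_real y) * of_real (H y) \<partial>lborel)"
  using sums_integral[OF fi ae sm] unfolding sH .
 have t: "(\<integral>y. ?f t y \<partial>lborel) = of_real (mass t) * total z t / z" for t
  using tail_transform(2)[OF z(1) zs, of t] by simp
 have "(%t. of_real (mass t) * total z t / z) sums (\<phi> z / z)" by (intro sums_divide mass_total z)
 from sums_unique2[OF I[unfolded t] this] show "(\<integral>y. exp (z * complex_of_real y) * of_real (H y) \<partial>lborel) = \<phi> z / z" .
qed

end

section \<open>The pole of the transform\<close>

context geometric_trade_time
begin

definition speed :: real where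
 "speed = (1 - pp 1) * (\<Sum>j\<in>UNIV. \<Sum>k\<in>UNIV. yv$j * rM' \<alpha>$j$k * xv$k)"

definition residue_const :: real where
 "residue_const = coef 1 * (\<Sum>j\<in>UNIV. w0$j * xv$j) * (\<Sum>j\<in>UNIV. yv$j) / speed"

lemma speed_pos: "0 < speed"
 unfolding speed_def using pp1
 by (intro mult_pos_pos perron_derivative_pos[OF alpha(3,1,2) perron(1,2,3,4)]) auto

lemma residue_const_pos: "0 < residue_const"
proof -
 have c: "0 < coef 1" unfolding coef_def using pp1 qq(1)[of 1] tau by simp
 obtain i where i: "w0$i \<noteq> 0" using w0(2) by (metis sum.neutral zero_neq_one)
 have "0 < (\<Sum>j\<in>UNIV. w0$j * xv$j)"
 proof (rule sum_pos2[of _ i])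
  show "0 < w0$i * xv$i" using i w0(1)[of i] perron(1)[of i] by simp
  show "0 <= w0$j * xv$j" for j using w0(1)[of j] perron(1)[of j] by simp
 qed auto
 moreover have "0 < (\<Sum>j\<in>UNIV. yv$j)" using perron(3) by (intro sum_pos) auto
 ultimately show ?thesis unfolding residue_const_def using c speed_pos by simp
qed

lemma perron_discounted:
 "(\<Sum>k\<in>UNIV. (1 - pp 1) * rM \<alpha> 1$j$k * xv$k) = xv$j"
 "(\<Sum>j\<in>UNIV. yv$j * ((1 - pp 1) * rM \<alpha> 1$j$k)) = yv$k"
proof -
 have "(\<Sum>k\<in>UNIV. (1 - pp 1) * rM \<alpha> 1$j$k * xv$k) = (1 - pp 1) * (\<Sum>k\<in>UNIV. rM \<alpha> 1$j$k * xv$k)"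
  unfolding sum_distrib_left by (rule sum.cong) auto
 then show "(\<Sum>k\<in>UNIV. (1 - pp 1) * rM \<alpha> 1$j$k * xv$k) = xv$j" unfolding perron(2) using pp1 by simp
 have "(\<Sum>j\<in>UNIV. yv$j * ((1 - pp 1) * rM \<alpha> 1$j$k)) = (1 - pp 1) * (\<Sum>j\<in>UNIV. yv$j * rM \<alpha> 1$j$k)"
  unfolding sum_distrib_left by (rule sum.cong) auto
 then show "(\<Sum>j\<in>UNIV. yv$j * ((1 - pp 1) * rM \<alpha> 1$j$k)) = yv$k" unfolding perron(4) using pp1 by simp
qed

lemma fixed_vector_unique:
 assumes v: "\<And>j. (\<Sum>k\<in>UNIV. (1 - pp 1) * rM \<alpha> 1$j$k * v$k) = (v :: real^'n)$j"
 obtains c where "v = c *\<^sub>R xv"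
proof (rule positive_matrix_eigenvector_unique[of "\<chi> j k. (1 - pp 1) * rM \<alpha> 1$j$k" xv v])
 have "emgf \<alpha>" using emgf_upto alpha by simp
 then show "0 < (\<chi> j k. (1 - pp 1) * rM \<alpha> 1$j$k)$j$k" for j k
  using rM_pos[of 1 \<alpha> j k] emgft_all[of \<alpha> 1] pp1 by simp
 show "(\<Sum>k\<in>UNIV. (\<chi> j k. (1 - pp 1) * rM \<alpha> 1$j$k)$j$k * xv$k) = xv$j" for j
  unfolding vec_lambda_beta by (rule perron_discounted)
qed (use v perron(1) that in auto)

lemma left_fixed_vector_unique:
 assumes v: "\<And>k. (\<Sum>j\<in>UNIV. v$j * ((1 - pp 1) * rM \<alpha> 1$j$k)) = (v :: real^'n)$k"
 obtains c where "v = c *\<^sub>R yv"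
proof (rule positive_matrix_eigenvector_unique[of "\<chi> k j. (1 - pp 1) * rM \<alpha> 1$j$k" yv v])
 have "emgf \<alpha>" using emgf_upto alpha by simp
 then show "0 < (\<chi> k j. (1 - pp 1) * rM \<alpha> 1$j$k)$k$j" for j k
  using rM_pos[of 1 \<alpha> j k] emgft_all[of \<alpha> 1] pp1 by simp
 show "(\<Sum>j\<in>UNIV. (\<chi> k j. (1 - pp 1) * rM \<alpha> 1$j$k)$k$j * yv$j) = yv$k" for k
  using perron_discounted(2)[of k] by (simp add: mult.commute)
 show "(\<Sum>j\<in>UNIV. (\<chi> k j. (1 - pp 1) * rM \<alpha> 1$j$k)$k$j * v$j) = v$k" for k
  using v[of k] by (simp add: mult.commute)
qed (use perron(3) that in auto)

abbreviation xc :: "complex^'n" where "xc \<equiv> \<chi> j. of_real (xv$j)"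
abbreviation yc :: "complex^'n" where "yc \<equiv> \<chi> j. of_real (yv$j)"

lemma Q_real: "Q 1 (of_real \<alpha>)$j$k = of_real ((1 - pp 1) * rM \<alpha> 1$j$k)"
 by (simp add: Q_def cM_of_real)

lemma resolvent_at_pole:
 obtains E g v where "open E" "E \<subseteq> {z. 0 < Re z \<and> Re z < s0}" "complex_of_real \<alpha> \<in> E"
  "\<And>z. z \<in> {z. 0 < Re z \<and> Re z < s0} ==> z \<noteq> of_real \<alpha> ==> det (mat 1 - Q 1 z) \<noteq> 0 ==> z \<in> E"
  "g holomorphic_on E" "\<And>k. (%z. v z$k) holomorphic_on E" "g (of_real \<alpha>) = (\<Sum>j\<in>UNIV. yc$j) / of_real speed"
  "\<And>z. z \<in> E ==> z \<noteq> of_real \<alpha> ==> (mat 1 - Q 1 z) *v ((g z / (of_real \<alpha> - z)) *s xc + v z) = (\<chi> j. 1)"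
proof (rule resolvent_pole[of "{z. 0 < Re z \<and> Re z < s0}" "of_real \<alpha>" "Q 1" xc yc "of_real speed"])
 show "open {z. 0 < Re z \<and> Re z < s0}" by (intro open_Collect_conj open_Collect_less continuous_intros)
 show "complex_of_real \<alpha> \<in> {z. 0 < Re z \<and> Re z < s0}" using alpha by simp
 show "(%z. Q 1 z$j$k) holomorphic_on {z. 0 < Re z \<and> Re z < s0}" for j k by (rule Q_holomorphic)
 have px: "(\<Sum>k\<in>UNIV. (1 - pp 1) * rM \<alpha> 1$j$k * xv$k) = xv$j" for j
  unfolding vec_lambda_beta by (rule perron_discounted)
 have py: "(\<Sum>j\<in>UNIV. yv$j * ((1 - pp 1) * rM \<alpha> 1$j$k)) = yv$k" for k
  by (rule perron_discounted)
 show "Q 1 (of_real \<alpha>) *v xc = xc"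
  unfolding vec_eq_iff matrix_vector_mult_def vec_lambda_beta Q_real of_real_mult[symmetric] of_real_sum[symmetric] px by simp
 show "(\<Sum>j\<in>UNIV. yc$j * Q 1 (of_real \<alpha>)$j$k) = yc$k" for k
  unfolding vec_lambda_beta Q_real of_real_mult[symmetric] of_real_sum[symmetric] py ..
 show "(\<Sum>k\<in>UNIV. yc$k * xc$k) = 1"
  unfolding vec_lambda_beta of_real_mult[symmetric] of_real_sum[symmetric] perron(5) by simp
 show "\<exists>c. v = c *s xc" if v: "Q 1 (of_real \<alpha>) *v v = v" for v
 proof -
  have e: "(\<Sum>k\<in>UNIV. of_real ((1 - pp 1) * rM \<alpha> 1$j$k) * v$k) = v$j" for j
   using v unfolding vec_eq_iff matrix_vector_mult_def vec_lambda_beta Q_real by blast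
  obtain a where a: "(\<chi> j. Re (v$j)) = a *\<^sub>R xv"
   by (rule fixed_vector_unique[of "\<chi> j. Re (v$j)"]) (use arg_cong[OF e, of Re] in auto)
  obtain b where b: "(\<chi> j. Im (v$j)) = b *\<^sub>R xv"
   by (rule fixed_vector_unique[of "\<chi> j. Im (v$j)"]) (use arg_cong[OF e, of Im] in auto)
  have "v = Complex a b *s xc" using a b by (simp add: vec_eq_iff complex_eq_iff)
  then show ?thesis ..
 qed
 have "deriv (%z. Q 1 z$j$k) (of_real \<alpha>) = of_real ((1 - pp 1) * rM' \<alpha>$j$k)" for j k
 proof -
  have "((%z. of_real (1 - pp 1) * cM z 1$j$k) has_field_derivative of_real (1 - pp 1) * of_real (rM' \<alpha>$j$k)) (at (of_real \<alpha>))"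
   using cM_has_derivative[OF alpha(3,1,2), of j k] unfolding deriv_cM_real[OF alpha(3,1,2)] by (rule DERIV_cmult)
  from DERIV_imp_deriv[OF this] show ?thesis by (simp add: Q_def)
 qed
 then show "(\<Sum>j\<in>UNIV. \<Sum>k\<in>UNIV. yc$j * deriv (%z. Q 1 z$j$k) (of_real \<alpha>) * xc$k) = of_real speed"
  by (simp add: speed_def sum_distrib_left mult_ac)
 show "complex_of_real speed \<noteq> 0" using speed_pos by simp
qed (use that in blast)

lemma transform_pole:
 obtains E R where "open E" "complex_of_real \<alpha> \<in> E"
  "\<And>z. 0 < Re z ==> Re z <= \<alpha> ==> z \<noteq> of_real \<alpha> ==> det (mat 1 - Q 1 z) \<noteq> 0 ==> z \<in> E"
  "R holomorphic_on E" "\<And>z. 0 < Re z ==> Re z < \<alpha> ==> z \<in> E ==> \<phi> z / z = of_real (residue_const / \<alpha>) / (of_real \<alpha> - z) + R z"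
proof -
 let ?a = "complex_of_real \<alpha>" and ?W = "{z. 0 < Re z \<and> Re z < s0}"
 have W: "open ?W" by (intro open_Collect_conj open_Collect_less continuous_intros)
 obtain E0 g v where E0: "open E0" "E0 \<subseteq> ?W" "?a \<in> E0"
  "\<And>z. z \<in> ?W ==> z \<noteq> ?a ==> det (mat 1 - Q 1 z) \<noteq> 0 ==> z \<in> E0"
  "g holomorphic_on E0" "\<And>k. (%z. v z$k) holomorphic_on E0" "g ?a = (\<Sum>j\<in>UNIV. yc$j) / of_real speed"
  "\<And>z. z \<in> E0 ==> z \<noteq> ?a ==> (mat 1 - Q 1 z) *v ((g z / (?a - z)) *s xc + v z) = (\<chi> j. 1)"
  by (rule resolvent_at_pole) blast
 let ?P = "%l u. open {z \<in> ?W. det (mat 1 - Q l z) \<noteq> 0} \<and> (\<forall>k. (%z. u z$k) holomorphic_on {z \<in> ?W. det (mat 1 - Q l z) \<noteq> 0}) \<and>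
   (\<forall>z. z \<in> ?W \<longrightarrow> det (mat 1 - Q l z) \<noteq> 0 \<longrightarrow> (mat 1 - Q l z) *v u z = (\<chi> j. 1))"
 have "\<exists>u. ?P l u" for l
 proof -
  have h: "(%z. (mat 1 - Q l z)$j$k) holomorphic_on ?W" for j k
   unfolding vector_minus_component by (intro holomorphic_intros Q_holomorphic)
  show ?thesis by (rule linear_system_holomorphic[OF W h, where b = "\<chi> j. 1"]) blast
 qed
 then have "\<forall>l. \<exists>u. ?P l u" ..
 from choice[OF this] obtain u where P: "\<And>l. ?P l (u l)" by blast
 have u: "\<And>l. open {z \<in> ?W. det (mat 1 - Q l z) \<noteq> 0}"
  "\<And>l k. (%z. u l z$k) holomorphic_on {z \<in> ?W. det (mat 1 - Q l z) \<noteq> 0}"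
  "\<And>l z. z \<in> ?W ==> det (mat 1 - Q l z) \<noteq> 0 ==> (mat 1 - Q l z) *v u l z = (\<chi> j. 1)" using P by blast+
 define E where "E = E0 \<inter> (\<Inter>l\<in>{2..\<tau>}. {z \<in> ?W. det (mat 1 - Q l z) \<noteq> 0})"
 have E: "open E" "E \<subseteq> E0" "\<And>l. l \<in> {2..\<tau>} ==> E \<subseteq> {z \<in> ?W. det (mat 1 - Q l z) \<noteq> 0}"
  unfolding E_def using E0(1) u(1) by (auto intro!: open_Int open_INT)
 have dl: "det (mat 1 - Q l z) \<noteq> 0" if l: "l \<in> {2..\<tau>}" and z: "0 < Re z" "Re z <= \<alpha>" for l z
 proof -
  have l': "l \<in> {1..\<tau>}" "Re z < \<alpha> \<or> l \<noteq> 1" using l by auto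
  show ?thesis by (rule contraction[OF l'(1) z l'(2)]) (rule dominated_matrix_det_nonzero)
 qed
 have mem: "z \<in> E" if "0 < Re z" "Re z <= \<alpha>" "z \<in> E0" for z
  unfolding E_def using that dl[OF _ that(1,2)] alpha by auto
 define h where "h z = of_real (coef 1) * g z * start_mean xc / z" for z
 define k where "k z = (of_real (coef 1) * (start_mean (v z) - 1) + (\<Sum>l = 2..\<tau>. of_real (coef l) * (start_mean (u l z) - 1))) / z" for z
 have nz: "z \<noteq> 0" if "z \<in> E" for z using E(2) E0(2) that by auto
 have gh: "g holomorphic_on E" "\<And>k. (%z. v z$k) holomorphic_on E" using E0(5,6) E(2) holomorphic_on_subset by blast+
 have uh: "(%z. u l z$k) holomorphic_on E" if "l \<in> {2..\<tau>}" for l k by (rule holomorphic_on_subset[OF u(2) E(3)[OF that]])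
 have hh: "h holomorphic_on E" unfolding h_def by (intro holomorphic_intros gh) (use nz in auto)
 have kh: "k holomorphic_on E" unfolding k_def by (intro holomorphic_intros gh uh) (use nz in auto)
 define R where "R z = k z - (if z = ?a then deriv h ?a else (h z - h ?a) / (z - ?a))" for z
 have Rh: "R holomorphic_on E" unfolding R_def by (intro holomorphic_intros kh pole_lemma_open hh E(1))
 have ha: "h ?a = of_real (residue_const / \<alpha>)"
  by (simp add: h_def E0(7) residue_const_def)
 have eq: "\<phi> z / z = of_real (residue_const / \<alpha>) / (?a - z) + R z" if z: "0 < Re z" "Re z < \<alpha>" "z \<in> E" for z
 proof -
  have za: "z \<noteq> ?a" using z by auto
  have zW: "z \<in> ?W" using z alpha by simp
  have inj: "w = w'" if "l \<in> {1..\<tau>}" "(mat 1 - Q l z) *v w = (\<chi> j. 1)" "(mat 1 - Q l z) *v w' = (\<chi> j. 1)" for l w w'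
  proof -
   have "(mat 1 - Q l z) *v (w - w') = 0" using that by (simp only: matrix_vector_mult_diff_distrib) simp
   then show ?thesis using det_nonzeroD[OF usol(3)[OF that(1) z(1,2)]] by fastforce
  qed
  have one: "1 \<in> {1..\<tau>}" using tau by simp
  have "usol 1 z = (g z / (?a - z)) *s xc + v z"
   by (rule inj[OF one usol(2)[OF one z(1,2)] E0(8)]) (use E(2) z za in auto)
  then have u1: "start_mean (usol 1 z) = g z / (?a - z) * start_mean xc + start_mean (v z)"
   by (simp add: distrib_left sum.distrib sum_distrib_left mult_ac)
  have ul: "usol l z = u l z" if "l \<in> {2..\<tau>}" for l
  proof -
   have l: "l \<in> {1..\<tau>}" using that by auto
   show ?thesis by (rule inj[OF l usol(2)[OF l z(1,2)] u(3)[OF zW usol(3)[OF l z(1,2)]]])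
  qed
  have "\<phi> z = of_real (coef 1) * (start_mean (usol 1 z) - 1) + (\<Sum>l = 2..\<tau>. of_real (coef l) * (start_mean (usol l z) - 1))"
   unfolding \<phi>_def using tau by (simp add: sum.atLeast_Suc_atMost numeral_2_eq_2)
  also have "(\<Sum>l = 2..\<tau>. of_real (coef l) * (start_mean (usol l z) - 1)) = (\<Sum>l = 2..\<tau>. of_real (coef l) * (start_mean (u l z) - 1))"
   using ul by (intro sum.cong) auto
  finally have p: "\<phi> z / z = (of_real (coef 1) * (g z / (?a - z) * start_mean xc + start_mean (v z) - 1) + (\<Sum>l = 2..\<tau>. of_real (coef l) * (start_mean (u l z) - 1))) / z"
   unfolding u1 by simp
  have alg: "(C * (G / d * X + V - 1) + S) / z = C * G * X / z / d + (C * (V - 1) + S) / z" for C G d X V S :: complex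
   by (simp add: add_divide_distrib diff_divide_distrib algebra_simps)
  have "h z / (?a - z) = h ?a / (?a - z) - (h z - h ?a) / (z - ?a)"
   using za by (simp add: divide_simps) (simp add: algebra_simps)
  then show ?thesis unfolding p alg unfolding R_def ha[symmetric] k_def using za by (simp add: h_def)
 qed
 show thesis
 proof (rule that[OF E(1) _ _ Rh eq])
  show "?a \<in> E" using mem[of ?a] alpha E0(3) by simp
  show "z \<in> E" if "0 < Re z" "Re z <= \<alpha>" "z \<noteq> of_real \<alpha>" "det (mat 1 - Q 1 z) \<noteq> 0" for z
   using mem[of z] E0(4)[of z] that alpha by auto
 qed
qed

sublocale ET: exponential_tail H \<alpha> "residue_const / \<alpha>"
 using alpha residue_const_pos H_props by unfold_locales auto

lemma pole_up_to_of_region: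
 assumes E: "open E" "R holomorphic_on E" and k: "0 < K" and d: "0 < \<delta>" "\<delta> <= \<alpha>"
  and R: "\<And>z. 0 < Re z ==> Re z < \<alpha> ==> z \<in> E ==> \<phi> z / z = of_real (residue_const / \<alpha>) / (of_real \<alpha> - z) + R z"
  and reg: "\<And>\<epsilon> \<theta>. 0 <= \<epsilon> ==> \<epsilon> < \<delta> ==> \<bar>\<theta>\<bar> <= K ==> Complex (\<alpha> - \<epsilon>) \<theta> \<in> E"
 shows "ET.pole_up_to K"
proof -
 have tr: "(\<integral>y. exp (Complex (\<alpha> - \<epsilon>) \<theta> * of_real y) * of_real (H y) \<partial>lborel) = of_real (residue_const / \<alpha>) / Complex \<epsilon> (- \<theta>) + R (Complex (\<alpha> - \<epsilon>) \<theta>)"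
  if "0 < \<epsilon>" "\<epsilon> < \<delta>" "\<bar>\<theta>\<bar> <= K" for \<epsilon> \<theta>
 proof -
  have "complex_of_real \<alpha> - Complex (\<alpha> - \<epsilon>) \<theta> = Complex \<epsilon> (- \<theta>)" by (simp add: complex_eq_iff)
  then show ?thesis using H_transform(2)[of "Complex (\<alpha> - \<epsilon>) \<theta>"] R[of "Complex (\<alpha> - \<epsilon>) \<theta>"] reg[of \<epsilon> \<theta>] that d by simp
 qed
 have int: "integrable lborel (%y. exp ((\<alpha> - \<epsilon>) * y) * H y)" if "0 < \<epsilon>" "\<epsilon> < \<delta>" for \<epsilon>
 proof -
  have "exp (complex_of_real (\<alpha> - \<epsilon>) * complex_of_real y) * of_real (H y) = of_real (exp ((\<alpha> - \<epsilon>) * y) * H y)" for y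
   by (simp add: exp_of_real del: of_real_diff flip: of_real_mult)
  then show ?thesis using H_transform(1)[of "of_real (\<alpha> - \<epsilon>)"] that d by (simp only: complex_of_real_integrable_eq Re_complex_of_real)
 qed
 have "continuous_on ({0..<\<delta>} \<times> {-K..K}) (%p. R (Complex (\<alpha> - fst p) (snd p)))"
  by (rule continuous_on_compose2[OF holomorphic_on_imp_continuous_on[OF E(2)]])
    (use reg in \<open>auto simp: Complex_eq intro!: continuous_intros\<close>)
 then have cont: "continuous_on ({0..<\<delta>} \<times> {-K..K}) (%(\<epsilon>, \<theta>). R (Complex (\<alpha> - \<epsilon>) \<theta>))" by (simp add: case_prod_beta')
 show ?thesis unfolding ET.pole_up_to_def
  using wiener_ikehara_convolution[OF d k H_props(4) H_props(1,2) int tr cont] by blast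
qed

text \<open>The pole is isolated, so a small rectangle to the left of \<open>\<alpha>\<close> contains no other singularity.\<close>

lemma pole_near_axis: obtains K where "0 < K" "ET.pole_up_to K"
proof -
 obtain E R where E: "open E" "complex_of_real \<alpha> \<in> E" "R holomorphic_on E"
  "\<And>z. 0 < Re z ==> Re z < \<alpha> ==> z \<in> E ==> \<phi> z / z = of_real (residue_const / \<alpha>) / (of_real \<alpha> - z) + R z"
  by (rule transform_pole) blast
 obtain d where d: "0 < d" "ball (complex_of_real \<alpha>) d \<subseteq> E" using E(1,2) open_contains_ball by blast
 define \<delta> where "\<delta> = min \<alpha> (d / 2)"
 have dl: "0 < \<delta>" "\<delta> <= \<alpha>" "\<delta> <= d / 2" using d alpha by (auto simp: \<delta>_def)
 have "ET.pole_up_to (d / 4)"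
 proof (rule pole_up_to_of_region[OF E(1,3) _ dl(1,2) E(4)])
  show "Complex (\<alpha> - \<epsilon>) \<theta> \<in> E" if "0 <= \<epsilon>" "\<epsilon> < \<delta>" "\<bar>\<theta>\<bar> <= d / 4" for \<epsilon> \<theta>
  proof -
   have "norm (complex_of_real \<alpha> - Complex (\<alpha> - \<epsilon>) \<theta>) <= \<bar>\<epsilon>\<bar> + \<bar>\<theta>\<bar>"
    using cmod_le[of "complex_of_real \<alpha> - Complex (\<alpha> - \<epsilon>) \<theta>"] by simp
   then have "Complex (\<alpha> - \<epsilon>) \<theta> \<in> ball (complex_of_real \<alpha>) d" using that dl d by (simp add: dist_norm)
   then show ?thesis using d by blast
  qed
 qed (use d in auto)
 then show ?thesis using that[of "d / 4"] d by simp
qed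

lemma pole_everywhere:
 assumes nl: "(\<exists>j. nonlattice_mgf (%z. exp (psi j z))) \<or> (\<exists>j k. 0 < \<rho> j k \<and> nonlattice_mgf (Ups j k))"
  and k: "0 < K"
 shows "ET.pole_up_to K"
proof -
 obtain E R where E: "open E" "complex_of_real \<alpha> \<in> E" "R holomorphic_on E"
  "\<And>z. 0 < Re z ==> Re z < \<alpha> ==> z \<in> E ==> \<phi> z / z = of_real (residue_const / \<alpha>) / (of_real \<alpha> - z) + R z"
  "\<And>z. 0 < Re z ==> Re z <= \<alpha> ==> z \<noteq> of_real \<alpha> ==> det (mat 1 - Q 1 z) \<noteq> 0 ==> z \<in> E"
  by (rule transform_pole) blast
 show ?thesis
 proof (rule pole_up_to_of_region[OF E(1,3) k alpha(1) order_refl E(4)])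
  fix \<epsilon> \<theta> assume e: "0 <= \<epsilon>" "\<epsilon> < \<alpha>"
  let ?z = "Complex (\<alpha> - \<epsilon>) \<theta>"
  have one: "1 \<in> {1..\<tau>}" using tau by simp
  show "?z \<in> E"
  proof (cases "?z = of_real \<alpha>")
   case False
   have "det (mat 1 - Q 1 ?z) \<noteq> 0"
   proof (cases "\<epsilon> = 0")
    case True
    then have z: "Re ?z = \<alpha>" "Im ?z \<noteq> 0" using False by (auto simp: complex_eq_iff)
    have "(\<Sum>j\<in>UNIV. yv$j * ((1 - pp 1) * rM (Re ?z) 1$j$k)) = yv$k" for k
     unfolding z by (rule perron_discounted)
    then show ?thesis unfolding Q_def
     by (intro no_peripheral_eigenvalue[OF alpha(3) _ _ z(2) _ perron(3) _ nl]) (use alpha pp1 z(1) in auto)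
   qed (rule usol(3)[OF one], use e in auto)
   then show ?thesis using E(5)[of ?z] e False by simp
  qed (use E in simp)
 qed
qed

end

section \<open>Pareto tails\<close>

theorem proposition3p1:
  fixes P :: "'n::finite \<Rightarrow> 'w measure"
    and X :: "real \<Rightarrow> 'w \<Rightarrow> real"
    and J :: "real \<Rightarrow> 'w \<Rightarrow> 'n"
    and G :: "real^'n^'n"
    and \<mu> \<sigma> :: "'n \<Rightarrow> real"
    and \<nu> :: "'n \<Rightarrow> real measure"
    and \<rho> :: "'n \<Rightarrow> 'n \<Rightarrow> real"
    and U :: "'n \<Rightarrow> 'n \<Rightarrow> real measure"
    and L :: "'n \<Rightarrow> real \<Rightarrow> 'w \<Rightarrow> real"
    and V :: "'n \<Rightarrow> 'n \<Rightarrow> nat \<Rightarrow> 'w \<Rightarrow> real"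
    and w0 :: "real^'n"
    and Pr :: "'w measure"
    and \<tau> :: nat
    and p q :: "nat \<Rightarrow> real"
    and T :: "'w \<Rightarrow> nat"
    and \<alpha> :: real
  defines "A \<equiv> matrix_laplace_exponent G \<mu> \<sigma> \<nu> \<rho> U"
    and "D \<equiv> laplace_domain P X"
    and "B \<equiv> discounted_exponential (p 1) (matrix_laplace_exponent G \<mu> \<sigma> \<nu> \<rho> U)"
    and "P_T \<equiv> (\<lambda>\<omega>. exp (X (real (T \<omega>)) \<omega>))"
  assumes process: "markov_modulated_levy P X J G \<mu> \<sigma> \<nu> \<rho> U L V"
    and w0: "\<forall>j. 0 \<le> w0 $ j" "(\<Sum>j\<in>UNIV. w0 $ j) = 1"
    \<comment> \<open>\<open>Pr\<close> is the law under which \<open>J\<^sub>0\<close> has distribution \<open>w0\<close>\<close>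
    and Pr_space: "prob_space Pr" "\<forall>j. sets Pr = sets (P j)"
    and Pr_law: "\<forall>S\<in>sets Pr. measure Pr S = (\<Sum>j\<in>UNIV. w0 $ j * measure (P j) S)"
    and \<tau>: "1 \<le> \<tau>"
    and p: "0 < p 1" "strict_mono_on {1..\<tau>} p" "p \<tau> < 1"
    and q: "\<forall>j\<in>{1..\<tau>}. 0 < q j" "(\<Sum>j = 1..\<tau>. q j) = 1"
    and T_indep: "prob_space.indep_set Pr {T -` S \<inter> space Pr | S. True}
          (process_sets (space Pr) X J)"
    and T_law: "\<forall>t\<ge>1. measure Pr {\<omega> \<in> space Pr. T \<omega> = t} =
          (\<Sum>j = 1..\<tau>. q j * (1 - p j) ^ (t - 1) * p j)"
    and \<alpha>: "0 < \<alpha>" "- \<alpha> \<in> D"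
      "dominant_real_eigenvalue (A (complex_of_real (- \<alpha>))) (- ln (1 - p 1))"
    and holomorphic: "extends_holomorphically A D {- \<alpha>..0}"
  shows "(\<forall>\<beta>>0. - \<beta> \<in> D \<and>
            dominant_real_eigenvalue (A (complex_of_real (- \<beta>))) (- ln (1 - p 1)) \<longrightarrow> \<beta> = \<alpha>) \<and>
         (\<forall>x y. x \<noteq> 0 \<and> B (- \<alpha>) *v x = x \<and> y \<noteq> 0 \<and> y v* B (- \<alpha>) = y \<longrightarrow>
           (let Mt = (q 1 * p 1 / (1 - p 1)) *
                  ((w0 \<bullet> x) * (y \<bullet> (\<chi> j. 1))) / (- (y \<bullet> (vector_derivative B (at (- \<alpha>)) *v x)))
            in 0 < Mt \<and>
               (\<exists>C1 C2. 0 < C1 \<and> C1 \<le> C2 \<and>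
                  (\<forall>\<^sub>F y in at_top.
                     Mt * C1 \<le> y powr \<alpha> * measure Pr {\<omega> \<in> space Pr. P_T \<omega> > y} \<and>
                     y powr \<alpha> * measure Pr {\<omega> \<in> space Pr. P_T \<omega> > y} \<le> Mt * C2)) \<and>
               ((\<exists>j. nonlattice_mgf (\<lambda>z. exp (levy_exponent (\<mu> j) (\<sigma> j) (\<nu> j) z))) \<or>
                (\<exists>j k. 0 < \<rho> j k \<and> nonlattice_mgf (transition_jump_mgf (\<rho> j k) (U j k))) \<longrightarrow>
                  ((\<lambda>y. y powr \<alpha> * measure Pr {\<omega> \<in> space Pr. P_T \<omega> > y}) \<longlongrightarrow> Mt / \<alpha>) at_top))) \<and>
         pareto_type_tail Pr P_T \<alpha> \<and>
         ((\<exists>j. 0 < (\<sigma> j)\<^sup>2) \<longrightarrow>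
            (\<exists>j. nonlattice_mgf (\<lambda>z. exp (levy_exponent (\<mu> j) (\<sigma> j) (\<nu> j) z))))"
proof -
  interpret markov_modulated_levy P X J G \<mu> \<sigma> \<nu> \<rho> U L V by (rule process)
  have ea: "emgf \<alpha>" using \<alpha>(2) unfolding D_def laplace_domain_def emgf_iff_mgf_domain by simp
  obtain \<epsilon> where ep: "0 < \<epsilon>" "emgf (\<alpha> + \<epsilon>)"
    using emgf_beyond[OF \<alpha>(1) ea] holomorphic unfolding A_def D_def by blast
  interpret geometric_trade_time P X J G \<mu> \<sigma> \<nu> \<rho> U L V w0 Pr \<tau> p q T \<alpha> "\<alpha> + \<epsilon>"
  proof (rule geometric_trade_time.intro[OF process geometric_trade_time_axioms.intro])
    show "0 \<le> w0$j" for j using w0(1) by blast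
    show "(\<Sum>j\<in>UNIV. w0$j) = 1" by (rule w0(2))
    show "prob_space Pr" by (rule Pr_space(1))
    show "sets Pr = sets (P j)" for j using Pr_space(2) by blast
    show "measure Pr S = (\<Sum>j\<in>UNIV. w0$j * measure (P j) S)" if "S \<in> sets Pr" for S using Pr_law that by blast
    show "1 \<le> \<tau>" by (rule \<tau>)
    show "0 < p 1" "strict_mono_on {1..\<tau>} p" "p \<tau> < 1" by (rule p)+
    show "0 < q j" if "j \<in> {1..\<tau>}" for j using q(1) that by blast
    show "(\<Sum>j = 1..\<tau>. q j) = 1" by (rule q(2))
    show "prob_space.indep_set Pr {T -` S \<inter> space Pr | S. True} (process_sets (space Pr) X J)" by (rule T_indep)
    show "measure Pr {\<omega> \<in> space Pr. T \<omega> = t} = (\<Sum>j = 1..\<tau>. q j * (1 - p j) ^ (t - 1) * p j)" if "1 \<le> t" for t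
      using T_law that by blast
    show "0 < \<alpha>" "\<alpha> < \<alpha> + \<epsilon>" "emgf (\<alpha> + \<epsilon>)" using \<alpha>(1) ep by auto
    show "dominant_real_eigenvalue (matrix_laplace_exponent G \<mu> \<sigma> \<nu> \<rho> U (complex_of_real (- \<alpha>))) (- ln (1 - p 1))"
      using \<alpha>(3) unfolding A_def .
  qed
  have c: "0 < - ln (1 - p 1)" using pp1 by simp
  have unique: "\<beta> = \<alpha>" if b: "0 < \<beta>" "- \<beta> \<in> D" "dominant_real_eigenvalue (A (complex_of_real (- \<beta>))) (- ln (1 - p 1))" for \<beta>
  proof (rule linorder_cases[of \<beta> \<alpha>])
    have eb: "emgf \<beta>" using b(2) unfolding D_def laplace_domain_def emgf_iff_mgf_domain by simp
    show ?thesis if "\<beta> < \<alpha>" using dominant_exponent_unique_less[OF ea b(1) that c] b(3) \<alpha>(3) unfolding A_def by blast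
    show ?thesis if "\<alpha> < \<beta>" using dominant_exponent_unique_less[OF eb \<alpha>(1) that c] b(3) \<alpha>(3) unfolding A_def by blast
  qed
  have B0: "B (- \<alpha>)$j$k = (1 - p 1) * rM \<alpha> 1$j$k" for j k
    unfolding B_def using discounted_exponential_eq[OF alpha(3) _ alpha(2), of "p 1" j k] \<alpha>(1) pp1 by simp
  have B1: "vector_derivative B (at (- \<alpha>)) = - ((1 - p 1) *\<^sub>R rM' \<alpha>)"
    unfolding B_def by (rule discounted_exponential_derivative[OF alpha(3,1,2) pp1(2)])
  have set_eq: "{\<omega> \<in> space Pr. P_T \<omega> > y} = {\<omega> \<in> space Pr. ln y < X (real (T \<omega>)) \<omega>}" if "0 < y" for y
  proof -
    have "ln y < x \<longleftrightarrow> y < exp x" for x using that by (metis exp_less_cancel_iff exp_ln)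
    then show ?thesis unfolding P_T_def by simp
  qed
  have tail_eq: "\<forall>\<^sub>F y in at_top. exp (\<alpha> * ln y) * H (ln y) = y powr \<alpha> * measure Pr {\<omega> \<in> space Pr. P_T \<omega> > y}"
    using eventually_gt_at_top[of 0] by eventually_elim (simp add: H_def set_eq powr_def)
  obtain \<kappa> where k: "0 < \<kappa>" "ET.pole_up_to \<kappa>" by (rule pole_near_axis)
  obtain C1 C2 where C: "0 < C1" "C1 \<le> C2" "\<forall>\<^sub>F x in at_top. C1 \<le> exp (\<alpha> * x) * H x \<and> exp (\<alpha> * x) * H x \<le> C2"
    by (rule ET.tail_bounds[OF k])
  have "\<forall>\<^sub>F y in at_top. C1 \<le> exp (\<alpha> * ln y) * H (ln y) \<and> exp (\<alpha> * ln y) * H (ln y) \<le> C2"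
    by (rule eventually_compose_filterlim[OF C(3) ln_at_top])
  then have bounds: "\<forall>\<^sub>F y in at_top. C1 \<le> y powr \<alpha> * measure Pr {\<omega> \<in> space Pr. P_T \<omega> > y} \<and> y powr \<alpha> * measure Pr {\<omega> \<in> space Pr. P_T \<omega> > y} \<le> C2"
    using tail_eq by eventually_elim simp
  have lim: "((\<lambda>y. y powr \<alpha> * measure Pr {\<omega> \<in> space Pr. P_T \<omega> > y}) \<longlongrightarrow> residue_const / \<alpha>) at_top"
    if "(\<exists>j. nonlattice_mgf (\<lambda>z. exp (levy_exponent (\<mu> j) (\<sigma> j) (\<nu> j) z))) \<or> (\<exists>j k. 0 < \<rho> j k \<and> nonlattice_mgf (transition_jump_mgf (\<rho> j k) (U j k)))"
    using filterlim_compose[OF ET.tail_limit[OF pole_everywhere[OF that]] ln_at_top] tail_eq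
    by (rule Lim_transform_eventually)
  have Mt: "(q 1 * p 1 / (1 - p 1)) * ((w0 \<bullet> x) * (y \<bullet> (\<chi> j. 1))) / (- (y \<bullet> (vector_derivative B (at (- \<alpha>)) *v x))) = residue_const"
    if x: "x \<noteq> 0" "B (- \<alpha>) *v x = x" and y: "y \<noteq> 0" "y v* B (- \<alpha>) = y" for x y
  proof -
    obtain a where a: "x = a *\<^sub>R xv"
      by (rule fixed_vector_unique[of x]) (use x(2) in \<open>auto simp: vec_eq_iff matrix_vector_mult_def B0\<close>)
    obtain b where b: "y = b *\<^sub>R yv"
      by (rule left_fixed_vector_unique[of y]) (use y(2) in \<open>auto simp: vec_eq_iff vector_matrix_mult_def B0 mult_ac\<close>)
    have ab: "a \<noteq> 0" "b \<noteq> 0" using x y a b by auto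
    have "- (y \<bullet> (vector_derivative B (at (- \<alpha>)) *v x)) = a * b * speed"
      unfolding B1 a b by (simp add: speed_def inner_vec_def matrix_vector_mult_def sum_distrib_left sum_negf[symmetric] mult_ac)
    moreover have "w0 \<bullet> x = a * (\<Sum>j\<in>UNIV. w0$j * xv$j)" "y \<bullet> (\<chi> j. 1) = b * (\<Sum>j\<in>UNIV. yv$j)"
      unfolding a b by (simp_all add: inner_vec_def sum_distrib_left mult_ac)
    ultimately show ?thesis unfolding residue_const_def coef_def using ab by simp
  qed
  have R: "0 < residue_const" by (rule residue_const_pos)
  have bounds': "\<exists>C1 C2. 0 < C1 \<and> C1 \<le> C2 \<and> (\<forall>\<^sub>F y in at_top.
      residue_const * C1 \<le> y powr \<alpha> * measure Pr {\<omega> \<in> space Pr. P_T \<omega> > y} \<and>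
      y powr \<alpha> * measure Pr {\<omega> \<in> space Pr. P_T \<omega> > y} \<le> residue_const * C2)"
    using C bounds R by (intro exI[of _ "C1 / residue_const"] exI[of _ "C2 / residue_const"]) (simp add: divide_right_mono)
  have pareto: "pareto_type_tail Pr P_T \<alpha>" unfolding pareto_type_tail_def using C(1,2) bounds by blast
  show ?thesis
  proof (intro conjI)
    show "\<forall>\<beta>>0. - \<beta> \<in> D \<and> dominant_real_eigenvalue (A (complex_of_real (- \<beta>))) (- ln (1 - p 1)) \<longrightarrow> \<beta> = \<alpha>"
      using unique by blast
    show "pareto_type_tail Pr P_T \<alpha>" by (rule pareto)
    show "(\<exists>j. 0 < (\<sigma> j)\<^sup>2) \<longrightarrow> (\<exists>j. nonlattice_mgf (\<lambda>z. exp (levy_exponent (\<mu> j) (\<sigma> j) (\<nu> j) z)))"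
      using gaussian_part_nonlattice by blast
  qed (unfold Let_def, use Mt R bounds' lim in simp)
qed

end
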